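(* There is a $\Bbbk$-linear monoidal functor $P'\colon\mathcal{LAW}(A)\to\Bbbk\text{-smod}$ which sends $\mathsf I$ to $\operatorname{Pol}_1(A)$ and each $Q\in\mathcal E_{\operatorname{Pol}_1(A)}$ to $\Bbbk$, and which sends the generating morphisms as follows, for all $a\in A$, $Q\in\mathcal E_{\operatorname{Pol}_1(A)}$: - $P'(\langle a\rangle)\colon\operatorname{Pol}_1(A)\to\operatorname{Pol}_1(A)$, $f\mapsto af$; - $P'(\mathsf x)\colon\operatorname{Pol}_1(A)\to\operatorname{Pol}_1(A)$, $f\mapsto xf$; - $P'(\sigma)\colon\operatorname{Pol}_2(A)\to\operatorname{Pol}_2(A)$, $f\mapsto s_1(f)-\partial_1(f)$; - $P'(\rho_Q)\colon\operatorname{Pol}_1(A)\to\operatorname{Pol}_1(A)$, $f\mapsto f$; - $P'(\lambda_Q)\colon\operatorname{Pol}_1(A)\to\operatorname{Pol}_1(A)$, $f\mapsto Qf$. Furthermore, the functor $P'$ is faithful.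
   Context: Conventions. $\Bbbk$ is a commutative ring. All algebras are associative unital $\Bbbk$-superalgebras; $\bar f\in\mathbb Z_2$ is the parity of $f$; formulas with parities are for homogeneous elements and extended linearly. Tensor products of superalgebras: $(f'\otimes g)(f\otimes g')=(-1)^{\bar f\bar g}f'f\otimes gg'$. For an algebra $F$, $Z(F)=\{f: fg=(-1)^{\bar f\bar g}gf\ \forall g\in F\}$; $f\in F$ is regular if it is neither a left nor a right zero-divisor. $\mathcal E_F$ is the set of even, central, regular elements of $F$, and $\widehat{\mathcal E}_F=\mathcal E_F\cup\{\mathsf I\}$ with $\mathsf I$ a formal symbol. Frobenius superalgebra. $A$ is a fixed Frobenius superalgebra, free over $\Bbbk$ with homogeneous (finite) basis $B$, with homogeneous trace map $\operatorname{tr}\colon A\to\Bbbk$ of parity $\varepsilon\in\mathbb Z_2$, Nakayama automorphism $\psi$ (so $\operatorname{tr}(ab)=(-1)^{\bar a\bar b}\operatorname{tr}(b\psi(a))$), and left dual basis $\{b^\vee:b\in B\}$ with $\operatorname{tr}(b^\vee c)=\delta_{b,c}$. For $a\in A$, $a_i=1^{\otimes(i-1)}\otimes a\otimes 1^{\otimes(n-i)}\in A^{\otimes n}$. Frobenius polynomial algebra. $\operatorname{Pol}_n(A)$ is the superalgebra generated by $A^{\otimes n}$ and $x_1,\dots,x_n$ of parity $\varepsilon$ subject to $x_ix_j=(-1)^{\varepsilon}x_jx_i$ ($i\ne j$) and $\mathbf a x_i=(-1)^{\varepsilon\bar{\mathbf a}}x_i\psi_i(\mathbf a)$ for $\mathbf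 a\in A^{\otimes n}$, where $\psi_i$ applies $\psi$ to the $i$-th factor. Write $x=x_1\in\operatorname{Pol}_1(A)$. $\operatorname{Pol}_n(A)$ is identified with $\operatorname{Pol}_1(A)^{\otimes n}$ via $x_i\mapsto1^{\otimes(i-1)}\otimes x\otimes1^{\otimes(n-i)}$, $\mathbf a\mapsto\mathbf a$. For $f=\sum_k a_{(k)}x^k\in\operatorname{Pol}_1(A)$ put $f_i=\sum_k (a_{(k)})_i x_i^k\in\operatorname{Pol}_n(A)$. $S_n$ acts on $\operatorname{Pol}_n(A)$ by superalgebra automorphisms: superpermutation of factors on $A^{\otimes n}$ and $w(x_i)=x_{w(i)}$. Put $t_{i,j}=\sum_{b\in B}(-1)^{\varepsilon\bar b}b_i(b^\vee)_j$. The Frobenius Demazure operators $\partial_i$ ($1\le i\le n-1$) are the $\Bbbk$-linear endomorphisms of $\operatorname{Pol}_n(A)$ determined by $\partial_i(\mathbf a)=0$ for $\mathbf a\in A^{\otimes n}$, $\partial_i(x_i)=t_{i,i+1}$, $\partial_i(x_{i+1})=-t_{i+1,i}$, $\partial_i(x_j)=0$ for $j\neq i,i+1$, and $\partial_i(fg)=\partial_i(f)g+s_i(f)\partial_i(g)$. A strict $\Bbbk$-linear monoidal supercategory is a strict monoidal category enriched in $\Bbbk$-supermodules with super interchange law $(f'\otimes g)\circ(f\otimes g')=(-1)^{\bar f\bar g}(f'\circ f)\otimes(g\circ g')$; juxtaposition denotes composition. $\Bbbk\text{-smod}$ is the category of $\Bbbk$-supermodules and all $\Bbbk$-linear maps (not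 necessarily parity-preserving), with the usual tensor product, $(f\otimes g)(v\otimes w)=(-1)^{\bar g\bar v}f(v)\otimes g(w)$. $\mathcal{LAW}(A)$ (higher-level affine wreath product category) is the strict $\Bbbk$-linear monoidal supercategory whose objects are generated by $\widehat{\mathcal E}_{\operatorname{Pol}_1(A)}$ (objects are words in this set, tensor product is concatenation), with generating morphisms $\sigma\colon\mathsf I\otimes\mathsf I\to\mathsf I\otimes\mathsf I$ (even), $\langle a\rangle\colon\mathsf I\to\mathsf I$ for $a\in A$ (parity $\bar a$), $\mathsf x\colon\mathsf I\to\mathsf I$ (parity $\varepsilon$), and even $\rho_Q\colon Q\otimes\mathsf I\to\mathsf I\otimes Q$, $\lambda_Q\colon\mathsf I\otimes Q\to Q\otimes\mathsf I$ for $Q\in\mathcal E_{\operatorname{Pol}_1(A)}$. For $f=\sum_r a_{(r)}x^r\in\operatorname{Pol}_1(A)$ put $[f]=\sum_r\langle a_{(r)}\rangle\mathsf x^r$. For $f=\sum\mu_{b,c,r,s}(b\otimes c)x_1^rx_2^s\in\operatorname{Pol}_2(A)$ put $[f]_Q=\sum\mu_{b,c,r,s}(\langle b\rangle\otimes1_Q\otimes\langle c\rangle)(\mathsf x^r\otimes1_Q\otimes\mathsf x^s)\in\operatorname{End}(\mathsf I\otimes Q\otimes\mathsf I)$. Relations, for all $a,b\in A$, $\lambda,\mu\in\Bbbk$, $Q\in\mathcal E_{\operatorname{Pol}_1(A)}$: $\langle 1\rangle=1_{\mathsf I}$, $\lambda\langle a\rangle+\mu\langle b\rangle=\langle\lambda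 a+\mu b\rangle$, $\langle a\rangle\langle b\rangle=\langle ab\rangle$; $\sigma^2=1$; $(\sigma\otimes1_{\mathsf I})(1_{\mathsf I}\otimes\sigma)(\sigma\otimes1_{\mathsf I})=(1_{\mathsf I}\otimes\sigma)(\sigma\otimes1_{\mathsf I})(1_{\mathsf I}\otimes\sigma)$; $\sigma(\langle a\rangle\otimes1_{\mathsf I})=(1_{\mathsf I}\otimes\langle a\rangle)\sigma$; $\sigma(\mathsf x\otimes1_{\mathsf I})=(1_{\mathsf I}\otimes\mathsf x)\sigma-\sum_{b\in B}(-1)^{\varepsilon\bar b}\langle b\rangle\otimes\langle b^\vee\rangle$; $\langle a\rangle\mathsf x=(-1)^{\varepsilon\bar a}\mathsf x\langle\psi(a)\rangle$; $\lambda_Q(\langle a\rangle\otimes1_Q)=(1_Q\otimes\langle a\rangle)\lambda_Q$; $\rho_Q(1_Q\otimes\langle a\rangle)=(\langle a\rangle\otimes1_Q)\rho_Q$; the same two relations with $\langle a\rangle$ replaced by $\mathsf x$; $\rho_Q\lambda_Q=[Q]\otimes1_Q$; $\lambda_Q\rho_Q=1_Q\otimes[Q]$; $(\sigma\otimes1_Q)(1_{\mathsf I}\otimes\rho_Q)(\rho_Q\otimes1_{\mathsf I})=(1_{\mathsf I}\otimes\rho_Q)(\rho_Q\otimes1_{\mathsf I})(1_Q\otimes\sigma)$; $(\lambda_Q\otimes1_{\mathsf I})(1_{\mathsf I}\otimes\lambda_Q)(\sigma\otimes1_Q)=(1_Q\otimes\sigma)(\lambda_Q\otimes1_{\mathsf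 I})(1_{\mathsf I}\otimes\lambda_Q)$; $(\rho_Q\otimes1_{\mathsf I})(1_Q\otimes\sigma)(\lambda_Q\otimes1_{\mathsf I})=(1_{\mathsf I}\otimes\lambda_Q)(\sigma\otimes1_Q)(1_{\mathsf I}\otimes\rho_Q)-[\partial_1(Q_1)]_Q$. In the claim, $\Bbbk\otimes\operatorname{Pol}_1(A)$ and $\operatorname{Pol}_1(A)\otimes\Bbbk$ are identified with $\operatorname{Pol}_1(A)$. *)

theory Defs
  imports Complex_Main "HOL-Library.Poly_Mapping" "HOL-Library.Z2" "HOL-Combinatorics.Transposition"
begin

text \<open>
  Parities are elements of \<^typ>\<open>bit\<close>.  The ground ring is a type of class
  \<^class>\<open>comm_ring_1\<close>.  \<open>ksgn p q\<close> is the scalar \<open>(-1)^(p q)\<close>.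
\<close>

definition ksgn :: "bit \<Rightarrow> bit \<Rightarrow> 'k::comm_ring_1" where
  "ksgn p q = (if p = 1 \<and> q = 1 then - 1 else 1)"


section \<open>Supermodules, tensor products, superalgebras\<close>

record ('k, 'm) smodule =
  carr :: "'m set"
  homog :: "bit \<Rightarrow> 'm set"
  zer :: 'm
  add :: "'m \<Rightarrow> 'm \<Rightarrow> 'm"
  smul :: "'k \<Rightarrow> 'm \<Rightarrow> 'm"

definition supermodule :: "('k::comm_ring_1, 'm, 'z) smodule_scheme \<Rightarrow> bool" where
  "supermodule M \<longleftrightarrow>
     zer M \<in> carr M \<and>
     (\<forall>u\<in>carr M. \<forall>v\<in>carr M. add M u v \<in> carr M \<and> add M u v = add M v u) \<and>
     (\<forall>u\<in>carr M. \<forall>v\<in>carr M. \<forall>w\<in>carr M. add M (add M u v) w = add M u (add M v w)) \<and>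
     (\<forall>u\<in>carr M. add M (zer M) u = u \<and> (\<exists>v\<in>carr M. add M u v = zer M)) \<and>
     (\<forall>c. \<forall>u\<in>carr M. smul M c u \<in> carr M) \<and>
     (\<forall>c. \<forall>u\<in>carr M. \<forall>v\<in>carr M. smul M c (add M u v) = add M (smul M c u) (smul M c v)) \<and>
     (\<forall>c d. \<forall>u\<in>carr M. smul M (c + d) u = add M (smul M c u) (smul M d u)) \<and>
     (\<forall>c d. \<forall>u\<in>carr M. smul M (c * d) u = smul M c (smul M d u)) \<and>
     (\<forall>u\<in>carr M. smul M 1 u = u) \<and>
     (\<forall>p. homog M p \<subseteq> carr M \<and> zer M \<in> homog M p \<and>
          (\<forall>u\<in>homog M p. \<forall>v\<in>homog M p. add M u v \<in> homog M p) \<and>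
          (\<forall>c. \<forall>u\<in>homog M p. smul M c u \<in> homog M p)) \<and>
     (\<forall>u\<in>carr M. \<exists>!vw. vw \<in> homog M 0 \<times> homog M 1 \<and> u = add M (fst vw) (snd vw))"

definition smod_hom ::
  "('k, 'm, 'z) smodule_scheme \<Rightarrow> ('k, 'n, 'y) smodule_scheme \<Rightarrow> ('m \<Rightarrow> 'n) \<Rightarrow> bool" where
  "smod_hom M N \<phi> \<longleftrightarrow>
     (\<forall>u\<in>carr M. \<phi> u \<in> carr N) \<and>
     (\<forall>u\<in>carr M. \<forall>v\<in>carr M. \<phi> (add M u v) = add N (\<phi> u) (\<phi> v)) \<and>
     (\<forall>c. \<forall>u\<in>carr M. \<phi> (smul M c u) = smul N c (\<phi> u))"

definition smod_hom_parity ::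
  "('k, 'm, 'z) smodule_scheme \<Rightarrow> ('k, 'n, 'y) smodule_scheme \<Rightarrow> bit \<Rightarrow> ('m \<Rightarrow> 'n) \<Rightarrow> bool" where
  "smod_hom_parity M N p \<phi> \<longleftrightarrow>
     smod_hom M N \<phi> \<and> (\<forall>q. \<forall>u\<in>homog M q. \<phi> u \<in> homog N (p + q))"

definition even_iso ::
  "('k, 'm, 'z) smodule_scheme \<Rightarrow> ('k, 'n, 'y) smodule_scheme \<Rightarrow> ('m \<Rightarrow> 'n) \<Rightarrow> bool" where
  "even_iso M N \<phi> \<longleftrightarrow> smod_hom_parity M N 0 \<phi> \<and> bij_betw \<phi> (carr M) (carr N)"

definition ground_smod :: "('k::comm_ring_1, 'k) smodule" where
  "ground_smod = \<lparr>carr = UNIV, homog = (\<lambda>p. if p = 0 then UNIV else {0}),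
                  zer = 0, add = (+), smul = (*)\<rparr>"

definition pscale :: "'k::comm_ring_1 \<Rightarrow> ('i \<Rightarrow>\<^sub>0 'k) \<Rightarrow> ('i \<Rightarrow>\<^sub>0 'k)" where
  "pscale c f = Poly_Mapping.map (\<lambda>d. c * d) f"

definition plinear :: "('i \<Rightarrow> ('j \<Rightarrow>\<^sub>0 'k::comm_ring_1)) \<Rightarrow> ('i \<Rightarrow>\<^sub>0 'k) \<Rightarrow> ('j \<Rightarrow>\<^sub>0 'k)" where
  "plinear \<phi> f = (\<Sum>i\<in>Poly_Mapping.keys f. pscale (Poly_Mapping.lookup f i) (\<phi> i))"

text \<open>The tensor product is the free module on pairs modulo the submodule \<open>tensor_rel\<close>.\<close>

inductive_set tensor_rel ::
  "('k::comm_ring_1, 'm, 'z) smodule_scheme \<Rightarrow> ('k, 'n, 'y) smodule_scheme \<Rightarrow> ('m \<times> 'n \<Rightarrow>\<^sub>0 'k) set"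
  for M N where
  add_left: "\<lbrakk>u \<in> carr M; u' \<in> carr M; v \<in> carr N\<rbrakk> \<Longrightarrow>
     Poly_Mapping.single (add M u u', v) 1 - Poly_Mapping.single (u, v) 1
       - Poly_Mapping.single (u', v) 1 \<in> tensor_rel M N"
| add_right: "\<lbrakk>u \<in> carr M; v \<in> carr N; v' \<in> carr N\<rbrakk> \<Longrightarrow>
     Poly_Mapping.single (u, add N v v') 1 - Poly_Mapping.single (u, v) 1
       - Poly_Mapping.single (u, v') 1 \<in> tensor_rel M N"
| scale_left: "\<lbrakk>u \<in> carr M; v \<in> carr N\<rbrakk> \<Longrightarrow>
     Poly_Mapping.single (smul M c u, v) 1 - Poly_Mapping.single (u, v) c \<in> tensor_rel M N"
| scale_right: "\<lbrakk>u \<in> carr M; v \<in> carr N\<rbrakk> \<Longrightarrow>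
     Poly_Mapping.single (u, smul N c v) 1 - Poly_Mapping.single (u, v) c \<in> tensor_rel M N"
| zero: "0 \<in> tensor_rel M N"
| plus: "\<lbrakk>r \<in> tensor_rel M N; r' \<in> tensor_rel M N\<rbrakk> \<Longrightarrow> r + r' \<in> tensor_rel M N"
| scale: "r \<in> tensor_rel M N \<Longrightarrow> pscale c r \<in> tensor_rel M N"

definition tensor_class ::
  "('k::comm_ring_1, 'm, 'z) smodule_scheme \<Rightarrow> ('k, 'n, 'y) smodule_scheme \<Rightarrow>
   ('m \<times> 'n \<Rightarrow>\<^sub>0 'k) \<Rightarrow> ('m \<times> 'n \<Rightarrow>\<^sub>0 'k) set" where
  "tensor_class M N f =
     {g. Poly_Mapping.keys g \<subseteq> carr M \<times> carr N \<and> g - f \<in> tensor_rel M N}"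

definition pure_tensor ::
  "('k::comm_ring_1, 'm, 'z) smodule_scheme \<Rightarrow> ('k, 'n, 'y) smodule_scheme \<Rightarrow>
   'm \<Rightarrow> 'n \<Rightarrow> ('m \<times> 'n \<Rightarrow>\<^sub>0 'k) set" where
  "pure_tensor M N u v = tensor_class M N (Poly_Mapping.single (u, v) 1)"

definition smod_tensor ::
  "('k::comm_ring_1, 'm, 'z) smodule_scheme \<Rightarrow> ('k, 'n, 'y) smodule_scheme \<Rightarrow>
   ('k, ('m \<times> 'n \<Rightarrow>\<^sub>0 'k) set) smodule" where
  "smod_tensor M N =
     \<lparr>carr = tensor_class M N ` {f. Poly_Mapping.keys f \<subseteq> carr M \<times> carr N},
      homog = (\<lambda>p. tensor_class M N `
                 {f. Poly_Mapping.keys f \<subseteq> (\<Union>q. homog M q \<times> homog N (p - q))}),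
      zer = tensor_class M N 0,
      add = (\<lambda>U V. \<Union>f\<in>U. \<Union>g\<in>V. tensor_class M N (f + g)),
      smul = (\<lambda>c U. \<Union>f\<in>U. tensor_class M N (pscale c f))\<rparr>"

record ('k, 'm) superalg = "('k, 'm) smodule" +
  mul :: "'m \<Rightarrow> 'm \<Rightarrow> 'm"
  unt :: 'm

text \<open>
  Centre in the super sense: \<open>f g = (-1)^(|f| |g|) g f\<close> for homogeneous \<open>f\<close>, \<open>g\<close>, extended
  linearly, so \<open>f = u + v\<close> with \<open>u\<close> even and \<open>v\<close> odd must satisfy
  \<open>f g = g u + (-1)^q g v\<close> for \<open>g\<close> of parity \<open>q\<close>.
\<close>

definition super_centre :: "('k::comm_ring_1, 'm, 'z) superalg_scheme \<Rightarrow> 'm set" where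
  "super_centre F = {f \<in> carr F. \<exists>u\<in>homog F 0. \<exists>v\<in>homog F 1. f = add F u v \<and>
     (\<forall>q. \<forall>g\<in>homog F q. mul F f g = add F (mul F g u) (smul F (ksgn 1 q) (mul F g v)))}"

definition regular :: "('k, 'm, 'z) superalg_scheme \<Rightarrow> 'm \<Rightarrow> bool" where
  "regular F f \<longleftrightarrow> f \<in> carr F \<and>
     (\<forall>g\<in>carr F. mul F f g = zer F \<longrightarrow> g = zer F) \<and>
     (\<forall>g\<in>carr F. mul F g f = zer F \<longrightarrow> g = zer F)"

definition ECR :: "('k::comm_ring_1, 'm, 'z) superalg_scheme \<Rightarrow> 'm set" where
  "ECR F = {f \<in> homog F 0. f \<in> super_centre F \<and> regular F f}"


section \<open>Frobenius superalgebras\<close>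

record ('k, 'a) frobenius_data =
  scl :: "'k \<Rightarrow> 'a \<Rightarrow> 'a"
  grade :: "bit \<Rightarrow> 'a set"
  basis :: "'a set"
  tr :: "'a \<Rightarrow> 'k"
  eps :: bit
  nak :: "'a \<Rightarrow> 'a"
  dual :: "'a \<Rightarrow> 'a"

text \<open>
  The sort \<open>{ring, monoid_mult}\<close> is that of unital rings in which \<open>0 = 1\<close> is permitted,
  so the zero algebra is not excluded.
\<close>

locale frobenius_superalgebra = module "scl A"
  for A :: "('k::comm_ring_1, 'a::{ring, monoid_mult}) frobenius_data" +
  assumes scl_mult_left: "scl A c a * b = scl A c (a * b)"
    and scl_mult_right: "a * scl A c b = scl A c (a * b)"
    and grade_subspace: "subspace (grade A p)"
    and grade_decomp: "\<exists>!uv. uv \<in> grade A 0 \<times> grade A 1 \<and> a = fst uv + snd uv"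
    and grade_mult: "\<lbrakk>a \<in> grade A p; b \<in> grade A q\<rbrakk> \<Longrightarrow> a * b \<in> grade A (p + q)"
    and grade_one: "1 \<in> grade A 0"
    and basis_finite: "finite (basis A)"
    and basis_homogeneous: "basis A \<subseteq> grade A 0 \<union> grade A 1"
    and basis_independent: "independent (basis A)"
    and basis_span: "span (basis A) = UNIV"
    and tr_linear: "module_hom (scl A) (*) (tr A)"
    and tr_parity: "\<lbrakk>a \<in> grade A p; p \<noteq> eps A\<rbrakk> \<Longrightarrow> tr A a = 0"
    and nak_linear: "module_hom (scl A) (scl A) (nak A)"
    and nak_bij: "bij (nak A)"
    and nak_mult: "nak A (a * b) = nak A a * nak A b"
    and nak_one: "nak A 1 = 1"
    and nak_grade: "a \<in> grade A p \<Longrightarrow> nak A a \<in> grade A p"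
    and nak_tr: "\<lbrakk>a \<in> grade A p; b \<in> grade A q\<rbrakk> \<Longrightarrow>
                   tr A (a * b) = ksgn p q * tr A (b * nak A a)"
    and dual_tr: "\<lbrakk>a \<in> basis A; b \<in> basis A\<rbrakk> \<Longrightarrow> tr A (dual A a * b) = (if a = b then 1 else 0)"
    and dual_inj: "inj_on (dual A) (basis A)"
    and dual_independent: "independent (dual A ` basis A)"
    and dual_span: "span (dual A ` basis A) = UNIV"

text \<open>
  Parity of a basis element (basis elements are homogeneous and nonzero).
\<close>

definition bpar :: "('k, 'a) frobenius_data \<Rightarrow> 'a \<Rightarrow> bit" where
  "bpar A b = (if b \<in> grade A 1 then 1 else 0)"


section \<open>Frobenius polynomial algebras\<close>

text \<open>
  Free algebras are monoid algebras of word monoids: words are lists under concatenation, and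
  \<^typ>\<open>'g list \<Rightarrow>\<^sub>0 'k\<close> carries the convolution product of \<^theory>\<open>HOL-Library.Poly_Mapping\<close>.
\<close>

instantiation list :: (type) monoid_add
begin
definition zero_list_def: "0 = []"
definition plus_list_def: "xs + ys = xs @ ys"
instance by standard (simp_all add: zero_list_def plus_list_def)
end

text \<open>
  \<open>GA i a\<close> stands for \<open>a_i\<close> and \<open>GX i\<close> for \<open>x_i\<close>.
\<close>

datatype 'a pgen = GA nat 'a | GX nat

type_synonym ('k, 'a) falg = "'a pgen list \<Rightarrow>\<^sub>0 'k"

abbreviation mon :: "'a pgen list \<Rightarrow> ('k::comm_ring_1, 'a) falg" where
  "mon w \<equiv> Poly_Mapping.single w 1"

primrec pgen_index :: "'a pgen \<Rightarrow> nat" where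
  "pgen_index (GA i a) = i"
| "pgen_index (GX i) = i"

definition falg_on :: "nat \<Rightarrow> ('k::comm_ring_1, 'a) falg set" where
  "falg_on n = {f. \<forall>w\<in>Poly_Mapping.keys f. \<forall>g\<in>set w. pgen_index g \<in> {1..n}}"

text \<open>
  The first group of relations presents \<open>A^{\<otimes>n}\<close> on the elements \<open>a_i\<close>
  (with \<open>a \<otimes> b = a_1 b_2\<close> etc.); the second group is the one involving the \<open>x_i\<close>.
  As both sides of \<open>\<a> x_i = (-1)^(\<epsilon> |\<a>|) x_i \<psi>_i(\<a>)\<close> are multiplicative in \<open>\<a>\<close>, it is
  imposed for \<open>\<a> = a_j\<close>.
\<close>

inductive_set pol_rel ::
  "('k::comm_ring_1, 'a::{ring, monoid_mult}) frobenius_data \<Rightarrow> nat \<Rightarrow> ('k, 'a) falg set"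
  for A n where
  tens_add: "i \<in> {1..n} \<Longrightarrow> mon [GA i (a + b)] - mon [GA i a] - mon [GA i b] \<in> pol_rel A n"
| tens_scale: "i \<in> {1..n} \<Longrightarrow> mon [GA i (scl A c a)] - pscale c (mon [GA i a]) \<in> pol_rel A n"
| tens_one: "i \<in> {1..n} \<Longrightarrow> mon [GA i 1] - 1 \<in> pol_rel A n"
| tens_mult: "i \<in> {1..n} \<Longrightarrow> mon [GA i a] * mon [GA i b] - mon [GA i (a * b)] \<in> pol_rel A n"
| tens_comm: "\<lbrakk>i \<in> {1..n}; j \<in> {1..n}; i \<noteq> j; a \<in> grade A p; b \<in> grade A q\<rbrakk> \<Longrightarrow>
     mon [GA i a] * mon [GA j b] - pscale (ksgn p q) (mon [GA j b] * mon [GA i a])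
       \<in> pol_rel A n"
| x_comm: "\<lbrakk>i \<in> {1..n}; j \<in> {1..n}; i \<noteq> j\<rbrakk> \<Longrightarrow>
     mon [GX i] * mon [GX j] - pscale (ksgn (eps A) (eps A)) (mon [GX j] * mon [GX i])
       \<in> pol_rel A n"
| x_nak: "\<lbrakk>i \<in> {1..n}; j \<in> {1..n}; a \<in> grade A p\<rbrakk> \<Longrightarrow>
     mon [GA j a] * mon [GX i]
       - pscale (ksgn (eps A) p) (mon [GX i] * mon [GA j (if i = j then nak A a else a)])
       \<in> pol_rel A n"

inductive_set pol_ideal ::
  "('k::comm_ring_1, 'a::{ring, monoid_mult}) frobenius_data \<Rightarrow> nat \<Rightarrow> ('k, 'a) falg set"
  for A n where
  rel: "r \<in> pol_rel A n \<Longrightarrow> r \<in> pol_ideal A n"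
| zero: "0 \<in> pol_ideal A n"
| plus: "\<lbrakk>r \<in> pol_ideal A n; s \<in> pol_ideal A n\<rbrakk> \<Longrightarrow> r + s \<in> pol_ideal A n"
| mult_left: "\<lbrakk>f \<in> falg_on n; r \<in> pol_ideal A n\<rbrakk> \<Longrightarrow> f * r \<in> pol_ideal A n"
| mult_right: "\<lbrakk>f \<in> falg_on n; r \<in> pol_ideal A n\<rbrakk> \<Longrightarrow> r * f \<in> pol_ideal A n"

definition pol_class ::
  "('k::comm_ring_1, 'a::{ring, monoid_mult}) frobenius_data \<Rightarrow> nat \<Rightarrow> ('k, 'a) falg \<Rightarrow> ('k, 'a) falg set"
  where "pol_class A n f = {g \<in> falg_on n. g - f \<in> pol_ideal A n}"

text \<open>
  \<open>Pol A n\<close> is the quotient of the free algebra by the two-sided ideal of relations.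
  \<open>Pol A 0\<close> has no generators and is the ground ring, with \<open>c\<close> represented by \<open>c\<close> times
  the empty word.

  \<open>pgen_homog\<close> and \<open>word_homog\<close> are relations, since \<open>0\<close> is homogeneous of both parities.
\<close>

primrec pgen_homog :: "('k, 'a) frobenius_data \<Rightarrow> 'a pgen \<Rightarrow> bit \<Rightarrow> bool" where
  "pgen_homog A (GA i a) p \<longleftrightarrow> a \<in> grade A p"
| "pgen_homog A (GX i) p \<longleftrightarrow> p = eps A"

primrec word_homog :: "('k, 'a) frobenius_data \<Rightarrow> 'a pgen list \<Rightarrow> bit \<Rightarrow> bool" where
  "word_homog A [] p \<longleftrightarrow> p = 0"
| "word_homog A (g # w) p \<longleftrightarrow> (\<exists>q r. p = q + r \<and> pgen_homog A g q \<and> word_homog A w r)"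

definition Pol ::
  "('k::comm_ring_1, 'a::{ring, monoid_mult}) frobenius_data \<Rightarrow> nat \<Rightarrow> ('k, ('k, 'a) falg set) superalg"
  where
  "Pol A n =
     \<lparr>carr = pol_class A n ` falg_on n,
      homog = (\<lambda>p. pol_class A n `
                 {f \<in> falg_on n. \<forall>w\<in>Poly_Mapping.keys f. word_homog A w p}),
      zer = pol_class A n 0,
      add = (\<lambda>C D. \<Union>f\<in>C. \<Union>g\<in>D. pol_class A n (f + g)),
      smul = (\<lambda>c C. \<Union>f\<in>C. pol_class A n (pscale c f)),
      mul = (\<lambda>C D. \<Union>f\<in>C. \<Union>g\<in>D. pol_class A n (f * g)),
      unt = pol_class A n 1\<rparr>"

primrec pgen_relabel :: "(nat \<Rightarrow> nat) \<Rightarrow> 'a pgen \<Rightarrow> 'a pgen" where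
  "pgen_relabel \<pi> (GA i a) = GA (\<pi> i) a"
| "pgen_relabel \<pi> (GX i) = GX (\<pi> i)"

definition falg_relabel :: "(nat \<Rightarrow> nat) \<Rightarrow> ('k::comm_ring_1, 'a) falg \<Rightarrow> ('k, 'a) falg" where
  "falg_relabel \<pi> f = plinear (\<lambda>w. mon (map (pgen_relabel \<pi>) w)) f"

text \<open>\<open>pol_at A n i f\<close> is \<open>f_i \<in> Pol_n(A)\<close> for \<open>f \<in> Pol_1(A)\<close>.\<close>

definition pol_at ::
  "('k::comm_ring_1, 'a::{ring, monoid_mult}) frobenius_data \<Rightarrow> nat \<Rightarrow> nat \<Rightarrow>
   ('k, 'a) falg set \<Rightarrow> ('k, 'a) falg set" where
  "pol_at A n i C = (\<Union>f\<in>C. pol_class A n (falg_relabel (\<lambda>_. i) f))"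

text \<open>
  The identification \<open>Pol_m(A) \<otimes> Pol_n(A) = Pol_{m+n}(A)\<close> induced by
  \<open>Pol_n(A) = Pol_1(A)^{\<otimes>n}\<close>: multiply \<open>f\<close> by \<open>g\<close> with indices shifted by \<open>m\<close>.
\<close>

definition pol_juxt ::
  "('k::comm_ring_1, 'a::{ring, monoid_mult}) frobenius_data \<Rightarrow> nat \<Rightarrow> nat \<Rightarrow>
   ('k, 'a) falg set \<Rightarrow> ('k, 'a) falg set \<Rightarrow> ('k, 'a) falg set" where
  "pol_juxt A m n C D =
     (\<Union>f\<in>C. \<Union>g\<in>D. pol_class A (m + n) (f * falg_relabel (\<lambda>j. j + m) g))"

text \<open>
  \<open>s_i\<close> is the algebra automorphism \<open>a_j \<mapsto> a_{s_i(j)}\<close>, \<open>x_j \<mapsto> x_{s_i(j)}\<close>; on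
  \<open>A^{\<otimes>n}\<close> the signs of the superpermutation appear on reordering factors by \<open>tens_comm\<close>.
\<close>

definition pol_swap ::
  "('k::comm_ring_1, 'a::{ring, monoid_mult}) frobenius_data \<Rightarrow> nat \<Rightarrow> nat \<Rightarrow>
   ('k, 'a) falg set \<Rightarrow> ('k, 'a) falg set" where
  "pol_swap A n i C = (\<Union>f\<in>C. pol_class A n (falg_relabel (transpose i (Suc i)) f))"

text \<open>The element \<open>t_{i,j}\<close>.\<close>

definition teleporter ::
  "('k::comm_ring_1, 'a) frobenius_data \<Rightarrow> nat \<Rightarrow> nat \<Rightarrow> ('k, 'a) falg" where
  "teleporter A i j =
     (\<Sum>b\<in>basis A. pscale (ksgn (eps A) (bpar A b)) (mon [GA i b, GA j (dual A b)]))"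

text \<open>
  The Frobenius Demazure operator \<open>\<partial>_i\<close>: the values on generators are extended to the free
  algebra by \<open>\<partial>_i(1) = 0\<close> and \<open>\<partial>_i(g w) = \<partial>_i(g) w + s_i(g) \<partial>_i(w)\<close>, and the
  resulting map is taken modulo the defining relations of \<open>Pol_n(A)\<close>.  (The values \<open>0\<close> on
  all \<open>a_j\<close> and the Leibniz rule give \<open>0\<close> on \<open>A^{\<otimes>n}\<close>.)
\<close>

primrec demazure_gen ::
  "('k::comm_ring_1, 'a) frobenius_data \<Rightarrow> nat \<Rightarrow> 'a pgen \<Rightarrow> ('k, 'a) falg" where
  "demazure_gen A i (GA j a) = 0"
| "demazure_gen A i (GX j) =
     (if j = i then teleporter A i (Suc i)
      else if j = Suc i then - teleporter A (Suc i) i else 0)"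

primrec demazure_word ::
  "('k::comm_ring_1, 'a) frobenius_data \<Rightarrow> nat \<Rightarrow> 'a pgen list \<Rightarrow> ('k, 'a) falg" where
  "demazure_word A i [] = 0"
| "demazure_word A i (g # w) =
     demazure_gen A i g * mon w
       + mon [pgen_relabel (transpose i (Suc i)) g] * demazure_word A i w"

definition demazure ::
  "('k::comm_ring_1, 'a::{ring, monoid_mult}) frobenius_data \<Rightarrow> nat \<Rightarrow> nat \<Rightarrow>
   ('k, 'a) falg set \<Rightarrow> ('k, 'a) falg set" where
  "demazure A n i C = (\<Union>f\<in>C. pol_class A n (plinear (demazure_word A i) f))"


section \<open>Strict monoidal supercategories and monoidal functors to supermodules\<close>

record ('k, 'o, 'm) supercat =
  Ob :: "'o set"
  Hom :: "'o \<Rightarrow> 'o \<Rightarrow> ('k, 'm) smodule"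
  Idn :: "'o \<Rightarrow> 'm"
  Cmp :: "'m \<Rightarrow> 'm \<Rightarrow> 'm"
  UnitOb :: 'o
  TensOb :: "'o \<Rightarrow> 'o \<Rightarrow> 'o"
  TensMor :: "'m \<Rightarrow> 'm \<Rightarrow> 'm"

record (overloaded) ('k::zero, 'o, 'm, 'u) smod_functor =
  on_ob :: "'o \<Rightarrow> ('k, 'u) smodule"
  on_mor :: "'m \<Rightarrow> 'u \<Rightarrow> 'u"
  fmu :: "'o \<Rightarrow> 'o \<Rightarrow> ('u \<times> 'u \<Rightarrow>\<^sub>0 'k) set \<Rightarrow> 'u"
  feta :: "'k \<Rightarrow> 'u"

text \<open>
  A linear (strong) monoidal superfunctor from a strict monoidal supercategory \<open>C\<close> to
  supermodules and all linear maps.  The tensor product of supermodules is not strict, so the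
  functor carries its structure isomorphisms \<open>fmu X Y : F X \<otimes> F Y \<rightarrow> F (X \<otimes> Y)\<close> and
  \<open>feta : k \<rightarrow> F 1\<close>.  Their naturality and coherence are stated on pure tensors, where
  \<open>(\<phi> \<otimes> \<gamma>)(u \<otimes> v) = (-1)^(|\<gamma>| |u|) \<phi>(u) \<otimes> \<gamma>(v)\<close>.
\<close>

definition monoidal_functor ::
  "('k::comm_ring_1, 'o, 'm) supercat \<Rightarrow> ('k, 'o, 'm, 'u) smod_functor \<Rightarrow> bool" where
  "monoidal_functor C F \<longleftrightarrow>
     (\<forall>X\<in>Ob C. supermodule (on_ob F X)) \<and>
     (\<forall>X\<in>Ob C. \<forall>Y\<in>Ob C. \<forall>f\<in>carr (Hom C X Y). smod_hom (on_ob F X) (on_ob F Y) (on_mor F f)) \<and>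
     (\<forall>X\<in>Ob C. \<forall>Y\<in>Ob C. \<forall>p. \<forall>f\<in>homog (Hom C X Y) p.
        smod_hom_parity (on_ob F X) (on_ob F Y) p (on_mor F f)) \<and>
     (\<forall>X\<in>Ob C. \<forall>Y\<in>Ob C. \<forall>f\<in>carr (Hom C X Y). \<forall>g\<in>carr (Hom C X Y). \<forall>u\<in>carr (on_ob F X).
        on_mor F (add (Hom C X Y) f g) u = add (on_ob F Y) (on_mor F f u) (on_mor F g u)) \<and>
     (\<forall>X\<in>Ob C. \<forall>Y\<in>Ob C. \<forall>c. \<forall>f\<in>carr (Hom C X Y). \<forall>u\<in>carr (on_ob F X).
        on_mor F (smul (Hom C X Y) c f) u = smul (on_ob F Y) c (on_mor F f u)) \<and>
     (\<forall>X\<in>Ob C. \<forall>u\<in>carr (on_ob F X). on_mor F (Idn C X) u = u) \<and>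
     (\<forall>X\<in>Ob C. \<forall>Y\<in>Ob C. \<forall>Z\<in>Ob C. \<forall>f\<in>carr (Hom C X Y). \<forall>g\<in>carr (Hom C Y Z).
        \<forall>u\<in>carr (on_ob F X). on_mor F (Cmp C g f) u = on_mor F g (on_mor F f u)) \<and>
     (\<forall>X\<in>Ob C. \<forall>Y\<in>Ob C.
        even_iso (smod_tensor (on_ob F X) (on_ob F Y)) (on_ob F (TensOb C X Y)) (fmu F X Y)) \<and>
     even_iso ground_smod (on_ob F (UnitOb C)) (feta F) \<and>
     (\<forall>X\<in>Ob C. \<forall>X'\<in>Ob C. \<forall>Y\<in>Ob C. \<forall>Y'\<in>Ob C. \<forall>p q.
        \<forall>f\<in>carr (Hom C X X'). \<forall>g\<in>homog (Hom C Y Y') q.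
        \<forall>u\<in>homog (on_ob F X) p. \<forall>v\<in>carr (on_ob F Y).
          on_mor F (TensMor C f g) (fmu F X Y (pure_tensor (on_ob F X) (on_ob F Y) u v)) =
          smul (on_ob F (TensOb C X' Y')) (ksgn q p)
            (fmu F X' Y' (pure_tensor (on_ob F X') (on_ob F Y') (on_mor F f u) (on_mor F g v)))) \<and>
     (\<forall>X\<in>Ob C. \<forall>Y\<in>Ob C. \<forall>Z\<in>Ob C.
        \<forall>u\<in>carr (on_ob F X). \<forall>v\<in>carr (on_ob F Y). \<forall>w\<in>carr (on_ob F Z).
          fmu F (TensOb C X Y) Z (pure_tensor (on_ob F (TensOb C X Y)) (on_ob F Z)
            (fmu F X Y (pure_tensor (on_ob F X) (on_ob F Y) u v)) w) =
          fmu F X (TensOb C Y Z) (pure_tensor (on_ob F X) (on_ob F (TensOb C Y Z)) u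
            (fmu F Y Z (pure_tensor (on_ob F Y) (on_ob F Z) v w)))) \<and>
     (\<forall>X\<in>Ob C. \<forall>c. \<forall>u\<in>carr (on_ob F X).
        fmu F (UnitOb C) X (pure_tensor (on_ob F (UnitOb C)) (on_ob F X) (feta F c) u)
          = smul (on_ob F X) c u \<and>
        fmu F X (UnitOb C) (pure_tensor (on_ob F X) (on_ob F (UnitOb C)) u (feta F c))
          = smul (on_ob F X) c u)"

definition faithful_functor ::
  "('k::zero, 'o, 'm) supercat \<Rightarrow> ('k, 'o, 'm, 'u) smod_functor \<Rightarrow> bool" where
  "faithful_functor C F \<longleftrightarrow>
     (\<forall>X\<in>Ob C. \<forall>Y\<in>Ob C. \<forall>f\<in>carr (Hom C X Y). \<forall>g\<in>carr (Hom C X Y).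
        (\<forall>u\<in>carr (on_ob F X). on_mor F f u = on_mor F g u) \<longrightarrow> f = g)"


section \<open>The higher-level affine wreath product category\<close>

text \<open>
  Morphisms are formal expressions in the generators, modulo the congruence \<open>law_eq\<close> generated
  by the axioms of a strict linear monoidal supercategory and the defining relations.
  \<open>g \<odot> f\<close> is the composite (first \<open>f\<close>), and \<open>f \<boxtimes> g\<close> the tensor product.
\<close>

datatype 'q lob = II | QQ 'q

datatype ('k, 'a, 'q) lmor =
  Ident "'q lob list"
| Comp "('k, 'a, 'q) lmor" "('k, 'a, 'q) lmor" (infixr \<open>\<odot>\<close> 65)
| Tens "('k, 'a, 'q) lmor" "('k, 'a, 'q) lmor" (infixr \<open>\<boxtimes>\<close> 70)
| Nul "'q lob list" "'q lob list"
| Plus "('k, 'a, 'q) lmor" "('k, 'a, 'q) lmor"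
| Scal 'k "('k, 'a, 'q) lmor"
| Sig
| Tok 'a
| Dot
| Rho 'q
| Lam 'q

type_synonym ('k, 'a) law_ob = "('k, 'a) falg set lob list"
type_synonym ('k, 'a) law_term = "('k, 'a, ('k, 'a) falg set) lmor"

definition law_obs ::
  "('k::comm_ring_1, 'a::{ring, monoid_mult}) frobenius_data \<Rightarrow> ('k, 'a) law_ob set" where
  "law_obs A = lists (insert II (QQ ` ECR (Pol A 1)))"

inductive law_arr ::
  "('k::comm_ring_1, 'a::{ring, monoid_mult}) frobenius_data \<Rightarrow>
   ('k, 'a) law_term \<Rightarrow> ('k, 'a) law_ob \<Rightarrow> ('k, 'a) law_ob \<Rightarrow> bool"
  for A where
  "X \<in> law_obs A \<Longrightarrow> law_arr A (Ident X) X X"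
| "\<lbrakk>law_arr A f X Y; law_arr A g Y Z\<rbrakk> \<Longrightarrow> law_arr A (g \<odot> f) X Z"
| "\<lbrakk>law_arr A f X X'; law_arr A g Y Y'\<rbrakk> \<Longrightarrow> law_arr A (f \<boxtimes> g) (X @ Y) (X' @ Y')"
| "\<lbrakk>X \<in> law_obs A; Y \<in> law_obs A\<rbrakk> \<Longrightarrow> law_arr A (Nul X Y) X Y"
| "\<lbrakk>law_arr A f X Y; law_arr A g X Y\<rbrakk> \<Longrightarrow> law_arr A (Plus f g) X Y"
| "law_arr A f X Y \<Longrightarrow> law_arr A (Scal c f) X Y"
| "law_arr A Sig [II, II] [II, II]"
| "law_arr A (Tok a) [II] [II]"
| "law_arr A Dot [II] [II]"
| "Q \<in> ECR (Pol A 1) \<Longrightarrow> law_arr A (Rho Q) [QQ Q, II] [II, QQ Q]"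
| "Q \<in> ECR (Pol A 1) \<Longrightarrow> law_arr A (Lam Q) [II, QQ Q] [QQ Q, II]"

inductive law_homog ::
  "('k::comm_ring_1, 'a::{ring, monoid_mult}) frobenius_data \<Rightarrow> ('k, 'a) law_term \<Rightarrow> bit \<Rightarrow> bool"
  for A where
  "law_homog A (Ident X) 0"
| "\<lbrakk>law_homog A f p; law_homog A g q\<rbrakk> \<Longrightarrow> law_homog A (g \<odot> f) (q + p)"
| "\<lbrakk>law_homog A f p; law_homog A g q\<rbrakk> \<Longrightarrow> law_homog A (f \<boxtimes> g) (p + q)"
| "law_homog A (Nul X Y) p"
| "\<lbrakk>law_homog A f p; law_homog A g p\<rbrakk> \<Longrightarrow> law_homog A (Plus f g) p"
| "law_homog A f p \<Longrightarrow> law_homog A (Scal c f) p"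
| "law_homog A Sig 0"
| "a \<in> grade A p \<Longrightarrow> law_homog A (Tok a) p"
| "law_homog A Dot (eps A)"
| "law_homog A (Rho Q) 0"
| "law_homog A (Lam Q) 0"

definition lsum :: "'q lob list \<Rightarrow> 'q lob list \<Rightarrow> ('k, 'a, 'q) lmor list \<Rightarrow> ('k, 'a, 'q) lmor" where
  "lsum X Y ts = foldr Plus ts (Nul X Y)"

primrec dots :: "nat \<Rightarrow> ('k, 'a, 'q) lmor" where
  "dots 0 = Ident [II]"
| "dots (Suc r) = Dot \<odot> dots r"

text \<open>
  Elements of \<open>Pol_1(A)\<close> and \<open>Pol_2(A)\<close> given by coefficients: \<open>\<Sum>_{r<N} a_(r) x^r\<close>, and
  \<open>\<Sum> \<mu>_{b,c,r,s} (b \<otimes> c) x_1^r x_2^s\<close> with \<open>b, c\<close> in the basis and \<open>r, s < N\<close>;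
  and the corresponding morphisms \<open>[f]\<close> and \<open>[f]_Q\<close>.  Lists \<open>bs\<close> enumerating the
  basis are used because formal sums of terms are ordered.
\<close>

definition pol1_of ::
  "('k::comm_ring_1, 'a::{ring, monoid_mult}) frobenius_data \<Rightarrow> (nat \<Rightarrow> 'a) \<Rightarrow> nat \<Rightarrow>
   ('k, 'a) falg set" where
  "pol1_of A a N = pol_class A 1 (\<Sum>r<N. mon (GA 1 (a r) # replicate r (GX 1)))"

definition bracket1 :: "(nat \<Rightarrow> 'a) \<Rightarrow> nat \<Rightarrow> ('k, 'a, 'q) lmor" where
  "bracket1 a N = lsum [II] [II] [Tok (a r) \<odot> dots r. r \<leftarrow> [0..<N]]"

definition pol2_of ::
  "('k::comm_ring_1, 'a::{ring, monoid_mult}) frobenius_data \<Rightarrow>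
   ('a \<Rightarrow> 'a \<Rightarrow> nat \<Rightarrow> nat \<Rightarrow> 'k) \<Rightarrow> nat \<Rightarrow> ('k, 'a) falg set" where
  "pol2_of A \<mu> N = pol_class A 2
     (\<Sum>b\<in>basis A. \<Sum>c\<in>basis A. \<Sum>r<N. \<Sum>s<N. pscale (\<mu> b c r s)
        (mon ([GA 1 b, GA 2 c] @ replicate r (GX 1) @ replicate s (GX 2))))"

definition bracket2 ::
  "'q \<Rightarrow> 'a list \<Rightarrow> ('a \<Rightarrow> 'a \<Rightarrow> nat \<Rightarrow> nat \<Rightarrow> 'k) \<Rightarrow> nat \<Rightarrow> ('k, 'a, 'q) lmor" where
  "bracket2 Q bs \<mu> N = lsum [II, QQ Q, II] [II, QQ Q, II]
     [Scal (\<mu> b c r s) ((Tok b \<boxtimes> Ident [QQ Q] \<boxtimes> Tok c) \<odot> (dots r \<boxtimes> Ident [QQ Q] \<boxtimes> dots s)).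
        b \<leftarrow> bs, c \<leftarrow> bs, r \<leftarrow> [0..<N], s \<leftarrow> [0..<N]]"

inductive law_eq ::
  "('k::comm_ring_1, 'a::{ring, monoid_mult}) frobenius_data \<Rightarrow>
   ('k, 'a) law_ob \<Rightarrow> ('k, 'a) law_ob \<Rightarrow> ('k, 'a) law_term \<Rightarrow> ('k, 'a) law_term \<Rightarrow> bool"
  for A where
  eq_refl: "law_arr A f X Y \<Longrightarrow> law_eq A X Y f f"
| eq_sym: "law_eq A X Y f g \<Longrightarrow> law_eq A X Y g f"
| eq_trans: "\<lbrakk>law_eq A X Y f g; law_eq A X Y g h\<rbrakk> \<Longrightarrow> law_eq A X Y f h"
| comp_cong: "\<lbrakk>law_eq A X Y f f'; law_eq A Y Z g g'\<rbrakk> \<Longrightarrow> law_eq A X Z (g \<odot> f) (g' \<odot> f')"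
| tens_cong: "\<lbrakk>law_eq A X X' f f'; law_eq A Y Y' g g'\<rbrakk> \<Longrightarrow>
    law_eq A (X @ Y) (X' @ Y') (f \<boxtimes> g) (f' \<boxtimes> g')"
| plus_cong: "\<lbrakk>law_eq A X Y f f'; law_eq A X Y g g'\<rbrakk> \<Longrightarrow> law_eq A X Y (Plus f g) (Plus f' g')"
| scal_cong: "law_eq A X Y f f' \<Longrightarrow> law_eq A X Y (Scal c f) (Scal c f')"
| plus_assoc: "\<lbrakk>law_arr A f X Y; law_arr A g X Y; law_arr A h X Y\<rbrakk> \<Longrightarrow>
    law_eq A X Y (Plus (Plus f g) h) (Plus f (Plus g h))"
| plus_comm: "\<lbrakk>law_arr A f X Y; law_arr A g X Y\<rbrakk> \<Longrightarrow> law_eq A X Y (Plus f g) (Plus g f)"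
| plus_zero: "law_arr A f X Y \<Longrightarrow> law_eq A X Y (Plus (Nul X Y) f) f"
| plus_minus: "law_arr A f X Y \<Longrightarrow> law_eq A X Y (Plus f (Scal (- 1) f)) (Nul X Y)"
| scal_plus: "\<lbrakk>law_arr A f X Y; law_arr A g X Y\<rbrakk> \<Longrightarrow>
    law_eq A X Y (Scal c (Plus f g)) (Plus (Scal c f) (Scal c g))"
| plus_scal: "law_arr A f X Y \<Longrightarrow> law_eq A X Y (Scal (c + d) f) (Plus (Scal c f) (Scal d f))"
| scal_scal: "law_arr A f X Y \<Longrightarrow> law_eq A X Y (Scal (c * d) f) (Scal c (Scal d f))"
| scal_one: "law_arr A f X Y \<Longrightarrow> law_eq A X Y (Scal 1 f) f"
| comp_assoc: "\<lbrakk>law_arr A f X Y; law_arr A g Y Z; law_arr A h Z W\<rbrakk> \<Longrightarrow>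
    law_eq A X W ((h \<odot> g) \<odot> f) (h \<odot> g \<odot> f)"
| comp_id_left: "law_arr A f X Y \<Longrightarrow> law_eq A X Y (Ident Y \<odot> f) f"
| comp_id_right: "law_arr A f X Y \<Longrightarrow> law_eq A X Y (f \<odot> Ident X) f"
| comp_plus_left: "\<lbrakk>law_arr A f X Y; law_arr A g Y Z; law_arr A h Y Z\<rbrakk> \<Longrightarrow>
    law_eq A X Z (Plus g h \<odot> f) (Plus (g \<odot> f) (h \<odot> f))"
| comp_plus_right: "\<lbrakk>law_arr A f X Y; law_arr A g X Y; law_arr A h Y Z\<rbrakk> \<Longrightarrow>
    law_eq A X Z (h \<odot> Plus f g) (Plus (h \<odot> f) (h \<odot> g))"
| comp_scal_left: "\<lbrakk>law_arr A f X Y; law_arr A g Y Z\<rbrakk> \<Longrightarrow>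
    law_eq A X Z (Scal c g \<odot> f) (Scal c (g \<odot> f))"
| comp_scal_right: "\<lbrakk>law_arr A f X Y; law_arr A g Y Z\<rbrakk> \<Longrightarrow>
    law_eq A X Z (g \<odot> Scal c f) (Scal c (g \<odot> f))"
| tens_assoc: "\<lbrakk>law_arr A f X X'; law_arr A g Y Y'; law_arr A h Z Z'\<rbrakk> \<Longrightarrow>
    law_eq A (X @ Y @ Z) (X' @ Y' @ Z') ((f \<boxtimes> g) \<boxtimes> h) (f \<boxtimes> g \<boxtimes> h)"
| tens_unit_left: "law_arr A f X Y \<Longrightarrow> law_eq A X Y (Ident [] \<boxtimes> f) f"
| tens_unit_right: "law_arr A f X Y \<Longrightarrow> law_eq A X Y (f \<boxtimes> Ident []) f"
| tens_id: "\<lbrakk>X \<in> law_obs A; Y \<in> law_obs A\<rbrakk> \<Longrightarrow>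
    law_eq A (X @ Y) (X @ Y) (Ident X \<boxtimes> Ident Y) (Ident (X @ Y))"
| tens_plus_left: "\<lbrakk>law_arr A f X X'; law_arr A g X X'; law_arr A h Y Y'\<rbrakk> \<Longrightarrow>
    law_eq A (X @ Y) (X' @ Y') (Plus f g \<boxtimes> h) (Plus (f \<boxtimes> h) (g \<boxtimes> h))"
| tens_plus_right: "\<lbrakk>law_arr A f X X'; law_arr A g Y Y'; law_arr A h Y Y'\<rbrakk> \<Longrightarrow>
    law_eq A (X @ Y) (X' @ Y') (f \<boxtimes> Plus g h) (Plus (f \<boxtimes> g) (f \<boxtimes> h))"
| tens_scal_left: "\<lbrakk>law_arr A f X X'; law_arr A g Y Y'\<rbrakk> \<Longrightarrow>
    law_eq A (X @ Y) (X' @ Y') (Scal c f \<boxtimes> g) (Scal c (f \<boxtimes> g))"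
| tens_scal_right: "\<lbrakk>law_arr A f X X'; law_arr A g Y Y'\<rbrakk> \<Longrightarrow>
    law_eq A (X @ Y) (X' @ Y') (f \<boxtimes> Scal c g) (Scal c (f \<boxtimes> g))"
| interchange: "\<lbrakk>law_arr A f X X'; law_arr A f' X' X''; law_arr A g' Y Y'; law_arr A g Y' Y'';
      law_homog A f p; law_homog A g q\<rbrakk> \<Longrightarrow>
    law_eq A (X @ Y) (X'' @ Y'') ((f' \<boxtimes> g) \<odot> (f \<boxtimes> g'))
      (Scal (ksgn p q) ((f' \<odot> f) \<boxtimes> (g \<odot> g')))"
| tok_one: "law_eq A [II] [II] (Tok 1) (Ident [II])"
| tok_linear: "law_eq A [II] [II] (Plus (Scal c (Tok a)) (Scal d (Tok b)))
      (Tok (scl A c a + scl A d b))"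
| tok_mult: "law_eq A [II] [II] (Tok a \<odot> Tok b) (Tok (a * b))"
| sig_sig: "law_eq A [II, II] [II, II] (Sig \<odot> Sig) (Ident [II, II])"
| braid: "law_eq A [II, II, II] [II, II, II]
      ((Sig \<boxtimes> Ident [II]) \<odot> (Ident [II] \<boxtimes> Sig) \<odot> (Sig \<boxtimes> Ident [II]))
      ((Ident [II] \<boxtimes> Sig) \<odot> (Sig \<boxtimes> Ident [II]) \<odot> (Ident [II] \<boxtimes> Sig))"
| sig_tok: "law_eq A [II, II] [II, II] (Sig \<odot> (Tok a \<boxtimes> Ident [II])) ((Ident [II] \<boxtimes> Tok a) \<odot> Sig)"
| sig_dot: "\<lbrakk>distinct bs; set bs = basis A\<rbrakk> \<Longrightarrow>
    law_eq A [II, II] [II, II] (Sig \<odot> (Dot \<boxtimes> Ident [II]))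
      (Plus ((Ident [II] \<boxtimes> Dot) \<odot> Sig)
        (Scal (- 1) (lsum [II, II] [II, II]
          [Scal (ksgn (eps A) (bpar A b)) (Tok b \<boxtimes> Tok (dual A b)). b \<leftarrow> bs])))"
| tok_dot: "a \<in> grade A p \<Longrightarrow>
    law_eq A [II] [II] (Tok a \<odot> Dot) (Scal (ksgn (eps A) p) (Dot \<odot> Tok (nak A a)))"
| lam_tok: "Q \<in> ECR (Pol A 1) \<Longrightarrow>
    law_eq A [II, QQ Q] [QQ Q, II] (Lam Q \<odot> (Tok a \<boxtimes> Ident [QQ Q])) ((Ident [QQ Q] \<boxtimes> Tok a) \<odot> Lam Q)"
| rho_tok: "Q \<in> ECR (Pol A 1) \<Longrightarrow>
    law_eq A [QQ Q, II] [II, QQ Q] (Rho Q \<odot> (Ident [QQ Q] \<boxtimes> Tok a)) ((Tok a \<boxtimes> Ident [QQ Q]) \<odot> Rho Q)"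
| lam_dot: "Q \<in> ECR (Pol A 1) \<Longrightarrow>
    law_eq A [II, QQ Q] [QQ Q, II] (Lam Q \<odot> (Dot \<boxtimes> Ident [QQ Q])) ((Ident [QQ Q] \<boxtimes> Dot) \<odot> Lam Q)"
| rho_dot: "Q \<in> ECR (Pol A 1) \<Longrightarrow>
    law_eq A [QQ Q, II] [II, QQ Q] (Rho Q \<odot> (Ident [QQ Q] \<boxtimes> Dot)) ((Dot \<boxtimes> Ident [QQ Q]) \<odot> Rho Q)"
| rho_lam: "\<lbrakk>Q \<in> ECR (Pol A 1); Q = pol1_of A a N\<rbrakk> \<Longrightarrow>
    law_eq A [II, QQ Q] [II, QQ Q] (Rho Q \<odot> Lam Q) (bracket1 a N \<boxtimes> Ident [QQ Q])"
| lam_rho: "\<lbrakk>Q \<in> ECR (Pol A 1); Q = pol1_of A a N\<rbrakk> \<Longrightarrow>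
    law_eq A [QQ Q, II] [QQ Q, II] (Lam Q \<odot> Rho Q) (Ident [QQ Q] \<boxtimes> bracket1 a N)"
| rho_sig: "Q \<in> ECR (Pol A 1) \<Longrightarrow>
    law_eq A [QQ Q, II, II] [II, II, QQ Q]
      ((Sig \<boxtimes> Ident [QQ Q]) \<odot> (Ident [II] \<boxtimes> Rho Q) \<odot> (Rho Q \<boxtimes> Ident [II]))
      ((Ident [II] \<boxtimes> Rho Q) \<odot> (Rho Q \<boxtimes> Ident [II]) \<odot> (Ident [QQ Q] \<boxtimes> Sig))"
| lam_sig: "Q \<in> ECR (Pol A 1) \<Longrightarrow>
    law_eq A [II, II, QQ Q] [QQ Q, II, II]
      ((Lam Q \<boxtimes> Ident [II]) \<odot> (Ident [II] \<boxtimes> Lam Q) \<odot> (Sig \<boxtimes> Ident [QQ Q]))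
      ((Ident [QQ Q] \<boxtimes> Sig) \<odot> (Lam Q \<boxtimes> Ident [II]) \<odot> (Ident [II] \<boxtimes> Lam Q))"
| mixed_braid: "\<lbrakk>Q \<in> ECR (Pol A 1); distinct bs; set bs = basis A;
      demazure A 2 1 (pol_at A 2 1 Q) = pol2_of A \<mu> N\<rbrakk> \<Longrightarrow>
    law_eq A [II, QQ Q, II] [II, QQ Q, II]
      ((Rho Q \<boxtimes> Ident [II]) \<odot> (Ident [QQ Q] \<boxtimes> Sig) \<odot> (Lam Q \<boxtimes> Ident [II]))
      (Plus ((Ident [II] \<boxtimes> Lam Q) \<odot> (Sig \<boxtimes> Ident [QQ Q]) \<odot> (Ident [II] \<boxtimes> Rho Q))
        (Scal (- 1) (bracket2 Q bs \<mu> N)))"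

definition law_class ::
  "('k::comm_ring_1, 'a::{ring, monoid_mult}) frobenius_data \<Rightarrow>
   ('k, 'a) law_ob \<Rightarrow> ('k, 'a) law_ob \<Rightarrow> ('k, 'a) law_term \<Rightarrow> ('k, 'a) law_term set" where
  "law_class A X Y f = {g. law_eq A X Y f g}"

definition LAW ::
  "('k::comm_ring_1, 'a::{ring, monoid_mult}) frobenius_data \<Rightarrow>
   ('k, ('k, 'a) law_ob, ('k, 'a) law_term set) supercat" where
  "LAW A =
     \<lparr>Ob = law_obs A,
      Hom = (\<lambda>X Y.
        \<lparr>carr = {law_class A X Y f | f. law_arr A f X Y},
         homog = (\<lambda>p. {law_class A X Y f | f. law_arr A f X Y \<and> law_homog A f p}),
         zer = law_class A X Y (Nul X Y),
         add = (\<lambda>F G. \<Union>f\<in>F. \<Union>g\<in>G. law_class A X Y (Plus f g)),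
         smul = (\<lambda>c F. \<Union>f\<in>F. law_class A X Y (Scal c f))\<rparr>),
      Idn = (\<lambda>X. law_class A X X (Ident X)),
      Cmp = (\<lambda>G F. \<Union>g\<in>G. \<Union>f\<in>F. \<Union>X. \<Union>Y. law_class A X Y (g \<odot> f)),
      UnitOb = [],
      TensOb = (@),
      TensMor = (\<lambda>F G. \<Union>f\<in>F. \<Union>g\<in>G. \<Union>X. \<Union>Y. law_class A X Y (f \<boxtimes> g))\<rparr>"

end

theory Submission
  imports Defs
begin

text \<open>
  \<^term>\<open>Pol A n\<close> is modelled on the free module over words \<open>b\<^sub>1 x\<^sup>r\<^sup>1 \<dots> b\<^sub>n x\<^sup>r\<^sup>n\<close> with
  \<open>b\<^sub>i\<close> in the basis, on which every diagram acts by an operator; checking the defining relations on these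
  operators gives the functor.  For faithfulness, a morphism into \<open>y \<otimes> Y\<close> is a sum of diagrams in which one
  strand, decorated by \<open>b x^r\<close> at its source, is pulled to the front, followed by a morphism into \<open>Y\<close> on the
  other strands.  Applied to a word with a huge power of \<open>x\<close> on the strand in question, such a sum has leading
  terms from which the action of each of these morphisms can be read off, so induction on the length of the target
  applies.  If the front strand is labelled by a central element \<open>Q\<close>, pulling it multiplies by \<open>Q\<close> on the
  strands crossed; multiplication by \<open>Q\<close> on all strands is injective and commutes with everything.
\<close>

text \<open>The ground ring is arbitrary, so nothing can be divided by: leading coefficients are
  signs \<open>s\<close> with \<open>s * s = 1\<close>, and regularity of \<open>Q\<close> enters as
  injectivity of multiplication. A crossing acts as the signed swap plus terms of lower degree in
  the \<open>x\<close>, because teleporters have degree 0; this takes the place of a basis theorem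
  for morphism spaces. Two obstacles shape the rest. Compatibility of a crossing with
  \<open>Q\<close> on both its strands amounts to invariance of the Demazure image of
  \<open>Q_1\<close> under the swap: the defect \<open>e\<close> satisfies
  \<open>e x_2 = x_1 e\<close>, and comparing exponents of \<open>x_2\<close> forces
  \<open>e = 0\<close>. Secondly, two \<open>Q\<close>-strands have no crossing, so a front strand
  labelled \<open>Q\<close> can only start at the first letter of the source other than
  \<open>II\<close>; a single term remains and no leading-term argument is needed there. For a front
  strand \<open>II\<close>, a coefficient with exponent near the huge power isolates the strands
  starting at the marked place once those further right are known to vanish; what remains is an
  induction on degree.\<close>

declare add_bit_eq_xor [simp del] One_nat_def [simp del]

abbreviation (input) "sng \<equiv> Poly_Mapping.single"
abbreviation (input) "lkp \<equiv> Poly_Mapping.lookup"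
abbreviation (input) "kys \<equiv> Poly_Mapping.keys"
abbreviation (input) "idv \<equiv> (\<lambda>v. v)"

section \<open>Free modules\<close>

lemma bit_exhaust: "(p::bit) = 0 | p = 1"
 using bit_not_zero_iff by blast

lemma ksgn_simps [simp]: "ksgn 0 q = 1" "ksgn p 0 = 1" "ksgn 1 1 = - 1"
 by (simp_all add: ksgn_def)

lemma ksgn_comm: "ksgn p q = ksgn q p"
 by (auto simp: ksgn_def)

lemma bit_add_self [simp]: "(p::bit) + p = 0"
 using bit_exhaust[of p] by auto

lemma bit_add_self_left [simp]: "(p::bit) + (p + q) = q"
 using bit_exhaust[of p] bit_exhaust[of q] by auto

lemma ksgn_add_right: "ksgn p (q + r) = ksgn p q * ksgn p r"
 using bit_exhaust[of p] bit_exhaust[of q] bit_exhaust[of r] by auto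

lemma ksgn_add_left: "ksgn (p + q) r = ksgn p r * ksgn q r"
 using bit_exhaust[of p] bit_exhaust[of q] bit_exhaust[of r] by auto

lemma ksgn_self [simp]: "ksgn p q * ksgn p q = 1"
 using bit_exhaust[of p] bit_exhaust[of q] by auto

lemma ksgn_self_left [simp]: "ksgn p q * (ksgn p q * c) = c"
 using bit_exhaust[of p] bit_exhaust[of q] by auto

lemma lookup_pscale [simp]: "lkp (pscale c f) i = c * lkp f i"
 unfolding pscale_def by (simp add: Poly_Mapping.map.rep_eq when_def)

lemma pscale_simps [simp]:
 "pscale 1 f = f" "pscale 0 f = 0" "pscale c 0 = 0"
 "pscale c (pscale d f) = pscale (c * d) f"
 "pscale c (sng i d) = sng i (c * d)"
 by (auto intro!: poly_mapping_eqI simp: mult.assoc lookup_single when_def)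

lemma pscale_add: "pscale c (f + g) = pscale c f + pscale c g"
 by (auto intro!: poly_mapping_eqI simp: lookup_add distrib_left)

lemma pscale_add_left: "pscale (c + d) f = pscale c f + pscale d f"
 by (auto intro!: poly_mapping_eqI simp: lookup_add distrib_right)

lemma pscale_diff: "pscale c (f - g) = pscale c f - pscale c g"
 by (auto intro!: poly_mapping_eqI simp: lookup_minus right_diff_distrib)

lemma pscale_uminus: "pscale c (- f) = - pscale c f" "pscale (- c) f = - pscale c f"
 by (auto intro!: poly_mapping_eqI)

lemma pscale_sum: "pscale c (sum f I) = (\<Sum>i\<in>I. pscale c (f i))"
 by (auto intro!: poly_mapping_eqI simp: lookup_sum sum_distrib_left)

lemma pscale_conv_mult: "pscale c f = sng 0 c * f"
 unfolding pscale_def by (rule mult_map_scale_conv_mult)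

lemma poly_mapping_sum_single:
 "(f :: 'i \<Rightarrow>\<^sub>0 'k::comm_ring_1) = (\<Sum>i\<in>kys f. sng i (lkp f i))"
proof (rule poly_mapping_eqI)
 fix j
 show "lkp f j = lkp
   (\<Sum>i\<in>kys f. sng i (lkp f i)) j"
  by (simp add: lookup_sum lookup_single when_def sum.delta' in_keys_iff)
qed

text \<open>The single case is offered only for keys of \<open>f\<close>, so that a bound on the
  support of \<open>f\<close> can be used there. Arguments that check an identity on words rest on
  this rule.\<close>

lemma poly_mapping_single_induct [case_names zero single add]:
 assumes "P 0" "\<And>i c. i : kys f ==> P (sng i c)"
  "\<And>g h. P g ==> P h ==> P (g + h)"
 shows "P (f :: 'i \<Rightarrow>\<^sub>0 'k::comm_ring_1)"
proof -
 have "I <= kys f ==> P (\<Sum>i\<in>I. sng i (lkp f i))" if "finite I" for I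
  using that by (induction) (use assms in auto)
 from this[of "kys f"] show ?thesis using poly_mapping_sum_single[of f] by simp
qed

lemma single_mult_commute:
 "f * sng 0 c = pscale c (f :: 'i::monoid_add \<Rightarrow>\<^sub>0 'k::comm_ring_1)"
proof (induction f rule: poly_mapping_single_induct)
 case (single i d)
 then show ?case by (simp add: mult_single mult.commute)
qed (simp_all add: distrib_right pscale_add)

lemma pscale_mult_left [simp]: "pscale c f * g = pscale c (f * (g :: 'i::monoid_add \<Rightarrow>\<^sub>0 'k::comm_ring_1))"
 by (simp add: pscale_conv_mult mult.assoc)

lemma pscale_mult_right [simp]: "f * pscale c g = pscale c (f * (g :: 'i::monoid_add \<Rightarrow>\<^sub>0 'k::comm_ring_1))"
proof -
 have "f * pscale c g = f * sng 0 c * g"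
  by (simp add: pscale_conv_mult mult.assoc)
 then show ?thesis by (simp add: single_mult_commute)
qed

text \<open>Operators are total functions on the whole free module, hence linearity is a predicate.
  Restriction to words of the right length is expressed separately, by \<open>opr\<close>.\<close>

definition lin :: "(('i \<Rightarrow>\<^sub>0 'k::comm_ring_1) => ('j \<Rightarrow>\<^sub>0 'k)) => bool" where
 "lin F \<longleftrightarrow> (\<forall>u v. F (u + v) = F u + F v) & (\<forall>c u. F (pscale c u) = pscale c (F u))"

lemma linI: "(\<And>u v. F (u + v) = F u + F v) ==> (\<And>c u. F (pscale c u) = pscale c (F u)) ==> lin F"
 by (auto simp: lin_def)

lemma lin_add: "lin F ==> F (u + v) = F u + F v" by (auto simp: lin_def)
lemma lin_pscale: "lin F ==> F (pscale c u) = pscale c (F u)" by (auto simp: lin_def)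
lemma lin_0: "lin F ==> F 0 = 0" using lin_pscale[of F 0 0] by simp
lemma lin_uminus: "lin F ==> F (- u) = - F u"
 using lin_pscale[of F "-1" u] by (simp add: pscale_uminus)
lemma lin_diff: "lin F ==> F (u - v) = F u - F v"
 using lin_add[of F u "- v"] lin_uminus[of F v] by simp
lemma lin_sum: "lin F ==> F (sum f I) = (\<Sum>i\<in>I. F (f i))"
 by (induction I rule: infinite_finite_induct) (auto simp: lin_0 lin_add)
lemma lin_single: "lin F ==> F (sng i c) = pscale c (F (sng i 1))"
 using lin_pscale[of F c "sng i 1"] by simp

lemma lin_id [simp]: "lin idv" "lin id" by (auto simp: lin_def)
lemma lin_comp: "lin F ==> lin G ==> lin (%v. G (F v))" by (auto simp: lin_def)
lemma lin_plus: "lin F ==> lin G ==> lin (%v. F v + G v)"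
 by (auto simp: lin_def pscale_add)
lemma lin_minus: "lin F ==> lin G ==> lin (%v. F v - G v)"
 by (auto simp: lin_def pscale_diff)
lemma lin_scale: "lin F ==> lin (%v. pscale c (F v))"
 by (auto simp: lin_def pscale_add mult.commute)
lemma lin_zero [simp]: "lin (%v. 0)" by (auto simp: lin_def)
lemma lin_mult_left [simp]: "lin (%v. u * v)" by (auto simp: lin_def distrib_left)
lemma lin_mult_right [simp]: "lin (%v. v * u)" by (auto simp: lin_def distrib_right)
lemma lin_summation: "(\<And>i. i : I ==> lin (F i)) ==> lin (%v. \<Sum>i\<in>I. F i v)"
 by (auto simp: lin_def sum.distrib pscale_sum)

lemma lin_eq_on:
 assumes "lin F" "lin G" "\<And>i. i : kys v ==> F (sng i 1) = G (sng i 1)"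
 shows "F v = G v"
proof (induction v rule: poly_mapping_single_induct)
 case (single i c)
 then show ?case using assms by (simp add: lin_single[of F i c] lin_single[of G i c])
qed (use assms in "auto simp: lin_0 lin_add")

lemma plinear_superset:
 assumes "finite I" "kys f <= I"
 shows "plinear \<phi> f = (\<Sum>i\<in>I. pscale (lkp f i) (\<phi> i))"
 unfolding plinear_def by (rule sum.mono_neutral_left) (use assms in "auto simp: in_keys_iff")

lemma lin_plinear [simp]: "lin (plinear \<phi>)"
proof (rule linI)
 fix u v :: "'a \<Rightarrow>\<^sub>0 'b"
 let ?I = "kys u \<union> kys v"
 have "plinear \<phi> (u + v) = (\<Sum>i\<in>?I. pscale (lkp (u + v) i) (\<phi> i))"
  by (rule plinear_superset) (auto simp: keys_add)
 moreover have "plinear \<phi> u = (\<Sum>i\<in>?I. pscale (lkp u i) (\<phi> i))"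
  by (rule plinear_superset) auto
 moreover have "plinear \<phi> v = (\<Sum>i\<in>?I. pscale (lkp v i) (\<phi> i))"
  by (rule plinear_superset) auto
 ultimately show "plinear \<phi> (u + v) = plinear \<phi> u + plinear \<phi> v"
  by (simp add: lookup_add pscale_add_left sum.distrib)
next
 fix c and u :: "'a \<Rightarrow>\<^sub>0 'b"
 have "plinear \<phi> (pscale c u) = (\<Sum>i\<in>kys u. pscale (lkp (pscale c u) i) (\<phi> i))"
  by (rule plinear_superset) (auto simp: in_keys_iff)
 then show "plinear \<phi> (pscale c u) = pscale c (plinear \<phi> u)"
  by (simp add: plinear_def pscale_sum)
qed

lemma plinear_single [simp]: "plinear \<phi> (sng i c) = pscale c (\<phi> i)"
 by (cases "c = 0") (simp_all add: plinear_def)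

lemma keys_pscale: "kys (pscale c f) <= kys f"
 by (auto simp: in_keys_iff)

text \<open>The submodule spanned by the words in \<open>I\<close>. Length, parity and degree of
  vectors are all stated as supports of this kind.\<close>

definition supp :: "'i set => ('i \<Rightarrow>\<^sub>0 'k::comm_ring_1) set" where
 "supp I = {v. kys v <= I}"

lemma supp_0 [simp]: "0 : supp I" by (simp add: supp_def)
lemma supp_add: "u : supp I ==> v : supp I ==> u + v : supp I"
 using keys_add[of u v] by (auto simp: supp_def)
lemma supp_pscale: "u : supp I ==> pscale c u : supp I"
 using keys_pscale[of c u] by (auto simp: supp_def)
lemma supp_uminus: "u : supp I ==> - u : supp I"
 by (auto simp: supp_def in_keys_iff)
lemma supp_diff: "u : supp I ==> v : supp I ==> u - v : supp I"
 using supp_add[of u I "- v"] supp_uminus[of v I] by simp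
lemma supp_sum: "(\<And>i. i : J ==> f i : supp I) ==> sum f J : supp I"
 by (induction J rule: infinite_finite_induct) (auto intro: supp_add)
lemma supp_single: "i : I ==> sng i c : supp I"
 by (auto simp: supp_def)
lemma supp_mono: "I <= J ==> u : supp I ==> u : supp J"
 by (auto simp: supp_def)

lemma lin_supp:
 assumes "lin F" "v : supp I" "\<And>i. i : I ==> F (sng i 1) : supp J"
 shows "F v : supp J"
proof (induction v rule: poly_mapping_single_induct)
 case (single i c)
 then have "i : I" using assms(2) by (auto simp: supp_def)
 then show ?case using assms lin_single[of F i c] by (auto intro: supp_pscale)
qed (use assms in "auto simp: lin_0 lin_add intro: supp_add")

lemma supp_mult:
 assumes "u : supp I" "v : supp J" "\<And>i j. i : I ==> j : J ==> i + j : K"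
 shows "u * v : supp (K :: 'i::monoid_add set)"
 using assms(1,2) keys_mult[of u v] assms(3) unfolding supp_def by blast

lemma supp_mult_single_induct:
 assumes "lin F" "lin G" "v : supp I" "\<And>i. i : I ==> F (sng i 1) = G (sng i 1)"
 shows "F v = G v"
 by (rule lin_eq_on) (use assms in "auto simp: supp_def")

lemma bilinear_eqI:
 assumes "\<And>v. lin (%u. F u v)" "\<And>v. lin (%u. G u v)" "\<And>u. lin (F u)" "\<And>u. lin (G u)"
  "u : supp I" "v : supp J"
  "\<And>i j. i : I ==> j : J ==> F (sng i 1) (sng j 1)
   = G (sng i 1) (sng j 1)"
 shows "F u v = G u v"
proof -
 have "F (sng i 1) v = G (sng i 1) v" if "i : I" for i
  by (rule supp_mult_single_induct[OF assms(3,4) \<open>v : supp J\<close>]) (use that assms in auto)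
 then show ?thesis
  by (intro supp_mult_single_induct[OF assms(1,2) \<open>u : supp I\<close>]) auto
qed

lemma supp_UNIV [simp]: "v : supp UNIV" by (simp add: supp_def)

lemma append_plus [simp]: "(xs :: 'e list) + ys = xs @ ys" by (simp add: plus_list_def)
lemma nil_zero [simp]: "(0 :: 'e list) = []" by (simp add: zero_list_def)

lemma vm_mult: "sng xs c * sng ys d = sng (xs @ ys) (c * d)"
 by (simp add: mult_single)

lemma one_single_Nil: "(1 :: 'e list \<Rightarrow>\<^sub>0 'k::comm_ring_1) = sng [] 1"
 by (metis nil_zero single_one)

definition FW :: "nat => 'a pgen list set" where "FW n = {w. \<forall>g\<in>set w. pgen_index g : {1..n}}"

lemma falg_on_supp: "falg_on n = supp (FW n)"
 by (auto simp: falg_on_def supp_def FW_def)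

lemma FW_append: "w @ w' : FW n \<longleftrightarrow> w : FW n & w' : FW n" by (auto simp: FW_def)
lemma FW_Cons: "g # w : FW n \<longleftrightarrow> pgen_index g : {1..n} & w : FW n" by (auto simp: FW_def)
lemma FW_Nil [simp]: "[] : FW n" by (auto simp: FW_def)
lemma FW_mono: "m <= n ==> FW m <= FW n" by (fastforce simp: FW_def)

lemma falg_on_closed [simp]: "0 : falg_on n" "1 : falg_on n" "f : falg_on n ==> g : falg_on n ==> f + g : falg_on n"
 "f : falg_on n ==> g : falg_on n ==> f - g : falg_on n" "f : falg_on n ==> - f : falg_on n"
 "f : falg_on n ==> pscale c f : falg_on n"
 "f : falg_on n ==> g : falg_on n ==> f * g : falg_on n"
 by (auto simp: falg_on_supp supp_add supp_diff supp_uminus supp_pscale one_single_Nil FW_append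
   intro!: supp_single intro: supp_mult)
lemma falg_on_mono: "m <= n ==> f : falg_on m ==> f : falg_on n"
 unfolding falg_on_supp by (rule supp_mono[OF FW_mono])
lemma falg_on_sum: "(\<And>i. i : I ==> f i : falg_on n) ==> sum f I : falg_on n"
 by (auto simp: falg_on_supp intro: supp_sum)
lemma falg_on_single: "w : FW n ==> sng w c : falg_on n"
 by (auto simp: falg_on_supp intro: supp_single)

section \<open>Operators on the tensor model\<close>

context frobenius_superalgebra begin

abbreviation (input) "OB \<equiv> law_obs A"

section \<open>Coordinates, dual basis and Nakayama automorphism\<close>

lemma tr_add: "tr A (a + b) = tr A a + tr A b"
 using tr_linear by (simp add: module_hom.add)
lemma tr_scale: "tr A (scl A c a) = c * tr A a"
 using tr_linear by (simp add: module_hom.scale)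
lemma tr_sum: "tr A (sum f I) = (\<Sum>i\<in>I. tr A (f i))"
 using tr_linear by (simp add: module_hom.sum)

lemma nak_add: "nak A (a + b) = nak A a + nak A b"
 using nak_linear by (simp add: module_hom.add)
lemma nak_scale: "nak A (scl A c a) = scl A c (nak A a)"
 using nak_linear by (simp add: module_hom.scale)

text \<open>The coordinate of \<open>a\<close> along the basis element \<open>b\<close>: pairing
  with the dual basis extracts coefficients, see \<open>cf_expand\<close>.\<close>

definition cf :: "'a => 'a => 'k" where "cf b a = tr A (dual A b * a)"

lemma cf_add: "cf b (a + a') = cf b a + cf b a'" by (simp add: cf_def distrib_left tr_add)
lemma cf_scale: "cf b (scl A c a) = c * cf b a" by (simp add: cf_def scl_mult_right tr_scale)
lemma cf_sum: "cf b (sum f I) = (\<Sum>i\<in>I. cf b (f i))" by (simp add: cf_def sum_distrib_left tr_sum)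
lemma cf_basis: "b : basis A ==> c : basis A ==> cf b c = (if b = c then 1 else 0)"
 by (simp add: cf_def dual_tr)

lemma cf_sum_basis:
 assumes "b : basis A" shows "cf b (\<Sum>c\<in>basis A. scl A (u c) c) = u b"
 using assms basis_finite by (simp add: cf_sum cf_scale cf_basis if_distrib cong: if_cong)

lemma cf_expand: "(\<Sum>b\<in>basis A. scl A (cf b a) b) = a"
proof -
 have "a : span (basis A)" using basis_span by simp
 then obtain u where u: "a = (\<Sum>b\<in>basis A. scl A (u b) b)"
  by (auto simp: span_finite[OF basis_finite])
 then have "\<forall>b\<in>basis A. cf b a = u b" using cf_sum_basis by blast
 then show ?thesis by (subst (2) u) (auto intro!: sum.cong)
qed

text \<open>Expand \<open>x\<close> in the dual basis; its coefficient at \<open>dual A c\<close> is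
  \<open>tr A (x * c)\<close>. Equalities in \<open>A\<close> can therefore be tested under the
  trace.\<close>

lemma trace_nondegenerate:
 assumes "\<And>c. c : basis A ==> tr A (x * c) = 0" shows "x = 0"
proof -
 have "x : span (dual A ` basis A)" using dual_span by simp
 then obtain u where u: "x = (\<Sum>b\<in>dual A ` basis A. scl A (u b) b)"
  by (auto simp: span_finite[OF finite_imageI[OF basis_finite]])
 then have u': "x = (\<Sum>b\<in>basis A. scl A (u (dual A b)) (dual A b))"
  using dual_inj by (simp add: sum.reindex)
 have "u (dual A c) = 0" if "c : basis A" for c
 proof -
  have "tr A (x * c) = (\<Sum>b\<in>basis A. u (dual A b) * (if b = c then 1 else 0))"
   unfolding u' sum_distrib_right tr_sum using that
   by (auto intro!: sum.cong simp: scl_mult_left tr_scale dual_tr)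
  also have "... = u (dual A c)" using that basis_finite by (simp add: if_distrib sum.delta cong: if_cong)
  finally show ?thesis using assms[OF that] by simp
 qed
 then show ?thesis by (subst u') (auto intro!: sum.neutral)
qed

lemma trace_eqI:
 assumes "\<And>c. c : basis A ==> tr A (x * c) = tr A (y * c)" shows "x = y"
proof -
 have "x - y = 0"
  by (rule trace_nondegenerate)
   (use assms module_hom.diff[OF tr_linear] in "auto simp: left_diff_distrib")
 then show ?thesis by simp
qed

lemma grade_zero [simp]: "0 : grade A p" using grade_subspace subspace_0 by blast
lemma grade_diff: "a : grade A p ==> b : grade A p ==> a - b : grade A p"
 using grade_subspace subspace_diff by blast

lemma grade_split:
 obtains u v where "u : grade A 0" "v : grade A 1" "a = u + v"
proof -
 from grade_decomp[of a] obtain uv where "uv : grade A 0 \<times> grade A 1 & a = fst uv + snd uv"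
  by (rule ex1E)
 then show ?thesis using that[of "fst uv" "snd uv"] by (simp add: mem_Times_iff)
qed

lemma grade_split': 
 obtains u v where "u : grade A p" "v : grade A (p + 1)" "a = u + v"
proof -
 obtain u v where "u : grade A 0" "v : grade A 1" "a = u + v" by (rule grade_split)
 then show ?thesis using that[of u v] that[of v u] bit_exhaust[of p] by (elim disjE) (simp_all add: add.commute)
qed

text \<open>The pairs \<open>(a, 0)\<close> and \<open>(0, a)\<close> would be two decompositions of
  \<open>a\<close> into even and odd part, and these are unique.\<close>

lemma grade_both:
 assumes "a : grade A p" "a : grade A q" "p ~= q" shows "a = 0"
proof -
 have a: "a : grade A 0" "a : grade A 1"
  using assms bit_exhaust[of p] bit_exhaust[of q] by metis+
 have "(a, 0) : grade A 0 \<times> grade A 1 & a = fst (a, 0) + snd (a, 0)"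
  "(0, a) : grade A 0 \<times> grade A 1 & a = fst (0, a) + snd (0, a)"
  using a by simp_all
 moreover obtain w where "\<And>uv. uv : grade A 0 \<times> grade A 1 & a = fst uv + snd uv ==> uv = w"
  using grade_decomp[of a] by (rule ex1E) blast
 ultimately have "(a, 0) = w" "(0, a) = w" by blast+
 then have "(a, 0) = (0, a)" by simp
 then show ?thesis by simp
qed

lemma basis_grade: "b : basis A ==> b : grade A (bpar A b)"
 using basis_homogeneous by (auto simp: bpar_def)

lemma trace_grade: "a : grade A p ==> b : grade A q ==> p + q ~= eps A ==> tr A (a * b) = 0"
 using grade_mult tr_parity by blast

text \<open>Split off the component \<open>v\<close> of the wrong parity and test it against basis
  elements \<open>c\<close>. Parity kills \<open>tr (v c)\<close> unless \<open>c\<close> has parity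
  opposite to \<open>b\<close>; then \<open>c\<close> differs from \<open>b\<close>, so the whole
  trace \<open>tr (dual b * c)\<close> is 0, and the other component contributes 0 by
  parity.\<close>

lemma dual_grade:
 assumes b: "b : basis A" shows "dual A b : grade A (bpar A b + eps A)"
proof -
 obtain u v where uv: "u : grade A (bpar A b + eps A)" "v : grade A (bpar A b + eps A + 1)"
  "dual A b = u + v" by (rule grade_split')
 have "v = 0"
 proof (rule trace_nondegenerate)
  fix c assume c: "c : basis A"
  show "tr A (v * c) = 0"
  proof (cases "bpar A c = bpar A b + 1")
   case True
   then have "b ~= c" by auto
   then have "tr A (u * c) + tr A (v * c) = 0"
   using dual_tr[OF b c] uv(3) by (simp add: distrib_right tr_add)
   moreover have "tr A (u * c) = 0"
   by (rule trace_grade[OF uv(1) basis_grade[OF c]])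
   (use True bit_exhaust[of "bpar A b"] bit_exhaust[of "eps A"] in auto)
   ultimately show ?thesis by simp
  next
   case False
   show ?thesis
   by (rule trace_grade[OF uv(2) basis_grade[OF c]])
   (use False bit_exhaust[of "bpar A b"] bit_exhaust[of "bpar A c"] bit_exhaust[of "eps A"] in auto)
  qed
 qed
 then show ?thesis using uv by simp
qed

lemma cf_grade:
 assumes "a : grade A p" "b : basis A" "bpar A b ~= p" shows "cf b a = 0"
 unfolding cf_def
 by (rule trace_grade[OF dual_grade[OF assms(2)] assms(1)])
   (use assms(3) bit_exhaust[of "bpar A b"] bit_exhaust[of p] bit_exhaust[of "eps A"] in auto)

definition nki :: "'a => 'a" where "nki = inv (nak A)"

lemma nak_nki [simp]: "nak A (nki a) = a" "nki (nak A a) = a"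
 using nak_bij by (simp_all add: nki_def bij_is_surj surj_f_inv_f bij_is_inj inv_f_f)

lemma nak_eq_iff: "nak A a = nak A b \<longleftrightarrow> a = b" by (metis nak_nki(2))
lemma nki_add: "nki (a + b) = nki a + nki b"
 by (subst nak_eq_iff[symmetric]) (simp add: nak_add)
lemma nki_scale: "nki (scl A c a) = scl A c (nki a)"
 by (subst nak_eq_iff[symmetric]) (simp add: nak_scale)
lemma nki_mult: "nki (a * b) = nki a * nki b"
 by (subst nak_eq_iff[symmetric]) (simp add: nak_mult)
lemma nki_one: "nki 1 = 1"
 by (subst nak_eq_iff[symmetric]) (simp add: nak_one)

text \<open>The axioms give only that \<open>nak\<close> preserves parity. The wrong component
  \<open>v\<close> of \<open>nki a\<close> has an image under \<open>nak\<close> that lies in both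
  parities, so it is 0 and \<open>v\<close> vanishes by injectivity.\<close>

lemma nki_grade:
 assumes "a : grade A p" shows "nki a : grade A p"
proof -
 obtain u v where uv: "u : grade A p" "v : grade A (p + 1)" "nki a = u + v" by (rule grade_split')
 then have "nak A v = a - nak A u" using nak_add[of u v] by (metis nak_nki(1) add_diff_cancel_left')
 then have "nak A v : grade A p" using assms uv nak_grade grade_diff by metis
 moreover have "nak A v : grade A (p + 1)" using uv nak_grade by auto
 ultimately have "nak A v = 0" using grade_both[of "nak A v" p "p + 1"] bit_exhaust[of p] by auto
 moreover have "nak A 0 = 0" using nak_scale[of 0 0] by simp
 ultimately have "v = 0" by (metis nak_eq_iff)
 then show ?thesis using uv by simp
qed

text \<open>The vector \<open>a x^r\<close> for arbitrary \<open>a\<close>, expanded in one-letter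
  words; the letter \<open>(b, r)\<close> stands for \<open>b x^r\<close> with \<open>b\<close> in
  the basis.\<close>

definition e1 :: "'a => nat => ('a \<times> nat) list \<Rightarrow>\<^sub>0 'k" where
 "e1 a r = (\<Sum>b\<in>basis A. pscale (cf b a) (sng [(b, r)] 1))"

lemma e1_basis: "b : basis A ==> e1 b r = sng [(b, r)] 1"
 using basis_finite by (simp add: e1_def cf_basis if_distrib[of "%c. pscale c _"] sum.delta
  del: pscale_simps(5) cong: if_cong)

lemma e1_add: "e1 (a + b) r = e1 a r + e1 b r"
 by (simp add: e1_def cf_add pscale_add_left sum.distrib del: pscale_simps(5))
lemma e1_scale: "e1 (scl A c a) r = pscale c (e1 a r)"
 by (simp add: e1_def cf_scale pscale_sum)
lemma e1_zero [simp]: "e1 0 r = 0" using e1_scale[of 0 0 r] by simp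
lemma e1_sum: "e1 (sum f I) r = (\<Sum>i\<in>I. e1 (f i) r)"
 by (induction I rule: infinite_finite_induct) (auto simp: e1_add)

section \<open>Parities and the model spaces\<close>

definition epar :: "'a \<times> nat => bit" where
 "epar e = bpar A (fst e) + (if odd (snd e) then eps A else 0)"

definition rpar :: "nat => bit" where "rpar r = (if odd r then eps A else 0)"

lemma epar_rpar: "epar (b, r) = bpar A b + rpar r" by (simp add: epar_def rpar_def)
lemma rpar_simps [simp]: "rpar 0 = 0" "rpar (Suc r) = eps A + rpar r"
 by (auto simp: rpar_def)
primrec lpar :: "('a \<times> nat) list => bit" where
 "lpar [] = 0" | "lpar (e # l) = epar e + lpar l"

lemma lpar_append [simp]: "lpar (l @ l') = lpar l + lpar l'"
 by (induction l) (simp_all add: add.assoc)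

definition L :: "nat => ('a \<times> nat) list set" where
 "L n = {l. length l = n & fst ` set l <= basis A}"

lemma L_0: "L 0 = {[]}" by (auto simp: L_def)
lemma L_append: "l : L m ==> l' : L n ==> l @ l' : L (m + n)" by (auto simp: L_def)
lemma L_Cons: "e # l : L (Suc n) \<longleftrightarrow> fst e : basis A & l : L n" by (auto simp: L_def)
lemma L_Suc: "l : L (Suc n) \<longleftrightarrow> (\<exists>e l'. l = e # l' & fst e : basis A & l' : L n)"
 by (cases l) (auto simp: L_def)
lemma L_take: "l : L (m + n) ==> take m l : L m" by (auto simp: L_def dest: in_set_takeD)
lemma L_drop: "l : L (m + n) ==> drop m l : L n" by (auto simp: L_def dest: in_set_dropD)
lemma L_split: assumes "l : L (m + n)" obtains l1 l2 where "l1 : L m" "l2 : L n" "l = l1 @ l2"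
 using L_take[OF assms] L_drop[OF assms] by (metis append_take_drop_id)
lemma L_length: "l : L n ==> length l = n" by (simp add: L_def)

definition VV :: "nat => (('a \<times> nat) list \<Rightarrow>\<^sub>0 'k) set" where "VV n = supp (L n)"
definition HV :: "bit => (('a \<times> nat) list \<Rightarrow>\<^sub>0 'k) set" where "HV p = supp {l. lpar l = p}"

lemma VV_closed [simp]: "0 : VV n" "u : VV n ==> v : VV n ==> u + v : VV n"
 "u : VV n ==> v : VV n ==> u - v : VV n" "u : VV n ==> pscale c u : VV n" "u : VV n ==> - u : VV n"
 by (auto simp: VV_def supp_add supp_diff supp_pscale supp_uminus)
lemma HV_closed [simp]: "0 : HV n" "u : HV n ==> v : HV n ==> u + v : HV n"
 "u : HV n ==> v : HV n ==> u - v : HV n" "u : HV n ==> pscale c u : HV n" "u : HV n ==> - u : HV n"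
 by (auto simp: HV_def supp_add supp_diff supp_pscale supp_uminus)
lemma VV_sum: "(\<And>i. i : I ==> f i : VV n) ==> sum f I : VV n"
 unfolding VV_def by (rule supp_sum)
lemma HV_sum: "(\<And>i. i : I ==> f i : HV n) ==> sum f I : HV n"
 unfolding HV_def by (rule supp_sum)
lemma VV_single: "l : L n ==> sng l c : VV n"
 by (auto simp: VV_def intro: supp_single)
lemma HV_single: "sng l c : HV (lpar l)"
 by (auto simp: HV_def intro: supp_single)
lemma VV_mult: "u : VV m ==> v : VV n ==> u * v : VV (m + n)"
 unfolding VV_def by (rule supp_mult) (auto simp: L_append)
lemma HV_mult: "u : HV p ==> v : HV q ==> u * v : HV (p + q)"
 unfolding HV_def by (rule supp_mult) auto

lemma VHV: "v : VV n ==> v : HV p ==> v : supp {l : L n. lpar l = p}"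
 by (auto simp: VV_def HV_def supp_def)

lemma VV_eqI:
 assumes "lin F" "lin G" "v : VV n" "\<And>l. l : L n ==> F (sng l 1) = G (sng l 1)"
 shows "F v = G v"
 by (rule supp_mult_single_induct[OF assms(1,2), of _ "L n"]) (use assms in "auto simp: VV_def")

lemma e1_VV: "e1 a r : VV 1"
 unfolding e1_def by (intro VV_sum VV_closed(4) VV_single) (auto simp: L_def)
lemma e1_HV: "a : grade A p ==> e1 a r : HV (p + rpar r)"
 unfolding e1_def
proof (intro HV_sum)
 fix b assume a: "a : grade A p" and b: "b : basis A"
 show "pscale (cf b a) (sng [(b, r)] 1) : HV (p + rpar r)"
 proof (cases "bpar A b = p")
  case True
  then show ?thesis using HV_single[of "[(b, r)]" "cf b a"] by (simp add: epar_rpar)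
 next
  case False
  then show ?thesis using cf_grade[OF a b] by simp
 qed
qed

text \<open>Multiplication of a homogeneous vector \<open>v\<close> by the sign
  \<open>(-1)^(p |v|)\<close>, written as an operator so that Koszul signs make sense for
  inhomogeneous vectors and operators.\<close>

definition Pw :: "bit => (('a \<times> nat) list \<Rightarrow>\<^sub>0 'k) => (('a \<times> nat) list \<Rightarrow>\<^sub>0 'k)" where
 "Pw p = plinear (%l. sng l (ksgn p (lpar l)))"

lemma lin_Pw [simp]: "lin (Pw p)" by (simp add: Pw_def)
lemma Pw_single [simp]: "Pw p (sng l c) = sng l (ksgn p (lpar l) * c)"
 by (simp add: Pw_def mult.commute)
lemma Pw_0 [simp]: "Pw 0 v = v"
 by (rule lin_eq_on[where F = "Pw 0" and G = "%v. v"]) auto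
lemma Pw_Pw [simp]: "Pw p (Pw q v) = Pw (p + q) v"
 by (rule lin_eq_on[where F = "%v. Pw p (Pw q v)" and G = "Pw (p + q)"]) (auto intro: lin_comp[OF lin_Pw lin_Pw] simp: ksgn_add_left)
lemma Pw_HV: "v : HV q ==> Pw p v = pscale (ksgn p q) v"
 by (rule supp_mult_single_induct[where F = "Pw p" and I = "{l. lpar l = q}"]) (auto simp: HV_def intro: lin_scale lin_id)
lemma Pw_in_HV: "v : HV q ==> Pw p v : HV q"
 by (simp add: Pw_HV)
lemma Pw_in_VV: "v : VV n ==> Pw p v : VV n"
 unfolding VV_def by (rule lin_supp[where I = "L n"]) (auto intro: supp_single)

lemma Pw_mult: "Pw p (u * v) = Pw p u * Pw p v"
 by (rule bilinear_eqI[where F = "%u v. Pw p (u * v)" and I = UNIV and J = UNIV])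
   (auto intro: lin_comp[OF lin_mult_left lin_Pw] lin_comp[OF lin_mult_right lin_Pw] lin_comp[OF lin_Pw lin_mult_left]
   lin_comp[OF lin_Pw lin_mult_right] simp: vm_mult ksgn_add_right)

text \<open>Conjugation by the sign operator: on an operator of parity \<open>q\<close> it is the
  scalar \<open>(-1)^(p q)\<close>, see \<open>twist_opar\<close>. It is defined for inhomogeneous
  operators too.\<close>

definition twist where "twist p F v = Pw p (F (Pw p v))"

lemma lin_twist: "lin F ==> lin (twist p F)"
 unfolding twist_def by (rule lin_comp[OF lin_comp[OF lin_Pw] lin_Pw])
lemma twist_id [simp]: "twist p idv = idv" "twist p id = id"
 by (auto simp: twist_def)
lemma twist_0 [simp]: "twist 0 F = F" by (auto simp: twist_def)
lemma twist_twist [simp]: "twist p (twist q F) = twist (p + q) F"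
 by (auto simp: twist_def add.commute)

definition opr where "opr m n F \<longleftrightarrow> lin F & (\<forall>v\<in>VV m. F v : VV n)"
text \<open>Parity is tested on words only; \<open>opar_HV\<close> extends it to all homogeneous
  vectors of the right length.\<close>

definition opar where "opar n p F \<longleftrightarrow> (\<forall>l\<in>L n. F (sng l 1) : HV (p + lpar l))"

lemma opr_lin: "opr m n F ==> lin F" by (simp add: opr_def)
lemma opr_VV: "opr m n F ==> v : VV m ==> F v : VV n" by (simp add: opr_def)
lemma oprI: assumes "lin F" "\<And>l. l : L m ==> F (sng l 1) : VV n" shows "opr m n F"
 using assms lin_supp[of F _ "L m" "L n"] unfolding opr_def VV_def by blast
lemma opr_id [simp]: "opr n n idv" "opr n n id" by (auto simp: opr_def)
lemma opr_comp: "opr l m F ==> opr m n G ==> opr l n (%v. G (F v))"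
 using lin_comp[of F G] by (auto simp: opr_def)
lemma opr_plus: "opr m n F ==> opr m n G ==> opr m n (%v. F v + G v)"
 by (auto simp: opr_def intro: lin_plus)
lemma opr_minus: "opr m n F ==> opr m n G ==> opr m n (%v. F v - G v)"
 by (auto simp: opr_def intro: lin_minus)
lemma opr_scale: "opr m n F ==> opr m n (%v. pscale c (F v))"
 by (auto simp: opr_def intro: lin_scale)
lemma opr_zero [simp]: "opr m n (%v. 0)" by (auto simp: opr_def)
lemma opr_sum: "(\<And>i. i : I ==> opr m n (F i)) ==> opr m n (%v. \<Sum>i\<in>I. F i v)"
 by (auto simp: opr_def intro: lin_summation VV_sum)

lemma opar_HV: "opar n p F ==> lin F ==> v : VV n ==> v : HV q ==> F v : HV (p + q)"
 unfolding HV_def[of "p + q"]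
 by (rule lin_supp[OF _ VHV[of v n q]]) (auto simp: opar_def HV_def)
lemma opar_id [simp]: "opar n 0 idv" "opar n 0 id" by (auto simp: opar_def HV_single)
lemma opar_comp: "opar l p F ==> opr l m F ==> opar m q G ==> lin G ==> opar l (q + p) (%v. G (F v))"
 unfolding opar_def[of l "q + p"] add.assoc
 by (intro ballI opar_HV[of m q G] opr_VV[of l m F] VV_single) (simp_all add: opar_def)
lemma opar_plus: "opar n p F ==> opar n p G ==> opar n p (%v. F v + G v)" by (auto simp: opar_def)
lemma opar_scale: "opar n p F ==> opar n p (%v. pscale c (F v))" by (auto simp: opar_def)
lemma opar_zero [simp]: "opar n p (%v. 0)" by (auto simp: opar_def)
lemma opar_sum: "(\<And>i. i : I ==> opar n p (F i)) ==> opar n p (%v. \<Sum>i\<in>I. F i v)"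
 by (auto simp: opar_def intro!: HV_sum)

lemma opr_twist: "opr m n F ==> opr m n (twist p F)"
 by (auto simp: opr_def lin_twist twist_def Pw_in_VV)
lemma opar_twist: "opar n q F ==> lin F ==> opar n q (twist p F)"
 by (auto simp: opar_def twist_def lin_single[of F _ "ksgn p _ * _"] intro!: Pw_in_HV)
   (metis HV_closed(4) lin_single)

lemma twist_opar:
 assumes "lin F" "opar n q F" "v : VV n" shows "twist p F v = pscale (ksgn p q) (F v)"
proof (rule VV_eqI[OF lin_twist[OF assms(1)] lin_scale[OF assms(1)] assms(3)])
 fix l assume "l : L n"
 then have "F (sng l 1) : HV (q + lpar l)" using assms by (auto simp: opar_def)
 then show "twist p F (sng l 1) = pscale (ksgn p q) (F (sng l 1))"
  using assms(1) by (simp add: twist_def lin_single[of F _ "ksgn p _"] lin_pscale Pw_HV ksgn_add_right ac_simps)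
qed

text \<open>The Koszul rule for \<open>F\<close> tensor \<open>G\<close>: passing \<open>G\<close>
  over the left block costs the twist by its parity. The length \<open>m\<close> must be a
  parameter, since a word does not record where its left factor ends.\<close>

definition tens where
 "tens m F G = plinear (%l. F (sng (take m l) 1) *
   twist (lpar (take m l)) G (sng (drop m l) 1))"

lemma lin_tens [simp]: "lin (tens m F G)" by (simp add: tens_def)

lemma tens_single: "tens m F G (sng l 1) =
  F (sng (take m l) 1) * twist (lpar (take m l)) G (sng (drop m l) 1)"
 by (simp add: tens_def)

lemma tens_append: "length l1 = m ==> tens m F G (sng (l1 @ l2) 1) =
  F (sng l1 1) * twist (lpar l1) G (sng l2 1)"
 by (simp add: tens_single)

lemma tens_mult:
 assumes "lin F" "lin G" "u : VV m" "u : HV p"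
 shows "tens m F G (u * v) = F u * twist p G v"
proof (rule bilinear_eqI[where F = "%u v. tens m F G (u * v)" and G = "%u v. F u * twist p G v"
   and I = "{l : L m. lpar l = p}" and J = UNIV])
 show "u : supp {l : L m. lpar l = p}" by (rule VHV) (use assms in auto)
qed (use assms in "auto intro: lin_comp[OF lin_mult_left lin_tens] lin_comp[OF lin_mult_right lin_tens]
   lin_comp[OF _ lin_mult_left] lin_comp[OF _ lin_mult_right] lin_twist simp: vm_mult tens_append L_length")

text \<open>An even right operator is unaffected by every twist, so here the left vector may be
  inhomogeneous.\<close>

lemma tens_mult_even:
 assumes "lin F" "lin G" "u : VV m" "opar n 0 G" "v : VV n"
 shows "tens m F G (u * v) = F u * G v"
proof (rule bilinear_eqI[where F = "%u v. tens m F G (u * v)" and G = "%u v. F u * G v"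
   and I = "L m" and J = "L n"])
 show "u : supp (L m)" "v : supp (L n)" using assms by (auto simp: VV_def)
qed (use assms in "auto intro: lin_comp[OF lin_mult_left lin_tens] lin_comp[OF lin_mult_right lin_tens]
   lin_comp[OF _ lin_mult_left] lin_comp[OF _ lin_mult_right] simp: vm_mult tens_append L_length twist_opar[OF _ _ VV_single]")

lemma opr_tens: assumes "opr m m' F" "opr n n' G" shows "opr (m + n) (m' + n') (tens m F G)"
proof (rule oprI)
 fix l assume "l : L (m + n)"
 then obtain l1 l2 where l: "l1 : L m" "l2 : L n" "l = l1 @ l2" by (rule L_split)
 have "F (sng l1 1) : VV m'" by (rule opr_VV[OF assms(1)]) (simp add: VV_single l)
 moreover have "twist (lpar l1) G (sng l2 1) : VV n'"
  by (rule opr_VV[OF opr_twist[OF assms(2)]]) (simp add: VV_single l)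
 ultimately show "tens m F G (sng l 1) : VV (m' + n')"
  by (simp add: l tens_append L_length VV_mult)
qed simp

lemma opar_tens: assumes "opar m p F" "opar n q G" "lin G" shows "opar (m + n) (p + q) (tens m F G)"
 unfolding opar_def
proof
 fix l assume "l : L (m + n)"
 then obtain l1 l2 where l: "l1 : L m" "l2 : L n" "l = l1 @ l2" by (rule L_split)
 have "F (sng l1 1) : HV (p + lpar l1)" using assms l by (auto simp: opar_def)
 moreover have "twist (lpar l1) G (sng l2 1) : HV (q + lpar l2)"
  using opar_twist[OF assms(2,3)] l by (auto simp: opar_def)
 ultimately show "tens m F G (sng l 1) : HV (p + q + lpar l)"
  using HV_mult by (fastforce simp: l tens_append L_length ac_simps)
qed

lemma tens_id_id [simp]: "tens m idv idv = idv"
proof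
 fix v show "tens m idv idv v = v"
  by (rule lin_eq_on[where G = "%v. v"]) (auto simp: tens_single vm_mult)
qed

lemma tens_0: "lin G ==> tens 0 idv G v = G v"
 by (rule lin_eq_on[where G = G]) (auto simp: tens_single one_single_Nil[symmetric])

lemma tens_unit_right: assumes "lin F" "v : VV m" shows "tens m F idv v = F v"
 by (rule VV_eqI[where G = F, OF _ _ assms(2)])
   (use assms in "auto simp: tens_single one_single_Nil[symmetric] L_length")

lemma tens_cong:
 assumes "v : VV (m + n)" "\<And>v. v : VV m ==> F v = F' v" "\<And>v. v : VV n ==> G v = G' v"
 shows "tens m F G v = tens m F' G' v"
proof (rule VV_eqI[OF _ _ assms(1)])
 fix l assume "l : L (m + n)"
 then obtain l1 l2 where l: "l1 : L m" "l2 : L n" "l = l1 @ l2" by (rule L_split)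
 then show "tens m F G (sng l 1) = tens m F' G' (sng l 1)"
  using assms(2,3) by (simp add: tens_append L_length twist_def VV_single)
qed auto

text \<open>Both sides cut a word at \<open>m\<close> and at \<open>m + n\<close>. The signs agree
  because the parity of the first \<open>m + n\<close> letters is the sum of the parities of the two
  blocks.\<close>

lemma tens_assoc:
 assumes "lin G" "lin H"
 shows "tens (m + n) (tens m F G) H v = tens m F (tens n G H) v"
proof (rule lin_eq_on[where F = "tens (m + n) (tens m F G) H" and G = "tens m F (tens n G H)"])
 fix l :: "('a \<times> nat) list"
 have *: "take m (take (m + n) l) = take m l" "drop m (take (m + n) l) = take n (drop m l)"
  "drop (m + n) l = drop n (drop m l)" by (simp_all add: add.commute drop_take)
 have **: "lpar (take (m + n) l) = lpar (take m l) + lpar (take n (drop m l))"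
  by (simp add: take_add)
 have d: "lpar (drop m l) = lpar (take n (drop m l)) + lpar (drop n (drop m l))"
  by (metis append_take_drop_id lpar_append)
 show "tens (m + n) (tens m F G) H (sng l 1) = tens m F (tens n G H) (sng l 1)"
  unfolding tens_single * ** twist_def[of _ "tens n G H"] Pw_single mult_1_right
   lin_single[OF lin_tens, of _ _ _ _ "ksgn _ _"] lin_pscale[OF lin_Pw]
  unfolding tens_single twist_def Pw_single mult_1_right Pw_mult Pw_Pw d
  by (simp add: lin_single[OF assms(1), of _ "ksgn _ _"] lin_single[OF assms(2), of _ "ksgn _ _"]
   lin_single[OF assms(2), of _ "ksgn _ _ * _"] lin_pscale ksgn_add_right ksgn_add_left mult.assoc ac_simps del: drop_drop)
qed auto

text \<open>The three forms of the interchange law: the middle pair of maps may be arbitrary as soon as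
 the inner left map or the outer right map is even.\<close>

lemma tens_comp:
 assumes "opr m m' F" "opar m p F" "opr n n' G" "lin F'" "lin G'" "opar n' q G'" "v : VV (m + n)"
 shows "tens m' F' G' (tens m F G v) = pscale (ksgn p q) (tens m (%v. F' (F v)) (%v. G' (G v)) v)"
proof (rule VV_eqI[OF _ _ assms(7)])
 fix l assume "l : L (m + n)"
 then obtain l1 l2 where l: "l1 : L m" "l2 : L n" "l = l1 @ l2" by (rule L_split)
 let ?u = "F (sng l1 1)" and ?v = "G (Pw (lpar l1) (sng l2 1))"
 have u: "?u : VV m'" "?u : HV (p + lpar l1)"
  using assms l by (auto simp: opar_def intro!: opr_VV[OF assms(1)] VV_single)
 have v: "?v : VV n'"
  by (rule opr_VV[OF assms(3)]) (use l in "auto simp: VV_single")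
 have "tens m' F' G' (tens m F G (sng l 1)) = tens m' F' G' (?u * Pw (lpar l1) ?v)"
  using l by (simp add: tens_append L_length twist_def)
 also have "... = F' ?u * twist (p + lpar l1) G' (Pw (lpar l1) ?v)"
  by (rule tens_mult) (use assms u in auto)
 also have "twist (p + lpar l1) G' (Pw (lpar l1) ?v) = Pw (lpar l1) (twist p G' ?v)"
  by (simp add: twist_def add.commute)
 also have "... = pscale (ksgn p q) (Pw (lpar l1) (G' ?v))"
  using assms v by (simp add: twist_opar lin_pscale)
 finally show "tens m' F' G' (tens m F G (sng l 1)) =
   pscale (ksgn p q) (tens m (%v. F' (F v)) (%v. G' (G v)) (sng l 1))"
  using l by (simp add: tens_append L_length twist_def)
qed (intro lin_comp[OF lin_tens lin_tens] lin_scale lin_tens)+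

lemma tens_comp_left_even:
 assumes "opr m m' F" "opar m 0 F" "lin G" "lin F'" "lin G'" "v : VV (m + n)"
 shows "tens m' F' G' (tens m F G v) = tens m (%v. F' (F v)) (%v. G' (G v)) v"
proof (rule VV_eqI[OF _ _ assms(6)])
 fix l assume "l : L (m + n)"
 then obtain l1 l2 where l: "l1 : L m" "l2 : L n" "l = l1 @ l2" by (rule L_split)
 let ?u = "F (sng l1 1)" and ?v = "G (Pw (lpar l1) (sng l2 1))"
 have u: "?u : VV m'" "?u : HV (lpar l1)"
  using assms l by (auto simp: opar_def intro!: opr_VV[OF assms(1)] VV_single)
 have "tens m' F' G' (tens m F G (sng l 1)) = tens m' F' G' (?u * Pw (lpar l1) ?v)"
  using l by (simp add: tens_append L_length twist_def)
 also have "... = F' ?u * twist (lpar l1) G' (Pw (lpar l1) ?v)"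
  by (rule tens_mult) (use assms u in auto)
 finally show "tens m' F' G' (tens m F G (sng l 1)) =
   tens m (%v. F' (F v)) (%v. G' (G v)) (sng l 1)"
  using l by (simp add: tens_append L_length twist_def)
qed (intro lin_comp[OF lin_tens lin_tens] lin_tens)+

lemma tens_comp_right_even:
 assumes "opr m m' F" "opr n n' G" "lin F'" "lin G'" "opar n' 0 G'" "v : VV (m + n)"
 shows "tens m' F' G' (tens m F G v) = tens m (%v. F' (F v)) (%v. G' (G v)) v"
proof (rule VV_eqI[OF _ _ assms(6)])
 fix l assume "l : L (m + n)"
 then obtain l1 l2 where l: "l1 : L m" "l2 : L n" "l = l1 @ l2" by (rule L_split)
 let ?u = "F (sng l1 1)" and ?v = "G (Pw (lpar l1) (sng l2 1))"
 have u: "?u : VV m'"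
  using assms l by (auto intro!: opr_VV[OF assms(1)] VV_single)
 have v: "?v : VV n'"
  by (rule opr_VV[OF assms(2)]) (use l in "auto simp: VV_single")
 have "tens m' F' G' (tens m F G (sng l 1)) = tens m' F' G' (?u * Pw (lpar l1) ?v)"
  using l by (simp add: tens_append L_length twist_def)
 also have "... = F' ?u * G' (Pw (lpar l1) ?v)"
  by (rule tens_mult_even) (use assms u v in "auto simp: Pw_in_VV")
 also have "G' (Pw (lpar l1) ?v) = Pw (lpar l1) (Pw (lpar l1) (G' (Pw (lpar l1) ?v)))" by simp
 also have "... = Pw (lpar l1) (G' ?v)"
  using twist_opar[OF assms(4,5) v, of "lpar l1"] unfolding twist_def by (simp add: add.assoc[symmetric])
 finally show "tens m' F' G' (tens m F G (sng l 1)) =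
   tens m (%v. F' (F v)) (%v. G' (G v)) (sng l 1)"
  using l by (simp add: tens_append L_length twist_def)
qed (intro lin_comp[OF lin_tens lin_tens] lin_tens)+

end

section \<open>The polynomial representation\<close>

context frobenius_superalgebra begin

definition La :: "'a => (('a \<times> nat) list \<Rightarrow>\<^sub>0 'k) => (('a \<times> nat) list \<Rightarrow>\<^sub>0 'k)" where
 "La a = plinear (%l. if length l = 1 then e1 (a * fst (hd l)) (snd (hd l)) else 0)"

text \<open>Left multiplication by \<open>x\<close> in normal form: applying
  \<open>a x = +- x psi(a)\<close> to \<open>a = nki b\<close> gives
  \<open>x b = +- nki b x\<close>. The length guard sends words outside the one-strand space to
  0.\<close>

definition Lx :: "(('a \<times> nat) list \<Rightarrow>\<^sub>0 'k) => (('a \<times> nat) list \<Rightarrow>\<^sub>0 'k)" where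
 "Lx = plinear (%l. if length l = 1 then
   pscale (ksgn (eps A) (bpar A (fst (hd l)))) (e1 (nki (fst (hd l))) (Suc (snd (hd l)))) else 0)"

lemma lin_La [simp]: "lin (La a)" by (simp add: La_def)
lemma lin_Lx [simp]: "lin Lx" by (simp add: Lx_def)

lemma La_e1: "La a (e1 b r) = e1 (a * b) r"
proof -
 have "La a (e1 b r) = (\<Sum>c\<in>basis A. pscale (cf c b) (e1 (a * c) r))"
  unfolding e1_def[of b] by (simp add: lin_sum[OF lin_La] lin_single[OF lin_La, of _ _ "cf _ _"]) (simp add: La_def)
 also have "... = e1 (a * (\<Sum>c\<in>basis A. scl A (cf c b) c)) r"
  by (simp add: sum_distrib_left scl_mult_right e1_sum e1_scale)
 finally show ?thesis by (simp add: cf_expand)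
qed

lemma Lx_e1:
 assumes b: "b : grade A p"
 shows "Lx (e1 b r) = pscale (ksgn (eps A) p) (e1 (nki b) (Suc r))"
proof -
 have nki_sum: "nki (sum f I) = (\<Sum>i\<in>I. nki (f i))" for f and I :: "'a set"
  using nki_add nki_scale[of 0 0] by (induction I rule: infinite_finite_induct) auto
 have "Lx (e1 b r) = (\<Sum>c\<in>basis A. pscale (cf c b) (pscale (ksgn (eps A) (bpar A c)) (e1 (nki c) (Suc r))))"
  unfolding e1_def[of b] by (simp add: lin_sum[OF lin_Lx] lin_single[OF lin_Lx, of _ "cf _ _"]) (simp add: Lx_def)
 also have "... = (\<Sum>c\<in>basis A. pscale (ksgn (eps A) p) (e1 (nki (scl A (cf c b) c)) (Suc r)))"
 proof (rule sum.cong)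
  fix c assume c: "c : basis A"
  show "pscale (cf c b) (pscale (ksgn (eps A) (bpar A c)) (e1 (nki c) (Suc r)))
   = pscale (ksgn (eps A) p) (e1 (nki (scl A (cf c b) c)) (Suc r))"
  proof (cases "bpar A c = p")
   case True then show ?thesis by (simp add: nki_scale e1_scale mult.commute)
  next
   case False
   then have "cf c b = 0" using cf_grade[OF b c] by simp
   then show ?thesis by (simp only: nki_scale e1_scale) simp
  qed
 qed simp
 also have "... = pscale (ksgn (eps A) p) (e1 (nki (\<Sum>c\<in>basis A. scl A (cf c b) c)) (Suc r))"
  by (simp add: nki_sum e1_sum pscale_sum)
 finally show ?thesis by (simp add: cf_expand)
qed

lemma L_1: "l : L 1 \<longleftrightarrow> (\<exists>b r. l = [(b, r)] & b : basis A)"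
 using L_Suc[of l 0] by (auto simp: L_0 One_nat_def)

lemma opr_La: "opr 1 1 (La a)"
 by (rule oprI) (auto simp: L_1 e1_basis[symmetric] La_e1 e1_VV)
lemma opr_Lx: "opr 1 1 Lx"
 by (rule oprI) (auto simp: L_1 e1_basis[symmetric] Lx_e1[OF basis_grade] e1_VV)
lemma opar_La: "a : grade A p ==> opar 1 p (La a)"
 unfolding opar_def
 by (auto simp: L_1 e1_basis[symmetric] La_e1 epar_rpar add.assoc[symmetric] intro!: e1_HV grade_mult basis_grade)
lemma opar_Lx: "opar 1 (eps A) Lx"
proof -
 have "e1 (nki b) (Suc r) : HV (eps A + (bpar A b + rpar r))" if "b : basis A" for b r
  using e1_HV[OF nki_grade[OF basis_grade[OF that]], of "Suc r"] by (simp add: ac_simps)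
 then show ?thesis
  unfolding opar_def by (auto simp: L_1 e1_basis[symmetric] Lx_e1[OF basis_grade] epar_rpar)
qed

lemma VV1_eqI:
 assumes "lin F" "lin G" "v : VV 1" "\<And>b r. b : basis A ==> F (e1 b r) = G (e1 b r)" shows "F v = G v"
 by (rule VV_eqI[OF assms(1-3)]) (use assms(4) in "auto simp: L_1 e1_basis")

lemma La_one: "v : VV 1 ==> La 1 v = v"
 by (rule VV1_eqI[where G = "%v. v"]) (auto simp: La_e1)
lemma La_mult: "v : VV 1 ==> La a (La b v) = La (a * b) v"
 by (rule VV1_eqI[where F = "%v. La a (La b v)"]) (auto simp: La_e1 mult.assoc intro: lin_comp[OF lin_La lin_La])
lemma La_add: "v : VV 1 ==> La (a + b) v = La a v + La b v"
 by (rule VV1_eqI[where G = "%v. La a v + La b v"]) (auto simp: La_e1 distrib_right e1_add intro: lin_plus)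
lemma La_scale: "v : VV 1 ==> La (scl A c a) v = pscale c (La a v)"
 by (rule VV1_eqI[where G = "%v. pscale c (La a v)"]) (auto simp: La_e1 scl_mult_left e1_scale intro: lin_scale)
text \<open>This is the relation that dictates \<open>nki\<close> in \<open>Lx\<close>: applying
  \<open>nki\<close> to \<open>nak A a * b\<close> returns \<open>a * nki b\<close>.\<close>

lemma La_Lx:
 assumes "a : grade A p" "v : VV 1"
 shows "La a (Lx v) = pscale (ksgn (eps A) p) (Lx (La (nak A a) v))"
proof (rule VV1_eqI[where F = "%v. La a (Lx v)" and G = "%v. pscale (ksgn (eps A) p) (Lx (La (nak A a) v))"])
 fix b r assume "b : basis A"
 then have g: "b : grade A (bpar A b)" "nak A a * b : grade A (p + bpar A b)"
  using assms by (auto intro: basis_grade grade_mult nak_grade)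
 show "La a (Lx (e1 b r)) = pscale (ksgn (eps A) p) (Lx (La (nak A a) (e1 b r)))"
  by (simp add: Lx_e1[OF g(1)] La_e1 Lx_e1[OF g(2)] lin_pscale nki_mult ksgn_add_right)
qed (auto intro: lin_comp[OF lin_Lx lin_La] lin_comp[OF lin_La lin_Lx] lin_scale assms)

text \<open>The operator \<open>F\<close> on the letter at place \<open>i\<close>, counted from 0,
  while the indices of \<open>x_i\<close> and \<open>a_i\<close> start at 1. Whatever follows that
  letter is left alone, so the total length is not a parameter.\<close>

definition ins where "ins i F = tens i idv (tens 1 F idv)"

lemma lin_ins [simp]: "lin (ins i F)" by (simp add: ins_def)

lemma ins_shift: "ins (m + j) G v = tens m idv (ins j G) v"
 unfolding ins_def by (subst tens_assoc[symmetric]) simp_all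

lemma ins_0: "lin F ==> ins 0 F v = tens 1 F idv v"
 by (simp add: ins_def tens_0)

lemma opr_ins: assumes "opr 1 1 F" "i < n" shows "opr n n (ins i F)"
proof -
 have n: "n = i + (1 + (n - i - 1))" using assms by simp
 show ?thesis unfolding ins_def by (subst n, subst (2) n) (intro opr_tens opr_id assms)
qed

lemma opar_ins: assumes "opar 1 p F" "i < n" shows "opar n p (ins i F)"
proof -
 have n: "n = i + (1 + (n - i - 1))" using assms by simp
 have "opar (i + (1 + (n - i - 1))) (0 + (p + 0)) (tens i idv (tens 1 F idv))"
  by (intro opar_tens opar_id assms lin_id lin_tens)
 then show ?thesis unfolding ins_def using n by simp
qed

lemma tens_right_cong:
 fixes F :: "(('a \<times> nat) list \<Rightarrow>\<^sub>0 'k) => (('a \<times> nat) list \<Rightarrow>\<^sub>0 'k)"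
 assumes "v : VV (m + n)" "\<And>v. v : VV n ==> G v = G' v"
 shows "tens m F G v = tens m F G' v"
 using tens_cong[OF assms(1), of F F G G'] assms(2) by blast

lemma tens_left_cong:
 assumes "v : VV (m + n)" "\<And>v. v : VV m ==> F v = F' v"
 shows "tens m F G v = tens m F' G v"
 using tens_cong[OF assms(1), of F F' G G] assms(2) by blast

lemma tens_scale_right: assumes "lin G" shows "tens m F (%v. pscale c (G v)) v = pscale c (tens m F G v)"
 by (rule lin_eq_on[where G = "%v. pscale c (tens m F G v)"])
   (auto simp: tens_single twist_def lin_pscale intro: lin_scale)

lemma tens_comp_id_left:
 assumes "lin G" "lin G'" "v : VV (m + n)"
 shows "tens m idv G' (tens m idv G v) = tens m idv (%v. G' (G v)) v"
 by (rule tens_comp_left_even[OF opr_id(1) opar_id(1)]) (use assms in auto)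

lemma tens_comp_id_right:
 assumes "opr m m' F" "lin F'" "v : VV (m + n)"
 shows "tens m' F' idv (tens m F idv v) = tens m (%v. F' (F v)) idv v"
 by (rule tens_comp_right_even[OF assms(1) opr_id(1) assms(2) _ opar_id(1) assms(3)]) auto

lemma ins_ins:
 assumes "opr 1 1 F" "opr 1 1 G" "v : VV n" "i < n"
 shows "ins i F (ins i G v) = ins i (%v. F (G v)) v"
proof -
 have n: "n = i + (1 + (n - i - 1))" using assms by simp
 have v: "v : VV (i + (1 + (n - i - 1)))" using assms(3) n by simp
 show ?thesis unfolding ins_def
  by (subst tens_comp_id_left[OF lin_tens lin_tens v])
   (rule tens_right_cong[OF v], rule tens_comp_id_right[OF assms(2) opr_lin[OF assms(1)]])
qed

lemma ins_cong:
 assumes "v : VV n" "i < n" "\<And>v. v : VV 1 ==> F v = F' v" shows "ins i F v = ins i F' v"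
proof -
 have v: "v : VV (i + (1 + (n - i - 1)))" using assms(1,2) by simp
 show ?thesis unfolding ins_def
  by (rule tens_right_cong[OF v], rule tens_left_cong) (use assms(3) in auto)
qed

text \<open>Strip the \<open>i\<close> leading letters; what remains is \<open>F\<close> on the left
  factor and \<open>G\<close> on the right one, so the sign is the one of the interchange
  law.\<close>

lemma ins_commute_less:
 assumes "opr 1 1 F" "opr 1 1 G" "opar 1 p F" "opar 1 q G" "v : VV n" "i < j" "j < n"
 shows "ins j G (ins i F v) = pscale (ksgn p q) (ins i F (ins j G v))"
proof -
 define d k where "d = j - i - 1" and "k = n - i - 1"
 have j: "j = i + (1 + d)" and d: "d < k" using assms by (auto simp: d_def k_def)
 have v: "v : VV (i + (1 + k))" using assms by (simp add: k_def)
 have insj: "ins j G v = tens i idv (tens 1 idv (ins d G)) v" for v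
  unfolding j ins_shift by (rule arg_cong[where f = "%f. tens i _ f v"]) (simp add: ins_shift fun_eq_iff flip: One_nat_def)
 have G: "opr k k (ins d G)" "opar k q (ins d G)"
  using assms d by (auto intro: opr_ins opar_ins)
 have 1: "tens 1 idv (ins d G) (tens 1 F idv u) = pscale (ksgn p q) (tens 1 F (ins d G) u)"
  if "u : VV (1 + k)" for u
  by (rule tens_comp[OF assms(1,3) opr_id(1) lin_id(1) opr_lin[OF G(1)] G(2) that])
 have 2: "tens 1 F idv (tens 1 idv (ins d G) u) = tens 1 F (ins d G) u" if "u : VV (1 + k)" for u
  by (rule tens_comp_left_even[OF opr_id(1) opar_id(1) _ opr_lin[OF assms(1)] lin_id(1) that]) simp
 have "ins j G (ins i F v) = tens i idv (%u. tens 1 idv (ins d G) (tens 1 F idv u)) v"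
  unfolding insj unfolding ins_def[of i] by (rule tens_comp_id_left[OF lin_tens lin_tens v])
 also have "... = tens i idv (%u. pscale (ksgn p q) (tens 1 F idv (tens 1 idv (ins d G) u))) v"
  by (rule tens_right_cong[OF v]) (simp only: 1 2)
 also have "... = pscale (ksgn p q) (tens i idv (%u. tens 1 F idv (tens 1 idv (ins d G) u)) v)"
  by (rule tens_scale_right) (rule lin_comp[OF lin_tens lin_tens])
 also have "tens i idv (%u. tens 1 F idv (tens 1 idv (ins d G) u)) v = ins i F (ins j G v)"
  unfolding insj unfolding ins_def[of i] by (rule tens_comp_id_left[OF lin_tens lin_tens v, symmetric])
 finally show ?thesis .
qed

lemma ins_commute:
 assumes "opr 1 1 F" "opr 1 1 G" "opar 1 p F" "opar 1 q G" "v : VV n" "i < n" "j < n" "i ~= j"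
 shows "ins i F (ins j G v) = pscale (ksgn p q) (ins j G (ins i F v))"
proof (cases "i < j")
 case True
 then show ?thesis using ins_commute_less[of F G p q v n i j] assms by simp
next
 case False
 then show ?thesis using ins_commute_less[of G F q p v n j i] assms by (simp add: ksgn_comm)
qed

primrec gact :: "'a pgen => (('a \<times> nat) list \<Rightarrow>\<^sub>0 'k) => (('a \<times> nat) list \<Rightarrow>\<^sub>0 'k)" where
 "gact (GA i a) = ins (i - 1) (La a)"
| "gact (GX i) = ins (i - 1) Lx"

lemma lin_gact [simp]: "lin (gact g)" by (cases g) auto

lemma opr_gact: "pgen_index g : {1..n} ==> opr n n (gact g)"
 by (cases g) (auto intro!: opr_ins opr_La opr_Lx)
lemma opar_gact: "pgen_index g : {1..n} ==> pgen_homog A g p ==> opar n p (gact g)"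
 by (cases g) (auto intro!: opar_ins opar_La opar_Lx)

primrec wact :: "'a pgen list => (('a \<times> nat) list \<Rightarrow>\<^sub>0 'k) => (('a \<times> nat) list \<Rightarrow>\<^sub>0 'k)" where
 "wact [] = idv"
| "wact (g # w) = (%v. gact g (wact w v))"

lemma lin_wact [simp]: "lin (wact w)"
 by (induction w) (auto intro: lin_comp[OF _ lin_gact])
lemma wact_append: "wact (w @ w') v = wact w (wact w' v)"
 by (induction w) auto

definition act :: "('k, 'a) falg => (('a \<times> nat) list \<Rightarrow>\<^sub>0 'k) => (('a \<times> nat) list \<Rightarrow>\<^sub>0 'k)" where
 "act f v = plinear (%w. wact w v) f"

lemma act_single [simp]: "act (sng w c) v = pscale c (wact w v)" by (simp add: act_def)
lemma lin_act_left: "lin (%f. act f v)" by (simp add: act_def)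
lemma lin_act [simp]: "lin (act f)"
 unfolding act_def[abs_def] plinear_def by (intro lin_summation lin_scale lin_wact)
lemma act_add: "act (f + g) v = act f v + act g v" by (rule lin_add[OF lin_act_left])
lemma act_diff: "act (f - g) v = act f v - act g v" by (rule lin_diff[OF lin_act_left])
lemma act_uminus: "act (- f) v = - act f v" by (rule lin_uminus[OF lin_act_left])
lemma act_pscale: "act (pscale c f) v = pscale c (act f v)" by (rule lin_pscale[OF lin_act_left])
lemma act_sum: "act (sum f I) v = (\<Sum>i\<in>I. act (f i) v)" by (rule lin_sum[OF lin_act_left])
lemma act_0 [simp]: "act 0 v = 0" by (rule lin_0[OF lin_act_left])
lemma act_1 [simp]: "act 1 v = v" by (simp add: one_single_Nil)
lemma act_mult: "act (f * g) v = act f (act g v)"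
 by (rule bilinear_eqI[where F = "%f g. act (f * g) v" and G = "%f g. act f (act g v)" and I = UNIV and J = UNIV])
   (auto intro: lin_comp[OF lin_mult_left lin_act_left] lin_comp[OF lin_mult_right lin_act_left]
   lin_comp[OF lin_act_left lin_act] lin_act_left simp: vm_mult wact_append)

lemma opr_wact: "w : FW n ==> opr n n (wact w)"
 by (induction w) (auto simp: FW_Cons intro: opr_comp[OF _ opr_gact])
lemma opr_act: "f : falg_on n ==> opr n n (act f)"
 unfolding act_def[abs_def] plinear_def
 by (intro opr_sum opr_scale opr_wact) (auto simp: falg_on_supp supp_def)

lemma opar_wact: "w : FW n ==> word_homog A w p ==> opar n p (wact w)"
proof (induction w arbitrary: p)
 case (Cons g w)
 then obtain q r where "p = q + r" "pgen_homog A g q" "word_homog A w r" by auto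
 then show ?case using Cons opar_comp[OF Cons.IH[of r] opr_wact opar_gact[of g n q] lin_gact]
  by (auto simp: FW_Cons)
qed auto

lemma opar_act:
 assumes "f : falg_on n" "\<forall>w\<in>kys f. word_homog A w p" shows "opar n p (act f)"
 unfolding act_def[abs_def] plinear_def
 by (intro opar_sum opar_scale opar_wact) (use assms in "auto simp: falg_on_supp supp_def")

lemma pol_rel_falg_on: "r : pol_rel A n ==> r : falg_on n"
 by (induction rule: pol_rel.induct) (auto simp: FW_Cons vm_mult intro!: falg_on_closed falg_on_single)

lemma pol_ideal_falg_on: "r : pol_ideal A n ==> r : falg_on n"
 by (induction rule: pol_ideal.induct) (auto intro: pol_rel_falg_on)

text \<open>Relations on one strand reduce to \<open>La\<close> and \<open>Lx\<close> on a single
  letter, relations between two strands to \<open>ins_commute\<close>.\<close>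

lemma act_pol_rel:
 assumes "r : pol_rel A n" "v : VV n" shows "act r v = 0"
 using assms(1)
proof (cases rule: pol_rel.cases)
 case (tens_add i a b)
 have "ins (i - 1) (La (a + b)) v = ins (i - 1) (%v. La a v + La b v) v"
  by (rule ins_cong[OF assms(2)]) (use tens_add in "auto simp: La_add")
 also have "... = ins (i - 1) (La a) v + ins (i - 1) (La b) v"
  by (rule lin_eq_on[where G = "%v. ins (i - 1) (La a) v + ins (i - 1) (La b) v"])
   (auto simp: ins_def tens_single twist_def distrib_left distrib_right lin_single[OF lin_tens, of _ _ _ _ "ksgn _ _"] pscale_add lin_add lin_pscale intro: lin_plus)
 finally show ?thesis using tens_add by (simp add: act_diff)
next
 case (tens_scale i c a)
 have "ins (i - 1) (La (scl A c a)) v = ins (i - 1) (%v. pscale c (La a v)) v"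
  by (rule ins_cong[OF assms(2)]) (use tens_scale in "auto simp: La_scale")
 also have "... = pscale c (ins (i - 1) (La a) v)"
  by (rule lin_eq_on[where G = "%v. pscale c (ins (i - 1) (La a) v)"])
   (auto simp: ins_def tens_single twist_def lin_single[OF lin_tens, of _ _ _ _ "ksgn _ _"] lin_pscale mult.commute intro: lin_scale)
 finally show ?thesis using tens_scale by (simp add: act_diff)
next
 case (tens_one i)
 have "ins (i - 1) (La 1) v = ins (i - 1) idv v"
  by (rule ins_cong[OF assms(2)]) (use tens_one in "auto simp: La_one")
 then show ?thesis using tens_one by (simp add: act_diff ins_def)
next
 case (tens_mult i a b)
 have "ins (i - 1) (La a) (ins (i - 1) (La b) v) = ins (i - 1) (%v. La a (La b v)) v"
  by (rule ins_ins[OF opr_La opr_La assms(2)]) (use tens_mult in auto)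
 also have "... = ins (i - 1) (La (a * b)) v"
  by (rule ins_cong[OF assms(2)]) (use tens_mult in "auto simp: La_mult")
 finally show ?thesis using tens_mult by (simp add: act_diff vm_mult)
next
 case (tens_comm i j a p b q)
 then show ?thesis
  using ins_commute[OF opr_La opr_La opar_La[of a p] opar_La[of b q] assms(2), of "i - 1" "j - 1"]
  by (auto simp: act_diff vm_mult)
next
 case (x_comm i j)
 then show ?thesis
  using ins_commute[OF opr_Lx opr_Lx opar_Lx opar_Lx assms(2), of "i - 1" "j - 1"]
  by (auto simp: act_diff vm_mult)
next
 case (x_nak i j a p)
 show ?thesis
 proof (cases "i = j")
  case True
  have "ins (i - 1) (La a) (ins (i - 1) Lx v) = ins (i - 1) (%v. La a (Lx v)) v"
   by (rule ins_ins[OF opr_La opr_Lx assms(2)]) (use x_nak in auto)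
  also have "... = ins (i - 1) (%v. pscale (ksgn (eps A) p) (Lx (La (nak A a) v))) v"
   by (rule ins_cong[OF assms(2)]) (use x_nak in "auto simp: La_Lx")
  also have "... = pscale (ksgn (eps A) p) (ins (i - 1) (%v. Lx (La (nak A a) v)) v)"
   by (rule lin_eq_on[where G = "%v. pscale (ksgn (eps A) p) (ins (i - 1) (%v. Lx (La (nak A a) v)) v)"])
   (auto simp: ins_def tens_single twist_def lin_single[OF lin_tens, of _ _ _ _ "ksgn _ _"] lin_pscale mult.commute intro: lin_scale)
  also have "ins (i - 1) (%v. Lx (La (nak A a) v)) v = ins (i - 1) Lx (ins (i - 1) (La (nak A a)) v)"
   by (rule ins_ins[OF opr_Lx opr_La assms(2), symmetric]) (use x_nak in auto)
  finally show ?thesis using x_nak True by (simp add: act_diff vm_mult)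
 next
  case False
  then show ?thesis
   using ins_commute[OF opr_La opr_Lx opar_La[of a p] opar_Lx assms(2), of "j - 1" "i - 1"] x_nak
   by (auto simp: act_diff vm_mult ksgn_comm)
 qed
qed

text \<open>The action thus factors through the quotient by the relations. In the case of right
  multiples it matters that \<open>f\<close> keeps \<open>v\<close> inside
  \<open>VV n\<close>.\<close>

lemma act_pol_ideal: "r : pol_ideal A n ==> v : VV n ==> act r v = 0"
proof (induction arbitrary: v rule: pol_ideal.induct)
 case (mult_right f r)
 then show ?case by (simp add: act_mult opr_VV[OF opr_act])
qed (auto simp: act_pol_rel act_add act_mult lin_0)

text \<open>The vector \<open>1\<close> of the model. The unit of \<open>A\<close> need not be a
  basis element, so in general this is a combination of words.\<close>

definition vac :: "nat => (('a \<times> nat) list \<Rightarrow>\<^sub>0 'k)" where "vac n = e1 1 0 ^ n"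

lemma vac_simps: "vac 0 = 1" "vac (Suc n) = e1 1 0 * vac n" "vac (m + n) = vac m * vac n" "vac 1 = e1 1 0"
 by (simp_all add: vac_def power_add)
lemma one_VV: "1 : VV 0" "1 : HV 0"
 by (auto simp: one_single_Nil L_0 intro!: VV_single) (metis HV_single lpar.simps(1))
lemma vac_VV: "vac n : VV n"
proof (induction n)
 case (Suc n)
 then show ?case using VV_mult[OF e1_VV Suc.IH, of 1 0] by (simp add: vac_simps(2) flip: Suc_eq_plus1_left)
qed (simp add: vac_simps one_VV)
lemma vac_HV: "vac n : HV 0"
proof (induction n)
 case (Suc n)
 then show ?case using HV_mult[OF e1_HV[OF grade_one, of 0] Suc.IH] by (simp add: vac_simps(2))
qed (simp add: vac_simps one_VV)

end

section \<open>Normal form of the polynomial algebra\<close>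

context frobenius_superalgebra begin

definition pc :: "nat => ('k, 'a) falg => ('k, 'a) falg => bool" where
 "pc n f g \<longleftrightarrow> f - g : pol_ideal A n"

lemma pol_ideal_pscale: assumes "r : pol_ideal A n" shows "pscale c r : pol_ideal A n"
proof -
 have "sng [] c * r : pol_ideal A n"
  by (rule pol_ideal.mult_left[OF falg_on_single assms]) simp
 then show ?thesis by (simp add: pscale_conv_mult)
qed
lemma pol_ideal_uminus: "r : pol_ideal A n ==> - r : pol_ideal A n"
 using pol_ideal_pscale[of r n "-1"] by (simp add: pscale_uminus)
lemma pc_refl [simp]: "pc n f f" by (simp add: pc_def pol_ideal.zero)
lemma pc_sym: "pc n f g ==> pc n g f"
 unfolding pc_def using pol_ideal_uminus[of "f - g" n] by simp
lemma pc_trans [trans]: "pc n f g ==> pc n g h ==> pc n f h"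
 unfolding pc_def using pol_ideal.plus[of "f - g" A n "g - h"] by simp
lemma pc_add: "pc n f g ==> pc n f' g' ==> pc n (f + f') (g + g')"
 unfolding pc_def using pol_ideal.plus[of "f - g" A n "f' - g'"] by (simp add: algebra_simps)
lemma pc_pscale: "pc n f g ==> pc n (pscale c f) (pscale c g)"
 unfolding pc_def using pol_ideal_pscale[of "f - g" n c] by (simp add: pscale_diff)
lemma pc_mult_left: "h : falg_on n ==> pc n f g ==> pc n (h * f) (h * g)"
 unfolding pc_def by (simp add: pol_ideal.mult_left flip: right_diff_distrib)
lemma pc_mult_right: "h : falg_on n ==> pc n f g ==> pc n (f * h) (g * h)"
 unfolding pc_def by (simp add: pol_ideal.mult_right flip: left_diff_distrib)
lemma pc_falg_on: "pc n f g ==> g : falg_on n ==> f : falg_on n"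
 unfolding pc_def using falg_on_closed(3)[of "f - g" n g] pol_ideal_falg_on by force
lemma pc_rel: "f - g : pol_rel A n ==> pc n f g" by (simp add: pc_def pol_ideal.rel)

lemma pc_word:
 assumes "pc n f g" "u : FW n" "w : FW n"
 shows "pc n (mon u * f * mon w) (mon u * g * mon w)"
 by (intro pc_mult_right pc_mult_left falg_on_single assms)

lemma pc_lin:
 assumes "lin F" "lin G" "v : supp I"
  "\<And>i. i : I ==> pc n (F (sng i 1)) (G (sng i 1))"
 shows "pc n (F v) (G v)"
proof (induction v rule: poly_mapping_single_induct)
 case (single i c)
 then have "i : I" using assms by (auto simp: supp_def)
 then show ?case using assms(4) by (simp add: lin_single[OF assms(1), of i c] lin_single[OF assms(2), of i c] pc_pscale)
qed (use assms in "auto simp: lin_0 lin_add pc_add")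

text \<open>All relations between different indices as one sign rule. The order
  \<open>x_i b_j\<close> is not a defining relation but the inverse of \<open>x_nak\<close>; the
  sign squares to 1.\<close>

lemma pc_swap:
 assumes "pgen_homog A g p" "pgen_homog A g' q" "pgen_index g ~= pgen_index g'"
  "pgen_index g : {1..n}" "pgen_index g' : {1..n}"
 shows "pc n (mon [g, g']) (pscale (ksgn p q) (mon [g', g]))"
proof (cases g; cases g')
 fix i a j b assume "g = GA i a" "g' = GA j b"
 then show ?thesis using pol_rel.tens_comm[of i n j a A p b q] assms
  by (intro pc_rel) (simp add: vm_mult)
next
 fix i a j assume g: "g = GA i a" "g' = GX j"
 then show ?thesis using pol_rel.x_nak[of j n i a A p] assms
  by (intro pc_rel) (simp add: vm_mult ksgn_comm)
next
 fix i j b assume g: "g = GX i" "g' = GA j b"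
 then have "pc n (mon [GA j b, GX i]) (pscale (ksgn (eps A) q) (mon [GX i, GA j b]))"
  using pol_rel.x_nak[of i n j b A q] assms by (intro pc_rel) (simp add: vm_mult)
 from pc_sym[OF pc_pscale[OF this, of "ksgn (eps A) q"]] show ?thesis
  using g assms by (simp add: mult.assoc)
next
 fix i j assume "g = GX i" "g' = GX j"
 then show ?thesis using pol_rel.x_comm[of i n j A] assms
  by (intro pc_rel) (simp add: vm_mult)
qed

definition block :: "nat => 'a \<times> nat => 'a pgen list" where
 "block i e = GA i (fst e) # replicate (snd e) (GX i)"

primrec pword :: "nat => ('a \<times> nat) list => 'a pgen list" where
 "pword i [] = []"
| "pword i (e # l) = block i e @ pword (Suc i) l"

definition psi :: "nat => (('a \<times> nat) list \<Rightarrow>\<^sub>0 'k) => ('k, 'a) falg" where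
 "psi i = plinear (%l. mon (pword i l))"

lemma lin_psi [simp]: "lin (psi i)" by (simp add: psi_def)
lemma psi_single [simp]: "psi i (sng l c) = pscale c (mon (pword i l))" by (simp add: psi_def)
lemma psi_one: "psi i 1 = 1" by (simp add: one_single_Nil)
lemma psi_Cons: "psi i (sng [e] c * v) = pscale c (mon (block i e) * psi (Suc i) v)"
proof (rule lin_eq_on[where F = "%v. psi i (sng [e] c * v)"
   and G = "%v. pscale c (mon (block i e) * psi (Suc i) v)"])
 show "lin (%v. psi i (sng [e] c * v))" by (rule lin_comp[OF lin_mult_left lin_psi])
 show "lin (%v. pscale c (mon (block i e) * psi (Suc i) v))"
  by (rule lin_scale[OF lin_comp[OF lin_psi lin_mult_left]])
qed (simp add: vm_mult)

lemma block_FW: "i : {1..n} ==> block i e : FW n" by (auto simp: block_def FW_def)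
lemma pword_FW: "1 <= i ==> i + length l <= Suc n ==> pword i l : FW n"
 by (induction l arbitrary: i) (auto simp: FW_append intro!: block_FW)
lemma psi_falg_on: "v : VV n ==> psi 1 v : falg_on n"
 unfolding VV_def falg_on_supp
 by (rule lin_supp[OF lin_psi]) (auto intro!: supp_single pword_FW simp: L_length)

lemma word_homog_append: "word_homog A w p ==> word_homog A w' q ==> word_homog A (w @ w') (p + q)"
proof (induction w arbitrary: p)
 case (Cons g w)
 then obtain r s where "p = r + s" "pgen_homog A g r" "word_homog A w s" by auto
 with Cons show ?case unfolding append_Cons word_homog.simps
  by (intro exI[of _ r] exI[of _ "s + q"]) (simp add: add.assoc)
qed simp
lemma word_homog_replicate: "word_homog A (replicate r (GX i)) (rpar r)"
 by (induction r) auto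
lemma word_homog_block: "fst e : basis A ==> word_homog A (block i e) (epar e)"
 using word_homog_replicate[of "snd e" i] basis_grade[of "fst e"] epar_rpar[of "fst e" "snd e"]
 by (auto simp: block_def)
lemma word_homog_pword: "fst ` set l <= basis A ==> word_homog A (pword i l) (lpar l)"
 by (induction l arbitrary: i) (auto intro!: word_homog_append word_homog_block)

text \<open>Induction on \<open>w\<close>, one application of \<open>pc_swap\<close> per letter. The
  outer words \<open>u\<close> and \<open>w'\<close> are carried along because the swaps happen in
  the middle of a longer word.\<close>

lemma pc_pass:
 assumes "pgen_homog A g p" "pgen_index g : {1..n}" "w : FW n" "u : FW n" "w' : FW n" "word_homog A w q"
  "\<forall>g'\<in>set w. pgen_index g' ~= pgen_index g"
 shows "pc n (mon (u @ [g] @ w @ w')) (pscale (ksgn p q) (mon (u @ w @ [g] @ w')))"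
 using assms(3,4,6,7)
proof (induction w arbitrary: u q)
 case Nil
 then show ?case by simp
next
 case (Cons g' w)
 then obtain r s where rs: "q = r + s" "pgen_homog A g' r" "word_homog A w s" by auto
 have "pc n (mon [g, g']) (pscale (ksgn p r) (mon [g', g]))"
  by (rule pc_swap) (use Cons.prems rs assms in "auto simp: FW_Cons")
 from pc_word[OF this Cons.prems(2), of "w @ w'"]
 have "pc n (mon (u @ [g] @ (g' # w) @ w')) (pscale (ksgn p r) (mon ((u @ [g']) @ [g] @ w @ w')))"
  using Cons.prems assms by (simp add: vm_mult FW_append FW_Cons)
 also have "pc n ... (pscale (ksgn p r) (pscale (ksgn p s) (mon ((u @ [g']) @ w @ [g] @ w'))))"
  by (intro pc_pscale Cons.IH) (use Cons.prems rs in "auto simp: FW_append FW_Cons")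
 finally show ?case by (simp add: rs ksgn_add_right)
qed

lemma pc_GA_add: "i : {1..n} ==> pc n (mon [GA i (a + b)]) (mon [GA i a] + mon [GA i b])"
 using pol_rel.tens_add[of i n a b A] by (intro pc_rel) (simp add: algebra_simps)
lemma pc_GA_scale: "i : {1..n} ==> pc n (mon [GA i (scl A c a)]) (pscale c (mon [GA i a]))"
 using pol_rel.tens_scale[of i n A c a] by (intro pc_rel) simp
lemma pc_GA_mult: "i : {1..n} ==> pc n (mon [GA i a, GA i b]) (mon [GA i (a * b)])"
 using pol_rel.tens_mult[of i n a b A] by (intro pc_rel) (simp add: vm_mult)
lemma pc_GA_one: "i : {1..n} ==> pc n (mon [GA i 1]) 1"
 using pol_rel.tens_one[of i n A] by (intro pc_rel)
lemma pc_GA_sum: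
 assumes i: "i : {1..n}" shows "finite I ==> pc n (mon [GA i (\<Sum>b\<in>I. scl A (u b) (f b))]) (\<Sum>b\<in>I. pscale (u b) (mon [GA i (f b)]))"
proof (induction I rule: finite_induct)
 case empty
 show ?case using pc_GA_scale[OF i, of 0 0] by simp
next
 case (insert b I)
 have "pc n (mon [GA i (\<Sum>b\<in>insert b I. scl A (u b) (f b))])
   (mon [GA i (scl A (u b) (f b))] + mon [GA i (\<Sum>b\<in>I. scl A (u b) (f b))])"
  using insert pc_GA_add[OF i] by simp
 also have "pc n ... (pscale (u b) (mon [GA i (f b)]) + (\<Sum>b\<in>I. pscale (u b) (mon [GA i (f b)])))"
  by (intro pc_add insert pc_GA_scale i)
 finally show ?case using insert by simp
qed

lemma pc_GA_expand:
 assumes "i : {1..n}" "w : FW n"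
 shows "pc n (mon (GA i a # w)) (\<Sum>b\<in>basis A. pscale (cf b a) (mon (GA i b # w)))"
 using pc_mult_right[OF falg_on_single[OF assms(2), of 1] pc_GA_sum[OF assms(1) basis_finite, of "%b. cf b a" "%b. b"]]
 by (simp add: cf_expand vm_mult sum_distrib_right del: pscale_simps(5))

lemma psi_e1_mult: "psi i (e1 a r * v) = (\<Sum>b\<in>basis A. pscale (cf b a) (mon (block i (b, r)) * psi (Suc i) v))"
 unfolding e1_def sum_distrib_right lin_sum[OF lin_psi] pscale_mult_left lin_pscale[OF lin_psi] psi_Cons by simp

lemma pc_GX_GA:
 assumes "i : {1..n}" "b : grade A p"
 shows "pc n (mon [GX i, GA i b]) (pscale (ksgn (eps A) p) (mon [GA i (nki b), GX i]))"
proof -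
 have "pc n (mon [GA i (nki b), GX i]) (pscale (ksgn (eps A) p) (mon [GX i, GA i b]))"
  using pol_rel.x_nak[of i n i "nki b" A p] assms nki_grade by (intro pc_rel) (simp add: vm_mult)
 from pc_sym[OF pc_pscale[OF this, of "ksgn (eps A) p"]] show ?thesis by simp
qed

primrec gop :: "'a pgen => (('a \<times> nat) list \<Rightarrow>\<^sub>0 'k) => (('a \<times> nat) list \<Rightarrow>\<^sub>0 'k)" where
 "gop (GA i a) = La a" | "gop (GX i) = Lx"

lemma gact_gop: "gact g = ins (pgen_index g - 1) (gop g)" by (cases g) auto
lemma opr_gop: "opr 1 1 (gop g)" by (cases g) (auto intro: opr_La opr_Lx)
lemma opar_gop: "pgen_homog A g p ==> opar 1 p (gop g)" by (cases g) (auto intro: opar_La opar_Lx)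

lemma ins_first: "lin F ==> ins 0 F (sng (e # l) 1) = F (sng [e] 1) * sng l 1"
 using tens_append[of "[e]" 1 F "%v. v" l] by (simp add: ins_0)

lemma ins_later:
 assumes "lin F" "opr 1 1 F" "opar 1 p F" "d < length l" "l : L (length l)"
 shows "ins (Suc d) F (sng (e # l) 1)
  = pscale (ksgn p (epar e)) (sng [e] 1 * ins d F (sng l 1))"
proof -
 have "ins (Suc d) F (sng (e # l) 1) = tens 1 idv (ins d F) (sng ([e] @ l) 1)"
  using ins_shift[of 1 d F] by (simp flip: Suc_eq_plus1_left)
 also have "... = sng [e] 1 * twist (epar e) (ins d F) (sng l 1)"
  by (subst tens_append) simp_all
 also have "twist (epar e) (ins d F) (sng l 1) = pscale (ksgn (epar e) p) (ins d F (sng l 1))"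
  by (rule twist_opar[OF _ opar_ins]) (use assms in "auto simp: VV_single")
 finally show ?thesis by (simp add: ksgn_comm)
qed

lemma pc_psi_first:
 assumes "pgen_homog A g p" "pgen_index g = i" "i : {1..n}" "fst e : basis A" "w : FW n"
  and w: "w = pword (Suc i) l"
 shows "pc n (mon (g # block i e @ w)) (psi i (gop g (sng [e] 1) * sng l 1))"
proof -
 obtain b r where e: "e = (b, r)" "b : basis A" using assms by (cases e) auto
 have "psi i (gop g (sng [e] 1) * sng l 1)
  = psi i (gop g (e1 b r) * sng l 1)" using e by (simp add: e1_basis)
 show ?thesis
 proof (cases g)
  case (GA j a)
  have [simp]: "j = i" using GA assms by simp
  have "replicate r (GX i) @ w : FW n" using assms by (auto simp: FW_append FW_def)
  from pc_mult_right[OF falg_on_single[OF this, of 1] pc_GA_mult[OF assms(3), of a b]]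
  have "pc n (mon (g # block i e @ w)) (mon (GA i (a * b) # replicate r (GX i) @ w))"
   by (simp add: GA e block_def vm_mult)
  also have "pc n ... (\<Sum>c\<in>basis A. pscale (cf c (a * b)) (mon (GA i c # replicate r (GX i) @ w)))"
   by (rule pc_GA_expand) (use assms in "auto simp: FW_append FW_def")
  finally show ?thesis using e
   by (simp add: GA e1_basis[symmetric] La_e1 psi_e1_mult block_def vm_mult w del: pscale_simps(5))
 next
  case (GX j)
  have [simp]: "j = i" using GX assms by simp
  have "replicate r (GX i) @ w : FW n" using assms by (auto simp: FW_append FW_def)
  from pc_mult_right[OF falg_on_single[OF this, of 1] pc_GX_GA[OF assms(3) basis_grade[OF e(2)]]]
  have "pc n (mon (g # block i e @ w)) (pscale (ksgn (eps A) (bpar A b)) (mon (GA i (nki b) # GX i # replicate r (GX i) @ w)))"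
   by (simp add: GX e block_def vm_mult)
  also have "pc n ... (pscale (ksgn (eps A) (bpar A b)) (\<Sum>c\<in>basis A. pscale (cf c (nki b)) (mon (GA i c # GX i # replicate r (GX i) @ w))))"
   by (intro pc_pscale pc_GA_expand) (use assms in "auto simp: FW_append FW_def")
  finally show ?thesis using e
   by (simp add: GX e1_basis[symmetric] Lx_e1[OF basis_grade] lin_pscale psi_e1_mult block_def vm_mult w del: pscale_simps(5))
 qed
qed

text \<open>Multiplying a normal word on the left by a generator: if its index is that of the first
  block it is absorbed by \<open>pc_psi_first\<close>, otherwise it passes that block with the same
  sign that \<open>ins_later\<close> produces.\<close>

lemma pc_psi_gop:
 assumes "pgen_homog A g p" "1 <= i" "i + length l <= Suc n" "fst ` set l <= basis A"
  "i <= pgen_index g" "pgen_index g < i + length l"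
 shows "pc n (mon (g # pword i l)) (psi i (ins (pgen_index g - i) (gop g) (sng l 1)))"
 using assms(2-)
proof (induction l arbitrary: i)
 case Nil
 then show ?case by simp
next
 case (Cons e l)
 have w: "pword (Suc i) l : FW n" using Cons.prems by (intro pword_FW) auto
 show ?case
 proof (cases "pgen_index g = i")
  case True
  then show ?thesis using pc_psi_first[OF assms(1) True, of n e "pword (Suc i) l" l] Cons.prems w
   by (simp add: ins_first[OF opr_lin[OF opr_gop]])
 next
  case False
  define d where "d = pgen_index g - Suc i"
  have d: "pgen_index g - i = Suc d" "d < length l" using False Cons.prems by (auto simp: d_def)
  have idx: "pgen_index g : {1..n}" "i : {1..n}" using Cons.prems by auto
  have l: "l : L (length l)" using Cons.prems by (auto simp: L_def)
  have "pc n (mon (g # block i e @ pword (Suc i) l)) (pscale (ksgn p (epar e)) (mon (block i e @ [g] @ pword (Suc i) l)))"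
   using pc_pass[OF assms(1) idx(1) block_FW[OF idx(2), of e] FW_Nil w word_homog_block] False Cons.prems
   by (auto simp: block_def)
  also have "pc n ... (pscale (ksgn p (epar e)) (mon (block i e) * psi (Suc i) (ins d (gop g) (sng l 1))))"
  proof -
   have "pc n (mon (g # pword (Suc i) l)) (psi (Suc i) (ins d (gop g) (sng l 1)))"
   unfolding d_def by (rule Cons.IH) (use Cons.prems False in auto)
   from pc_pscale[OF pc_mult_left[OF falg_on_single[OF block_FW[OF idx(2)]] this]] show ?thesis
   by (simp add: vm_mult del: pscale_simps(5))
  qed
  finally show ?thesis
   using d l by (simp add: ins_later[OF opr_lin[OF opr_gop] opr_gop opar_gop[OF assms(1)]] lin_pscale psi_Cons)
 qed
qed

lemma pc_psi_gact_homog: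
 assumes "pgen_homog A g p" "pgen_index g : {1..n}" "v : VV n"
 shows "pc n (mon [g] * psi 1 v) (psi 1 (gact g v))"
proof (rule pc_lin[where F = "%v. mon [g] * psi 1 v" and G = "%v. psi 1 (gact g v)" and I = "L n"])
 fix l assume "l : L n"
 then show "pc n (mon [g] * psi 1 (sng l 1)) (psi 1 (gact g (sng l 1)))"
  using pc_psi_gop[OF assms(1), of 1 l n] assms(2) by (simp add: L_def vm_mult gact_gop)
qed (use assms in "auto simp: VV_def intro: lin_comp[OF lin_psi lin_mult_left] lin_comp[OF lin_gact lin_psi]")

text \<open>Signs require a homogeneous generator, so a general \<open>a\<close> is split into its
  even and odd part.\<close>

lemma pc_psi_gact:
 assumes "pgen_index g : {1..n}" "v : VV n"
 shows "pc n (mon [g] * psi 1 v) (psi 1 (gact g v))"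
proof (cases g)
 case (GX i)
 then show ?thesis using pc_psi_gact_homog[of g "eps A"] assms by simp
next
 case (GA i a)
 obtain u w where uw: "u : grade A 0" "w : grade A 1" "a = u + w" by (rule grade_split)
 have i: "i : {1..n}" using assms GA by simp
 have "pc n (mon [g] * psi 1 v) (mon [GA i u] * psi 1 v + mon [GA i w] * psi 1 v)"
  using pc_mult_right[OF psi_falg_on[OF assms(2)] pc_GA_add[OF i, of u w]]
  by (simp add: GA uw distrib_right)
 also have "pc n ... (psi 1 (gact (GA i u) v) + psi 1 (gact (GA i w) v))"
  by (intro pc_add pc_psi_gact_homog) (use uw assms GA in auto)
 also have "psi 1 (gact (GA i u) v) + psi 1 (gact (GA i w) v) = psi 1 (gact g v)"
  using act_pol_rel[OF pol_rel.tens_add[OF i, of u w] assms(2)]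
  by (simp add: act_diff GA uw flip: lin_add[OF lin_psi]) (simp add: algebra_simps eq_diff_eq)
 finally show ?thesis .
qed

lemma pc_psi_act:
 assumes "f : falg_on n" "v : VV n" shows "pc n (f * psi 1 v) (psi 1 (act f v))"
proof (rule pc_lin[where F = "%f. f * psi 1 v" and G = "%f. psi 1 (act f v)" and I = "FW n"])
 fix w :: "'a pgen list" assume "w : FW n"
 then have "pc n (mon w * psi 1 v) (psi 1 (wact w v))"
 proof (induction w)
  case (Cons g w)
  then have w: "w : FW n" "pgen_index g : {1..n}" by (auto simp: FW_Cons)
  have "pc n (mon [g] * (mon w * psi 1 v)) (mon [g] * psi 1 (wact w v))"
   by (intro pc_mult_left Cons.IH w falg_on_single) (use w in "auto simp: FW_Cons")
  also have "pc n ... (psi 1 (gact g (wact w v)))"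
   by (rule pc_psi_gact[OF w(2) opr_VV[OF opr_wact[OF w(1)] assms(2)]])
  finally show ?case by (simp add: vm_mult flip: mult.assoc)
 qed (simp add: one_single_Nil[symmetric])
 then show "pc n (mon w * psi 1 v) (psi 1 (act (mon w) v))" by simp
qed (use assms in "auto simp: falg_on_supp intro: lin_comp[OF lin_act_left lin_psi]")

lemma pc_psi_vac: "1 <= i ==> i + m <= Suc n ==> pc n (psi i (vac m)) 1"
proof (induction m arbitrary: i)
 case 0
 then show ?case by (simp add: vac_simps psi_one)
next
 case (Suc m)
 then have i: "i : {1..n}" by auto
 have IH: "pc n (psi (Suc i) (vac m)) 1" using Suc by simp
 have f: "psi (Suc i) (vac m) : falg_on n" using pc_falg_on[OF IH] by simp
 have "psi i (vac (Suc m)) = (\<Sum>b\<in>basis A. pscale (cf b 1) (mon [GA i b])) * psi (Suc i) (vac m)"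
  by (simp add: vac_simps psi_e1_mult block_def sum_distrib_right del: pscale_simps(5))
 also have "pc n ... (mon [GA i 1] * psi (Suc i) (vac m))"
  using pc_GA_expand[OF i FW_Nil, of 1] by (intro pc_mult_right f) (rule pc_sym)
 also have "pc n ... (1 * psi (Suc i) (vac m))"
  by (intro pc_mult_right f pc_GA_one i)
 also have "pc n ... 1" using IH by simp
 finally show ?case .
qed

text \<open>Normal-form coordinates of \<open>f\<close>, obtained by letting \<open>f\<close> act on
  the vector representing 1.\<close>

definition PHI :: "nat => ('k, 'a) falg => (('a \<times> nat) list \<Rightarrow>\<^sub>0 'k)" where
 "PHI n f = act f (vac n)"

lemma lin_PHI [simp]: "lin (PHI n)" unfolding PHI_def[abs_def] by (rule lin_act_left)
lemma PHI_VV: "f : falg_on n ==> PHI n f : VV n"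
 unfolding PHI_def by (rule opr_VV[OF opr_act vac_VV])
lemma PHI_mult: "PHI n (f * g) = act f (PHI n g)" by (simp add: PHI_def act_mult)
lemma PHI_1: "PHI n 1 = vac n" by (simp add: PHI_def)

text \<open>Modulo the relations
  \<open>f = f * 1 = f * psi 1 (vac n) = psi 1 (act f (vac n))\<close>, the last step because
  \<open>psi\<close> commutes with the action.\<close>

lemma pc_psi_PHI: "f : falg_on n ==> pc n f (psi 1 (PHI n f))"
proof -
 assume f: "f : falg_on n"
 have "pc n (f * psi 1 (vac n)) (psi 1 (PHI n f))"
  unfolding PHI_def by (rule pc_psi_act[OF f vac_VV])
 moreover have "pc n (f * psi 1 (vac n)) (f * 1)"
  by (intro pc_mult_left f pc_psi_vac) auto
 ultimately show ?thesis using pc_trans[OF pc_sym, of n "f * psi 1 (vac n)" "f * 1"] by simp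
qed

lemma Lx_e1_one: "Lx (e1 1 r) = e1 1 (Suc r)"
 using Lx_e1[OF grade_one, of r] by (simp add: nki_one)

lemma ins_mult:
 assumes "opr 1 1 F" "u : VV i" "u : HV 0" "x : VV 1" "w : VV m"
 shows "ins i F (u * (x * w)) = u * (F x * w)"
proof -
 have "tens 1 F idv (x * w) = F x * w"
  by (rule tens_mult_even[OF opr_lin[OF assms(1)] lin_id(1) assms(4) opar_id(1) assms(5)])
 then show ?thesis
  unfolding ins_def by (subst tens_mult[OF lin_id(1) lin_tens assms(2,3)]) simp
qed

lemma PHI_block:
 assumes "u : VV i" "u : HV 0" "w : VV m" "b : basis A"
 shows "wact (block (Suc i) (b, r)) (u * (e1 1 0 * w)) = u * (sng [(b, r)] 1 * w)"
proof -
 have "wact (replicate r (GX (Suc i))) (u * (e1 1 0 * w)) = u * (e1 1 r * w)"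
  by (induction r) (simp_all add: ins_mult[OF opr_Lx assms(1,2) e1_VV assms(3)] Lx_e1_one)
 then show ?thesis using assms
  by (simp add: block_def ins_mult[OF opr_La assms(1,2) e1_VV assms(3)] La_e1 e1_basis)
qed

text \<open>The vector \<open>u\<close> collects the places on the left that are still in the
  vacuum. It is even, so operators pass it without a sign, and the induction can peel letters from
  the front although the word acts from its right end.\<close>

lemma wact_pword:
 assumes "l : L m" "u : VV i" "u : HV 0"
 shows "wact (pword (Suc i) l) (u * vac m) = u * sng l 1"
 using assms
proof (induction l arbitrary: i u m)
 case Nil
 then show ?case by (simp add: L_def vac_simps one_single_Nil[symmetric])
next
 case (Cons e l)
 then obtain m' where m: "m = Suc m'" and e: "fst e : basis A" and l: "l : L m'"
  by (cases m) (auto simp: L_Cons L_def)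
 have u': "u * e1 1 0 : VV (Suc i)" "u * e1 1 0 : HV 0"
  using VV_mult[OF Cons.prems(2) e1_VV[of 1 0]] HV_mult[OF Cons.prems(3) e1_HV[OF grade_one, of 0]]
  by (simp_all flip: Suc_eq_plus1)
 have "wact (pword (Suc i) (e # l)) (u * vac m)
   = wact (block (Suc i) e) (wact (pword (Suc (Suc i)) l) ((u * e1 1 0) * vac m'))"
  by (simp add: wact_append m vac_simps mult.assoc)
 also have "... = wact (block (Suc i) e) (u * (e1 1 0 * sng l 1))"
  using Cons.IH[OF l u'] by (simp add: mult.assoc)
 also have "... = u * sng (e # l) 1"
  using PHI_block[OF Cons.prems(2,3) VV_single[OF l], of "fst e" "snd e" 1] e by (simp add: vm_mult)
 finally show ?case .
qed

lemma PHI_psi: "v : VV n ==> PHI n (psi 1 v) = v"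
proof (rule VV_eqI[where F = "%v. PHI n (psi 1 v)" and G = "%v. v"])
 fix l assume "l : L n"
 then show "PHI n (psi 1 (sng l 1)) = sng l 1"
  using wact_pword[of l n 1 0] one_VV by (simp add: PHI_def One_nat_def)
qed (auto intro: lin_comp[OF lin_psi lin_PHI])

text \<open>The word problem in \<open>Pol A n\<close> is solved: \<open>psi\<close> and
  \<open>PHI\<close> are mutually inverse, so equality in the quotient is equality of
  vectors.\<close>

lemma pc_iff_PHI: "f : falg_on n ==> g : falg_on n ==> pc n f g \<longleftrightarrow> PHI n f = PHI n g"
proof
 assume "pc n f g"
 then show "PHI n f = PHI n g"
  using act_pol_ideal[of "f - g" n "vac n"] vac_VV by (simp add: pc_def PHI_def act_diff)
next
 assume "f : falg_on n" "g : falg_on n" "PHI n f = PHI n g"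
 then show "pc n f g" using pc_psi_PHI[of f n] pc_psi_PHI[of g n] pc_sym pc_trans by metis
qed

end

section \<open>Teleporters and the Demazure operator\<close>

lemma falg_relabel_single [simp]: "falg_relabel \<pi> (sng w c) = sng (map (pgen_relabel \<pi>) w) c"
 by (simp add: falg_relabel_def)
lemma lin_falg_relabel [simp]: "lin (falg_relabel \<pi>)"
 unfolding falg_relabel_def[abs_def] by simp
lemma pgen_index_relabel [simp]: "pgen_index (pgen_relabel \<pi> g) = \<pi> (pgen_index g)"
 by (cases g) auto
lemma pgen_homog_relabel [simp]: "pgen_homog A (pgen_relabel \<pi> g) = pgen_homog A g"
 by (cases g) auto
lemma falg_relabel_falg_on:
 assumes "f : falg_on m" "\<And>i. i : {1..m} ==> \<pi> i : {1..n}" shows "falg_relabel \<pi> f : falg_on n"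
 unfolding falg_on_supp
 by (rule lin_supp[OF lin_falg_relabel assms(1)[unfolded falg_on_supp]])
   (use assms(2) in "auto intro!: supp_single simp: FW_def")

abbreviation tr12 :: "nat => nat" where "tr12 \<equiv> transpose 1 2"

lemma tr12_simps: "tr12 1 = 2" "tr12 2 = 1" "i ~= 1 ==> i ~= 2 ==> tr12 i = i"
 by (auto simp: transpose_def)

lemma tr12_mem: "i : {1..2} ==> tr12 i : {1..2}"
 by (auto simp: transpose_def)

lemma index2: "i : {1..2::nat} \<longleftrightarrow> i = 1 | i = 2" by auto

context frobenius_superalgebra begin

lemma gact_GA_add: "i : {1..n} ==> v : VV n ==> gact (GA i (a + b)) v = gact (GA i a) v + gact (GA i b) v"
 using act_pol_rel[OF pol_rel.tens_add[of i n a b]] by (simp add: act_diff act_add diff_diff_eq)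
lemma gact_GA_scale: "i : {1..n} ==> v : VV n ==> gact (GA i (scl A c a)) v = pscale c (gact (GA i a) v)"
 using act_pol_rel[OF pol_rel.tens_scale[of i n A c a]] by (simp add: act_diff act_pscale)
lemma gact_GA_mult: "i : {1..n} ==> v : VV n ==> gact (GA i a) (gact (GA i b) v) = gact (GA i (a * b)) v"
 using act_pol_rel[OF pol_rel.tens_mult[of i n a b]] by (simp add: act_diff vm_mult)
lemma gact_swap:
 assumes "pgen_homog A g p" "pgen_homog A g' q" "pgen_index g ~= pgen_index g'"
  "pgen_index g : {1..n}" "pgen_index g' : {1..n}" "v : VV n"
 shows "gact g (gact g' v) = pscale (ksgn p q) (gact g' (gact g v))"
 using act_pol_ideal[OF pc_swap[OF assms(1-5), unfolded pc_def] assms(6)] by (simp add: act_diff act_pscale)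
lemma gact_nak:
 assumes "i : {1..n}" "a : grade A p" "v : VV n"
 shows "gact (GA i a) (gact (GX i) v) = pscale (ksgn (eps A) p) (gact (GX i) (gact (GA i (nak A a)) v))"
 using act_pol_rel[OF pol_rel.x_nak[of i n i a A p]] assms by (simp add: act_diff act_pscale vm_mult)
lemma gact_GA_sum:
 assumes "i : {1..n}" "v : VV n"
 shows "gact (GA i (\<Sum>b\<in>I. scl A (u b) (f b))) v = (\<Sum>b\<in>I. pscale (u b) (gact (GA i (f b)) v))"
proof -
 have 0: "gact (GA i 0) v = 0" using gact_GA_scale[OF assms, of 0 0] by simp
 show ?thesis
 proof (induction I rule: infinite_finite_induct)
  case (insert b I)
  then show ?case using gact_GA_add[OF assms] gact_GA_scale[OF assms] by (simp del: gact.simps)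
 qed (use 0 in auto)
qed

lemma gact_VV: "pgen_index g : {1..n} ==> v : VV n ==> gact g v : VV n"
 by (rule opr_VV[OF opr_gact])

lemma dual_expand: "(\<Sum>b\<in>basis A. scl A (tr A (x * b)) (dual A b)) = x"
proof (rule trace_eqI)
 fix c assume c: "c : basis A"
 have "tr A ((\<Sum>b\<in>basis A. scl A (tr A (x * b)) (dual A b)) * c)
   = (\<Sum>b\<in>basis A. tr A (x * b) * (if b = c then 1 else 0))"
  unfolding sum_distrib_right tr_sum using c by (intro sum.cong) (auto simp: scl_mult_left tr_scale dual_tr)
 also have "... = tr A (x * c)" using c basis_finite by (simp add: if_distrib cong: if_cong)
 finally show "tr A ((\<Sum>b\<in>basis A. scl A (tr A (x * b)) (dual A b)) * c) = tr A (x * c)" .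
qed

definition tele :: "nat => nat => (('a \<times> nat) list \<Rightarrow>\<^sub>0 'k) => (('a \<times> nat) list \<Rightarrow>\<^sub>0 'k)" where
 "tele i j v = (\<Sum>b\<in>basis A. pscale (ksgn (eps A) (bpar A b)) (gact (GA i b) (gact (GA j (dual A b)) v)))"

lemma act_teleporter: "act (teleporter A i j) v = tele i j v"
 unfolding teleporter_def tele_def act_sum act_pscale by simp

lemma tele_VV: "i : {1..n} ==> j : {1..n} ==> v : VV n ==> tele i j v : VV n"
 unfolding tele_def by (intro VV_sum VV_closed gact_VV) auto

text \<open>The coefficient of \<open>c\<close> in \<open>a * b\<close> is
  \<open>tr (dual c * a * b)\<close>, which is also the coefficient of \<open>dual b\<close> in
  \<open>dual c * a\<close>. Reading it the second way moves \<open>a\<close> from place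
  \<open>i\<close> to place \<open>j\<close>.\<close>

lemma tele_slide:
 assumes a: "a : grade A p" and ij: "i : {1..n}" "j : {1..n}" and v: "v : VV n"
 shows "gact (GA i a) (tele i j v) = pscale (ksgn (eps A) p) (tele i j (gact (GA j a) v))"
proof -
 have vj: "gact (GA j x) v : VV n" for x by (rule gact_VV) (use ij v in auto)
 have "gact (GA i a) (tele i j v) = (\<Sum>b\<in>basis A. pscale (ksgn (eps A) (bpar A b)) (gact (GA i (a * b)) (gact (GA j (dual A b)) v)))"
  unfolding tele_def lin_sum[OF lin_gact] lin_pscale[OF lin_gact] gact_GA_mult[OF ij(1) vj] ..
 also have "... = (\<Sum>b\<in>basis A. \<Sum>c\<in>basis A. pscale (ksgn (eps A) (bpar A b) * cf c (a * b)) (gact (GA i c) (gact (GA j (dual A b)) v)))"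
 proof (intro sum.cong refl)
  fix b
  have "gact (GA i (a * b)) (gact (GA j (dual A b)) v) = (\<Sum>c\<in>basis A. pscale (cf c (a * b)) (gact (GA i c) (gact (GA j (dual A b)) v)))"
   using gact_GA_sum[OF ij(1) vj, of "%c. cf c (a * b)" "%c. c" "basis A"] by (simp add: cf_expand del: gact.simps)
  then show "pscale (ksgn (eps A) (bpar A b)) (gact (GA i (a * b)) (gact (GA j (dual A b)) v))
   = (\<Sum>c\<in>basis A. pscale (ksgn (eps A) (bpar A b) * cf c (a * b)) (gact (GA i c) (gact (GA j (dual A b)) v)))"
   by (simp add: pscale_sum del: gact.simps)
 qed
 also have "... = (\<Sum>b\<in>basis A. \<Sum>c\<in>basis A. pscale (ksgn (eps A) p * (ksgn (eps A) (bpar A c) * cf c (a * b))) (gact (GA i c) (gact (GA j (dual A b)) v)))"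
 proof (intro sum.cong refl)
  fix b c assume bc: "b : basis A" "c : basis A"
  show "pscale (ksgn (eps A) (bpar A b) * cf c (a * b)) (gact (GA i c) (gact (GA j (dual A b)) v))
   = pscale (ksgn (eps A) p * (ksgn (eps A) (bpar A c) * cf c (a * b))) (gact (GA i c) (gact (GA j (dual A b)) v))"
  proof (cases "bpar A c = p + bpar A b")
   case True
   then show ?thesis by (simp add: ksgn_add_right mult.assoc del: gact.simps)
  next
   case False
   then have "cf c (a * b) = 0" using cf_grade[OF grade_mult[OF a basis_grade[OF bc(1)]] bc(2)] by simp
   then show ?thesis by simp
  qed
 qed
 also have "... = (\<Sum>c\<in>basis A. \<Sum>b\<in>basis A. pscale (ksgn (eps A) p * (ksgn (eps A) (bpar A c) * cf c (a * b))) (gact (GA i c) (gact (GA j (dual A b)) v)))"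
  by (rule sum.swap)
 also have "... = (\<Sum>c\<in>basis A. pscale (ksgn (eps A) p) (pscale (ksgn (eps A) (bpar A c)) (gact (GA i c) (gact (GA j (dual A c)) (gact (GA j a) v)))))"
 proof (intro sum.cong refl)
  fix c
  have "gact (GA j (dual A c)) (gact (GA j a) v) = (\<Sum>b\<in>basis A. pscale (cf c (a * b)) (gact (GA j (dual A b)) v))"
   unfolding gact_GA_mult[OF ij(2) v] cf_def mult.assoc[symmetric]
   using gact_GA_sum[OF ij(2) v, of "%b. tr A (dual A c * a * b)" "dual A" "basis A"]
   by (simp add: dual_expand del: gact.simps)
  then show "(\<Sum>b\<in>basis A. pscale (ksgn (eps A) p * (ksgn (eps A) (bpar A c) * cf c (a * b))) (gact (GA i c) (gact (GA j (dual A b)) v)))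
   = pscale (ksgn (eps A) p) (pscale (ksgn (eps A) (bpar A c)) (gact (GA i c) (gact (GA j (dual A c)) (gact (GA j a) v))))"
   by (simp add: lin_sum[OF lin_gact] lin_pscale[OF lin_gact] pscale_sum mult.assoc del: gact.simps)
 qed
 also have "... = pscale (ksgn (eps A) p) (tele i j (gact (GA j a) v))"
  by (simp add: tele_def pscale_sum del: gact.simps)
 finally show ?thesis .
qed

text \<open>The same exchange of expansions in the other direction. Now \<open>a\<close> stands in
  front under the trace and must be moved to the end, which is where the Nakayama automorphism
  appears.\<close>

lemma tele_slide_nak:
 assumes a: "a : grade A p" and ij: "i : {1..n}" "j : {1..n}" "i ~= j" and v: "v : VV n"
 shows "gact (GA j a) (tele i j v) = pscale (ksgn (eps A) p) (tele i j (gact (GA i (nak A a)) v))"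
proof -
 have vj: "gact (GA j x) v : VV n" for x by (rule gact_VV) (use ij v in auto)
 let ?G = "%b c. gact (GA i b) (gact (GA j (dual A c)) v)"
 have "gact (GA j a) (tele i j v) = (\<Sum>b\<in>basis A. pscale (ksgn (eps A) (bpar A b) * ksgn p (bpar A b)) (gact (GA i b) (gact (GA j (a * dual A b)) v)))"
  unfolding tele_def lin_sum[OF lin_gact] lin_pscale[OF lin_gact]
 proof (intro sum.cong refl)
  fix b assume b: "b : basis A"
  have "gact (GA j a) (?G b b) = pscale (ksgn p (bpar A b)) (gact (GA i b) (gact (GA j a) (gact (GA j (dual A b)) v)))"
   by (rule gact_swap) (use a basis_grade[OF b] ij vj in "auto simp del: gact.simps")
  then show "pscale (ksgn (eps A) (bpar A b)) (gact (GA j a) (?G b b))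
   = pscale (ksgn (eps A) (bpar A b) * ksgn p (bpar A b)) (gact (GA i b) (gact (GA j (a * dual A b)) v))"
   by (simp add: gact_GA_mult[OF ij(2) v] del: gact.simps)
 qed
 also have "... = (\<Sum>b\<in>basis A. \<Sum>c\<in>basis A. pscale (ksgn (eps A) (bpar A c) * ksgn p (bpar A c) * cf b (c * nak A a)) (?G b c))"
 proof (intro sum.cong refl)
  fix b assume b: "b : basis A"
  have "gact (GA i b) (gact (GA j (a * dual A b)) v) = (\<Sum>c\<in>basis A. pscale (tr A (a * dual A b * c)) (?G b c))"
   using gact_GA_sum[OF ij(2) v, of "%c. tr A (a * dual A b * c)" "dual A" "basis A"]
   by (simp add: dual_expand lin_sum[OF lin_gact] lin_pscale[OF lin_gact] del: gact.simps)
  moreover have "ksgn (eps A) (bpar A b) * ksgn p (bpar A b) * tr A (a * dual A b * c)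
   = ksgn (eps A) (bpar A c) * ksgn p (bpar A c) * cf b (c * nak A a)" if c: "c : basis A" for c
  proof -
   have g: "dual A b * c : grade A (bpar A b + eps A + bpar A c)"
   by (intro grade_mult dual_grade basis_grade b c)
   have *: "tr A (a * dual A b * c) = ksgn p (bpar A b + eps A + bpar A c) * cf b (c * nak A a)"
   unfolding cf_def mult.assoc[symmetric] using nak_tr[OF a g] by (simp add: mult.assoc)
   show ?thesis
   proof (cases "bpar A b = bpar A c + p")
   case True
   then show ?thesis unfolding *
   using bit_exhaust[of p] bit_exhaust[of "bpar A c"] bit_exhaust[of "eps A"] by (elim disjE) simp_all
   next
   case False
   then have "cf b (c * nak A a) = 0"
   using cf_grade[OF grade_mult[OF basis_grade[OF c] nak_grade[OF a]] b] by simp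
   then show ?thesis unfolding * by simp
   qed
  qed
  ultimately show "pscale (ksgn (eps A) (bpar A b) * ksgn p (bpar A b)) (gact (GA i b) (gact (GA j (a * dual A b)) v))
   = (\<Sum>c\<in>basis A. pscale (ksgn (eps A) (bpar A c) * ksgn p (bpar A c) * cf b (c * nak A a)) (?G b c))"
   by (simp add: pscale_sum del: gact.simps)
 qed
 also have "... = (\<Sum>c\<in>basis A. \<Sum>b\<in>basis A. pscale (ksgn (eps A) (bpar A c) * ksgn p (bpar A c) * cf b (c * nak A a)) (?G b c))"
  by (rule sum.swap)
 also have "... = (\<Sum>c\<in>basis A. pscale (ksgn (eps A) p) (pscale (ksgn (eps A) (bpar A c)) (gact (GA i c) (gact (GA j (dual A c)) (gact (GA i (nak A a)) v)))))"
 proof (intro sum.cong refl)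
  fix c assume c: "c : basis A"
  have "gact (GA j (dual A c)) (gact (GA i (nak A a)) v) = pscale (ksgn (bpar A c + eps A) p) (gact (GA i (nak A a)) (gact (GA j (dual A c)) v))"
   by (rule gact_swap) (use a nak_grade dual_grade[OF c] ij v in auto)
  then have "gact (GA i c) (gact (GA j (dual A c)) (gact (GA i (nak A a)) v))
   = pscale (ksgn (bpar A c + eps A) p) (gact (GA i (c * nak A a)) (gact (GA j (dual A c)) v))"
   by (simp add: gact_GA_mult[OF ij(1) vj] lin_pscale[OF lin_gact] del: gact.simps)
  also have "gact (GA i (c * nak A a)) (gact (GA j (dual A c)) v) = (\<Sum>b\<in>basis A. pscale (cf b (c * nak A a)) (?G b c))"
   using gact_GA_sum[OF ij(1) vj, of "%b. cf b (c * nak A a)" "%b. b" "basis A"]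
   by (simp add: cf_expand del: gact.simps)
  finally have 1: "gact (GA i c) (gact (GA j (dual A c)) (gact (GA i (nak A a)) v))
   = pscale (ksgn (bpar A c + eps A) p) (\<Sum>b\<in>basis A. pscale (cf b (c * nak A a)) (?G b c))" .
  have 2: "ksgn (eps A) p * (ksgn (eps A) (bpar A c) * (ksgn (bpar A c + eps A) p * z)) =
   ksgn (eps A) (bpar A c) * ksgn p (bpar A c) * z" for z :: 'k
   using bit_exhaust[of p] bit_exhaust[of "bpar A c"] bit_exhaust[of "eps A"] by (elim disjE) simp_all
  show "(\<Sum>b\<in>basis A. pscale (ksgn (eps A) (bpar A c) * ksgn p (bpar A c) * cf b (c * nak A a)) (?G b c))
   = pscale (ksgn (eps A) p) (pscale (ksgn (eps A) (bpar A c)) (gact (GA i c) (gact (GA j (dual A c)) (gact (GA i (nak A a)) v))))"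
   unfolding 1 by (simp add: pscale_sum mult.assoc 2[unfolded mult.assoc] del: gact.simps)
 qed
 also have "... = pscale (ksgn (eps A) p) (tele i j (gact (GA i (nak A a)) v))"
  by (simp add: tele_def pscale_sum del: gact.simps)
 finally show ?thesis .
qed

text \<open>Moving \<open>x_j\<close> to the front replaces \<open>dual b\<close> by
  \<open>nak (dual b)\<close>. Expanding \<open>b\<close> in the dual basis on one side and
  \<open>c\<close> in the elements \<open>nak (dual b)\<close> on the other shows that the two
  places have exchanged their roles.\<close>

lemma tele_slide_x:
 assumes ij: "i : {1..n}" "j : {1..n}" "i ~= j" and v: "v : VV n"
 shows "tele i j (gact (GX j) v) = gact (GX j) (tele j i v)"
proof -
 have vj: "gact (GA j x) v : VV n" "gact (GA i x) v : VV n" for x by (rule gact_VV; use ij v in auto)+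
 let ?G = "%b c. gact (GA i (dual A c)) (gact (GA j (nak A (dual A b))) v)"
 have "tele i j (gact (GX j) v) = (\<Sum>b\<in>basis A. pscale (ksgn (eps A) (bpar A b + eps A)) (gact (GX j) (gact (GA i b) (gact (GA j (nak A (dual A b))) v))))"
  unfolding tele_def
 proof (intro sum.cong refl)
  fix b assume b: "b : basis A"
  have 1: "gact (GA j (dual A b)) (gact (GX j) v) = pscale (ksgn (eps A) (bpar A b + eps A)) (gact (GX j) (gact (GA j (nak A (dual A b))) v))"
   by (rule gact_nak[OF ij(2) dual_grade[OF b] v])
  have 2: "gact (GA i b) (gact (GX j) (gact (GA j (nak A (dual A b))) v))
   = pscale (ksgn (bpar A b) (eps A)) (gact (GX j) (gact (GA i b) (gact (GA j (nak A (dual A b))) v)))"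
   by (rule gact_swap) (use basis_grade[OF b] ij vj in "auto simp del: gact.simps")
  show "pscale (ksgn (eps A) (bpar A b)) (gact (GA i b) (gact (GA j (dual A b)) (gact (GX j) v)))
   = pscale (ksgn (eps A) (bpar A b + eps A)) (gact (GX j) (gact (GA i b) (gact (GA j (nak A (dual A b))) v)))"
   unfolding 1 lin_pscale[OF lin_gact] 2
   using bit_exhaust[of "bpar A b"] bit_exhaust[of "eps A"] by (elim disjE) simp_all
 qed
 also have "... = (\<Sum>b\<in>basis A. \<Sum>c\<in>basis A. pscale (ksgn (eps A) (bpar A c) * tr A (b * c)) (gact (GX j) (?G b c)))"
 proof (intro sum.cong refl)
  fix b assume b: "b : basis A"
  have u: "gact (GA j (nak A (dual A b))) v : VV n" by (rule vj)
  have "gact (GA i b) (gact (GA j (nak A (dual A b))) v) = (\<Sum>c\<in>basis A. pscale (tr A (b * c)) (?G b c))"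
   using gact_GA_sum[OF ij(1) u, of "%c. tr A (b * c)" "dual A" "basis A"]
   by (simp add: dual_expand del: gact.simps)
  moreover have "ksgn (eps A) (bpar A b + eps A) * tr A (b * c) = ksgn (eps A) (bpar A c) * tr A (b * c)"
   if c: "c : basis A" for c
  proof (cases "bpar A b + bpar A c = eps A")
   case True
   then show ?thesis
   using bit_exhaust[of "bpar A b"] bit_exhaust[of "bpar A c"] bit_exhaust[of "eps A"] by (elim disjE) simp_all
  next
   case False
   then show ?thesis using trace_grade[OF basis_grade[OF b] basis_grade[OF c]] by simp
  qed
  ultimately show "pscale (ksgn (eps A) (bpar A b + eps A)) (gact (GX j) (gact (GA i b) (gact (GA j (nak A (dual A b))) v)))
   = (\<Sum>c\<in>basis A. pscale (ksgn (eps A) (bpar A c) * tr A (b * c)) (gact (GX j) (?G b c)))"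
   by (simp add: lin_sum[OF lin_gact] lin_pscale[OF lin_gact] pscale_sum del: gact.simps)
 qed
 also have "... = (\<Sum>c\<in>basis A. \<Sum>b\<in>basis A. pscale (ksgn (eps A) (bpar A c) * tr A (b * c)) (gact (GX j) (?G b c)))"
  by (rule sum.swap)
 also have "... = (\<Sum>c\<in>basis A. pscale (ksgn (eps A) (bpar A c)) (gact (GX j) (gact (GA j c) (gact (GA i (dual A c)) v))))"
 proof (intro sum.cong refl)
  fix c assume c: "c : basis A"
  have 1: "gact (GA j c) (gact (GA i (dual A c)) v) = pscale (ksgn (bpar A c) (bpar A c + eps A)) (gact (GA i (dual A c)) (gact (GA j c) v))"
   by (rule gact_swap) (use basis_grade[OF c] dual_grade[OF c] ij v in auto)
  have nak_sum: "nak A (sum f I) = (\<Sum>i\<in>I. nak A (f i))" for f and I :: "'a set"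
   using nak_add nak_scale[of 0 0] by (induction I rule: infinite_finite_induct) auto
  \<comment> \<open>Expansion of \<open>c\<close> in the elements \<open>nak A (dual A b)\<close>:
    apply \<open>nak\<close> to the dual-basis expansion of \<open>nki c\<close>.\<close>
  have "c = nak A (\<Sum>b\<in>basis A. scl A (tr A (nki c * b)) (dual A b))"
   by (simp add: dual_expand)
  also have "... = (\<Sum>b\<in>basis A. scl A (tr A (nki c * b)) (nak A (dual A b)))"
   by (simp add: nak_sum nak_scale)
  finally have "gact (GA j c) v = (\<Sum>b\<in>basis A. pscale (tr A (nki c * b)) (gact (GA j (nak A (dual A b))) v))"
   using gact_GA_sum[OF ij(2) v, of "%b. tr A (nki c * b)" "%b. nak A (dual A b)" "basis A"] by simp
  also have "... = (\<Sum>b\<in>basis A. pscale (ksgn (bpar A c) (bpar A c + eps A) * tr A (b * c)) (gact (GA j (nak A (dual A b))) v))"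
  proof (intro sum.cong refl)
   fix b assume b: "b : basis A"
   have *: "tr A (nki c * b) = ksgn (bpar A c) (bpar A b) * tr A (b * c)"
   using nak_tr[OF nki_grade[OF basis_grade[OF c]] basis_grade[OF b]] by simp
   have "tr A (nki c * b) = ksgn (bpar A c) (bpar A c + eps A) * tr A (b * c)"
   proof (cases "bpar A b = bpar A c + eps A")
   case True
   then show ?thesis unfolding * by simp
   next
   case False
   then have "bpar A b + bpar A c ~= eps A" by (metis add.commute bit_add_self_left)
   then show ?thesis unfolding * using trace_grade[OF basis_grade[OF b] basis_grade[OF c]] by simp
   qed
   then show "pscale (tr A (nki c * b)) (gact (GA j (nak A (dual A b))) v)
   = pscale (ksgn (bpar A c) (bpar A c + eps A) * tr A (b * c)) (gact (GA j (nak A (dual A b))) v)" by simp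
  qed
  finally have 2: "gact (GA j c) v = (\<Sum>b\<in>basis A. pscale (ksgn (bpar A c) (bpar A c + eps A) * tr A (b * c)) (gact (GA j (nak A (dual A b))) v))" .
  show "(\<Sum>b\<in>basis A. pscale (ksgn (eps A) (bpar A c) * tr A (b * c)) (gact (GX j) (?G b c)))
   = pscale (ksgn (eps A) (bpar A c)) (gact (GX j) (gact (GA j c) (gact (GA i (dual A c)) v)))"
   unfolding 1 2 by (simp add: lin_sum[OF lin_gact] lin_pscale[OF lin_gact] pscale_sum del: gact.simps)
 qed
 also have "... = gact (GX j) (tele j i v)"
  unfolding tele_def lin_sum[OF lin_gact] lin_pscale[OF lin_gact] ..
 finally show ?thesis .
qed

text \<open>The operator of \<open>s_1\<close> on the model: the superpermutation of the two
  letters, including their powers of \<open>x\<close>.\<close>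

definition Sw :: "(('a \<times> nat) list \<Rightarrow>\<^sub>0 'k) => (('a \<times> nat) list \<Rightarrow>\<^sub>0 'k)" where
 "Sw = plinear (%l. if length l = 2 then sng [l ! 1, l ! 0] (ksgn (epar (l ! 0)) (epar (l ! 1))) else 0)"

lemma lin_Sw [simp]: "lin Sw" by (simp add: Sw_def)
lemma Sw_single: "Sw (sng [e, e'] 1) = sng [e', e] (ksgn (epar e) (epar e'))"
 by (simp add: Sw_def One_nat_def)

lemma L_2: "l : L 2 \<longleftrightarrow> (\<exists>e e'. l = [e, e'] & [e] : L 1 & [e'] : L 1)"
 unfolding L_def by (auto simp: numeral_2_eq_2 length_Suc_conv One_nat_def)

lemma opr_Sw: "opr 2 2 Sw"
 by (rule oprI) (auto simp: L_2 Sw_single intro!: VV_single)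

lemma Sw_mult:
 assumes "u : VV 1" "u : HV p" "v : VV 1" "v : HV q"
 shows "Sw (u * v) = pscale (ksgn p q) (v * u)"
proof (rule bilinear_eqI[where F = "%u v. Sw (u * v)" and G = "%u v. pscale (ksgn p q) (v * u)"
   and I = "{l : L 1. lpar l = p}" and J = "{l : L 1. lpar l = q}"])
 fix i j assume "i : {l : L 1. lpar l = p}" "j : {l : L 1. lpar l = q}"
 then show "Sw (sng i 1 * sng j 1) = pscale (ksgn p q) (sng j 1 * sng i 1)"
  by (auto simp: L_1 vm_mult Sw_single)
qed (use VHV[OF assms(1,2)] VHV[OF assms(3,4)] in "auto intro: lin_comp[OF lin_mult_left lin_Sw] lin_comp[OF lin_mult_right lin_Sw]
   lin_scale")

lemma Sw_Sw: "v : VV 2 ==> Sw (Sw v) = v"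
proof (rule VV_eqI[where F = "%v. Sw (Sw v)" and G = "%v. v"])
 fix l assume "l : L 2"
 then show "Sw (Sw (sng l 1)) = sng l 1"
  by (auto simp: L_2 Sw_single lin_single[OF lin_Sw, of _ "ksgn _ _"] ksgn_comm)
qed (auto intro: lin_comp[OF lin_Sw lin_Sw])

lemma vac_2: "vac 2 = e1 1 0 * e1 1 0"
 by (simp add: vac_def power2_eq_square)

lemma Sw_vac: "Sw (vac 2) = vac 2"
 using Sw_mult[OF e1_VV e1_HV e1_VV e1_HV, of 1 0 1 0 0 0] grade_one by (simp add: vac_2)

lemma Sw_gact_homog:
 assumes "pgen_homog A g p" "pgen_index g : {1..2}" "v : VV 2"
 shows "Sw (gact g v) = gact (pgen_relabel tr12 g) (Sw v)"
proof (rule VV_eqI[where F = "%v. Sw (gact g v)" and G = "%v. gact (pgen_relabel tr12 g) (Sw v)", OF _ _ assms(3)])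
 fix l assume "l : L 2"
 then obtain e e' where l: "l = [e, e']" "[e] : L 1" "[e'] : L 1" by (auto simp: L_2)
 let ?F = "gop g"
 have F: "opr 1 1 ?F" "opar 1 p ?F" "lin ?F" using opr_gop opar_gop[OF assms(1)] opr_lin[OF opr_gop] by auto
 have gr: "gop (pgen_relabel tr12 g) = ?F" by (cases g) auto
 have e: "sng [e] 1 : VV 1" "sng [e] 1 : HV (epar e)"
   "sng [e'] 1 : VV 1" "sng [e'] 1 : HV (epar e')"
  using l HV_single[of "[e]" 1] HV_single[of "[e']" 1] by (auto simp: VV_single)
 have Fe: "?F (sng [e] 1) : VV 1" "?F (sng [e] 1) : HV (p + epar e)"
  "?F (sng [e'] 1) : VV 1" "?F (sng [e'] 1) : HV (p + epar e')"
  by (intro opr_VV[OF F(1)] opar_HV[OF F(2,3)] e)+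
 have i1: "ins 1 ?F (sng [x, y] 1) = pscale (ksgn p (epar x)) (sng [x] 1 * ?F (sng [y] 1))"
  if "[x] : L 1" "[y] : L 1" for x y
 proof -
  have "ins 0 ?F (sng [y] 1) = ?F (sng [y] 1)"
   using ins_first[OF F(3), of y "[]"] by (simp add: one_single_Nil[symmetric])
  moreover have "ins (Suc 0) ?F (sng [x, y] 1)
   = pscale (ksgn p (epar x)) (sng [x] 1 * ins 0 ?F (sng [y] 1))"
   by (rule ins_later[OF F(3,1,2)]) (use that in "auto simp: L_def")
  ultimately show ?thesis by (simp add: One_nat_def)
 qed
 have i0: "ins 0 ?F (sng [x, y] 1) = ?F (sng [x] 1) * sng [y] 1" for x y
  using ins_first[OF F(3)] by simp
 consider "pgen_index g = 1" | "pgen_index g = 2" using assms(2) by fastforce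
 then show "Sw (gact g (sng l 1)) = gact (pgen_relabel tr12 g) (Sw (sng l 1))"
 proof cases
  case 1
  show ?thesis unfolding gact_gop pgen_index_relabel gr 1 tr12_simps l Sw_single
   using i1[OF l(3,2)] by (simp add: One_nat_def i0 Sw_mult[OF Fe(1,2) e(3,4)] lin_single[OF lin_ins, of _ _ _ "ksgn _ _"] ksgn_add_left mult.commute)
 next
  case 2
  show ?thesis unfolding gact_gop pgen_index_relabel gr 2 tr12_simps l Sw_single
   using i1[OF l(2,3)] by (simp add: One_nat_def i0 lin_pscale Sw_mult[OF e(1,2) Fe(3,4)] lin_single[OF lin_ins, of _ _ _ "ksgn _ _"] ksgn_add_right ksgn_comm)
 qed
qed (auto intro: lin_comp[OF lin_gact lin_Sw] lin_comp[OF lin_Sw lin_gact])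

lemma Sw_VV: "v : VV 2 ==> Sw v : VV 2" by (rule opr_VV[OF opr_Sw])

lemma Sw_gact:
 assumes "pgen_index g : {1..2}" "v : VV 2"
 shows "Sw (gact g v) = gact (pgen_relabel tr12 g) (Sw v)"
proof (cases g)
 case (GX i)
 then show ?thesis using Sw_gact_homog[of g "eps A" v] assms by simp
next
 case (GA i a)
 obtain u w where uw: "u : grade A 0" "w : grade A 1" "a = u + w" by (rule grade_split)
 have i: "i : {1..2}" "tr12 i : {1..2}" using assms GA by (auto intro: tr12_mem simp del: atLeastAtMost_iff)
 show ?thesis
  using Sw_gact_homog[of "GA i u" 0 v] Sw_gact_homog[of "GA i w" 1 v] uw i assms(2)
  unfolding GA pgen_relabel.simps uw(3) gact_GA_add[OF i(1) assms(2)] gact_GA_add[OF i(2) Sw_VV[OF assms(2)]]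
  by (simp add: lin_add[OF lin_Sw] del: gact.simps)
qed

lemma Sw_act:
 assumes "f : falg_on 2" "v : VV 2" shows "Sw (act f v) = act (falg_relabel tr12 f) (Sw v)"
proof (rule supp_mult_single_induct[where F = "%f. Sw (act f v)" and G = "%f. act (falg_relabel tr12 f) (Sw v)" and I = "FW 2"])
 fix w :: "'a pgen list" assume "w : FW 2"
 then have "Sw (wact w v) = wact (map (pgen_relabel tr12) w) (Sw v)"
 proof (induction w)
  case (Cons g w)
  then have g: "pgen_index g : {1..2}" "w : FW 2" by (auto simp: FW_Cons)
  show ?case using Sw_gact[OF g(1) opr_VV[OF opr_wact[OF g(2)] assms(2)]] Cons.IH g by simp
 qed simp
 then show "Sw (act (mon w) v) = act (falg_relabel tr12 (mon w)) (Sw v)" by simp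
qed (use assms in "auto simp: falg_on_supp intro: lin_comp[OF lin_act_left lin_Sw] lin_comp[OF lin_falg_relabel lin_act_left]")

section \<open>The Demazure operator on the free algebra and on the model\<close>

definition dem :: "('k, 'a) falg => ('k, 'a) falg" where "dem = plinear (demazure_word A 1)"

lemma lin_dem [simp]: "lin dem" by (simp add: dem_def)
lemma dem_single [simp]: "dem (sng w c) = pscale c (demazure_word A 1 w)" by (simp add: dem_def)

lemma demazure_word_append: "demazure_word A 1 (w @ w') = demazure_word A 1 w * mon w' + mon (map (pgen_relabel tr12) w) * demazure_word A 1 w'"
proof (induction w)
 case Nil
 then show ?case by (simp add: one_single_Nil[symmetric])
next
 case (Cons g w)
 have 1: "mon (w @ w') = mon w * mon w'" by (simp add: vm_mult)
 have 2: "mon (map (pgen_relabel tr12) (g # w)) = mon [pgen_relabel tr12 g] * mon (map (pgen_relabel tr12) w)"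
  by (simp add: vm_mult)
 show ?case unfolding append_Cons demazure_word.simps Cons.IH 1 2 Suc_1
  by (simp only: distrib_left distrib_right mult.assoc add.assoc)
qed

lemma dem_mult: "dem (f * g) = dem f * g + falg_relabel tr12 f * dem g"
 by (rule bilinear_eqI[where F = "%f g. dem (f * g)" and I = UNIV and J = UNIV])
   (auto intro: lin_plus lin_comp[OF lin_mult_left lin_dem] lin_comp[OF lin_mult_right lin_dem]
   lin_comp[OF lin_dem lin_mult_right] lin_comp[OF lin_falg_relabel lin_mult_right] lin_comp[OF lin_dem lin_mult_left]
   simp: vm_mult demazure_word_append)

lemma dem_1: "dem 1 = 0" by (simp add: one_single_Nil)

lemma teleporter_falg_on: "i : {1..n} ==> j : {1..n} ==> teleporter A i j : falg_on n"
 unfolding teleporter_def by (intro falg_on_sum falg_on_closed(6) falg_on_single) (auto simp: FW_Cons)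

lemma demazure_gen_falg_on: "demazure_gen A 1 g : falg_on 2"
 by (cases g) (auto simp: Suc_1 intro!: teleporter_falg_on falg_on_closed)

lemma demazure_word_falg_on: "w : FW 2 ==> demazure_word A 1 w : falg_on 2"
 by (induction w) (auto intro!: falg_on_closed demazure_gen_falg_on falg_on_single simp: FW_Cons transpose_def)

lemma dem_falg_on: "f : falg_on 2 ==> dem f : falg_on 2"
 unfolding falg_on_supp by (erule lin_supp[OF lin_dem]) (simp add: demazure_word_falg_on[unfolded falg_on_supp])

text \<open>Relations without an \<open>x\<close> are killed outright, since the operator vanishes
  on each \<open>a_j\<close>. The two kinds that contain \<open>x\<close> are exactly the sliding
  rules for teleporters.\<close>

lemma act_dem_pol_rel:
 assumes "r : pol_rel A 2" "v : VV 2" shows "act (dem r) v = 0"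
 using assms(1)
proof (cases rule: pol_rel.cases)
 case (x_comm i j)
 have 1: "tele 1 2 (gact (GX 2) v) = gact (GX 2) (tele 2 1 v)" by (rule tele_slide_x) (use assms in auto)
 have 2: "tele 2 1 (gact (GX 1) v) = gact (GX 1) (tele 1 2 v)" by (rule tele_slide_x) (use assms in auto)
 consider "i = 1" "j = 2" | "i = 2" "j = 1" using x_comm by (auto simp: index2 simp del: atLeastAtMost_iff)
 then show ?thesis using 1 2
  by cases (simp_all add: x_comm(1) vm_mult lin_diff[OF lin_dem] lin_pscale[OF lin_dem] act_diff act_add act_mult
   act_uminus act_pscale act_teleporter tr12_simps lin_uminus[OF lin_gact] one_single_Nil[symmetric] del: gact.simps)
next
 case (x_nak i j a p)
 have i12: "1 : {1..2::nat}" "2 : {1..2::nat}" by auto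
 note t = tele_slide[OF x_nak(4) i12 assms(2)] tele_slide[OF x_nak(4) i12(2,1) assms(2)]
  tele_slide_nak[OF x_nak(4) i12 _ assms(2)] tele_slide_nak[OF x_nak(4) i12(2,1) _ assms(2)]
 consider "i = 1" "j = 1" | "i = 1" "j = 2" | "i = 2" "j = 1" | "i = 2" "j = 2"
  using x_nak by (auto simp: index2 simp del: atLeastAtMost_iff)
 then show ?thesis using t
  by cases (simp_all add: x_nak(1) vm_mult lin_diff[OF lin_dem] lin_pscale[OF lin_dem] act_diff act_add act_mult
   act_uminus act_pscale act_teleporter tr12_simps lin_uminus[OF lin_gact] pscale_uminus one_single_Nil[symmetric] del: gact.simps)
qed (simp_all add: lin_diff[OF lin_dem] lin_pscale[OF lin_dem] vm_mult dem_1)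

text \<open>By the Leibniz rule, right multiples produce the relabelled \<open>r\<close>.
  Conjugating with \<open>Sw\<close> shows that it too acts as 0.\<close>

lemma act_dem_pol_ideal: "r : pol_ideal A 2 ==> v : VV 2 ==> act (dem r) v = 0"
proof (induction arbitrary: v rule: pol_ideal.induct)
 case (rel r)
 then show ?case by (simp add: act_dem_pol_rel)
next
 case (mult_left f r)
 then show ?case using act_pol_ideal[OF mult_left(2,4)]
  by (simp add: dem_mult act_add act_mult lin_0)
next
 case (mult_right f r)
 have r: "falg_relabel tr12 r : falg_on 2"
  by (rule falg_relabel_falg_on[OF pol_ideal_falg_on[OF mult_right(2)]]) (rule tr12_mem)
 have "act (falg_relabel tr12 r) u = 0" if "u : VV 2" for u
  using Sw_act[OF pol_ideal_falg_on[OF mult_right(2)] Sw_VV[OF that]] act_pol_ideal[OF mult_right(2) Sw_VV[OF that]]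
  by (simp add: Sw_Sw that lin_0)
 then show ?case using mult_right
  by (simp add: dem_mult act_add act_mult opr_VV[OF opr_act] dem_falg_on)
qed (simp_all add: lin_0 lin_add act_add)

definition Dz :: "(('a \<times> nat) list \<Rightarrow>\<^sub>0 'k) => (('a \<times> nat) list \<Rightarrow>\<^sub>0 'k)" where
 "Dz v = PHI 2 (dem (psi 1 v))"

lemma lin_Dz [simp]: "lin Dz"
 by (rule linI) (simp_all add: Dz_def lin_add[OF lin_psi] lin_add[OF lin_dem] lin_add[OF lin_PHI]
   lin_pscale[OF lin_psi] lin_pscale[OF lin_dem] lin_pscale[OF lin_PHI])

lemma PHI_dem: "f : falg_on 2 ==> PHI 2 (dem f) = Dz (PHI 2 f)"
 using act_dem_pol_ideal[of "f - psi 1 (PHI 2 f)" "vac 2"] pc_psi_PHI[of f 2] vac_VV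
 by (simp add: pc_def Dz_def PHI_def lin_diff act_diff)

lemma Dz_act:
 assumes "f : falg_on 2" "v : VV 2"
 shows "Dz (act f v) = act (dem f) v + act (falg_relabel tr12 f) (Dz v)"
proof -
 define h where "h = psi 1 v"
 have h: "h : falg_on 2" "PHI 2 h = v" using assms by (simp_all add: h_def psi_falg_on PHI_psi)
 have "Dz (act f v) = PHI 2 (dem (f * h))"
  using PHI_dem[of "f * h"] assms h by (simp add: PHI_mult)
 also have "... = act (dem f) v + act (falg_relabel tr12 f) (Dz v)"
  using h PHI_dem[of h] by (simp add: dem_mult lin_add PHI_mult)
 finally show ?thesis .
qed

definition tau :: "(('a \<times> nat) list \<Rightarrow>\<^sub>0 'k) => (('a \<times> nat) list \<Rightarrow>\<^sub>0 'k)" where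
 "tau v = Sw v - Dz v"

lemma lin_tau [simp]: "lin tau" unfolding tau_def[abs_def] by (intro lin_minus lin_Sw lin_Dz)
lemma opr_tau: "opr 2 2 tau"
proof -
 have "opr 2 2 Dz" unfolding opr_def
  by (intro conjI ballI lin_Dz) (auto simp: Dz_def intro!: PHI_VV dem_falg_on psi_falg_on)
 then show ?thesis unfolding tau_def[abs_def] by (intro opr_minus opr_Sw)
qed
lemma tau_VV: "v : VV 2 ==> tau v : VV 2" by (rule opr_VV[OF opr_tau])

text \<open>Multiplicativity of \<open>Sw\<close> and the Leibniz rule of \<open>Dz\<close>,
  subtracted. The relations of a crossing with polynomials, including the mixed braid relation, are
  instances of this identity.\<close>

lemma tau_act:
 assumes "f : falg_on 2" "v : VV 2"
 shows "tau (act f v) = act (falg_relabel tr12 f) (tau v) - act (dem f) v"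
 using Dz_act[OF assms] Sw_act[OF assms] by (simp add: tau_def lin_diff)

lemma tau_vac: "tau (vac 2) = vac 2"
 using PHI_dem[of 1] by (simp add: tau_def Sw_vac PHI_1 dem_1 lin_0)

lemma tau_gact:
 assumes "pgen_index g : {1..2}" "v : VV 2"
 shows "tau (gact g v) = gact (pgen_relabel tr12 g) (tau v) - act (demazure_gen A 1 g) v"
 using tau_act[of "mon [g]" v] assms by (simp add: falg_on_single FW_Cons one_single_Nil[symmetric])

lemma tau_GA: "i : {1..2} ==> v : VV 2 ==> tau (gact (GA i a) v) = gact (GA (tr12 i) a) (tau v)"
 using tau_gact[of "GA i a" v] by (simp del: gact.simps)
lemma tau_X1: "v : VV 2 ==> tau (gact (GX 1) v) = gact (GX 2) (tau v) - tele 1 2 v"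
 using tau_gact[of "GX 1" v] by (simp del: gact.simps add: tr12_simps act_teleporter)
lemma tau_X2: "v : VV 2 ==> tau (gact (GX 2) v) = gact (GX 1) (tau v) + tele 2 1 v"
 using tau_gact[of "GX 2" v] by (simp del: gact.simps add: tr12_simps act_teleporter act_uminus)
lemma tau_tele:
 assumes "i : {1..2}" "j : {1..2}" "v : VV 2"
 shows "tau (tele i j v) = tele (tr12 i) (tr12 j) (tau v)"
 unfolding tele_def lin_sum[OF lin_tau] lin_pscale[OF lin_tau]
 using assms by (intro sum.cong refl) (simp add: tau_GA gact_VV del: gact.simps)

text \<open>The vacuum generates \<open>VV n\<close> under the generators, so identities of linear
  operators follow from their value there and from stability under each generator.\<close>

lemma VV_vac_induct:
 fixes F G :: "(('a \<times> nat) list \<Rightarrow>\<^sub>0 'k) => (('a \<times> nat) list \<Rightarrow>\<^sub>0 'k)"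
 assumes "v : VV n" "lin F" "lin G" "F (vac n) = G (vac n)"
  "\<And>(g :: 'a pgen) v. pgen_index g : {1..n} ==> v : VV n ==> F v = G v ==> F (gact g v) = G (gact g v)"
 shows "F v = G v"
proof -
 have w: "F (wact w (vac n)) = G (wact w (vac n))" if "w : FW n" for w
  using that by (induction w) (auto simp: assms(4) FW_Cons intro!: assms(5) opr_VV[OF opr_wact] vac_VV)
 have "F (PHI n f) = G (PHI n f)" if "f : falg_on n" for f
  by (rule supp_mult_single_induct[where F = "%f. F (PHI n f)" and G = "%f. G (PHI n f)" and I = "FW n"])
   (use that w in "auto simp: falg_on_supp PHI_def intro: lin_comp[OF lin_act_left assms(2)] lin_comp[OF lin_act_left assms(3)]")
 from this[OF psi_falg_on[OF assms(1)]] show ?thesis using PHI_psi[OF assms(1)] by simp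
qed

text \<open>For \<open>x_1\<close>, pushing it through twice yields the corrections
  \<open>t_{2,1}\<close> and \<open>- t_{2,1}\<close>, which cancel since the crossing also
  exchanges the indices of a teleporter; \<open>x_2\<close> is similar.\<close>

lemma tau_tau: "v : VV 2 ==> tau (tau v) = v"
proof (rule VV_vac_induct[where F = "%v. tau (tau v)" and G = "%v. v" and n = 2])
 fix g :: "'a pgen" and v assume g: "pgen_index g : {1..2}" and v: "v : VV 2" and IH: "tau (tau v) = v"
 show "tau (tau (gact g v)) = gact g v"
 proof (cases g)
  case (GA i a)
  then have "i : {1..2}" using g by simp
  then show ?thesis using IH v tr12_mem[of i] by (simp add: GA tau_GA tau_VV transpose_involutory del: gact.simps)
 next
  case (GX i)
  then consider "i = 1" | "i = 2" using g by fastforce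
  then show ?thesis
  proof cases
   case 1
   then show ?thesis using IH v
   by (simp add: GX tau_X1 tau_X2 tau_VV lin_diff[OF lin_tau] tau_tele tr12_simps del: gact.simps)
  next
   case 2
   then show ?thesis using IH v
   by (simp add: GX tau_X1 tau_X2 tau_VV lin_add[OF lin_tau] tau_tele tr12_simps del: gact.simps)
  qed
 qed
qed (auto simp: tau_vac intro: lin_comp[OF lin_tau lin_tau])

end

section \<open>The braid relation\<close>

context frobenius_superalgebra begin

lemma tens_minus_left: "tens m (%v. F v - F' v) G v = tens m F G v - tens m F' G v"
 by (rule lin_eq_on[where G = "%v. tens m F G v - tens m F' G v"])
   (auto simp: tens_single left_diff_distrib intro: lin_minus)
lemma tens_minus_right: "tens m F (%v. G v - G' v) v = tens m F G v - tens m F G' v"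
 by (rule lin_eq_on[where G = "%v. tens m F G v - tens m F G' v"])
   (auto simp: tens_single twist_def lin_diff right_diff_distrib intro: lin_minus)

lemma gact_shift: "1 <= pgen_index g ==> gact (pgen_relabel (%j. j + m) g) v = tens m idv (gact g) v"
proof -
 assume "1 <= pgen_index g"
 then have i: "pgen_index g + m - 1 = m + (pgen_index g - 1)" by simp
 have g: "gop (pgen_relabel (%j. j + m) g) = gop g" by (cases g) auto
 show ?thesis unfolding gact_gop pgen_index_relabel i g ins_shift ..
qed

text \<open>A polynomial in the last \<open>n\<close> variables acts on the right tensor factor
  only; \<open>act_left\<close> is the counterpart for the first variables. Both transport
  two-strand identities to three strands.\<close>

lemma act_shift:
 assumes "f : falg_on n" "v : VV (m + n)"
 shows "act (falg_relabel (%j. j + m) f) v = tens m idv (act f) v"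
proof (rule supp_mult_single_induct[where F = "%f. act (falg_relabel (%j. j + m) f) v"
   and G = "%f. tens m idv (act f) v" and I = "FW n"])
 show "lin (%f. tens m idv (act f) v)"
 proof (rule linI)
  show "tens m idv (act (f + g)) v = tens m idv (act f) v + tens m idv (act g) v" for f g
   by (rule lin_eq_on[where G = "%v. tens m idv (act f) v + tens m idv (act g) v"])
   (auto simp: tens_single twist_def act_add lin_add distrib_left intro: lin_plus)
  show "tens m idv (act (pscale c f)) v = pscale c (tens m idv (act f) v)" for c f
   using tens_scale_right[OF lin_act, of m "%v. v" c f v] by (simp add: act_pscale[abs_def])
 qed
next
 fix w :: "'a pgen list" assume "w : FW n"
 then have "wact (map (pgen_relabel (%j. j + m)) w) v = tens m idv (wact w) v"
 proof (induction w)
  case (Cons g w)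
  then have g: "1 <= pgen_index g" "w : FW n" by (auto simp: FW_Cons)
  show ?case using Cons.IH[OF g(2)] tens_comp_id_left[OF lin_wact lin_gact assms(2), of g w]
   by (simp add: gact_shift[OF g(1)])
 qed simp
 moreover have "act (mon w) = wact w" by (simp add: fun_eq_iff)
 ultimately show "act (falg_relabel (%j. j + m) (mon w)) v = tens m idv (act (mon w)) v" by simp
qed (use assms in "auto simp: falg_on_supp intro: lin_comp[OF lin_falg_relabel lin_act_left]")

lemma gact_left: assumes "pgen_index g : {1..m}" shows "gact g v = tens m (gact g) idv v"
proof -
 define i d where "i = pgen_index g - 1" and "d = m - i - 1"
 have m: "m = i + (1 + d)" using assms by (auto simp: i_def d_def)
 have "tens m (ins i (gop g)) idv v = tens i idv (tens (1 + d) (tens 1 (gop g) idv) idv) v"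
  unfolding ins_def m by (rule tens_assoc) auto
 also have "tens (1 + d) (tens 1 (gop g) idv) idv = tens 1 (gop g) idv"
  using tens_assoc[where m = 1 and n = d and F = "gop g" and G = "%v. v" and H = "%v. v"] by (simp add: fun_eq_iff)
 finally show ?thesis by (simp add: gact_gop i_def ins_def)
qed

lemma act_left:
 assumes "f : falg_on m" "v : VV (m + n)"
 shows "act f v = tens m (act f) idv v"
proof (rule supp_mult_single_induct[where F = "%f. act f v" and G = "%f. tens m (act f) idv v" and I = "FW m"])
 show "lin (%f. tens m (act f) idv v)"
 proof (rule linI)
  show "tens m (act (f + g)) idv v = tens m (act f) idv v + tens m (act g) idv v" for f g
   by (rule lin_eq_on[where G = "%v. tens m (act f) idv v + tens m (act g) idv v"])
   (auto simp: tens_single act_add distrib_right intro: lin_plus)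
  show "tens m (act (pscale c f)) idv v = pscale c (tens m (act f) idv v)" for c f
   by (rule lin_eq_on[where G = "%v. pscale c (tens m (act f) idv v)"])
   (auto simp: tens_single act_pscale intro: lin_scale)
 qed
next
 fix w :: "'a pgen list" assume "w : FW m"
 then have "wact w v = tens m (wact w) idv v"
 proof (induction w)
  case (Cons g w)
  then have g: "pgen_index g : {1..m}" "w : FW m" by (auto simp: FW_Cons)
  show ?case using Cons.IH[OF g(2)] tens_comp_id_right[OF opr_wact[OF g(2)] lin_gact assms(2), of g] gact_left[OF g(1)]
   by simp
 qed simp
 moreover have "act (mon w) = wact w" by (simp add: fun_eq_iff)
 ultimately show "act (mon w) v = tens m (act (mon w)) idv v" by simp
qed (use assms in "auto simp: falg_on_supp lin_act_left")

text \<open>Each word of letters is a homogeneous word of generators applied to the vacuum, so it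
  suffices to follow parities along such words. A teleporter has the parity of \<open>x\<close>,
  hence corrections never disturb the grading.\<close>

lemma opar_tau: "opar 2 0 tau"
proof -
 have dg: "opar 2 p (act (demazure_gen A 1 g))" if "pgen_homog A g p" for g p
 proof -
  have t: "opar 2 (eps A) (act (teleporter A i j))" if "i : {1..2}" "j : {1..2}" for i j
  proof (rule opar_act[OF teleporter_falg_on[OF that]], rule ballI)
   fix w assume "w : kys (teleporter A i j)"
   moreover have "teleporter A i j : supp ((%b. [GA i b, GA j (dual A b)]) ` basis A)"
   unfolding teleporter_def by (intro supp_sum supp_pscale supp_single imageI)
   ultimately obtain b where b: "w = [GA i b, GA j (dual A b)]" "b : basis A" by (auto simp: supp_def)
   show "word_homog A w (eps A)"
   using basis_grade[OF b(2)] dual_grade[OF b(2)] unfolding b(1) word_homog.simps pgen_homog.simps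
   by (intro exI[of _ "bpar A b"] exI[of _ "bpar A b + eps A"] exI[of _ 0]) simp
  qed
  show ?thesis using that t[of 1 2] t[of 2 1]
   by (cases g) (auto simp: act_uminus opar_def)
 qed
 have main: "wact w (vac 2) : HV p & tau (wact w (vac 2)) : HV p" if "w : FW 2" "word_homog A w p" for w p
  using that
 proof (induction w arbitrary: p)
  case Nil
  then show ?case by (simp add: tau_vac vac_HV)
 next
  case (Cons g w)
  then obtain q r where qr: "p = q + r" "pgen_homog A g q" "word_homog A w r" by auto
  have g: "pgen_index g : {1..2}" "w : FW 2" "pgen_index (pgen_relabel tr12 g) : {1..2}"
   using Cons.prems by (auto simp: FW_Cons transpose_def)
  have V: "wact w (vac 2) : VV 2" by (rule opr_VV[OF opr_wact[OF g(2)] vac_VV])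
  note IH = Cons.IH[OF g(2) qr(3)]
  have "gact (pgen_relabel tr12 g) (tau (wact w (vac 2))) : HV p"
   unfolding qr(1) by (rule opar_HV[OF opar_gact[OF g(3)]]) (use qr IH V in "auto simp: tau_VV")
  moreover have "act (demazure_gen A 1 g) (wact w (vac 2)) : HV p" "gact g (wact w (vac 2)) : HV p"
   unfolding qr(1) by (rule opar_HV[OF dg[OF qr(2)]] opar_HV[OF opar_gact[OF g(1) qr(2)]]; use IH V in auto)+
  ultimately show ?case using V by (simp add: tau_gact[OF g(1)])
 qed
 show ?thesis unfolding opar_def
 proof
  fix l assume l: "l : L 2"
  then have "sng l 1 = wact (pword 1 l) (vac 2)"
   using PHI_psi[OF VV_single[OF l, of 1]] by (simp add: PHI_def)
  then show "tau (sng l 1) : HV (0 + lpar l)"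
   using main[of "pword 1 l" "lpar l"] l by (simp add: pword_FW L_def word_homog_pword)
 qed
qed

definition t1 where "t1 = tens 2 tau idv"
definition t2 where "t2 = tens 1 idv tau"

lemma lin_t [simp]: "lin t1" "lin t2" by (simp_all add: t1_def t2_def)
lemma t_VV: "v : VV 3 ==> t1 v : VV 3" "v : VV 3 ==> t2 v : VV 3"
 using opr_VV[OF opr_tens[OF opr_tau opr_id(1)[of 1]], of v] opr_VV[OF opr_tens[OF opr_id(1)[of 1] opr_tau], of v]
 by (simp_all add: t1_def t2_def)

lemma tr12_falg: "f : falg_on 2 ==> falg_relabel tr12 f : falg_on 2"
 by (rule falg_relabel_falg_on) (auto intro: tr12_mem simp del: atLeastAtMost_iff)

lemma t1_act:
 assumes "f : falg_on 2" "v : VV 3"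
 shows "t1 (act f v) = act (falg_relabel tr12 f) (t1 v) - act (dem f) v"
proof -
 have v: "v : VV (2 + 1)" using assms by simp
 have tv: "t1 v : VV (2 + 1)" using t_VV assms by simp
 have "t1 (act f v) = tens 2 (%v. tau (act f v)) idv v"
  unfolding t1_def act_left[OF assms(1) v] by (rule tens_comp_id_right[OF opr_act[OF assms(1)] lin_tau v])
 also have "... = tens 2 (%v. act (falg_relabel tr12 f) (tau v) - act (dem f) v) idv v"
  by (rule tens_left_cong[OF v]) (rule tau_act[OF assms(1)])
 also have "... = tens 2 (%v. act (falg_relabel tr12 f) (tau v)) idv v - act (dem f) v"
  unfolding tens_minus_left act_left[OF dem_falg_on[OF assms(1)] v] ..
 also have "tens 2 (%v. act (falg_relabel tr12 f) (tau v)) idv v = act (falg_relabel tr12 f) (t1 v)"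
  unfolding act_left[OF tr12_falg[OF assms(1)] tv] unfolding t1_def
  by (rule tens_comp_id_right[OF opr_tau lin_act v, symmetric])
 finally show ?thesis .
qed

abbreviation sh where "sh \<equiv> falg_relabel (%j. j + 1)"

lemma t2_act:
 assumes "f : falg_on 2" "v : VV 3"
 shows "t2 (act (sh f) v) = act (sh (falg_relabel tr12 f)) (t2 v) - act (sh (dem f)) v"
proof -
 have v: "v : VV (1 + 2)" using assms by simp
 have tv: "t2 v : VV (1 + 2)" using t_VV assms by simp
 have "t2 (act (sh f) v) = tens 1 idv (%v. tau (act f v)) v"
  unfolding t2_def act_shift[OF assms(1) v] by (rule tens_comp_id_left[OF lin_act lin_tau v])
 also have "... = tens 1 idv (%v. act (falg_relabel tr12 f) (tau v) - act (dem f) v) v"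
  by (rule tens_right_cong[OF v]) (rule tau_act[OF assms(1)])
 also have "... = tens 1 idv (%v. act (falg_relabel tr12 f) (tau v)) v - act (sh (dem f)) v"
  unfolding tens_minus_right act_shift[OF dem_falg_on[OF assms(1)] v] ..
 also have "tens 1 idv (%v. act (falg_relabel tr12 f) (tau v)) v = act (sh (falg_relabel tr12 f)) (t2 v)"
  unfolding act_shift[OF tr12_falg[OF assms(1)] tv] unfolding t2_def
  by (rule tens_comp_id_left[OF lin_tau lin_act v, symmetric])
 finally show ?thesis .
qed

lemma sh_teleporter: "act (sh (teleporter A i j)) v = tele (i + 1) (j + 1) v"
 unfolding teleporter_def tele_def lin_sum[OF lin_falg_relabel] lin_pscale[OF lin_falg_relabel] act_sum act_pscale
 by simp

lemma t1_gens:
 assumes "v : VV 3"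
 shows "t1 (gact (GA 1 a) v) = gact (GA 2 a) (t1 v)" "t1 (gact (GA 2 a) v) = gact (GA 1 a) (t1 v)"
  "t1 (gact (GX 1) v) = gact (GX 2) (t1 v) - tele 1 2 v" "t1 (gact (GX 2) v) = gact (GX 1) (t1 v) + tele 2 1 v"
 using t1_act[of "mon [GA 1 a]" v] t1_act[of "mon [GA 2 a]" v] t1_act[of "mon [GX 1]" v] t1_act[of "mon [GX 2]" v] assms
 by (simp_all add: falg_on_single FW_Cons tr12_simps one_single_Nil[symmetric] act_teleporter act_uminus del: gact.simps)

lemma t2_gens:
 assumes "v : VV 3"
 shows "t2 (gact (GA 2 a) v) = gact (GA 3 a) (t2 v)" "t2 (gact (GA 3 a) v) = gact (GA 2 a) (t2 v)"
  "t2 (gact (GX 2) v) = gact (GX 3) (t2 v) - tele 2 3 v" "t2 (gact (GX 3) v) = gact (GX 2) (t2 v) + tele 3 2 v"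
 using t2_act[of "mon [GA 1 a]" v] t2_act[of "mon [GA 2 a]" v] t2_act[of "mon [GX 1]" v] t2_act[of "mon [GX 2]" v] assms
 by (simp_all add: falg_on_single FW_Cons tr12_simps one_single_Nil[symmetric] sh_teleporter act_uminus lin_uminus lin_0[OF lin_falg_relabel] del: gact.simps)

lemma t1_3: assumes "pgen_index g = 3" "v : VV 3" shows "t1 (gact g v) = gact g (t1 v)"
proof -
 have v: "v : VV (2 + 1)" using assms by simp
 have g: "gact g = tens 2 idv (ins 0 (gop g))"
  using ins_shift[of 2 0 "gop g"] by (simp add: gact_gop assms fun_eq_iff)
 have "t1 (gact g v) = tens 2 tau (ins 0 (gop g)) v" unfolding t1_def g
  by (rule tens_comp_left_even[OF opr_id(1) opar_id(1) lin_ins lin_tau lin_id(1) v])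
 also have "... = gact g (t1 v)" unfolding t1_def g
  by (rule tens_comp_left_even[OF opr_tau opar_tau lin_id(1) lin_id(1) lin_ins v, symmetric])
 finally show ?thesis .
qed

lemma t2_1: assumes "pgen_index g = 1" "v : VV 3" shows "t2 (gact g v) = gact g (t2 v)"
proof -
 have v: "v : VV (1 + 2)" using assms by simp
 have g: "gact g = tens 1 (gop g) idv"
  using ins_0[of "gop g"] opr_lin[OF opr_gop] by (simp add: gact_gop assms fun_eq_iff)
 have "t2 (gact g v) = tens 1 (gop g) tau v" unfolding t2_def g
  by (rule tens_comp_right_even[OF opr_gop opr_id(1) lin_id(1) lin_tau opar_tau v])
 also have "... = gact g (t2 v)" unfolding t2_def g
  by (rule tens_comp_left_even[OF opr_id(1) opar_id(1) lin_tau opr_lin[OF opr_gop] lin_id(1) v, symmetric])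
 finally show ?thesis .
qed

lemma t_tele:
 assumes "v : VV 3"
 shows "t1 (tele 2 3 v) = tele 1 3 (t1 v)" "t1 (tele 1 3 v) = tele 2 3 (t1 v)" "t1 (tele 3 2 v) = tele 3 1 (t1 v)"
  "t2 (tele 1 2 v) = tele 1 3 (t2 v)" "t2 (tele 2 1 v) = tele 3 1 (t2 v)" "t2 (tele 1 3 v) = tele 1 2 (t2 v)"
  "t1 (tele 3 1 v) = tele 3 2 (t1 v)" "t2 (tele 3 1 v) = tele 2 1 (t2 v)"
 unfolding tele_def lin_sum[OF lin_t(1)] lin_pscale[OF lin_t(1)] lin_sum[OF lin_t(2)] lin_pscale[OF lin_t(2)]
 using assms by (simp_all add: t1_gens t2_gens t1_3 t2_1 gact_VV del: gact.simps)

lemma t_square: "v : VV 3 ==> t1 (t1 v) = v" "v : VV 3 ==> t2 (t2 v) = v"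
proof -
 assume "v : VV 3"
 then have v: "v : VV (2 + 1)" "v : VV (1 + 2)" by simp_all
 have "t1 (t1 v) = tens 2 (%v. tau (tau v)) idv v" unfolding t1_def
  by (rule tens_comp_id_right[OF opr_tau lin_tau v(1)])
 also have "... = tens 2 idv idv v" by (rule tens_left_cong[OF v(1)]) (rule tau_tau)
 finally show "t1 (t1 v) = v" by simp
 have "t2 (t2 v) = tens 1 idv (%v. tau (tau v)) v" unfolding t2_def
  by (rule tens_comp_id_left[OF lin_tau lin_tau v(2)])
 also have "... = tens 1 idv idv v" by (rule tens_right_cong[OF v(2)]) (rule tau_tau)
 finally show "t2 (t2 v) = v" by simp
qed

lemma t_vac: "t1 (vac 3) = vac 3" "t2 (vac 3) = vac 3"
proof -
 have 21: "vac 3 = vac 2 * vac 1" and 12: "vac 3 = vac 1 * vac 2"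
  using vac_simps(3)[of 2 1] vac_simps(3)[of 1 2] by simp_all
 show "t1 (vac 3) = vac 3" unfolding t1_def 21
  by (subst tens_mult[OF lin_tau lin_id(1) vac_VV vac_HV]) (simp add: tau_vac)
 show "t2 (vac 3) = vac 3" unfolding t2_def 12
  by (subst tens_mult[OF lin_id(1) lin_tau vac_VV vac_HV]) (simp add: tau_vac)
qed

text \<open>Both sides push every generator through in the same way: teleporter corrections arise on
  both, and they agree by \<open>t_tele\<close> and \<open>t_square\<close>.\<close>

lemma braid_relation: "v : VV 3 ==> t1 (t2 (t1 v)) = t2 (t1 (t2 v))"
proof (rule VV_vac_induct[where n = 3 and F = "%v. t1 (t2 (t1 v))" and G = "%v. t2 (t1 (t2 v))"])
 fix g :: "'a pgen" and v assume g: "pgen_index g : {1..3}" and v: "v : VV 3"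
  and IH: "t1 (t2 (t1 v)) = t2 (t1 (t2 v))"
 have tv: "t1 v : VV 3" "t2 v : VV 3" "t1 (t2 v) : VV 3" "t2 (t1 v) : VV 3" "t1 (t1 v) : VV 3" "t2 (t2 v) : VV 3"
  using v t_VV by auto
 consider "pgen_index g = 1" | "pgen_index g = 2" | "pgen_index g = 3" using g by fastforce
 then show "t1 (t2 (t1 (gact g v))) = t2 (t1 (t2 (gact g v)))"
  using v tv IH
  by cases (cases g; simp add: t1_gens t2_gens t1_3 t2_1 t_tele t_square lin_diff lin_add gact_VV tele_VV del: gact.simps)+
qed (auto simp: t_vac intro: lin_comp[OF lin_comp[OF lin_t(1) lin_t(2)] lin_t(1)] lin_comp[OF lin_comp[OF lin_t(2) lin_t(1)] lin_t(2)])

end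

section \<open>Polynomial algebras as supermodules\<close>

context frobenius_superalgebra begin

lemma pol_class_pc: "pc n f g ==> pol_class A n f = pol_class A n g"
 unfolding pol_class_def by (auto simp: pc_def[symmetric]) (metis pc_trans pc_sym)+
lemma pol_class_mem: "f : falg_on n ==> f : pol_class A n f"
 by (simp add: pol_class_def pol_ideal.zero)
lemma pol_classD: "g : pol_class A n f ==> g : falg_on n & pc n g f"
 by (simp add: pol_class_def pc_def)
lemma pol_class_eq_iff: "f : falg_on n ==> pol_class A n f = pol_class A n g \<longleftrightarrow> pc n f g"
 using pol_class_pc pol_class_mem pol_classD by blast

text \<open>Operations on the quotient are defined as unions over all representatives; such a union
  collapses to a single class once the operation respects the congruence.\<close>

lemma pol_class_UN:
 assumes "f0 : falg_on n" "\<And>f. f : falg_on n ==> pc n f f0 ==> pc m (T f) (T f0)"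
 shows "(\<Union>f\<in>pol_class A n f0. pol_class A m (T f)) = pol_class A m (T f0)"
proof -
 have "pol_class A m (T f) = pol_class A m (T f0)" if "f : pol_class A n f0" for f
  using pol_classD[OF that] assms(2) pol_class_pc by blast
 then show ?thesis using pol_class_mem[OF assms(1)] by blast
qed

lemma pol_class_UN2:
 assumes "f0 : falg_on n" "g0 : falg_on n'"
  "\<And>f g. f : falg_on n ==> pc n f f0 ==> g : falg_on n' ==> pc n' g g0 ==> pc m (T f g) (T f0 g0)"
 shows "(\<Union>f\<in>pol_class A n f0. \<Union>g\<in>pol_class A n' g0. pol_class A m (T f g)) = pol_class A m (T f0 g0)"
proof -
 have "pol_class A m (T f g) = pol_class A m (T f0 g0)"
  if "f : pol_class A n f0" "g : pol_class A n' g0" for f g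
  using pol_classD[OF that(1)] pol_classD[OF that(2)] assms(3) pol_class_pc by blast
 then show ?thesis using pol_class_mem[OF assms(1)] pol_class_mem[OF assms(2)] by blast
qed

lemma Pol_add: "f : falg_on n ==> g : falg_on n ==> add (Pol A n) (pol_class A n f) (pol_class A n g) = pol_class A n (f + g)"
 unfolding Pol_def by simp (rule pol_class_UN2[where T = "(+)"], auto intro: pc_add)
lemma Pol_smul: "f : falg_on n ==> smul (Pol A n) c (pol_class A n f) = pol_class A n (pscale c f)"
 unfolding Pol_def by simp (rule pol_class_UN[where T = "pscale c"], auto intro: pc_pscale)
lemma Pol_mul: "f : falg_on n ==> g : falg_on n ==> mul (Pol A n) (pol_class A n f) (pol_class A n g) = pol_class A n (f * g)"
 unfolding Pol_def by simp (rule pol_class_UN2[where T = "(*)"], auto intro: pc_trans[OF pc_mult_left pc_mult_right])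
lemma Pol_zer: "zer (Pol A n) = pol_class A n 0" by (simp add: Pol_def)
lemma Pol_unt: "unt (Pol A n) = pol_class A n 1" by (simp add: Pol_def)
lemma Pol_carr: "u : carr (Pol A n) \<longleftrightarrow> (\<exists>f\<in>falg_on n. u = pol_class A n f)" by (auto simp: Pol_def)
lemma Pol_homog: "u : homog (Pol A n) p \<longleftrightarrow>
  (\<exists>f\<in>falg_on n. (\<forall>w\<in>kys f. word_homog A w p) & u = pol_class A n f)" by (auto simp: Pol_def)

text \<open>Coordinates of a class; the choice of representative is harmless by
  \<open>PH_class\<close>. With \<open>PS\<close> it gives mutually inverse bijections between
  \<open>Pol A n\<close> and \<open>VV n\<close>.\<close>

definition PH where "PH n C = PHI n (SOME f. f : C)"
definition PS where "PS n v = pol_class A n (psi 1 v)"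

lemma PH_class: "f : falg_on n ==> PH n (pol_class A n f) = PHI n f"
proof -
 assume f: "f : falg_on n"
 then have "(SOME g. g : pol_class A n f) : pol_class A n f" using pol_class_mem someI by metis
 then show ?thesis using pol_classD pc_iff_PHI[OF _ f] by (auto simp: PH_def)
qed

lemma PH_VV: "u : carr (Pol A n) ==> PH n u : VV n" by (auto simp: Pol_carr PH_class PHI_VV)
lemma PS_carr: "v : VV n ==> PS n v : carr (Pol A n)" by (auto simp: PS_def Pol_carr intro: psi_falg_on)
lemma PH_PS [simp]: "v : VV n ==> PH n (PS n v) = v" by (simp add: PS_def PH_class psi_falg_on PHI_psi)
lemma PS_PH [simp]: "u : carr (Pol A n) ==> PS n (PH n u) = u"
 by (auto simp: Pol_carr PH_class PS_def intro!: pol_class_pc pc_sym[OF pc_psi_PHI])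
lemma PH_inj: "u : carr (Pol A n) ==> v : carr (Pol A n) ==> PH n u = PH n v \<longleftrightarrow> u = v"
 by (metis PS_PH)

lemma PH_add: "u : carr (Pol A n) ==> v : carr (Pol A n) ==> PH n (add (Pol A n) u v) = PH n u + PH n v & add (Pol A n) u v : carr (Pol A n)"
 by (auto simp: Pol_carr Pol_add PH_class lin_add) 
lemma PH_smul: "u : carr (Pol A n) ==> PH n (smul (Pol A n) c u) = pscale c (PH n u) & smul (Pol A n) c u : carr (Pol A n)"
 by (auto simp: Pol_carr Pol_smul PH_class lin_pscale)
lemma PH_mul: "f : falg_on n ==> u : carr (Pol A n) ==> PH n (mul (Pol A n) (pol_class A n f) u) = act f (PH n u) & mul (Pol A n) (pol_class A n f) u : carr (Pol A n)"
 by (auto simp: Pol_carr Pol_mul PH_class PHI_mult)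
lemma PH_zer: "PH n (zer (Pol A n)) = 0" "zer (Pol A n) : carr (Pol A n)"
 by (auto simp: Pol_zer PH_class lin_0 Pol_carr)

text \<open>A homogeneous class contains a homogeneous representative, whose action preserves the
  grading; conversely the normal form of a homogeneous vector uses homogeneous words only.\<close>

lemma PH_homog: "u : homog (Pol A n) p \<longleftrightarrow> u : carr (Pol A n) & PH n u : HV p"
proof
 assume "u : homog (Pol A n) p"
 then obtain f where f: "f : falg_on n" "\<forall>w\<in>kys f. word_homog A w p" "u = pol_class A n f"
  by (auto simp: Pol_homog)
 have "act f (vac n) : HV (p + 0)" by (rule opar_HV[OF opar_act[OF f(1,2)]]) (auto simp: vac_VV vac_HV)
 then show "u : carr (Pol A n) & PH n u : HV p" using f by (auto simp: PH_class PHI_def Pol_carr)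
next
 assume u: "u : carr (Pol A n) & PH n u : HV p"
 then have "PH n u : supp {l : L n. lpar l = p}" by (intro VHV) (auto simp: PH_VV)
 then have "psi 1 (PH n u) : supp {w. word_homog A w p}"
  by (rule lin_supp[OF lin_psi]) (auto intro!: supp_single simp: L_def word_homog_pword)
 then show "u : homog (Pol A n) p" unfolding Pol_homog
  using u PS_PH[of u n] psi_falg_on[OF PH_VV] by (auto simp: PS_def supp_def)
qed

lemma HV_disjoint: assumes "v : HV 0" "v : HV 1" shows "v = 0"
proof (rule poly_mapping_eqI)
 fix k
 have "k \<notin> kys v" using assms by (auto simp: HV_def supp_def subset_iff)
 then show "lkp v k = lkp 0 k" by (simp add: in_keys_iff)
qed

definition qrep :: "('k, 'a) falg set => ('k, 'a) falg" where "qrep Q = (SOME f. f : Q)"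

lemma ECR_rep:
 assumes "Q : ECR (Pol A 1)" shows "qrep Q : falg_on 1" "Q = pol_class A 1 (qrep Q)"
proof -
 from assms obtain f where f: "f : falg_on 1" "Q = pol_class A 1 f" by (auto simp: ECR_def Pol_homog)
 then have "qrep Q : pol_class A 1 f" using pol_class_mem[OF f(1)] unfolding qrep_def by (metis someI)
 then show "qrep Q : falg_on 1" "Q = pol_class A 1 (qrep Q)" using pol_classD pol_class_pc f by blast+
qed

lemma act_pc: "pc n f g ==> v : VV n ==> act f v = act g v"
 using act_pol_ideal[of "f - g" n v] by (simp add: pc_def act_diff)

lemma ECR_act_even:
 assumes "Q : ECR (Pol A 1)" shows "opar 1 0 (act (qrep Q))"
proof -
 from assms obtain f where f: "f : falg_on 1" "\<forall>w\<in>kys f. word_homog A w 0" "Q = pol_class A 1 f"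
  by (auto simp: ECR_def Pol_homog)
 then have "pc 1 (qrep Q) f" using ECR_rep[OF assms] pol_class_eq_iff by metis
 then show ?thesis using opar_act[OF f(1,2)] act_pc by (auto simp: opar_def VV_single)
qed

text \<open>Centrality makes left multiplication by \<open>Q\<close> equal to right multiplication
  by \<open>Q\<close>, and right multiplication commutes with the left action of every
  \<open>f\<close>.\<close>

lemma ECR_act_commute:
 assumes Q: "Q : ECR (Pol A 1)" and f: "f : falg_on 1" and v: "v : VV 1"
 shows "act (qrep Q) (act f v) = act f (act (qrep Q) v)"
proof -
 let ?q = "qrep Q" and ?z = "PHI 1 (qrep Q)"
 note q = ECR_rep[OF Q]
 have "Q : super_centre (Pol A 1)" "Q : homog (Pol A 1) 0" using Q by (auto simp: ECR_def)
 then obtain u w where uw: "u : homog (Pol A 1) 0" "w : homog (Pol A 1) 1" "Q = add (Pol A 1) u w"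
  and comm: "\<And>q g. g : homog (Pol A 1) q ==>
   mul (Pol A 1) Q g = add (Pol A 1) (mul (Pol A 1) g u) (smul (Pol A 1) (ksgn 1 q) (mul (Pol A 1) g w))"
  by (auto simp: super_centre_def)
 have uw': "u : carr (Pol A 1)" "w : carr (Pol A 1)" "PH 1 u : HV 0" "PH 1 w : HV 1"
  using uw by (auto simp: PH_homog)
 have z: "?z = PH 1 Q" using q PH_class by metis
 then have zz: "?z = PH 1 u + PH 1 w" using uw PH_add[OF uw'(1,2)] by simp
 have "?z : HV 0" using z \<open>Q : homog (Pol A 1) 0\<close> PH_homog by simp
 then have "PH 1 w : HV 0" using zz uw' HV_closed(3)[of ?z 0 "PH 1 u"] by simp
 \<comment> \<open>Since \<open>Q\<close> is even, the odd summand in the definition of the super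
   centre is also even, hence 0; the signs in the centrality condition disappear with it.\<close>
 then have w0: "PH 1 w = 0" using uw' HV_disjoint by blast
 then have zu: "?z = PH 1 u" using zz by simp
 \<comment> \<open>Right multiplication of \<open>v\<close> by \<open>Q\<close> is expressed as the
   action of the normal form of \<open>v\<close> on the coordinates of \<open>Q\<close>.\<close>
 have 1: "act ?q v = act (psi 1 v) ?z" if "v : VV 1" for v
 proof (rule VV_eqI[where F = "act ?q" and G = "%v. act (psi 1 v) ?z", OF _ _ that])
  show "lin (%v. act (psi 1 v) ?z)" by (rule lin_comp[OF lin_psi lin_act_left])
  fix l assume l: "l : L 1"
  let ?g = "PS 1 (sng l 1)"
  have g: "?g : carr (Pol A 1)" "?g : homog (Pol A 1) (lpar l)"
   using l by (auto simp: PH_homog VV_single HV_single intro!: PS_carr)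
  have pg: "psi 1 (sng l 1) : falg_on 1" by (rule psi_falg_on[OF VV_single[OF l]])
  have "act ?q (sng l 1) = PH 1 (mul (Pol A 1) Q ?g)"
   using PH_mul[OF q(1) g(1)] q(2) l by (simp add: VV_single)
  also have "... = PH 1 (mul (Pol A 1) ?g u) + pscale (ksgn 1 (lpar l)) (PH 1 (mul (Pol A 1) ?g w))"
   using PH_mul[OF pg uw'(1)] PH_mul[OF pg uw'(2)] PH_add PH_smul
   unfolding comm[OF g(2)] PS_def[of 1 "sng l 1", symmetric] by metis
  also have "... = act (psi 1 (sng l 1)) (PH 1 u)"
   using PH_mul[OF pg uw'(1)] PH_mul[OF pg uw'(2)] w0
   unfolding PS_def[of 1 "sng l 1", symmetric] by (simp add: lin_0)
  finally show "act ?q (sng l 1) = act (psi 1 (sng l 1)) ?z" by (simp add: zu)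
 qed simp
 let ?h = "psi 1 v"
 have h: "?h : falg_on 1" "PHI 1 ?h = v" using v psi_falg_on PHI_psi by auto
 have "PHI 1 (f * ?h) = act f v" using h by (simp add: PHI_mult)
 then have "act ?q (act f v) = act (psi 1 (PHI 1 (f * ?h))) ?z" using 1[of "act f v"] opr_VV[OF opr_act[OF f] v] by simp
 also have "... = act (f * ?h) ?z"
  by (rule act_pc[OF pc_sym[OF pc_psi_PHI] PHI_VV]) (use f h q in auto)
 also have "... = act f (act ?q v)" using 1[OF v] by (simp add: act_mult)
 finally show ?thesis .
qed

text \<open>Regularity of \<open>Q\<close>, transported to the model.\<close>

lemma ECR_act_inj:
 assumes Q: "Q : ECR (Pol A 1)" and v: "v : VV 1" "act (qrep Q) v = 0" shows "v = 0"
proof -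
 note q = ECR_rep[OF Q]
 have "regular (Pol A 1) Q" using Q by (simp add: ECR_def)
 moreover have c: "PS 1 v : carr (Pol A 1)" by (rule PS_carr[OF v(1)])
 moreover have "mul (Pol A 1) Q (PS 1 v) = zer (Pol A 1)"
  using PH_mul[OF q(1) c] q(2) v PH_zer PH_inj by (metis PH_PS)
 ultimately have "PS 1 v = zer (Pol A 1)" by (auto simp: regular_def)
 then show ?thesis using PH_PS[OF v(1)] PH_zer by simp
qed

end

section \<open>The Demazure operator on central elements\<close>

context frobenius_superalgebra begin

lemma Dz_vac: "Dz (vac 2) = 0" using PHI_dem[of 1] by (simp add: PHI_1 dem_1 lin_0)
lemma Dz_VV: "v : VV 2 ==> Dz v : VV 2"
 by (auto simp: Dz_def intro!: PHI_VV dem_falg_on psi_falg_on)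

lemma Dz_gact: "pgen_index g : {1..2} ==> v : VV 2 ==>
  Dz (gact g v) = act (demazure_gen A 1 g) v + gact (pgen_relabel tr12 g) (Dz v)"
 using Dz_act[of "mon [g]" v] by (simp add: falg_on_single FW_Cons one_single_Nil[symmetric])

lemma Sw_tele: "i : {1..2} ==> j : {1..2} ==> v : VV 2 ==> Sw (tele i j v) = tele (tr12 i) (tr12 j) (Sw v)"
 unfolding tele_def lin_sum[OF lin_Sw] lin_pscale[OF lin_Sw]
 by (intro sum.cong refl) (simp add: Sw_gact gact_VV del: gact.simps)

text \<open>On generators this is \<open>t_{1,2}\<close> and \<open>- t_{2,1}\<close> being
  exchanged up to sign by the swap; the Leibniz rule propagates it.\<close>

lemma Dz_Sw: "v : VV 2 ==> Dz (Sw v) = - Sw (Dz v)"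
proof (rule VV_vac_induct[where F = "%v. Dz (Sw v)" and G = "%v. - Sw (Dz v)" and n = 2])
 fix g :: "'a pgen" and v assume g: "pgen_index g : {1..2}" and v: "v : VV 2" and IH: "Dz (Sw v) = - Sw (Dz v)"
 have gr: "pgen_index (pgen_relabel tr12 g) : {1..2}" "pgen_relabel tr12 (pgen_relabel tr12 g) = g"
  using g tr12_mem by (cases g; auto simp: transpose_def)+
 have t: "tele 1 2 (Sw v) = Sw (tele 2 1 v)" "tele 2 1 (Sw v) = Sw (tele 1 2 v)"
  using v by (auto simp: Sw_tele tr12_simps)
 have dg: "act (demazure_gen A 1 (pgen_relabel tr12 g)) (Sw v) = - Sw (act (demazure_gen A 1 g) v)"
 proof (cases g)
  case (GA i a) then show ?thesis by (simp add: lin_0)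
 next
  case (GX i)
  then consider "i = 1" | "i = 2" using g by fastforce
  then show ?thesis by cases (simp_all add: GX tr12_simps act_teleporter act_uminus t lin_uminus[OF lin_Sw])
 qed
 show "Dz (Sw (gact g v)) = - Sw (Dz (gact g v))"
  using g v gr IH
  by (simp add: Sw_gact Dz_gact Sw_VV dg lin_add[OF lin_Sw] lin_uminus[OF lin_gact] Dz_VV del: gact.simps)
next
 show "lin (%v. - Sw (Dz v))" by (rule linI) (simp_all add: lin_add lin_pscale pscale_uminus)
 show "lin (%v. Dz (Sw v))" by (rule lin_comp[OF lin_Sw lin_Dz])
qed (auto simp: Dz_vac Sw_vac lin_0)

text \<open>Right multiplication by \<open>x_2\<close> on a normal word: it lands at the very end,
  so it raises the second exponent and produces no sign.\<close>

definition bump :: "('a \<times> nat) list => ('a \<times> nat) list" where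
 "bump l = [l ! 0, (fst (l ! 1), Suc (snd (l ! 1)))]"

lemma replicate_snoc: "replicate n x @ [x] = x # replicate n x" by (induction n) auto

lemma PHI_right_x2:
 assumes "e : falg_on 2" shows "PHI 2 (e * mon [GX 2]) = plinear (%l. sng (bump l) 1) (PHI 2 e)"
proof -
 have "PHI 2 (psi 1 v * mon [GX 2]) = plinear (%l. sng (bump l) 1) v" if "v : VV 2" for v
 proof (rule VV_eqI[where F = "%v. PHI 2 (psi 1 v * mon [GX 2])", OF _ _ that])
  show "lin (%v. PHI 2 (psi 1 v * mon [GX 2]))"
   using lin_comp[OF lin_comp[OF lin_psi[of 1] lin_mult_right[of "mon [GX 2]"]] lin_PHI[of 2]] by simp
  fix l assume l: "l : L 2"
  then obtain e b s where lb: "l = [e, (b, s)]" by (auto simp: L_2)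
  have "(mon (pword 1 l) * mon [GX 2] :: ('k, 'a) falg) = mon (pword 1 (bump l))"
   by (simp add: lb bump_def vm_mult block_def replicate_snoc One_nat_def numeral_2_eq_2)
  moreover have "bump l : L 2" using l by (auto simp: lb bump_def L_def)
  then have "PHI 2 (mon (pword 1 (bump l))) = sng (bump l) 1"
   using PHI_psi[OF VV_single[of "bump l" 2 1]] by simp
  ultimately show "PHI 2 (psi 1 (sng l 1) * mon [GX 2]) =
   plinear (%l. sng (bump l) 1) (sng l 1)" by simp
 qed simp
 from this[OF PHI_VV[OF assms]] pc_mult_right[OF falg_on_single pc_psi_PHI[OF assms], of "[GX 2]" 1] show ?thesis
  using pc_iff_PHI[of "e * mon [GX 2]" 2 "psi 1 (PHI 2 e) * mon [GX 2]"] assms psi_falg_on[OF PHI_VV[OF assms]]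
  by (simp add: FW_Cons falg_on_single)
qed

text \<open>Take a word of the support whose second exponent is maximal. Its bump occurs on the left
  with the same coefficient, since \<open>bump\<close> is injective on two-letter words, but
  multiplication by \<open>x_1\<close> never raises the second exponent.\<close>

lemma bump_eq_x1_zero:
 assumes z: "z : VV 2" and eq: "plinear (%l. sng (bump l) 1) z = gact (GX 1) z" shows "z = 0"
proof (rule ccontr)
 assume "z ~= 0"
 let ?K = "kys z"
 let ?deg = "%l :: ('a \<times> nat) list. snd (l ! 1)"
 have ne: "?K ~= {}" using \<open>z ~= 0\<close> by (metis poly_mapping_sum_single sum.empty)
 define M where "M = Max (?deg ` ?K)"
 have "M : ?deg ` ?K" unfolding M_def using ne by (intro Max_in) auto
 then obtain l where l: "l : ?K" "?deg l = M" by auto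
 let ?I = "{l : L 2. ?deg l <= M}"
 have zI: "z : supp ?I" using z unfolding supp_def VV_def M_def by (auto intro!: Max_ge)
 have "gact (GX 1) z : supp ?I"
 proof (rule lin_supp[OF lin_gact zI])
  fix k assume k: "k : ?I"
  then obtain e e' where ee: "k = [e, e']" "[e] : L 1" "[e'] : L 1" by (auto simp: L_2)
  have "Lx (sng [e] 1) : VV 1" using opr_VV[OF opr_Lx] ee by (simp add: VV_single)
  moreover have "x @ [e'] : ?I" if "x : L 1" for x
   using L_append[OF that ee(3)] that k ee by (auto simp: L_1)
  ultimately show "gact (GX 1) (sng k 1) : supp ?I"
   unfolding ee by (auto simp: ins_first VV_def intro!: supp_mult[where J = "{[e']}"] supp_single)
 qed
 moreover have "lkp (plinear (%l. sng (bump l) (1::'k)) z) (bump l) = lkp z l"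
 proof -
  have inj: "bump k = bump l \<longleftrightarrow> k = l" if "k : ?K" for k
  proof -
   have "k : L 2" "l : L 2" using that l z by (auto simp: VV_def supp_def)
   then obtain x b s y c r where "l = [x, (b, s)]" "k = [y, (c, r)]" by (auto simp: L_2)
   then show ?thesis by (simp add: bump_def One_nat_def)
  qed
  have "lkp (plinear (%l. sng (bump l) (1::'k)) z) (bump l)
   = (\<Sum>k\<in>?K. if k = l then lkp z k else 0)"
   unfolding plinear_def lookup_sum by (intro sum.cong) (auto simp: lookup_single when_def inj)
  then show ?thesis using l by simp
 qed
 then have "bump l : kys (gact (GX 1) z)" using l by (simp only: in_keys_iff eq simp_thms)
 ultimately have "bump l : ?I" by (auto simp: supp_def simp del: gact.simps)
 then show False using l by (simp add: bump_def One_nat_def)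
qed

lemma act_commute:
 assumes "opr n n F" "f : falg_on n" "v : VV n"
  "\<And>g u. pgen_index g : {1..n} ==> u : VV n ==> F (gact g u) = gact g (F u)"
 shows "F (act f v) = act f (F v)"
proof (rule supp_mult_single_induct[where F = "%f. F (act f v)" and G = "%f. act f (F v)" and I = "FW n"])
 fix w :: "'a pgen list" assume "w : FW n"
 then have "F (wact w v) = wact w (F v)"
  by (induction w) (auto simp: FW_Cons assms(4) opr_VV[OF opr_wact] assms(3))
 then show "F (act (mon w) v) = act (mon w) (F v)" by simp
qed (use assms(1,2) in "auto simp: falg_on_supp lin_act_left opr_lin intro: lin_comp[OF lin_act_left]")

text \<open>On words in the index 1 alone, the transposition of 1 and 2 and the shift by one
  coincide: both turn \<open>f_1\<close> into \<open>f_2\<close>.\<close>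

lemma relabel_swap_sh: "f : falg_on 1 ==> falg_relabel tr12 f = sh f"
proof -
 assume f: "f : falg_on 1"
 have g: "pgen_relabel tr12 g = pgen_relabel (%j. j + 1) g" if "pgen_index g : {1..1}" for g
  using that by (cases g) (auto simp: tr12_simps)
 show ?thesis
  by (rule supp_mult_single_induct[OF lin_falg_relabel lin_falg_relabel, of _ "FW 1"])
   (use f g in \<open>auto simp: falg_on_supp FW_def intro!: arg_cong[where f = "%w. sng w 1"] map_cong\<close>)
qed

lemma gact_first: "pgen_index g = 1 ==> gact g v = tens 1 (gop g) idv v"
 by (simp add: gact_gop ins_0 opr_lin[OF opr_gop])
lemma gact_second: "pgen_index g = 2 ==> gact g v = tens 1 idv (ins 0 (gop g)) v"
 using ins_shift[of 1 0 "gop g" v] by (simp add: gact_gop One_nat_def)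

context
 fixes Q assumes Q: "Q : ECR (Pol A 1)"
begin

text \<open>A representative of \<open>Q_1\<close> in two variables; \<open>cq2\<close> represents
  \<open>Q_2\<close>.\<close>

definition "cq = qrep Q"
definition "cq2 = sh cq"

lemma cq_falg: "cq : falg_on 1" "cq : falg_on 2" "cq2 : falg_on 2"
 using ECR_rep(1)[OF Q] falg_on_mono[of 1 2 cq] falg_relabel_falg_on[of cq 1 "%j. j + 1" 2]
 by (auto simp: cq_def cq2_def)
lemma cq_opr: "opr 1 1 (act cq)" "opar 1 0 (act cq)" "opr 2 2 (act cq)" "opr 2 2 (act cq2)"
 using opr_act cq_falg ECR_act_even[OF Q] by (auto simp: cq_def)

lemma cq_tens: "v : VV 2 ==> act cq v = tens 1 (act cq) idv v" "v : VV 2 ==> act cq2 v = tens 1 idv (act cq) v"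
 using act_left[OF cq_falg(1), of v 1] act_shift[OF cq_falg(1), of v 1] by (simp_all add: cq2_def)

lemma gop_cq: "v : VV 1 ==> act cq (ins 0 (gop g) v) = ins 0 (gop g) (act cq v)"
proof -
 assume v: "v : VV 1"
 let ?g = "pgen_relabel (%_. 1) g"
 have "gact ?g = ins 0 (gop g)" by (cases g) auto
 then show ?thesis using ECR_act_commute[OF Q falg_on_single[of "[?g]" 1 1] v] by (simp add: cq_def FW_Cons)
qed

text \<open>On its own strand \<open>Q\<close> is central by \<open>ECR_act_commute\<close>; on the
  other strand it passes without a sign because it is even.\<close>

lemma cq_gact:
 assumes "pgen_index g : {1..2}" and v: "v : VV 2"
 shows "act cq (gact g v) = gact g (act cq v)" "act cq2 (gact g v) = gact g (act cq2 v)"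
proof -
 note oG = opr_gop[of g]
 have lG: "lin (gop g)" by (rule opr_lin[OF oG])
 have v': "v : VV (1 + 1)" using v by simp
 have gv: "gact g v : VV 2" by (rule gact_VV) fact+
 have g0: "ins 0 (gop g) u = gop g u" if "u : VV 1" for u
  using that by (simp add: ins_0 lG tens_unit_right)
 consider "pgen_index g = 1" | "pgen_index g = 2" using assms(1) by fastforce
 then have "act cq (gact g v) = gact g (act cq v) & act cq2 (gact g v) = gact g (act cq2 v)"
 proof cases
  case 1
  have "act cq (gact g v) = tens 1 (%v. act cq (gop g v)) idv v"
   unfolding cq_tens(1)[OF gv] unfolding gact_first[OF 1] by (rule tens_comp_id_right[OF oG lin_act v'])
  also have "... = tens 1 (%v. gop g (act cq v)) idv v"
   by (rule tens_left_cong[OF v']) (use gop_cq[of _ g] g0 opr_VV[OF cq_opr(1)] in auto)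
  also have "... = gact g (act cq v)"
   unfolding cq_tens(1)[OF v] gact_first[OF 1] by (rule tens_comp_id_right[OF cq_opr(1) lG v', symmetric])
  finally have a: "act cq (gact g v) = gact g (act cq v)" .
  have "act cq2 (gact g v) = tens 1 (gop g) (act cq) v"
   unfolding cq_tens(2)[OF gv] unfolding gact_first[OF 1]
   by (rule tens_comp_right_even[OF oG opr_id(1) lin_id(1) lin_act cq_opr(2) v'])
  also have "... = gact g (act cq2 v)"
   unfolding cq_tens(2)[OF v] gact_first[OF 1]
   by (rule tens_comp_left_even[OF opr_id(1) opar_id(1) lin_act lG lin_id(1) v', symmetric])
  finally show ?thesis using a by simp
 next
  case 2
  have "act cq (gact g v) = tens 1 (act cq) (ins 0 (gop g)) v"
   unfolding cq_tens(1)[OF gv] unfolding gact_second[OF 2]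
   by (rule tens_comp_left_even[OF opr_id(1) opar_id(1) lin_ins lin_act lin_id(1) v'])
  also have "... = gact g (act cq v)"
   unfolding cq_tens(1)[OF v] gact_second[OF 2]
   by (rule tens_comp_left_even[OF cq_opr(1,2) lin_id(1) lin_id(1) lin_ins v', symmetric])
  finally have a: "act cq (gact g v) = gact g (act cq v)" .
  have "act cq2 (gact g v) = tens 1 idv (%v. act cq (ins 0 (gop g) v)) v"
   unfolding cq_tens(2)[OF gv] unfolding gact_second[OF 2] by (rule tens_comp_id_left[OF lin_ins lin_act v'])
  also have "... = tens 1 idv (%v. ins 0 (gop g) (act cq v)) v"
   by (rule tens_right_cong[OF v']) (rule gop_cq)
  also have "... = gact g (act cq2 v)"
   unfolding cq_tens(2)[OF v] gact_second[OF 2] by (rule tens_comp_id_left[OF lin_act lin_ins v', symmetric])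
  finally show ?thesis using a by simp
 qed
 then show "act cq (gact g v) = gact g (act cq v)" "act cq2 (gact g v) = gact g (act cq2 v)" by auto
qed

lemma cq_central:
 assumes "f : falg_on 2" "v : VV 2"
 shows "act cq (act f v) = act f (act cq v)" "act cq2 (act f v) = act f (act cq2 v)"
 using act_commute[OF cq_opr(3) assms] act_commute[OF cq_opr(4) assms] cq_gact by auto

lemma Sw_cq:
 assumes u: "u : VV 2" shows "Sw (act cq u) = act cq2 (Sw u)" "Sw (act cq2 u) = act cq (Sw u)"
proof -
 have 1: "Sw (act cq u) = act cq2 (Sw u)" if "u : VV 2" for u
  using Sw_act[OF cq_falg(2) that] relabel_swap_sh[OF cq_falg(1)] by (simp add: cq2_def)
 show "Sw (act cq u) = act cq2 (Sw u)" using 1 u by blast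
 show "Sw (act cq2 u) = act cq (Sw u)"
  using 1[OF Sw_VV[OF u]] Sw_Sw[OF u] Sw_Sw[OF opr_VV[OF cq_opr(3) Sw_VV[OF u]]] by metis
qed

text \<open>Differentiating the commutation of \<open>Q_1\<close> with \<open>x_1\<close> and
  \<open>x_2\<close> gives two formulas for the Demazure image of \<open>Q_1\<close>. Swapping the
  first one makes it comparable with the second, and their difference is an element \<open>e\<close>
  with \<open>e x_2 = x_1 e\<close>, hence 0.\<close>

lemma dem_cq_symmetric:
 assumes v: "v : VV 2" shows "Sw (act (dem cq) (Sw v)) = act (dem cq) v"
proof -
 define D where "D = act (dem cq)"
 define D' where "D' v = Sw (D (Sw v))" for v
 have dq: "dem cq : falg_on 2" by (rule dem_falg_on[OF cq_falg(2)])
 have rel: "falg_relabel tr12 cq = cq2" "falg_relabel tr12 (mon [GX 1]) = mon [GX 2]" "falg_relabel tr12 (mon [GX 2]) = mon [GX 1]"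
  using relabel_swap_sh[OF cq_falg(1)] by (auto simp: cq2_def tr12_simps)
 have X: "mon [GX 1] : falg_on 2" "mon [GX 2] : falg_on 2" by (auto intro!: falg_on_single simp: FW_Cons)
 \<comment> \<open>\<open>Q_1 x_i\<close> and \<open>x_i Q_1\<close> are equal in
   \<open>Pol A 2\<close>, so their Demazure images act alike.\<close>
 have comm: "act (dem (cq * mon [GX i])) u = act (dem (mon [GX i] * cq)) u" if i: "i : {1..2}" and u: "u : VV 2" for i u
 proof -
  have Xi: "mon [GX i] : falg_on 2" using i by (auto intro!: falg_on_single simp: FW_Cons)
  have "PHI 2 (cq * mon [GX i]) = PHI 2 (mon [GX i] * cq)"
   unfolding PHI_def act_mult by (rule cq_central(1)[OF Xi vac_VV])
  then have "pc 2 (cq * mon [GX i]) (mon [GX i] * cq)"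
   by (subst pc_iff_PHI) (auto intro: falg_on_closed Xi cq_falg)
  then show ?thesis using act_dem_pol_ideal[of "cq * mon [GX i] - mon [GX i] * cq" u] u
   by (simp add: pc_def lin_diff[OF lin_dem] act_diff)
 qed
 have e1: "D (gact (GX 1) u) + act cq2 (tele 1 2 u) = tele 1 2 (act cq u) + gact (GX 2) (D u)" if u: "u : VV 2" for u
  using comm[of 1 u] u
  by (simp add: dem_mult rel act_add act_mult D_def act_teleporter one_single_Nil[symmetric] tr12_simps del: gact.simps)
 have e2: "D (gact (GX 2) u) - act cq2 (tele 2 1 u) = - tele 2 1 (act cq u) + gact (GX 1) (D u)" if u: "u : VV 2" for u
  using comm[of 2 u] u
  by (simp add: dem_mult rel act_add act_diff act_mult D_def act_teleporter one_single_Nil[symmetric] tr12_simps act_uminus lin_uminus[OF lin_act] del: gact.simps)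
 have DV: "D u : VV 2" if "u : VV 2" for u using opr_VV[OF opr_act[OF dq] that] by (simp add: D_def)
 have qV: "act cq u : VV 2" "act cq2 u : VV 2" if "u : VV 2" for u using opr_VV[OF cq_opr(3) that] opr_VV[OF cq_opr(4) that] by auto
 note Swq = Sw_cq
 have ct: "act cq2 (tele i j u) = tele i j (act cq2 u)" "act cq (tele i j u) = tele i j (act cq u)"
  if "u : VV 2" "i : {1..2}" "j : {1..2}" for u i j
  using cq_central[OF teleporter_falg_on[OF that(2,3)] that(1)] by (simp_all add: act_teleporter)
 have T: "tele i j u : VV 2" if "u : VV 2" "i : {1..2}" "j : {1..2}" for u i j
  by (rule tele_VV) (use that in auto)
 have i12: "1 : {1..2::nat}" "2 : {1..2::nat}" by auto
 \<comment> \<open>The teleporter terms on both sides agree by centrality of \<open>Q_1\<close> and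
   \<open>Q_2\<close> and cancel in the difference.\<close>
 have E: "D (gact (GX 2) u) - D' (gact (GX 2) u) = gact (GX 1) (D u - D' u)" if u: "u : VV 2" for u
 proof -
  have a: "gact (GX 1) (Sw u) = Sw (gact (GX 2) u)" using u by (simp add: Sw_gact tr12_simps del: gact.simps)
  have b: "Sw (gact (GX 2) (D (Sw u))) = gact (GX 1) (Sw (D (Sw u)))"
   using Sw_gact[of "GX 2" "D (Sw u)"] DV[OF Sw_VV[OF u]] by (simp add: tr12_simps del: gact.simps)
  have "Sw (D (Sw (gact (GX 2) u)) + act cq2 (tele 1 2 (Sw u))) = Sw (tele 1 2 (act cq (Sw u)) + gact (GX 2) (D (Sw u)))"
   using e1[OF Sw_VV[OF u]] unfolding a by simp
  then have "D' (gact (GX 2) u) + act cq (tele 2 1 u) = tele 2 1 (act cq2 u) + gact (GX 1) (D' u)"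
   using u by (simp add: D'_def lin_add[OF lin_Sw] b Swq Sw_tele Sw_Sw Sw_VV DV qV T tr12_simps del: gact.simps)
  then have 1: "D' (gact (GX 2) u) + tele 2 1 (act cq u) = tele 2 1 (act cq2 u) + gact (GX 1) (D' u)"
   using ct[OF u i12(2,1)] by simp
  have 2: "D (gact (GX 2) u) + tele 2 1 (act cq u) = tele 2 1 (act cq2 u) + gact (GX 1) (D u)"
   using e2[OF u] ct[OF u i12(2,1)] by (simp add: algebra_simps del: gact.simps)
  have "D (gact (GX 2) u) - D' (gact (GX 2) u)
   = (D (gact (GX 2) u) + tele 2 1 (act cq u)) - (D' (gact (GX 2) u) + tele 2 1 (act cq u))" by simp
  then show ?thesis unfolding 1 2 by (simp add: lin_diff[OF lin_gact] del: gact.simps)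
 qed
 \<comment> \<open>Writing the difference as the action of one element of the algebra lets right
   multiplication by \<open>x_2\<close> be read off at the vacuum.\<close>
 define e where "e = dem cq - falg_relabel tr12 (dem cq)"
 have e: "e : falg_on 2" unfolding e_def by (intro falg_on_closed(4) dq tr12_falg)
 have De: "D u - D' u = act e u" if "u : VV 2" for u
  using Sw_act[OF dq Sw_VV[OF that]] Sw_Sw[OF that] by (simp add: D_def D'_def e_def act_diff)
 have "PHI 2 (e * mon [GX 2]) = gact (GX 1) (PHI 2 e)"
  using E[OF vac_VV] De[OF vac_VV] De[OF gact_VV[OF _ vac_VV], of "GX 2"]
  by (simp add: PHI_def act_mult del: gact.simps)
 then have "PHI 2 e = 0" using bump_eq_x1_zero[OF PHI_VV[OF e]] PHI_right_x2[OF e] by simp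
 then have "e : pol_ideal A 2" using pc_iff_PHI[OF e, of 0] by (simp add: lin_0 pc_def)
 then have "act e v = 0" by (rule act_pol_ideal) fact
 then show ?thesis using De[OF v] by (simp add: D_def D'_def)
qed

text \<open>By \<open>Dz_Sw\<close> and the symmetry just shown, the Demazure image of
  \<open>Q_2\<close> is the negative of that of \<open>Q_1\<close>; the two corrections cancel on
  the product \<open>Q_1 Q_2\<close>.\<close>

lemma tau_cq_cq2:
 assumes v: "v : VV 2" shows "tau (act cq (act cq2 v)) = act cq (act cq2 (tau v))"
proof -
 have qV: "act cq u : VV 2" "act cq2 u : VV 2" if "u : VV 2" for u using opr_VV[OF cq_opr(3) that] opr_VV[OF cq_opr(4) that] by auto
 note Swq = Sw_cq
 have Dq: "Dz (act cq u) = act (dem cq) u + act cq2 (Dz u)" if "u : VV 2" for u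
  using Dz_act[OF cq_falg(2) that] relabel_swap_sh[OF cq_falg(1)] by (simp add: cq2_def)
 have Dq2: "Dz (act cq2 u) = - act (dem cq) u + act cq (Dz u)" if u: "u : VV 2" for u
 proof -
  have "Dz (act cq2 u) = Dz (Sw (act cq (Sw u)))" using u by (simp add: Swq Sw_VV Sw_Sw)
  also have "... = - Sw (act (dem cq) (Sw u) + act cq2 (Dz (Sw u)))"
   using u by (simp add: Dz_Sw qV Sw_VV Dq)
  also have "... = - act (dem cq) u - act cq (Sw (Dz (Sw u)))"
   using u by (simp add: lin_add[OF lin_Sw] dem_cq_symmetric Swq Dz_VV Sw_VV)
  also have "Sw (Dz (Sw u)) = - Dz u" using u by (simp add: Dz_Sw lin_uminus[OF lin_Sw] Sw_Sw Dz_VV)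
  finally show ?thesis by (simp add: lin_uminus)
 qed
 have c: "act cq2 (act (dem cq) v) = act (dem cq) (act cq2 v)" "act cq (act (dem cq) v) = act (dem cq) (act cq v)"
  "act cq (act cq2 u) = act cq2 (act cq u)" if "u : VV 2" for u
  using cq_central[OF dem_falg_on[OF cq_falg(2)] v] cq_central(1)[OF cq_falg(3) that] by auto
 show ?thesis
  using v by (simp add: tau_def Swq qV Dq Dq2 lin_diff lin_add lin_uminus c Sw_VV Dz_VV)
qed

end

end

section \<open>Soundness of the polynomial representation\<close>

text \<open>Each \<open>QQ\<close> goes to the ground ring, so an object is sent to the polynomial
  algebra with one variable per letter \<open>II\<close>.\<close>

abbreviation nI :: "'q lob list => nat" where "nI X \<equiv> count_list X II"

primrec src :: "('k, 'a, 'q) lmor => 'q lob list" where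
 "src (Ident X) = X" | "src (g \<odot> f) = src f" | "src (f \<boxtimes> g) = src f @ src g" | "src (Nul X Y) = X"
| "src (Plus f g) = src f" | "src (Scal c f) = src f" | "src Sig = [II, II]" | "src (Tok a) = [II]"
| "src Dot = [II]" | "src (Rho Q) = [QQ Q, II]" | "src (Lam Q) = [II, QQ Q]"

primrec tgt :: "('k, 'a, 'q) lmor => 'q lob list" where
 "tgt (Ident X) = X" | "tgt (g \<odot> f) = tgt g" | "tgt (f \<boxtimes> g) = tgt f @ tgt g" | "tgt (Nul X Y) = Y"
| "tgt (Plus f g) = tgt f" | "tgt (Scal c f) = tgt f" | "tgt Sig = [II, II]" | "tgt (Tok a) = [II]"
| "tgt Dot = [II]" | "tgt (Rho Q) = [II, QQ Q]" | "tgt (Lam Q) = [QQ Q, II]"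

lemma sum_list_concat: "sum_list (concat tss) = (\<Sum>ts\<leftarrow>tss. sum_list ts)"
 by (induction tss) auto

lemma src_dots [simp]: "src (dots r) = [II]" by (induction r) auto
lemma tgt_dots [simp]: "tgt (dots r) = [II]" by (induction r) auto
lemma src_lsum: "\<forall>t\<in>set ts. src t = X ==> src (lsum X Y ts) = X"
 by (cases ts) (auto simp: lsum_def)
lemma tgt_lsum: "\<forall>t\<in>set ts. tgt t = Y ==> tgt (lsum X Y ts) = Y"
 by (cases ts) (auto simp: lsum_def)
lemma src_bracket1 [simp]: "src (bracket1 a N) = [II]" and tgt_bracket1 [simp]: "tgt (bracket1 a N) = [II]"
 unfolding bracket1_def by (rule src_lsum tgt_lsum; simp)+

context frobenius_superalgebra begin

text \<open>Source and target are determined by the term, so typing is a recursive predicate that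
  the simplifier can evaluate; \<open>law_arr_iff\<close> connects it with
  \<open>law_arr\<close>.\<close>

primrec wt :: "('k, 'a) law_term => bool" where
 "wt (Ident X) = (X : OB)"
| "wt (g \<odot> f) = (wt f & wt g & src g = tgt f)"
| "wt (f \<boxtimes> g) = (wt f & wt g)"
| "wt (Nul X Y) = (X : OB & Y : OB)"
| "wt (Plus f g) = (wt f & wt g & src g = src f & tgt g = tgt f)"
| "wt (Scal c f) = wt f" | "wt Sig = True" | "wt (Tok a) = True" | "wt Dot = True"
| "wt (Rho Q) = (Q : ECR (Pol A 1))" | "wt (Lam Q) = (Q : ECR (Pol A 1))"

lemma law_arr_wt: "law_arr A f X Y ==> wt f & src f = X & tgt f = Y"
 by (induction rule: law_arr.induct) auto

lemma wt_law_arr: "wt f ==> law_arr A f (src f) (tgt f)"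
 by (induction f) (auto intro: law_arr.intros)

lemma law_arr_iff: "law_arr A f X Y \<longleftrightarrow> wt f & src f = X & tgt f = Y"
 using law_arr_wt wt_law_arr by metis

lemma obs_simps [simp]: "[] : OB" "x # X : OB \<longleftrightarrow> (case x of II => True | QQ Q => Q : ECR (Pol A 1)) & X : OB"
 "X @ Y : OB \<longleftrightarrow> X : OB & Y : OB"
 by (auto simp: law_obs_def split: lob.splits)

lemma wt_obs: "wt f ==> src f : OB & tgt f : OB"
 by (induction f) auto

lemma lsum_wt: "X : OB ==> Y : OB ==> \<forall>t\<in>set ts. wt t & src t = X & tgt t = Y ==>
  wt (lsum X Y ts)"
proof (induction ts)
 case (Cons t ts)
 then show ?case using src_lsum[of ts X Y] tgt_lsum[of ts Y X] by (auto simp: lsum_def)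
qed (auto simp: lsum_def)

lemma dots_wt [simp]: "wt (dots r)"
 by (induction r) auto

lemma bracket1_wt [simp]: "wt (bracket1 a N)"
 unfolding bracket1_def by (rule lsum_wt) auto

lemma bracket2_wt:
 assumes "Q : ECR (Pol A 1)"
 shows "wt (bracket2 Q bs \<mu> N)" "src (bracket2 Q bs \<mu> N) = [II, QQ Q, II]" "tgt (bracket2 Q bs \<mu> N) = [II, QQ Q, II]"
 unfolding bracket2_def by (rule lsum_wt src_lsum tgt_lsum; use assms in auto)+

lemma sig_dot_wt: "wt (lsum [II, II] [II, II] [Scal (k b) (Tok (f b) \<boxtimes> Tok (g b)). b \<leftarrow> bs])"
 by (rule lsum_wt) auto

lemma law_eq_arr: "law_eq A X Y f g ==> law_arr A f X Y & law_arr A g X Y"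
proof (induction rule: law_eq.induct)
 case (mixed_braid Q bs \<mu> N)
 then show ?case by (simp add: law_arr_iff bracket2_wt)
qed (auto simp: law_arr_iff sig_dot_wt src_lsum tgt_lsum wt_obs)

text \<open>Interpretation of terms on the model. It is total, also on ill-typed terms; only
  well-typed ones are covered by \<open>ev_opr\<close>.\<close>

primrec ev :: "('k, 'a) law_term => (('a \<times> nat) list \<Rightarrow>\<^sub>0 'k) => (('a \<times> nat) list \<Rightarrow>\<^sub>0 'k)" where
 "ev (Ident X) = idv"
| "ev (g \<odot> f) = (%v. ev g (ev f v))"
| "ev (f \<boxtimes> g) = tens (nI (src f)) (ev f) (ev g)"
| "ev (Nul X Y) = (%v. 0)"
| "ev (Plus f g) = (%v. ev f v + ev g v)"
| "ev (Scal c f) = (%v. pscale c (ev f v))"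
| "ev Sig = tau" | "ev (Tok a) = La a" | "ev Dot = Lx" | "ev (Rho Q) = idv" | "ev (Lam Q) = act (qrep Q)"

lemma ev_opr: "wt f ==> opr (nI (src f)) (nI (tgt f)) (ev f)"
proof (induction f)
 case (Comp g f)
 then show ?case by (auto intro: opr_comp)
next
 case (Tens f g)
 then show ?case by (auto intro: opr_tens)
next
 case Sig
 then show ?case using opr_tau by simp
next
 case (Tok a)
 then show ?case using opr_La by simp
next
 case Dot
 then show ?case using opr_Lx by simp
next
 case (Lam Q)
 then show ?case using opr_act[OF ECR_rep(1)] by simp
qed (auto intro: opr_plus opr_scale)

lemma ev_lin: "wt f ==> lin (ev f)" using ev_opr opr_lin by blast
lemma ev_VV: "wt f ==> v : VV (nI (src f)) ==> ev f v : VV (nI (tgt f))" using ev_opr opr_VV by blast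

lemma ev_opar: "law_homog A f p ==> wt f ==> opar (nI (src f)) p (ev f)"
proof (induction rule: law_homog.induct)
 case (2 f p g q)
 then show ?case using opar_comp[of "nI (src f)" p "ev f" "nI (tgt f)" q "ev g"] by (auto simp: ev_opr ev_lin)
next
 case (3 f p g q)
 then show ?case using opar_tens[of "nI (src f)" p "ev f" "nI (src g)" q "ev g"] by (auto simp: ev_lin)
next
 case 7
 then show ?case using opar_tau by simp
next
 case (8 a p)
 then show ?case using opar_La by simp
next
 case 9
 then show ?case using opar_Lx by simp
next
 case (11 Q)
 then show ?case using ECR_act_even by simp
qed (auto intro: opar_plus opar_scale)

lemma ev_lsum: "ev (lsum X Y ts) v = (\<Sum>t\<leftarrow>ts. ev t v)"
 by (induction ts) (auto simp: lsum_def)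

lemma ev_dots: "ev (dots r) v = (Lx ^^ r) v"
 by (induction r) auto

lemma gact_VV1: "pgen_index g = 1 ==> v : VV 1 ==> gact g v = gop g v"
 by (simp add: gact_gop ins_0 opr_lin[OF opr_gop] tens_unit_right)

lemma Lx_funpow_VV: "v : VV 1 ==> (Lx ^^ r) v : VV 1"
 by (induction r) (auto intro: opr_VV[OF opr_Lx])

lemma wact_replicate_x1: "v : VV 1 ==> wact (replicate r (GX 1)) v = (Lx ^^ r) v"
 using gact_VV1[of "GX 1"] by (induction r) (auto simp: Lx_funpow_VV simp del: gact.simps)

lemma ev_bracket1:
 assumes "v : VV 1" shows "ev (bracket1 a N) v = act (\<Sum>r<N. mon (GA 1 (a r) # replicate r (GX 1))) v"
proof -
 have "wact (GA 1 (a r) # replicate r (GX 1)) v = La (a r) ((Lx ^^ r) v)" for r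
  using gact_VV1[of "GA 1 (a r)"] assms by (simp add: wact_replicate_x1 Lx_funpow_VV del: gact.simps)
 then show ?thesis
  by (simp add: bracket1_def ev_lsum act_sum ev_dots o_def interv_sum_list_conv_sum_set_nat atLeast0LessThan del: wact.simps)
qed

lemma lin_funpow_Lx [simp]: "lin (Lx ^^ r)"
proof (induction r)
 case (Suc r)
 then show ?case using lin_comp[OF Suc lin_Lx] by (simp add: o_def)
qed (auto simp: id_def[symmetric])
lemma opr_funpow_Lx: "opr 1 1 (Lx ^^ r)" by (simp add: opr_def Lx_funpow_VV)

lemma wact_replicate_x2: "v : VV 2 ==> wact (replicate r (GX 2)) v = tens 1 idv (Lx ^^ r) v"
proof (induction r)
 case 0
 show ?case by (simp add: id_def)
next
 case (Suc r)
 have v: "v : VV (1 + 1)" using Suc by simp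
 have "wact (replicate (Suc r) (GX 2)) v = tens 1 idv (ins 0 Lx) (tens 1 idv (Lx ^^ r) v)"
  using Suc gact_second[of "GX 2"] by (simp del: gact.simps)
 also have "... = tens 1 idv (%v. ins 0 Lx ((Lx ^^ r) v)) v"
  by (rule tens_comp_id_left[OF lin_funpow_Lx lin_ins v])
 also have "... = tens 1 idv (Lx ^^ Suc r) v"
  by (rule tens_right_cong[OF v]) (simp add: ins_0 tens_unit_right Lx_funpow_VV)
 finally show ?case .
qed

lemma wact_replicate_x1_2: "v : VV 2 ==> wact (replicate r (GX 1)) v = tens 1 (Lx ^^ r) idv v"
proof (induction r)
 case 0
 show ?case by (simp add: id_def)
next
 case (Suc r)
 have v: "v : VV (1 + 1)" using Suc by simp
 have "wact (replicate (Suc r) (GX 1)) v = tens 1 Lx idv (tens 1 (Lx ^^ r) idv v)"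
  using Suc gact_first[of "GX 1"] by (simp del: gact.simps)
 also have "... = tens 1 (Lx ^^ Suc r) idv v"
  using tens_comp_id_right[OF opr_funpow_Lx lin_Lx v] by (simp add: o_def)
 finally show ?case .
qed

lemma tens_factor:
 assumes "lin F" "lin G" "v : VV (m + n)"
 shows "tens m F G v = tens m F idv (tens m idv G v)"
 by (rule tens_comp_left_even[OF opr_id(1) opar_id(1) assms(2) assms(1) lin_id(1) assms(3), symmetric])

lemma tens0: "lin G ==> tens 0 idv G = G"
 by (simp add: tens_0 fun_eq_iff)

text \<open>The order of factors in \<open>[f]_Q\<close>, with both tokens applied after both
  powers, matches the order of the words in \<open>pol2_of\<close>, so no sign arises.\<close>

lemma bracket2_term:
 assumes v: "v : VV 2"
 shows "tens 1 (La b) (La c) (tens 1 (Lx ^^ r) (Lx ^^ s) v)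
  = wact ([GA 1 b, GA 2 c] @ replicate r (GX 1) @ replicate s (GX 2)) v"
proof -
 have v': "v : VV (1 + 1)" using v by simp
 have 1: "tens 1 (Lx ^^ r) (Lx ^^ s) v = wact (replicate r (GX 1) @ replicate s (GX 2)) v"
  using tens_factor[OF lin_funpow_Lx[of r] lin_funpow_Lx[of s] v'] v
  by (simp add: wact_append wact_replicate_x2 wact_replicate_x1_2 opr_VV[OF opr_tens[OF opr_id(1)[of 1] opr_funpow_Lx, simplified]])
 define u where "u = wact (replicate r (GX 1) @ replicate s (GX 2)) v"
 have "u : VV 2" unfolding u_def
  by (rule opr_VV[OF opr_wact v]) (auto simp: FW_def)
 then have u: "u : VV (1 + 1)" by simp
 have "tens 1 (La b) (La c) u = tens 1 (La b) idv (tens 1 idv (La c) u)"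
  by (rule tens_factor[OF lin_La lin_La u])
 also have "tens 1 idv (La c) u = tens 1 idv (ins 0 (La c)) u"
  by (rule tens_right_cong[OF u]) (simp add: ins_0 tens_unit_right)
 finally show ?thesis
  using gact_first[of "GA 1 b"] gact_second[of "GA 2 c"] 1 by (simp add: u_def del: gact.simps)
qed

lemma ev_bracket2:
 assumes "v : VV 2" "distinct bs" "set bs = basis A"
 shows "ev (bracket2 Q bs \<mu> N) v = act (\<Sum>b\<in>basis A. \<Sum>c\<in>basis A. \<Sum>r<N. \<Sum>s<N. pscale (\<mu> b c r s)
   (mon ([GA 1 b, GA 2 c] @ replicate r (GX 1) @ replicate s (GX 2)))) v"
proof -
 have f: "ev (dots r) = Lx ^^ r" for r by (simp add: ev_dots fun_eq_iff)
 have n: "nI [QQ Q :: ('k, 'a) falg set lob] = 0" by simp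
 have "ev (bracket2 Q bs \<mu> N) v = (\<Sum>b\<leftarrow>bs. \<Sum>c\<leftarrow>bs. \<Sum>r\<leftarrow>[0..<N]. \<Sum>s\<leftarrow>[0..<N].
   pscale (\<mu> b c r s) (tens 1 (La b) (La c) (tens 1 (Lx ^^ r) (Lx ^^ s) v)))"
  by (simp add: bracket2_def ev_lsum sum_list_concat o_def map_concat f tens0)
 also have "... = (\<Sum>b\<in>basis A. \<Sum>c\<in>basis A. \<Sum>r<N. \<Sum>s<N. pscale (\<mu> b c r s) (tens 1 (La b) (La c) (tens 1 (Lx ^^ r) (Lx ^^ s) v)))"
  using assms(2,3) by (simp add: sum_list_distinct_conv_sum_set interv_sum_list_conv_sum_set_nat atLeast0LessThan)
 finally show ?thesis by (simp add: act_sum act_pscale bracket2_term[OF assms(1)] del: wact.simps pscale_simps(5))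
qed

text \<open>Relabelling every index to 1 does nothing to a word in the index 1, so
  \<open>Q_1\<close> is represented by the same free-algebra element; the Demazure operator may then
  be evaluated on that representative.\<close>

lemma pol_at_ECR:
 assumes Q: "Q : ECR (Pol A 1)"
 shows "demazure A 2 1 (pol_at A 2 1 Q) = pol_class A 2 (dem (cq Q))"
proof -
 note q = ECR_rep[OF Q, folded cq_def[OF Q]]
 have idg: "pgen_relabel (%_. 1) g = g" if "pgen_index g : {1..1}" for g
  using that by (cases g) auto
 have id: "falg_relabel (%_. 1) f = f" if "f : falg_on 1" for f
  by (rule supp_mult_single_induct[where F = "falg_relabel (%_. 1)" and G = "%f. f" and I = "FW 1"])
   (use that idg in \<open>auto simp: falg_on_supp FW_def intro!: arg_cong[where f = "%w. sng w 1"] map_idI\<close>)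
 \<comment> \<open>The ideal for one variable is carried into the ideal for two by letting both
   representatives act on the vacuum through the first factor.\<close>
 have pol2: "pc 2 f g" if "f : falg_on 1" "g : falg_on 1" "pc 1 f g" for f g
 proof -
  have "act f (vac 2) = act g (vac 2)"
   using act_left[OF that(1), of "vac 2" 1] act_left[OF that(2), of "vac 2" 1]
   tens_left_cong[of "vac 2" 1 1 "act f" "act g"] act_pc[OF that(3)] vac_VV[of 2] by simp
  then show ?thesis using pc_iff_PHI[of f 2 g] falg_on_mono[of 1 2 f] falg_on_mono[of 1 2 g] that by (simp add: PHI_def)
 qed
 have "pol_at A 2 1 Q = pol_class A 2 (falg_relabel (%_. 1) (cq Q))"
  unfolding pol_at_def by (subst q(2), rule pol_class_UN[OF q(1)]) (use q(1) in "auto simp: id intro: pol2")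
 then have 1: "pol_at A 2 1 Q = pol_class A 2 (cq Q)" unfolding id[OF q(1)] .
 have "pc 2 (dem f) (dem (cq Q))" if "f : falg_on 2" "pc 2 f (cq Q)" for f
  using that act_dem_pol_ideal[of "f - cq Q" "vac 2"] vac_VV pc_iff_PHI[of "dem f" 2 "dem (cq Q)"] dem_falg_on cq_falg[OF Q]
  by (simp add: pc_def lin_diff[OF lin_dem] PHI_def act_diff)
 then show ?thesis
  unfolding 1 demazure_def dem_def[symmetric] by (intro pol_class_UN cq_falg[OF Q]) auto
qed

lemma tens_add_left: "tens m (%v. F v + F' v) G v = tens m F G v + tens m F' G v"
 by (rule lin_eq_on[where G = "%v. tens m F G v + tens m F' G v"])
   (auto simp: tens_single distrib_right intro: lin_plus)
lemma tens_add_right: "tens m F (%v. G v + G' v) v = tens m F G v + tens m F G' v"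
 by (rule lin_eq_on[where G = "%v. tens m F G v + tens m F G' v"])
   (auto simp: tens_single twist_def lin_add distrib_left intro: lin_plus)
lemma tens_scale_left: "tens m (%v. pscale c (F v)) G v = pscale c (tens m F G v)"
 by (rule lin_eq_on[where G = "%v. pscale c (tens m F G v)"])
   (auto simp: tens_single intro: lin_scale)

lemmas op_tens_cong = tens_cong
lemmas op_tens_assoc = tens_assoc
lemmas op_tens_unit_right = tens_unit_right

text \<open>The category axioms are properties of \<open>tens\<close>, and the relations of
  crossings with tokens and dots are the rules for \<open>tau\<close>. Since \<open>Rho\<close> acts
  as the identity and \<open>Lam\<close> as \<open>Q\<close>, the relations with \<open>Q\<close>
  become statements about \<open>Q_1\<close> and \<open>Q_2\<close>.\<close>

theorem soundness: "law_eq A X Y f g ==> v : VV (nI X) ==> ev f v = ev g v"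
proof (induction arbitrary: v rule: law_eq.induct)
 case (comp_cong X Y f f' Z g g')
 have "wt f" "src f = X" "tgt f = Y" using law_eq_arr[OF comp_cong(1)] by (auto simp: law_arr_iff)
 then have "ev f v : VV (nI Y)" using ev_VV comp_cong.prems by auto
 then show ?case using comp_cong.IH comp_cong.prems by simp
next
 case (tens_cong X X' f f' Y Y' g g')
 have "src f = X" "src f' = X" using law_eq_arr[OF tens_cong(1)] by (auto simp: law_arr_iff)
 then show ?case unfolding ev.simps
  using op_tens_cong[of v "nI X" "nI Y" "ev f" "ev f'" "ev g" "ev g'"] tens_cong by simp
next
 case (comp_plus_right f X Y g h Z)
 then show ?case by (simp add: law_arr_iff lin_add[OF ev_lin])
next
 case (comp_scal_right f X Y g Z c)
 then show ?case by (simp add: law_arr_iff lin_pscale[OF ev_lin])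
next
 case (tens_assoc f X X' g Y Y' h Z Z')
 then show ?case by (simp add: law_arr_iff op_tens_assoc ev_lin)
next
 case (tens_unit_left f X Y)
 then show ?case by (simp add: law_arr_iff tens_0 ev_lin)
next
 case (tens_unit_right f X Y)
 then show ?case by (simp add: law_arr_iff op_tens_unit_right ev_lin)
next
 case (tens_plus_left f X X' g h Y Y')
 then show ?case
by (simp add: law_arr_iff tens_add_left)
next
 case (tens_plus_right f X X' g Y Y' h)
 then show ?case
by (simp add: law_arr_iff tens_add_right)
next
 case (tens_scal_left f X X' g Y Y' c)
 then show ?case
by (simp add: law_arr_iff tens_scale_left)
next
 case (tens_scal_right f X X' g Y Y' c)
 then show ?case by (simp add: law_arr_iff tens_scale_right ev_lin)
next
 case (interchange f X X' f' X'' g' Y Y' g Y'' p q)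
 then show ?case
  using tens_comp[of "nI X" "nI X'" "ev f" p "nI Y" "nI Y'" "ev g'" "ev f'" "ev g" q v]
   ev_opr[of f] ev_opr[of g'] ev_opar[of f p] ev_opar[of g q]
  by (simp add: law_arr_iff ev_lin)
next
 case tok_one
 then show ?case by (simp add: La_one)
next
 case (tok_linear c a d b)
 then show ?case by (simp add: La_add La_scale)
next
 case (tok_mult a b)
 then show ?case by (simp add: La_mult)
next
 case sig_sig
 then show ?case by (simp add: tau_tau)
next
 case braid
 then show ?case using braid_relation[of v] by (simp add: t1_def t2_def)
next
 case (sig_tok a)
 then have v: "v : VV (1 + 1)" "v : VV 2" by simp_all
 have 1: "tens 1 (La a) idv v = gact (GA 1 a) v" using gact_first[of "GA 1 a" v] by simp
 have 2: "tens 1 idv (La a) (tau v) = gact (GA 2 a) (tau v)"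
 proof -
  have "gact (GA 2 a) (tau v) = tens 1 idv (ins 0 (La a)) (tau v)"
   using gact_second[of "GA 2 a" "tau v"] by (simp del: gact.simps)
  then show ?thesis by (simp only:) (rule tens_right_cong[where n = 1]; use tau_VV[OF v(2)] in "simp_all add: ins_0 op_tens_unit_right")
 qed
 show ?case using 1 2 tau_GA[of 1 v a] v by (simp add: tr12_simps del: gact.simps)
next
 case (sig_dot bs)
 then have v: "v : VV (1 + 1)" "v : VV 2" by simp_all
 have 1: "tens 1 Lx idv v = gact (GX 1) v" using gact_first[of "GX 1" v] by simp
 have 2: "tens 1 idv Lx (tau v) = gact (GX 2) (tau v)"
 proof -
  have "gact (GX 2) (tau v) = tens 1 idv (ins 0 Lx) (tau v)"
   using gact_second[of "GX 2" "tau v"] by (simp del: gact.simps)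
  then show ?thesis by (simp only:) (rule tens_right_cong[where n = 1]; use tau_VV[OF v(2)] in "simp_all add: ins_0 op_tens_unit_right")
 qed
 have 3: "tens 1 (La b) (La c) v = gact (GA 1 b) (gact (GA 2 c) v)" for b c
  using bracket2_term[OF v(2), of b c 0 0] by (simp add: id_def del: gact.simps)
 show ?case using sig_dot 1 2 tau_X1[OF v(2)]
  by (simp add: ev_lsum o_def sum_list_distinct_conv_sum_set 3 tele_def pscale_uminus del: gact.simps)
next
 case (tok_dot a p)
 then show ?case by (simp add: La_Lx)
next
 case (lam_tok Q a)
 then show ?case
  using ECR_act_commute[OF lam_tok(1) falg_on_single[of "[GA 1 a]" 1 1], of v] gact_VV1[of "GA 1 a"]
  by (simp add: FW_Cons op_tens_unit_right tens0
   opr_VV[OF opr_La] opr_VV[OF opr_act[OF ECR_rep(1)]] del: gact.simps)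
next
 case (rho_tok Q a)
 then show ?case by (simp add: op_tens_unit_right tens0)
next
 case (lam_dot Q)
 then show ?case
  using ECR_act_commute[OF lam_dot(1) falg_on_single[of "[GX 1]" 1 1], of v] gact_VV1[of "GX 1"]
  by (simp add: FW_Cons op_tens_unit_right tens0
   opr_VV[OF opr_Lx] opr_VV[OF opr_act[OF ECR_rep(1)]] del: gact.simps)
next
 case (rho_dot Q)
 then show ?case by (simp add: op_tens_unit_right tens0)
next
 case (rho_lam Q a N)
 have "pc 1 (qrep Q) (\<Sum>r<N. mon (GA 1 (a r) # replicate r (GX 1)))"
  using ECR_rep[OF rho_lam(1)] pol_class_eq_iff rho_lam(2) unfolding pol1_of_def by metis
 then show ?case using rho_lam act_pc ev_bracket1[of v a N] bracket1_wt ev_lin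
  by (simp add: op_tens_unit_right)
next
 case (lam_rho Q a N)
 have "pc 1 (qrep Q) (\<Sum>r<N. mon (GA 1 (a r) # replicate r (GX 1)))"
  using ECR_rep[OF lam_rho(1)] pol_class_eq_iff lam_rho(2) unfolding pol1_of_def by metis
 then show ?case using lam_rho act_pc ev_bracket1[of v a N] bracket1_wt ev_lin
  by (simp add: tens0)
next
 case (rho_sig Q)
 then show ?case
  by (simp add: op_tens_unit_right tens0)
next
 \<comment> \<open>Pulling \<open>Q\<close> across two strands multiplies by \<open>Q_1 Q_2\<close>,
   so the relation is \<open>tau_cq_cq2\<close>.\<close>
 case (lam_sig Q)
 have v: "v : VV 2" "tau v : VV 2" using lam_sig tau_VV by simp_all
 note Q = lam_sig(1)
 have u: "act (cq2 Q) v : VV 2" "act (cq2 Q) (tau v) : VV 2" "act (cq Q) (act (cq2 Q) v) : VV 2"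
  using v by (auto intro!: opr_VV[OF cq_opr(4)[OF Q]] opr_VV[OF cq_opr(3)[OF Q]])
 show ?case
  using tau_cq_cq2[OF Q v(1)] cq_tens(2)[OF Q v(1)] cq_tens(2)[OF Q v(2)] cq_tens(1)[OF Q u(1)] cq_tens(1)[OF Q u(2)] v
  by (simp add: cq_def[OF Q] op_tens_unit_right tens0)
next
 \<comment> \<open>The left side acts as \<open>tau\<close> after \<open>Q_1\<close>; pushing
   \<open>Q_1\<close> through the crossing gives \<open>Q_2\<close> and the Demazure
   correction.\<close>
 case (mixed_braid Q bs \<mu> N)
 note Q = mixed_braid(1)
 have v: "v : VV 2" "tau v : VV 2" using mixed_braid tau_VV by simp_all
 have "pc 2 (dem (cq Q)) (\<Sum>b\<in>basis A. \<Sum>c\<in>basis A. \<Sum>r<N. \<Sum>s<N. pscale (\<mu> b c r s)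
   (mon ([GA 1 b, GA 2 c] @ replicate r (GX 1) @ replicate s (GX 2))))"
  using mixed_braid(4) pol_class_eq_iff[OF dem_falg_on[OF cq_falg(2)[OF Q]]] unfolding pol_at_ECR[OF Q] pol2_of_def by simp
 then have b: "act (dem (cq Q)) v = ev (bracket2 Q bs \<mu> N) v"
  using ev_bracket2[OF v(1) mixed_braid(2,3)] act_pc v by simp
 have "tau (act (cq Q) v) = act (cq2 Q) (tau v) - act (dem (cq Q)) v"
  using tau_act[OF cq_falg(2)[OF Q] v(1)] relabel_swap_sh[OF cq_falg(1)[OF Q]] by (simp add: cq2_def[OF Q])
 then show ?case
  using cq_tens(1)[OF Q v(1)] cq_tens(2)[OF Q v(2)] v b
  by (simp add: cq_def[OF Q] op_tens_unit_right tens0 pscale_uminus)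
qed (simp_all add: pscale_add pscale_add_left pscale_uminus add.assoc add.commute)

end

section \<open>The monoidal functor\<close>

text \<open>\<open>Pol A n\<close> is a superalgebra record, while a functor takes values in plain
  supermodules; truncation forgets product and unit only.\<close>

lemma truncate_simps [simp]:
 "carr (smodule.truncate M) = carr M" "homog (smodule.truncate M) = homog M" "zer (smodule.truncate M) = zer M"
 "add (smodule.truncate M) = add M" "smul (smodule.truncate M) = smul M"
 by (simp_all add: smodule.truncate_def)

context frobenius_superalgebra begin

section \<open>Classes of terms and operations on them\<close>

definition cl :: "('k, 'a) law_term => ('k, 'a) law_term set" where
 "cl f = law_class A (src f) (tgt f) f"

lemma law_class_eq:
 "law_arr A f X Y ==> law_class A X Y f = law_class A X Y g \<longleftrightarrow> law_eq A X Y f g"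
 unfolding law_class_def using law_eq.eq_refl law_eq.eq_sym law_eq.eq_trans by blast
lemma law_class_cl: "law_arr A f X Y ==> law_class A X Y f = cl f"
 by (simp add: cl_def law_arr_iff)
lemma law_class_ill: "\<not> law_arr A f X Y ==> law_class A X Y f = {}"
 unfolding law_class_def using law_eq_arr by blast
text \<open>With this convention operations on classes are total and send ill-typed input to the
  empty set, so \<open>cl_cmp\<close>, \<open>cl_ten\<close> and \<open>cmp_assoc\<close> hold
  without typing conditions.\<close>

lemma cl_ill: "\<not> wt f ==> cl f = {}" by (simp add: cl_def law_class_ill law_arr_iff)
lemma cl_mem: "wt f ==> f : cl f"
 by (simp add: cl_def law_class_def law_eq.eq_refl law_arr_iff)
lemma cl_memD: "g : cl f ==> wt f & wt g & src g = src f & tgt g = tgt f & law_eq A (src f) (tgt f) f g"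
 using law_eq_arr[of "src f" "tgt f" f g] by (auto simp: cl_def law_class_def law_arr_iff)
lemma cl_eq_iff: assumes "wt f" shows "cl f = cl g \<longleftrightarrow> law_eq A (src f) (tgt f) f g"
proof
 assume "cl f = cl g"
 then have "f : cl g" using cl_mem[OF assms] by simp
 from cl_memD[OF this] show "law_eq A (src f) (tgt f) f g" using law_eq.eq_sym by metis
next
 assume e: "law_eq A (src f) (tgt f) f g"
 then have "src g = src f" "tgt g = tgt f" "law_arr A f (src f) (tgt f)"
  using law_eq_arr[OF e] by (auto simp: law_arr_iff)
 then show "cl f = cl g" using law_class_eq[of f "src f" "tgt f" g] e by (simp add: cl_def)
qed
lemma cl_eqI: assumes e: "law_eq A X Y f g" shows "cl f = cl g"
proof -
 have "wt f" "src f = X" "tgt f = Y" using law_eq_arr[OF e] by (simp_all add: law_arr_iff)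
 then show ?thesis using cl_eq_iff e by simp
qed
lemma cl_of_mem: "g : cl f ==> cl g = cl f"
 using cl_memD[of g f] cl_eqI[of "src f" "tgt f" f g] by simp

text \<open>The unions over all source and target objects in \<open>LAW\<close> collapse, since all
  but the actual pair contribute the empty class.\<close>

lemma UN_law_class: "(\<Union>X Y. law_class A X Y f) = cl f"
proof -
 have "law_class A X Y f <= cl f" for X Y
  using law_class_ill[of f X Y] law_class_cl[of f X Y] by (cases "law_arr A f X Y") auto
 then show ?thesis by (auto simp: cl_def)
qed

definition cmp where "cmp G F = Cmp (LAW A) G F"
definition ten where "ten F G = TensMor (LAW A) F G"
definition pls where "pls F G = (\<Union>f\<in>F. \<Union>g\<in>G. cl (Plus f g))"
text \<open>Scaling of morphism classes; from here on the short name hides the record selector,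
  which is written \<open>frobenius_data.scl\<close>.\<close>

definition scl where "scl c F = (\<Union>f\<in>F. cl (Scal c f))"

lemma cmp_alt: "cmp G F = (\<Union>g\<in>G. \<Union>f\<in>F. cl (g \<odot> f))"
 by (simp add: cmp_def LAW_def UN_law_class)
lemma ten_alt: "ten F G = (\<Union>f\<in>F. \<Union>g\<in>G. cl (f \<boxtimes> g))"
 by (simp add: ten_def LAW_def UN_law_class)

lemma cl_cmp: "cl (g \<odot> f) = cmp (cl g) (cl f)"
proof (cases "wt g & wt f")
 case True
 have "cl (g' \<odot> f') = cl (g \<odot> f)" if "g' : cl g" "f' : cl f" for g' f'
 proof (cases "src g = tgt f")
  case True
  then show ?thesis using cl_memD[OF that(1)] cl_memD[OF that(2)]
   by (intro cl_eqI[OF law_eq.eq_sym[OF law_eq.comp_cong]]) auto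
 next
  case False
  then show ?thesis using cl_memD[OF that(1)] cl_memD[OF that(2)] by (simp add: cl_ill)
 qed
 then show ?thesis unfolding cmp_alt using True cl_mem by blast
next
 case False
 then show ?thesis by (auto simp: cmp_alt cl_ill)
qed

lemma cl_ten: "cl (f \<boxtimes> g) = ten (cl f) (cl g)"
proof (cases "wt g & wt f")
 case True
 have "cl (f' \<boxtimes> g') = cl (f \<boxtimes> g)" if "g' : cl g" "f' : cl f" for g' f'
  using cl_memD[OF that(1)] cl_memD[OF that(2)]
  by (intro cl_eqI[OF law_eq.eq_sym[OF law_eq.tens_cong]]) auto
 then show ?thesis unfolding ten_alt using True cl_mem by blast
next
 case False
 then show ?thesis by (auto simp: ten_alt cl_ill)
qed

lemma cl_pls: "cl (Plus f g) = pls (cl f) (cl g)"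
proof (cases "wt g & wt f")
 case True
 have "cl (Plus f' g') = cl (Plus f g)" if "g' : cl g" "f' : cl f" for g' f'
 proof (cases "src g = src f & tgt g = tgt f")
  case True
  then show ?thesis using cl_memD[OF that(1)] cl_memD[OF that(2)]
   by (intro cl_eqI[OF law_eq.eq_sym[OF law_eq.plus_cong]]) auto
 next
  case False
  then have "\<not> wt (Plus f g)" "\<not> wt (Plus f' g')"
   using cl_memD[OF that(1)] cl_memD[OF that(2)] by auto
  then show ?thesis using cl_ill by metis
 qed
 then show ?thesis unfolding pls_def using True cl_mem by blast
next
 case False
 then show ?thesis by (auto simp: pls_def cl_ill)
qed

lemma cl_scl: "cl (Scal c f) = scl c (cl f)"
proof (cases "wt f")
 case True
 have "cl (Scal c f') = cl (Scal c f)" if "f' : cl f" for f'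
  using cl_memD[OF that] by (intro cl_eqI[OF law_eq.eq_sym[OF law_eq.scal_cong]]) auto
 then show ?thesis unfolding scl_def using True cl_mem by blast
next
 case False
 then show ?thesis by (auto simp: scl_def cl_ill)
qed

lemma LAW_simps:
 "Ob (LAW A) = OB" "Idn (LAW A) X = law_class A X X (Ident X)" "UnitOb (LAW A) = []" "TensOb (LAW A) = (@)"
 "F : carr (Hom (LAW A) X Y) \<longleftrightarrow> (\<exists>f. law_arr A f X Y & F = cl f)"
 "F : homog (Hom (LAW A) X Y) p \<longleftrightarrow> (\<exists>f. law_arr A f X Y & law_homog A f p & F = cl f)"
 by (simp_all add: LAW_def) (metis law_class_cl)+

lemma LAW_add: "law_arr A f X Y ==> law_arr A g X Y ==> add (Hom (LAW A) X Y) (cl f) (cl g) = cl (Plus f g)"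
proof -
 assume f: "law_arr A f X Y" and g: "law_arr A g X Y"
 have "law_class A X Y (Plus f' g') = cl (Plus f' g')" if "f' : cl f" "g' : cl g" for f' g'
  by (rule law_class_cl) (use f g cl_memD[OF that(1)] cl_memD[OF that(2)] in "simp add: law_arr_iff")
 then have "(\<Union>f'\<in>cl f. \<Union>g'\<in>cl g. law_class A X Y (Plus f' g')) = pls (cl f) (cl g)"
  unfolding pls_def by auto
 moreover have "add (Hom (LAW A) X Y) (cl f) (cl g) = (\<Union>f'\<in>cl f. \<Union>g'\<in>cl g. law_class A X Y (Plus f' g'))"
  by (simp add: LAW_def)
 ultimately show ?thesis by (simp only: cl_pls)
qed

lemma LAW_smul: "law_arr A f X Y ==> smul (Hom (LAW A) X Y) c (cl f) = cl (Scal c f)"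
proof -
 assume f: "law_arr A f X Y"
 have "law_class A X Y (Scal c f') = cl (Scal c f')" if "f' : cl f" for f'
  by (rule law_class_cl) (use f cl_memD[OF that(1)] in "simp add: law_arr_iff")
 then have "(\<Union>f'\<in>cl f. law_class A X Y (Scal c f')) = scl c (cl f)"
  unfolding scl_def by auto
 moreover have "smul (Hom (LAW A) X Y) c (cl f) = (\<Union>f'\<in>cl f. law_class A X Y (Scal c f'))"
  by (simp add: LAW_def)
 ultimately show ?thesis by (simp only: cl_scl)
qed

text \<open>All axioms are pulled back from vectors along the injective map
  \<open>PH\<close>.\<close>

lemma Pol_supermodule: "supermodule (smodule.truncate (Pol A n))"
proof -
 let ?M = "Pol A n"
 \<comment> \<open>Projection of a vector onto its words of parity \<open>p\<close>; it supplies the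
   even and odd components.\<close>
 define pt where "pt p = plinear (%l. if lpar l = p then sng l (1::'k) else 0)" for p
 have pt_HV: "pt p v : HV p" for p v
  unfolding HV_def pt_def by (rule lin_supp[OF lin_plinear supp_UNIV]) (auto intro: supp_single)
 have pt_VV: "pt p v : VV n" if "v : VV n" for p v
  unfolding VV_def pt_def by (rule lin_supp[OF lin_plinear, of _ "L n"]) (use that in "auto simp: VV_def intro: supp_single")
 have pt_sum: "pt 0 v + pt 1 v = v" for v
  by (rule lin_eq_on[where F = "%v. pt 0 v + pt 1 v" and G = "%v. v"]) (auto simp: pt_def intro: lin_plus)
 have eqI: "u = v" if "u : carr ?M" "v : carr ?M" "PH n u = PH n v" for u v
  using PH_inj that by blast
 note a = PH_add[THEN conjunct1] PH_add[THEN conjunct2] PH_smul[THEN conjunct1] PH_smul[THEN conjunct2] PH_zer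
 have neg: "\<exists>v\<in>carr ?M. add ?M u v = zer ?M" if "u : carr ?M" for u
  by (rule bexI[of _ "smul ?M (-1) u"], rule eqI) (use that in "simp_all add: a pscale_uminus")
 have dec: "\<exists>!vw. vw : homog ?M 0 \<times> homog ?M 1 & u = add ?M (fst vw) (snd vw)" if u: "u : carr ?M" for u
 proof (rule ex1I[of _ "(PS n (pt 0 (PH n u)), PS n (pt 1 (PH n u)))"])
  have "u = add ?M (PS n (pt 0 (PH n u))) (PS n (pt 1 (PH n u)))"
   by (rule eqI) (use u pt_VV[OF PH_VV[OF u]] in "simp_all add: PS_carr a pt_sum")
  then show "(PS n (pt 0 (PH n u)), PS n (pt 1 (PH n u))) : homog ?M 0 \<times> homog ?M 1 \<and>
   u = add ?M (fst (PS n (pt 0 (PH n u)), PS n (pt 1 (PH n u)))) (snd (PS n (pt 0 (PH n u)), PS n (pt 1 (PH n u))))"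
   using pt_VV[OF PH_VV[OF u]] pt_HV by (simp add: PH_homog PS_carr)
 next
  fix vw assume vw: "vw : homog ?M 0 \<times> homog ?M 1 & u = add ?M (fst vw) (snd vw)"
  then have c: "fst vw : carr ?M" "snd vw : carr ?M" "PH n (fst vw) : HV 0" "PH n (snd vw) : HV 1"
   by (auto simp: PH_homog)
  have eq: "PH n u = PH n (fst vw) + PH n (snd vw)" using vw a(1)[OF c(1,2)] by simp
  then have "pt 0 (PH n u) + pt 1 (PH n u) = PH n (fst vw) + PH n (snd vw)" by (simp add: pt_sum)
  then have d: "pt 0 (PH n u) - PH n (fst vw) = PH n (snd vw) - pt 1 (PH n u)" by (simp add: algebra_simps)
  \<comment> \<open>The left expression is even, and by the previous equation it equals an odd
    one.\<close>
  have "pt 0 (PH n u) - PH n (fst vw) = 0"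
   by (rule HV_disjoint) (use pt_HV c d in \<open>auto intro: HV_closed(3)\<close>, metis HV_closed(3) pt_HV)
  then have "pt 0 (PH n u) = PH n (fst vw)" "pt 1 (PH n u) = PH n (snd vw)" using d by simp_all
  then show "vw = (PS n (pt 0 (PH n u)), PS n (pt 1 (PH n u)))" using c by (metis PS_PH prod.collapse)
 qed
 have c: "add ?M u v = add ?M v u" "add ?M (add ?M u v) w = add ?M u (add ?M v w)" "add ?M (zer ?M) u = u"
   "smul ?M c (add ?M u v) = add ?M (smul ?M c u) (smul ?M c v)" "smul ?M (c + d) u = add ?M (smul ?M c u) (smul ?M d u)"
   "smul ?M (c * d) u = smul ?M c (smul ?M d u)" "smul ?M 1 u = u"
  if "u : carr ?M" "v : carr ?M" "w : carr ?M" for u v w c d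
  by (rule eqI; use that in "simp add: a pscale_add pscale_add_left add.assoc add.commute")+
 have h: "u : homog ?M p ==> u : carr ?M" "zer ?M : homog ?M p"
   "u : homog ?M p ==> v : homog ?M p ==> add ?M u v : homog ?M p"
   "u : homog ?M p ==> smul ?M c u : homog ?M p" for u v p c
  by (simp_all add: PH_homog a)
 show ?thesis unfolding supermodule_def truncate_simps
  by (intro conjI ballI allI subsetI; (rule a(6) h(2) | (rule c neg dec a(2) a(4) h; assumption)))
qed

section \<open>Tensor products of polynomial supermodules\<close>

context
 fixes m n :: nat
begin

abbreviation (input) "PM \<equiv> smodule.truncate (Pol A m)"
abbreviation (input) "PN \<equiv> smodule.truncate (Pol A n)"

definition mm where "mm = plinear (%uv. PH m (fst uv) * PH n (snd uv))"
text \<open>The candidate inverse of \<open>mm\<close>: a word of length \<open>m + n\<close> is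
  sent to the pure tensor of its two parts.\<close>

definition nf where "nf = plinear (%l. sng (PS m (sng (take m l) 1), PS n (sng (drop m l) 1)) 1)"

lemma lin_mm [simp]: "lin mm" and lin_nf [simp]: "lin nf" by (simp_all add: mm_def nf_def)
lemma mm_single [simp]: "mm (sng (u, v) c) = pscale c (PH m u * PH n v)" by (simp add: mm_def)

lemma mm_tensor_rel: "r : tensor_rel PM PN ==> mm r = 0"
 by (induction rule: tensor_rel.induct)
   (auto simp: lin_diff[OF lin_mm] lin_add[OF lin_mm] lin_pscale[OF lin_mm] lin_0[OF lin_mm] PH_add PH_smul distrib_left distrib_right)

lemma tensor_rel_uminus: "r : tensor_rel PM PN ==> - r : tensor_rel PM PN"
 using tensor_rel.scale[of r PM PN "-1"] by (simp add: pscale_uminus)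

definition tc where "tc f g \<longleftrightarrow> f - g : tensor_rel PM PN"

lemma tc_refl [simp]: "tc f f" by (simp add: tc_def tensor_rel.zero)
lemma tc_sym: "tc f g ==> tc g f" unfolding tc_def using tensor_rel_uminus[of "f - g"] by simp
lemma tc_trans [trans]: "tc f g ==> tc g h ==> tc f h"
 unfolding tc_def using tensor_rel.plus[of "f - g" PM PN "g - h"] by simp
lemma tc_add: "tc f g ==> tc f' g' ==> tc (f + f') (g + g')"
 unfolding tc_def using tensor_rel.plus[of "f - g" PM PN "f' - g'"] by (simp add: algebra_simps)
lemma tc_pscale: "tc f g ==> tc (pscale c f) (pscale c g)"
 unfolding tc_def using tensor_rel.scale[of "f - g" PM PN c] by (simp add: pscale_diff)
lemma tc_lin: 
 assumes "lin F" "lin G" "v : supp I" "\<And>i. i : I ==> tc (F (sng i 1)) (G (sng i 1))"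
 shows "tc (F v) (G v)"
proof (induction v rule: poly_mapping_single_induct)
 case (single i c)
 then have "i : I" using assms by (auto simp: supp_def)
 then show ?case using assms(4) by (simp add: lin_single[OF assms(1), of i c] lin_single[OF assms(2), of i c] tc_pscale)
qed (use assms in "auto simp: lin_0 lin_add tc_add")

lemma PS_add: "v : VV k ==> w : VV k ==> PS k (v + w) = add (Pol A k) (PS k v) (PS k w)"
 by (rule PH_inj[THEN iffD1, of _ k]) (auto simp: PS_carr PH_add)
lemma PS_scale: "v : VV k ==> PS k (pscale c v) = smul (Pol A k) c (PS k v)"
 by (rule PH_inj[THEN iffD1, of _ k]) (auto simp: PS_carr PH_smul)

text \<open>The tensor relations let the left entry be expanded in words. The induction carries
  membership in \<open>VV m\<close> along, since the relations are imposed only for carrier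
  elements.\<close>

lemma tc_expand_left:
 assumes "v : carr (Pol A n)" "w : VV m"
 shows "tc (sng (PS m w, v) 1) (plinear (%l. sng (PS m (sng l 1), v) 1) w)"
proof -
 have scale: "tc (sng (PS m (pscale c w), v) 1) (pscale c (sng (PS m w, v) 1))" if "w : VV m" for c w
  using tensor_rel.scale_left[of "PS m w" PM v PN c] that assms by (simp add: tc_def PS_scale PS_carr)
 have "w : VV m & ?thesis"
 proof (induction w rule: poly_mapping_single_induct)
  case zero
  show ?case using scale[of 0 0] by (simp add: lin_0[OF lin_plinear])
 next
  case (single l c)
  then have "l : L m" using assms by (auto simp: VV_def supp_def)
  then show ?case using scale[of "sng l 1" c] by (auto simp: VV_single)
 next
  case (add g h)
  have "tc (sng (PS m (g + h), v) 1) (sng (PS m g, v) 1 + sng (PS m h, v) 1)"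
   using tensor_rel.add_left[of "PS m g" PM "PS m h" v PN] add assms by (simp add: tc_def PS_add PS_carr diff_diff_eq)
  then show ?case using add tc_trans[OF _ tc_add] by (auto simp: lin_add[OF lin_plinear])
 qed
 then show ?thesis ..
qed

lemma tc_expand_right:
 assumes "u : carr (Pol A m)" "w : VV n"
 shows "tc (sng (u, PS n w) 1) (plinear (%l. sng (u, PS n (sng l 1)) 1) w)"
proof -
 have scale: "tc (sng (u, PS n (pscale c w)) 1) (pscale c (sng (u, PS n w) 1))" if "w : VV n" for c w
  using tensor_rel.scale_right[of u PM "PS n w" PN c] that assms by (simp add: tc_def PS_scale PS_carr)
 have "w : VV n & ?thesis"
 proof (induction w rule: poly_mapping_single_induct)
  case zero
  show ?case using scale[of 0 0] by (simp add: lin_0[OF lin_plinear])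
 next
  case (single l c)
  then have "l : L n" using assms by (auto simp: VV_def supp_def)
  then show ?case using scale[of "sng l 1" c] by (auto simp: VV_single)
 next
  case (add g h)
  have "tc (sng (u, PS n (g + h)) 1) (sng (u, PS n g) 1 + sng (u, PS n h) 1)"
   using tensor_rel.add_right[of u PM "PS n g" PN "PS n h"] add assms by (simp add: tc_def PS_add PS_carr diff_diff_eq)
  then show ?case using add tc_trans[OF _ tc_add] by (auto simp: lin_add[OF lin_plinear])
 qed
 then show ?thesis ..
qed

abbreviation KK where "KK \<equiv> carr (Pol A m) \<times> carr (Pol A n)"

text \<open>Expanding both entries of a pure tensor by bilinearity yields its normal form. Hence
  \<open>mm\<close> detects exactly the tensor relations.\<close>

lemma tc_nf_mm: "f : supp KK ==> tc f (nf (mm f))"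
proof (rule tc_lin[where F = "%f. f" and G = "%f. nf (mm f)" and I = KK])
 fix uv assume "uv : KK"
 then obtain u v where uv: "uv = (u, v)" "u : carr (Pol A m)" "v : carr (Pol A n)" by auto
 let ?e = "%l l'. sng (PS m (sng l 1), PS n (sng l' 1)) (1::'k)"
 have "tc (sng (u, v) 1) (plinear (%l. sng (PS m (sng l 1), v) 1) (PH m u))"
  using tc_expand_left[OF uv(3) PH_VV[OF uv(2)]] uv by simp
 also have "tc ... (plinear (%l. plinear (?e l) (PH n v)) (PH m u))"
 proof (rule tc_lin[OF lin_plinear lin_plinear, of _ "L m"])
  fix l assume "l : L m"
  then show "tc (plinear (%l. sng (PS m (sng l 1), v) 1) (sng l 1))
   (plinear (%l. plinear (?e l) (PH n v)) (sng l 1))"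
   using tc_expand_right[OF PS_carr[OF VV_single[of l m 1]] PH_VV[OF uv(3)]] uv by simp
 qed (use PH_VV[OF uv(2)] in "simp add: VV_def")
 also have "plinear (%l. plinear (?e l) (PH n v)) (PH m u) = nf (PH m u * PH n v)"
 proof (rule bilinear_eqI[where F = "%a b. plinear (%l. plinear (?e l) b) a" and G = "%a b. nf (a * b)" and I = "L m" and J = "L n"])
  show "lin (%b. plinear (%l. plinear (?e l) b) a)" for a
   unfolding plinear_def[of _ a] by (intro lin_summation lin_scale lin_plinear)
 qed (use PH_VV[OF uv(2)] PH_VV[OF uv(3)] in "auto simp: VV_def vm_mult nf_def L_length intro: lin_comp[OF lin_mult_left lin_plinear] lin_comp[OF lin_mult_right lin_plinear]")
 finally show "tc (sng uv 1) (nf (mm (sng uv 1)))" by (simp add: uv)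
qed (auto intro: lin_comp[OF lin_mm lin_nf])

lemma mm_zero_iff: "f : supp KK ==> mm f = 0 \<longleftrightarrow> f : tensor_rel PM PN"
 using tc_nf_mm[of f] mm_tensor_rel by (auto simp: lin_0[OF lin_nf] tc_def)

lemma mm_VV: "f : supp KK ==> mm f : VV (m + n)"
 unfolding VV_def by (rule lin_supp[OF lin_mm]) (auto simp: VV_def[symmetric] intro!: VV_mult PH_VV)

lemma mm_nf: "w : VV (m + n) ==> mm (nf w) = w & nf w : supp KK"
proof
 assume w: "w : VV (m + n)"
 show "mm (nf w) = w"
 proof (rule VV_eqI[where F = "%w. mm (nf w)" and G = "%w. w", OF _ _ w])
  fix l assume "l : L (m + n)"
  then show "mm (nf (sng l 1)) = sng l 1"
   by (simp add: nf_def VV_single L_take L_drop vm_mult)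
 qed (auto intro: lin_comp[OF lin_nf lin_mm])
 show "nf w : supp KK"
  by (rule lin_supp[OF lin_nf w[unfolded VV_def]]) (auto simp: nf_def intro!: supp_single PS_carr VV_single L_take L_drop)
qed

lemma tensor_class_alt: "tensor_class PM PN f = {g : supp KK. tc g f}"
 by (auto simp: tensor_class_def supp_def tc_def)
lemma tensor_class_eq: "f : supp KK ==> tensor_class PM PN f = tensor_class PM PN g \<longleftrightarrow> tc f g"
 unfolding tensor_class_alt using tc_sym tc_trans tc_refl by blast
lemma tensor_UN:
 assumes "f : supp KK" "\<And>g. g : supp KK ==> tc g f ==> T g : supp KK & tc (T g) (T f)"
 shows "(\<Union>g\<in>tensor_class PM PN f. tensor_class PM PN (T g)) = tensor_class PM PN (T f)"
proof -
 have "tensor_class PM PN (T g) = tensor_class PM PN (T f)" if "g : tensor_class PM PN f" for g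
  using that assms(2)[of g] tensor_class_eq[of "T g" "T f"] by (auto simp: tensor_class_alt[of f])
 moreover have "f : tensor_class PM PN f" using assms(1) by (simp add: tensor_class_alt)
 ultimately show ?thesis by blast
qed

definition fm where "fm T = PS (m + n) (mm (SOME f. f : T))"

lemma fm_class: "f : supp KK ==> fm (tensor_class PM PN f) = PS (m + n) (mm f)"
proof -
 assume f: "f : supp KK"
 then have "(SOME g. g : tensor_class PM PN f) : tensor_class PM PN f"
  by (intro someI[of "%g. g : tensor_class PM PN f" f]) (simp add: tensor_class_alt)
 then have "tc (SOME g. g : tensor_class PM PN f) f" by (simp add: tensor_class_alt)
 then have "mm (SOME g. g : tensor_class PM PN f) = mm f"
  using mm_tensor_rel[of "(SOME g. g : tensor_class PM PN f) - f"] by (simp add: tc_def lin_diff[OF lin_mm])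
 then show ?thesis by (simp add: fm_def)
qed

lemma fm_pure: "u : carr (Pol A m) ==> v : carr (Pol A n) ==> fm (pure_tensor PM PN u v) = PS (m + n) (PH m u * PH n v)"
 unfolding pure_tensor_def by (subst fm_class) (auto intro!: supp_single)

text \<open>Injectivity is \<open>mm_zero_iff\<close> applied to a difference of representatives,
  surjectivity is given by \<open>nf\<close>.\<close>

lemma fm_even_iso: "even_iso (smod_tensor PM PN) (smodule.truncate (Pol A (m + n))) fm"
proof -
 have C: "carr (smod_tensor PM PN) = tensor_class PM PN ` supp KK" by (simp add: smod_tensor_def supp_def)
 have a: "add (smod_tensor PM PN) (tensor_class PM PN f) (tensor_class PM PN g) = tensor_class PM PN (f + g)"
  if "f : supp KK" "g : supp KK" for f g
 proof -
  have "(\<Union>g\<in>tensor_class PM PN g. tensor_class PM PN (f' + g)) = tensor_class PM PN (f' + g)" if f': "f' : supp KK" for f'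
   by (rule tensor_UN) (use that \<open>g : supp KK\<close> in "auto intro: supp_add tc_add")
  moreover have "(\<Union>f'\<in>tensor_class PM PN f. tensor_class PM PN (f' + g)) = tensor_class PM PN (f + g)"
   by (rule tensor_UN[where T = "%f. f + g"]) (use that in "auto intro: supp_add tc_add")
  ultimately show ?thesis by (simp add: smod_tensor_def) (auto simp: tensor_class_alt[of f])
 qed
 have s: "smul (smod_tensor PM PN) c (tensor_class PM PN f) = tensor_class PM PN (pscale c f)"
  if "f : supp KK" for c f
  unfolding smod_tensor_def by simp (rule tensor_UN[where T = "pscale c"]; use that in "auto intro: supp_pscale tc_pscale")
 have hom: "smod_hom (smod_tensor PM PN) (smodule.truncate (Pol A (m + n))) fm"
  unfolding smod_hom_def C truncate_simps
 proof (intro conjI ballI allI; elim imageE)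
  fix T f assume "T = tensor_class PM PN f" "f : supp KK"
  then show "fm T : carr (Pol A (m + n))" by (simp add: fm_class PS_carr mm_VV)
 next
  fix T f T' f' assume "T = tensor_class PM PN f" "f : supp KK" "T' = tensor_class PM PN f'" "f' : supp KK"
  then show "fm (add (smod_tensor PM PN) T T') = add (Pol A (m + n)) (fm T) (fm T')"
   by (simp add: a fm_class supp_add lin_add[OF lin_mm] PS_add mm_VV)
 next
  fix c T f assume "T = tensor_class PM PN f" "f : supp KK"
  then show "fm (smul (smod_tensor PM PN) c T) = smul (Pol A (m + n)) c (fm T)"
   by (simp add: s fm_class supp_pscale lin_pscale[OF lin_mm] PS_scale mm_VV)
 qed
 have par: "fm T : homog (Pol A (m + n)) p" if "T : homog (smod_tensor PM PN) p" for T p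
 proof -
  let ?H = "\<Union>q. homog (Pol A m) q \<times> homog (Pol A n) (p - q)"
  from that obtain f where f: "T = tensor_class PM PN f" "f : supp ?H" by (auto simp: smod_tensor_def supp_def)
  have "?H <= KK" by (auto simp: PH_homog)
  then have f': "f : supp KK" using f(2) supp_mono by blast
  have "mm f : HV p" unfolding HV_def
  proof (rule lin_supp[OF lin_mm f(2)])
   fix uv assume "uv : ?H"
   then obtain u v q where "uv = (u, v)" "u : homog (Pol A m) q" "v : homog (Pol A n) (p - q)" by auto
   then show "mm (sng uv 1) : supp {l. lpar l = p}"
   using HV_mult[of "PH m u" q "PH n v" "p - q"] by (auto simp: PH_homog HV_def)
  qed
  then show ?thesis using f' by (simp add: f(1) fm_class PH_homog PS_carr mm_VV)
 qed
 have "inj_on fm (tensor_class PM PN ` supp KK)"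
 proof (rule inj_onI, elim imageE)
  fix T T' f g assume *: "fm T = fm T'" "T = tensor_class PM PN f" "T' = tensor_class PM PN g" "f : supp KK" "g : supp KK"
  then have "mm f = mm g" using PH_PS[OF mm_VV] by (metis fm_class)
  then have "tc f g" using mm_zero_iff[OF supp_diff[OF *(4,5)]] by (simp add: tc_def lin_diff[OF lin_mm])
  then show "T = T'" using * tensor_class_eq by simp
 qed
 moreover have "fm ` (tensor_class PM PN ` supp KK) = carr (Pol A (m + n))"
 proof (intro equalityI subsetI)
  fix w assume w: "w : carr (Pol A (m + n))"
  then have "fm (tensor_class PM PN (nf (PH (m + n) w))) = w"
   using mm_nf[OF PH_VV[OF w]] by (simp add: fm_class)
  then show "w : fm ` (tensor_class PM PN ` supp KK)" using mm_nf[OF PH_VV[OF w]] by (metis imageI)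
 qed (auto simp: fm_class intro!: PS_carr mm_VV)
 ultimately show ?thesis
  unfolding even_iso_def smod_hom_parity_def bij_betw_def C using hom par by simp
qed

text \<open>The vacuum factors as \<open>vac m * vac n\<close>; the shifted \<open>g\<close> acts on
  the right factor, then \<open>f\<close> on the left one, so juxtaposition of polynomials is
  concatenation of words in the model.\<close>

lemma pol_juxt_PS:
 assumes "u : carr (Pol A m)" "v : carr (Pol A n)"
 shows "pol_juxt A m n u v = PS (m + n) (PH m u * PH n v)"
proof -
 obtain f g where fg: "f : falg_on m" "u = pol_class A m f" "g : falg_on n" "v = pol_class A n g"
  using assms by (auto simp: Pol_carr)
 have F: "f * falg_relabel (%j. j + m) g : falg_on (m + n)" if "f : falg_on m" "g : falg_on n" for f g
  using that by (intro falg_on_closed falg_on_mono[of m "m + n" f] falg_relabel_falg_on[of g n]) auto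
 have P: "PHI (m + n) (f * falg_relabel (%j. j + m) g) = PHI m f * PHI n g" if "f : falg_on m" "g : falg_on n" for f g
 proof -
  have v: "vac (m + n) : VV (m + n)" by (rule vac_VV)
  have "act (falg_relabel (%j. j + m) g) (vac (m + n)) = vac m * PHI n g"
   unfolding act_shift[OF that(2) v] unfolding vac_simps(3)
   by (subst tens_mult[OF lin_id(1) lin_act vac_VV vac_HV]) (simp add: PHI_def)
  then have "PHI (m + n) (f * falg_relabel (%j. j + m) g) = act f (vac m * PHI n g)" by (simp add: PHI_def act_mult)
  also have "... = PHI m f * PHI n g"
   unfolding act_left[OF that(1) VV_mult[OF vac_VV PHI_VV[OF that(2)]]]
   by (subst tens_mult[OF lin_act lin_id(1) vac_VV vac_HV]) (simp add: PHI_def)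
  finally show ?thesis .
 qed
 have "pol_juxt A m n u v = pol_class A (m + n) (f * falg_relabel (%j. j + m) g)"
  unfolding pol_juxt_def fg(2,4)
  by (rule pol_class_UN2[where T = "%f g. f * falg_relabel (%j. j + m) g", OF fg(1,3)])
   (use fg in "auto simp: pc_iff_PHI F P")
 also have "... = PS (m + n) (PH m u * PH n v)"
  unfolding PS_def fg(2,4) PH_class[OF fg(1)] PH_class[OF fg(3)] P[OF fg(1,3), symmetric]
  by (rule pol_class_pc[OF pc_psi_PHI[OF F[OF fg(1,3)]]])
 finally show ?thesis .
qed

end

end

context frobenius_superalgebra begin

section \<open>The functor and its values\<close>

definition on_morf :: "('k, 'a) law_term set => ('k, 'a) falg set => ('k, 'a) falg set" where
 "on_morf F u = (let t = (SOME t. t : F) in PS (nI (tgt t)) (ev t (PH (nI (src t)) u)))"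

definition Pfun :: "('k, ('k, 'a) law_ob, ('k, 'a) law_term set, ('k, 'a) falg set) smod_functor" where
 "Pfun = \<lparr>on_ob = (%X. smodule.truncate (Pol A (nI X))), on_mor = on_morf,
   fmu = (%X Y. fm (nI X) (nI Y)), feta = (%c. PS 0 (pscale c 1))\<rparr>"

lemma Pfun_simps [simp]: "on_ob Pfun X = smodule.truncate (Pol A (nI X))" "on_mor Pfun = on_morf"
 "fmu Pfun X Y = fm (nI X) (nI Y)" "feta Pfun c = PS 0 (pscale c 1)"
 by (simp_all add: Pfun_def)

text \<open>Soundness makes the choice of a term in the class irrelevant.\<close>

lemma on_morf_cl:
 assumes "law_arr A f X Y" "u : carr (Pol A (nI X))"
 shows "on_morf (cl f) u = PS (nI Y) (ev f (PH (nI X) u))"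
proof -
 have f: "wt f" "src f = X" "tgt f = Y" using assms by (auto simp: law_arr_iff)
 have "(SOME t. t : cl f) : cl f" by (rule someI[of "%t. t : cl f" f]) (rule cl_mem[OF f(1)])
 from cl_memD[OF this] show ?thesis
  using soundness[OF _ PH_VV[OF assms(2)], of Y f "SOME t. t : cl f"] f by (simp add: on_morf_def Let_def)
qed

lemma ev_VV': "law_arr A f X Y ==> v : VV (nI X) ==> ev f v : VV (nI Y)"
 using ev_VV by (auto simp: law_arr_iff)

lemma PH_on_morf:
 assumes "law_arr A f X Y" "u : carr (Pol A (nI X))"
 shows "PH (nI Y) (on_morf (cl f) u) = ev f (PH (nI X) u) & on_morf (cl f) u : carr (Pol A (nI Y))"
 using ev_VV'[OF assms(1) PH_VV[OF assms(2)]] by (simp add: on_morf_cl[OF assms] PS_carr)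

lemma Pol_eqI: "u : carr (Pol A n) ==> v : carr (Pol A n) ==> PH n u = PH n v ==> u = v"
 using PH_inj by blast

lemma on_morf_smod_hom:
 assumes f: "law_arr A f X Y"
 shows "smod_hom (smodule.truncate (Pol A (nI X))) (smodule.truncate (Pol A (nI Y))) (on_morf (cl f))"
 unfolding smod_hom_def truncate_simps
proof (intro conjI ballI allI)
 have l: "lin (ev f)" using f by (simp add: law_arr_iff ev_lin)
 show "on_morf (cl f) u : carr (Pol A (nI Y))" if "u : carr (Pol A (nI X))" for u
  using PH_on_morf[OF f that] by simp
 show "on_morf (cl f) (add (Pol A (nI X)) u v) = add (Pol A (nI Y)) (on_morf (cl f) u) (on_morf (cl f) v)"
  if "u : carr (Pol A (nI X))" "v : carr (Pol A (nI X))" for u v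
  using PH_on_morf[OF f] that by (intro Pol_eqI[of _ "nI Y"]) (simp_all add: PH_add lin_add[OF l])
 show "on_morf (cl f) (smul (Pol A (nI X)) c u) = smul (Pol A (nI Y)) c (on_morf (cl f) u)"
  if "u : carr (Pol A (nI X))" for c u
  using PH_on_morf[OF f] that by (intro Pol_eqI[of _ "nI Y"]) (simp_all add: PH_smul lin_pscale[OF l])
qed

lemma PH_unit: "PH 0 (unt (Pol A 0)) = 1" "unt (Pol A 0) : carr (Pol A 0)"
 by (auto simp: Pol_unt PH_class PHI_1 vac_simps Pol_carr)

lemma VV_0: "v : VV 0 ==> \<exists>c. v = pscale c 1"
proof -
 assume "v : VV 0"
 then have "kys v <= {[]}" by (simp add: VV_def supp_def L_0)
 then have "v = sng [] (lkp v [])"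
  by (intro poly_mapping_eqI) (auto simp: lookup_single when_def in_keys_iff)
 then show ?thesis by (metis mult.right_neutral one_single_Nil pscale_simps(5))
qed

lemma PS_scalar_1: "pscale c 1 : VV 0" "pscale c 1 : HV 0"
 using one_VV by simp_all

lemma feta_iso: "even_iso ground_smod (smodule.truncate (Pol A 0)) (%c. PS 0 (pscale c 1))"
proof -
 have hom: "smod_hom ground_smod (smodule.truncate (Pol A 0)) (%c. PS 0 (pscale c 1))"
  unfolding smod_hom_def truncate_simps ground_smod_def using one_VV
  by (auto simp: PS_carr pscale_add_left PS_add PS_scale[symmetric])
 moreover have "PS 0 (pscale c 1) : homog (Pol A 0) q" if "c : homog ground_smod q" for c q
  using that one_VV by (cases "q = 0") (auto simp: ground_smod_def PH_homog PS_carr split: if_splits)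
 moreover have "inj (%c. PS 0 (pscale c 1))"
 proof (rule injI)
  fix c d assume "PS 0 (pscale c 1) = PS 0 (pscale d 1)"
  then have "pscale c 1 = (pscale d 1 :: ('a \<times> nat) list \<Rightarrow>\<^sub>0 'k)"
   using PH_PS PS_scalar_1 by metis
  from arg_cong[where f = "%v. lkp v []", OF this] show "c = d" by (simp add: one_single_Nil)
 qed
 moreover have "range (%c. PS 0 (pscale c 1)) = carr (Pol A 0)"
 proof (intro equalityI subsetI)
  fix u assume u: "u : carr (Pol A 0)"
  then obtain c where "PH 0 u = pscale c 1" using VV_0[OF PH_VV] by blast
  then have "u = PS 0 (pscale c 1)" using PS_PH[OF u] by simp
  then show "u : range (%c. PS 0 (pscale c 1))" by blast
 qed (auto intro!: PS_carr PS_scalar_1)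
 ultimately show ?thesis
  unfolding even_iso_def smod_hom_parity_def bij_betw_def by (auto simp: ground_smod_def)
qed

lemma Pfun_monoidal: "monoidal_functor (LAW A) Pfun"
 unfolding monoidal_functor_def LAW_simps Pfun_simps truncate_simps
proof (intro conjI ballI allI)
 fix X :: "('k, 'a) law_ob" show "supermodule (smodule.truncate (Pol A (nI X)))" by (rule Pol_supermodule)
next
 fix X Y F assume "F : carr (Hom (LAW A) X Y)"
 then obtain f where f: "law_arr A f X Y" "F = cl f" by (auto simp: LAW_simps)
 then show "smod_hom (smodule.truncate (Pol A (nI X))) (smodule.truncate (Pol A (nI Y))) (on_morf F)"
  using on_morf_smod_hom by simp
next
 fix X Y p F assume "F : homog (Hom (LAW A) X Y) p"
 then obtain f where f: "law_arr A f X Y" "law_homog A f p" "F = cl f" by (auto simp: LAW_simps)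
 have w: "wt f" "src f = X" "tgt f = Y" using f by (auto simp: law_arr_iff)
 have "smod_hom (smodule.truncate (Pol A (nI X))) (smodule.truncate (Pol A (nI Y))) (on_morf F)"
  using on_morf_smod_hom[OF f(1)] f(3) by simp
 moreover have "on_morf F u : homog (Pol A (nI Y)) (p + q)" if "u : homog (Pol A (nI X)) q" for u q
  using that PH_on_morf[OF f(1), of u] opar_HV[OF ev_opar[OF f(2) w(1)] ev_lin[OF w(1)] _, of "PH (nI X) u" q] w
  by (simp add: PH_homog f(3) PH_VV)
 ultimately show "smod_hom_parity (smodule.truncate (Pol A (nI X))) (smodule.truncate (Pol A (nI Y))) p (on_morf F)"
  by (simp add: smod_hom_parity_def)
next
 fix X Y F G u assume "F : carr (Hom (LAW A) X Y)" "G : carr (Hom (LAW A) X Y)" and u: "u : carr (Pol A (nI X))"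
 then obtain f g where f: "law_arr A f X Y" "F = cl f" and g: "law_arr A g X Y" "G = cl g" by (auto simp: LAW_simps)
 have fg: "law_arr A (Plus f g) X Y" using f g by (simp add: law_arr_iff)
 show "on_morf (add (Hom (LAW A) X Y) F G) u = add (Pol A (nI Y)) (on_morf F u) (on_morf G u)"
  using PH_on_morf[OF f(1) u] PH_on_morf[OF g(1) u] PH_on_morf[OF fg u] unfolding f(2) g(2) LAW_add[OF f(1) g(1)]
  by (intro Pol_eqI[of _ "nI Y"]) (simp_all add: PH_add)
next
 fix X Y c F u assume "F : carr (Hom (LAW A) X Y)" and u: "u : carr (Pol A (nI X))"
 then obtain f where f: "law_arr A f X Y" "F = cl f" by (auto simp: LAW_simps)
 have fc: "law_arr A (Scal c f) X Y" using f by (simp add: law_arr_iff)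
 show "on_morf (smul (Hom (LAW A) X Y) c F) u = smul (Pol A (nI Y)) c (on_morf F u)"
  using PH_on_morf[OF f(1) u] PH_on_morf[OF fc u] unfolding f(2) LAW_smul[OF f(1)]
  by (intro Pol_eqI[of _ "nI Y"]) (simp_all add: PH_smul)
next
 fix X u assume X: "X : OB" and u: "u : carr (Pol A (nI X))"
 have i: "law_arr A (Ident X) X X" using X by (simp add: law_arr_iff)
 show "on_morf (law_class A X X (Ident X)) u = u"
  unfolding law_class_cl[OF i] using PH_on_morf[OF i u] u by (intro Pol_eqI[of _ "nI X"]) auto
next
 fix X Y Z F G u assume "F : carr (Hom (LAW A) X Y)" "G : carr (Hom (LAW A) Y Z)" and u: "u : carr (Pol A (nI X))"
 then obtain f g where f: "law_arr A f X Y" "F = cl f" and g: "law_arr A g Y Z" "G = cl g" by (auto simp: LAW_simps)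
 have fg: "law_arr A (g \<odot> f) X Z" using f g by (simp add: law_arr_iff)
 show "on_morf (Cmp (LAW A) G F) u = on_morf G (on_morf F u)"
  using PH_on_morf[OF f(1) u] PH_on_morf[OF g(1)] PH_on_morf[OF fg u]
  unfolding f(2) g(2) cmp_def[symmetric] cl_cmp[symmetric] by (intro Pol_eqI[of _ "nI Z"]) auto
next
 fix X Y :: "('k, 'a) law_ob" show "even_iso (smod_tensor (smodule.truncate (Pol A (nI X))) (smodule.truncate (Pol A (nI Y))))
   (smodule.truncate (Pol A (nI (X @ Y)))) (fm (nI X) (nI Y))"
  using fm_even_iso by simp
next
 fix X X' Y Y' p q F G u v
 assume "F : carr (Hom (LAW A) X X')" "G : homog (Hom (LAW A) Y Y') q"
  and u: "u : homog (Pol A (nI X)) p" and v: "v : carr (Pol A (nI Y))"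
 then obtain f g where f: "law_arr A f X X'" "F = cl f" and g: "law_arr A g Y Y'" "law_homog A g q" "G = cl g" by (auto simp: LAW_simps)
 have fg: "law_arr A (f \<boxtimes> g) (X @ Y) (X' @ Y')" using f g by (simp add: law_arr_iff)
 have w: "wt f" "src f = X" "wt g" "src g = Y" using f g by (auto simp: law_arr_iff)
 have uv: "u : carr (Pol A (nI X))" "PH (nI X) u : HV p" using u by (auto simp: PH_homog)
 have uvV: "PH (nI X) u * PH (nI Y) v : VV (nI X + nI Y)" by (intro VV_mult PH_VV uv v)
 have PF: "PH (nI X') (on_morf F u) = ev f (PH (nI X) u)" "on_morf F u : carr (Pol A (nI X'))"
  "PH (nI Y') (on_morf G v) = ev g (PH (nI Y) v)" "on_morf G v : carr (Pol A (nI Y'))"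
  using PH_on_morf[OF f(1) uv(1)] PH_on_morf[OF g(1) v] by (auto simp: f(2) g(3))
 have eV: "ev f (PH (nI X) u) * ev g (PH (nI Y) v) : VV (nI X' + nI Y')"
  by (intro VV_mult ev_VV'[OF f(1)] ev_VV'[OF g(1)] PH_VV uv v)
 have "ev (f \<boxtimes> g) (PH (nI X) u * PH (nI Y) v) = ev f (PH (nI X) u) * twist p (ev g) (PH (nI Y) v)"
  using w by (simp add: tens_mult[OF ev_lin ev_lin PH_VV[OF uv(1)] uv(2)])
 \<comment> \<open>The Koszul sign of the tensor product of maps is exactly the twist built into
   \<open>tens\<close>.\<close>
 also have "twist p (ev g) (PH (nI Y) v) = pscale (ksgn p q) (ev g (PH (nI Y) v))"
  by (rule twist_opar[OF ev_lin[OF w(3)] ev_opar[OF g(2) w(3)]]) (use PH_VV[OF v] w in simp)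
 finally have E: "ev (f \<boxtimes> g) (PH (nI X) u * PH (nI Y) v) = pscale (ksgn q p) (ev f (PH (nI X) u) * ev g (PH (nI Y) v))"
  by (simp add: ksgn_comm)
 show "on_morf (TensMor (LAW A) F G) (fm (nI X) (nI Y) (pure_tensor (smodule.truncate (Pol A (nI X))) (smodule.truncate (Pol A (nI Y))) u v))
  = smul (Pol A (nI (X' @ Y'))) (ksgn q p) (fm (nI X') (nI Y')
   (pure_tensor (smodule.truncate (Pol A (nI X'))) (smodule.truncate (Pol A (nI Y'))) (on_morf F u) (on_morf G v)))"
  unfolding fm_pure[OF uv(1) v] fm_pure[OF PF(2,4)] PF(1,3) unfolding f(2) g(3) ten_def[symmetric] cl_ten[symmetric]
  using uvV eV PH_on_morf[OF fg, of "PS (nI X + nI Y) (PH (nI X) u * PH (nI Y) v)"] PS_carr[OF uvV] PS_carr[OF eV] E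
  by (intro Pol_eqI[of _ "nI X' + nI Y'"]) (simp_all add: PH_smul)
next
 fix X Y Z :: "('k, 'a) law_ob" and u v w assume u: "u : carr (Pol A (nI X))" and v: "v : carr (Pol A (nI Y))" and w: "w : carr (Pol A (nI Z))"
 have 1: "PH (nI X) u * PH (nI Y) v : VV (nI X + nI Y)" "PH (nI Y) v * PH (nI Z) w : VV (nI Y + nI Z)"
  by (intro VV_mult PH_VV u v w)+
 show "fm (nI (X @ Y)) (nI Z) (pure_tensor (smodule.truncate (Pol A (nI (X @ Y)))) (smodule.truncate (Pol A (nI Z)))
   (fm (nI X) (nI Y) (pure_tensor (smodule.truncate (Pol A (nI X))) (smodule.truncate (Pol A (nI Y))) u v)) w) =
  fm (nI X) (nI (Y @ Z)) (pure_tensor (smodule.truncate (Pol A (nI X))) (smodule.truncate (Pol A (nI (Y @ Z)))) u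
   (fm (nI Y) (nI Z) (pure_tensor (smodule.truncate (Pol A (nI Y))) (smodule.truncate (Pol A (nI Z))) v w)))"
  unfolding fm_pure[OF u v] fm_pure[OF v w] count_list_append
  unfolding fm_pure[OF PS_carr[OF 1(1)] w] fm_pure[OF u PS_carr[OF 1(2)]]
  by (simp add: 1 mult.assoc add.assoc)
next
 fix X :: "('k, 'a) law_ob" and c u assume u: "u : carr (Pol A (nI X))"
 have e: "PS 0 (pscale c 1) : carr (Pol A 0)" by (rule PS_carr) (rule PS_scalar_1)
 show "fm (nI ([] :: ('k, 'a) law_ob)) (nI X) (pure_tensor (smodule.truncate (Pol A (nI ([] :: ('k, 'a) law_ob)))) (smodule.truncate (Pol A (nI X))) (PS 0 (pscale c 1)) u)
   = smul (Pol A (nI X)) c u"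
  "fm (nI X) (nI ([] :: ('k, 'a) law_ob)) (pure_tensor (smodule.truncate (Pol A (nI X))) (smodule.truncate (Pol A (nI ([] :: ('k, 'a) law_ob)))) u (PS 0 (pscale c 1)))
   = smul (Pol A (nI X)) c u"
  using fm_pure[OF e u] fm_pure[OF u e] u PH_VV[OF u] PS_scalar_1
  by (simp_all add: PS_scale)
qed (use feta_iso in "simp add: Pfun_def")

lemma on_morf_values:
 shows "f : carr (Pol A 1) ==> on_morf (law_class A [II] [II] (Tok a)) f = mul (Pol A 1) (pol_class A 1 (mon [GA 1 a])) f"
  and "f : carr (Pol A 1) ==> on_morf (law_class A [II] [II] Dot) f = mul (Pol A 1) (pol_class A 1 (mon [GX 1])) f"
  and "g : carr (Pol A 2) ==> on_morf (law_class A [II, II] [II, II] Sig) g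
   = add (Pol A 2) (pol_swap A 2 1 g) (smul (Pol A 2) (- 1) (demazure A 2 1 g))"
  and "Q : ECR (Pol A 1) ==> f : carr (Pol A 1) ==> on_morf (law_class A [QQ Q, II] [II, QQ Q] (Rho Q)) f = f"
  and "Q : ECR (Pol A 1) ==> f : carr (Pol A 1) ==> on_morf (law_class A [II, QQ Q] [QQ Q, II] (Lam Q)) f = mul (Pol A 1) Q f"
proof -
 have arr: "law_arr A (Tok a) [II] [II]" "law_arr A Dot [II] [II]" "law_arr A Sig [II, II] [II, II]"
  "Q : ECR (Pol A 1) ==> law_arr A (Rho Q) [QQ Q, II] [II, QQ Q]"
  "Q : ECR (Pol A 1) ==> law_arr A (Lam Q) [II, QQ Q] [QQ Q, II]"
  by (simp_all add: law_arr_iff)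
 have w: "mon [GA 1 a] : falg_on 1" "mon [GX 1] : falg_on 1" by (auto intro!: falg_on_single simp: FW_Cons)
 show "on_morf (law_class A [II] [II] (Tok a)) f = mul (Pol A 1) (pol_class A 1 (mon [GA 1 a])) f" if f: "f : carr (Pol A 1)"
  using PH_on_morf[OF arr(1), of f] PH_mul[OF w(1) f] f gact_VV1[of "GA 1 a", OF _ PH_VV[OF f]]
  by (intro Pol_eqI[of _ 1]) (simp_all add: law_class_cl[OF arr(1)] del: gact.simps)
 show "on_morf (law_class A [II] [II] Dot) f = mul (Pol A 1) (pol_class A 1 (mon [GX 1])) f" if f: "f : carr (Pol A 1)"
  using PH_on_morf[OF arr(2), of f] PH_mul[OF w(2) f] f gact_VV1[of "GX 1", OF _ PH_VV[OF f]]
  by (intro Pol_eqI[of _ 1]) (simp_all add: law_class_cl[OF arr(2)] del: gact.simps)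
 show "on_morf (law_class A [QQ Q, II] [II, QQ Q] (Rho Q)) f = f" if Q: "Q : ECR (Pol A 1)" and f: "f : carr (Pol A 1)"
  using PH_on_morf[OF arr(4)[OF Q], of f] f
  by (intro Pol_eqI[of _ 1]) (simp_all add: law_class_cl[OF arr(4)[OF Q]])
 show "on_morf (law_class A [II, QQ Q] [QQ Q, II] (Lam Q)) f = mul (Pol A 1) Q f" if Q: "Q : ECR (Pol A 1)" and f: "f : carr (Pol A 1)"
 proof -
  note q = ECR_rep[OF Q]
  have "PH 1 (mul (Pol A 1) Q f) = act (qrep Q) (PH 1 f) & mul (Pol A 1) Q f : carr (Pol A 1)"
   using PH_mul[OF q(1) f] q(2) by simp
  then show ?thesis
   using PH_on_morf[OF arr(5)[OF Q], of f] f
   by (intro Pol_eqI[of _ 1]) (simp_all add: law_class_cl[OF arr(5)[OF Q]])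
 qed
 show "on_morf (law_class A [II, II] [II, II] Sig) g
   = add (Pol A 2) (pol_swap A 2 1 g) (smul (Pol A 2) (- 1) (demazure A 2 1 g))" if g: "g : carr (Pol A 2)"
 proof -
  obtain h where h: "h : falg_on 2" "g = pol_class A 2 h" using g by (auto simp: Pol_carr)
  have rel: "PHI 2 (falg_relabel tr12 f) = Sw (PHI 2 f)" if "f : falg_on 2" for f
   using Sw_act[OF that vac_VV] by (simp add: PHI_def Sw_vac)
  have s: "pol_swap A 2 1 g = pol_class A 2 (falg_relabel tr12 h)"
   unfolding pol_swap_def h(2) Suc_1 by (rule pol_class_UN[OF h(1)]) (simp add: pc_iff_PHI h(1) tr12_falg rel)
  have d: "demazure A 2 1 g = pol_class A 2 (dem h)"
   unfolding demazure_def h(2) dem_def[symmetric]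
   by (rule pol_class_UN[OF h(1)]) (simp add: pc_iff_PHI h(1) dem_falg_on PHI_dem)
  have c: "pol_class A 2 f : carr (Pol A 2)" if "f : falg_on 2" for f using that by (auto simp: Pol_carr)
  show ?thesis unfolding law_class_cl[OF arr(3)] s d
   using PH_on_morf[OF arr(3), of g] g h c[OF tr12_falg[OF h(1)]] c[OF dem_falg_on[OF h(1)]]
   by (intro Pol_eqI[of _ 2]) (simp_all add: PH_add PH_smul PH_class tr12_falg dem_falg_on rel PHI_dem tau_def pscale_uminus)
 qed
qed

end

section \<open>Whiskering calculus\<close>

context frobenius_superalgebra begin

definition idm where "idm X = cl (Ident X)"
definition nul where "nul X Y = cl (Nul X Y)"
text \<open>Whiskering by identities on both sides. Composites of whiskered generators are easier to
  rearrange than nested tensor products, to which \<open>ten_decomp\<close> reduces.\<close>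

definition wh where "wh W F W' = ten (idm W) (ten F (idm W'))"

definition hm where "hm X Y = {F. \<exists>f. law_arr A f X Y & F = cl f}"
definition hmg where "hmg X Y p = {F. \<exists>f. law_arr A f X Y & law_homog A f p & F = cl f}"

lemma hmg_hm: "F : hmg X Y p ==> F : hm X Y" by (auto simp: hm_def hmg_def)

lemma cl_wh: "cl (Ident W \<boxtimes> f \<boxtimes> Ident W') = wh W (cl f) W'" by (simp add: wh_def idm_def cl_ten)

lemma mem_cmp: "t : cmp G F \<longleftrightarrow> (\<exists>g\<in>G. \<exists>f\<in>F. t : cl (g \<odot> f))" by (auto simp: cmp_alt)
text \<open>The defining term of an intermediate class may stand for all of its members. In the
  ill-typed case both sides are false.\<close>

lemma cl_sat1: "(\<exists>k\<in>cl s. t : cl (k \<odot> f)) \<longleftrightarrow> t : cl (s \<odot> f)"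
proof
 assume "t : cl (s \<odot> f)"
 then have "wt (s \<odot> f)" using cl_memD by blast
 then show "\<exists>k\<in>cl s. t : cl (k \<odot> f)" using \<open>t : cl (s \<odot> f)\<close> cl_mem[of s] by auto
qed (auto simp: cl_cmp dest: cl_of_mem)
lemma cl_sat2: "(\<exists>k\<in>cl s. t : cl (f \<odot> k)) \<longleftrightarrow> t : cl (f \<odot> s)"
proof
 assume "t : cl (f \<odot> s)"
 then have "wt (f \<odot> s)" using cl_memD by blast
 then show "\<exists>k\<in>cl s. t : cl (f \<odot> k)" using \<open>t : cl (f \<odot> s)\<close> cl_mem[of s] by auto
qed (auto simp: cl_cmp dest: cl_of_mem)

lemma assoc_cl: "cl ((h \<odot> g) \<odot> f) = cl (h \<odot> g \<odot> f)"
proof (cases "wt ((h \<odot> g) \<odot> f)")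
 case True
 then show ?thesis by (intro cl_eqI[OF law_eq.comp_assoc]) (auto simp: law_arr_iff)
next
 case False
 then have "\<not> wt (h \<odot> g \<odot> f)" by auto
 then show ?thesis using False cl_ill by metis
qed

text \<open>This holds for arbitrary sets of terms, since ill-typed composites are empty on both
  sides, and can therefore be used as a rewrite rule without typing conditions.\<close>

lemma cmp_assoc: "cmp (cmp H G) F = cmp H (cmp G F)"
proof -
 have "t : cmp (cmp H G) F \<longleftrightarrow> (\<exists>h\<in>H. \<exists>g\<in>G. \<exists>f\<in>F. t : cl ((h \<odot> g) \<odot> f))" for t
 proof -
  have "t : cmp (cmp H G) F \<longleftrightarrow> (\<exists>h\<in>H. \<exists>g\<in>G. \<exists>f\<in>F. \<exists>k\<in>cl (h \<odot> g). t : cl (k \<odot> f))"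
   unfolding mem_cmp[of t] Bex_def[of "cmp H G"] mem_cmp by fast
  then show ?thesis by (simp only: cl_sat1)
 qed
 moreover have "t : cmp H (cmp G F) \<longleftrightarrow> (\<exists>h\<in>H. \<exists>g\<in>G. \<exists>f\<in>F. t : cl (h \<odot> g \<odot> f))" for t
 proof -
  have "t : cmp H (cmp G F) \<longleftrightarrow> (\<exists>h\<in>H. \<exists>g\<in>G. \<exists>f\<in>F. \<exists>k\<in>cl (g \<odot> f). t : cl (h \<odot> k))"
   unfolding mem_cmp[of t] Bex_def[of "cmp G F"] mem_cmp by fast
  then show ?thesis by (simp only: cl_sat2)
 qed
 ultimately show ?thesis by (auto simp: assoc_cl)
qed

lemmas term_ops = cl_pls[symmetric] cl_scl[symmetric] cl_cmp[symmetric] cl_ten[symmetric]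

lemma law_arr_rules:
 "law_arr A f X Y ==> law_arr A g Y Z ==> law_arr A (g \<odot> f) X Z"
 "law_arr A f X Y ==> law_arr A g X' Y' ==> law_arr A (f \<boxtimes> g) (X @ X') (Y @ Y')"
 "law_arr A f X Y ==> law_arr A g X Y ==> law_arr A (Plus f g) X Y"
 "law_arr A f X Y ==> law_arr A (Scal c f) X Y"
 "X : OB ==> law_arr A (Ident X) X X"
 by (auto simp: law_arr_iff)

lemma hm_obs: "F : hm X Y ==> X : OB & Y : OB"
 using wt_obs by (auto simp: hm_def law_arr_iff)

lemma cmp_hm: "F : hm X Y ==> G : hm Y Z ==> cmp G F : hm X Z"
 by (unfold hm_def mem_Collect_eq, elim exE conjE, rule exI, rule conjI, rule law_arr_rules(1), assumption, assumption?, simp only: cl_cmp)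
lemma ten_hm: "F : hm X Y ==> G : hm X' Y' ==> ten F G : hm (X @ X') (Y @ Y')"
 by (unfold hm_def mem_Collect_eq, elim exE conjE, rule exI, rule conjI, rule law_arr_rules(2), assumption, assumption?, simp only: cl_ten)
lemma pls_hm: "F : hm X Y ==> G : hm X Y ==> pls F G : hm X Y"
 by (unfold hm_def mem_Collect_eq, elim exE conjE, rule exI, rule conjI, rule law_arr_rules(3), assumption, assumption?, simp only: cl_pls)
lemma scl_hm: "F : hm X Y ==> scl c F : hm X Y"
 by (unfold hm_def mem_Collect_eq, elim exE conjE, rule exI, rule conjI, rule law_arr_rules(4), assumption, assumption?, simp only: cl_scl)
lemma idm_hm: "X : OB ==> idm X : hm X X"
 unfolding hm_def idm_def using law_arr_rules(5) by blast
lemma nul_hm: "X : OB ==> Y : OB ==> nul X Y : hm X Y"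
 unfolding hm_def nul_def by (auto simp: law_arr_iff intro!: exI[of _ "Nul X Y"])
lemma wh_hm: "F : hm X Y ==> W : OB ==> W' : OB ==> B = W @ X @ W' ==> C = W @ Y @ W' ==> wh W F W' : hm B C"
 unfolding wh_def by (auto intro!: ten_hm idm_hm)

lemma cmp_hmg: "F : hmg X Y p ==> G : hmg Y Z q ==> cmp G F : hmg X Z (q + p)"
 by (unfold hmg_def mem_Collect_eq, elim exE conjE, rule exI, rule conjI, rule law_arr_rules(1), assumption, assumption?, rule conjI, rule law_homog.intros(2), assumption, assumption?, simp only: cl_cmp)
lemma ten_hmg: "F : hmg X Y p ==> G : hmg X' Y' q ==> ten F G : hmg (X @ X') (Y @ Y') (p + q)"
 by (unfold hmg_def mem_Collect_eq, elim exE conjE, rule exI, rule conjI, rule law_arr_rules(2), assumption, assumption?, rule conjI, rule law_homog.intros(3), assumption, assumption?, simp only: cl_ten)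
lemma pls_hmg: "F : hmg X Y p ==> G : hmg X Y p ==> pls F G : hmg X Y p"
 by (unfold hmg_def mem_Collect_eq, elim exE conjE, rule exI, rule conjI, rule law_arr_rules(3), assumption, assumption?, rule conjI, rule law_homog.intros(5), assumption, assumption?, simp only: cl_pls)
lemma scl_hmg: "F : hmg X Y p ==> scl c F : hmg X Y p"
 by (unfold hmg_def mem_Collect_eq, elim exE conjE, rule exI, rule conjI, rule law_arr_rules(4), assumption, assumption?, rule conjI, rule law_homog.intros(6), assumption, assumption?, simp only: cl_scl)
lemma idm_hmg: "X : OB ==> idm X : hmg X X 0"
 unfolding hmg_def idm_def using law_arr_rules(5) law_homog.intros(1) by blast
lemma nul_hmg: "X : OB ==> Y : OB ==> nul X Y : hmg X Y p"
 unfolding hmg_def nul_def by (auto simp: law_arr_iff intro!: exI[of _ "Nul X Y"] law_homog.intros)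
lemma wh_hmg: "F : hmg X Y p ==> W : OB ==> W' : OB ==> B = W @ X @ W' ==> C = W @ Y @ W' ==> wh W F W' : hmg B C p"
 unfolding wh_def using ten_hmg[OF idm_hmg[of W] ten_hmg[of F X Y p "idm W'" W' W' 0]] idm_hmg by simp

lemma cmp_idm_left: "F : hm X Y ==> cmp (idm Y) F = F"
 by (unfold hm_def idm_def mem_Collect_eq, elim exE conjE, simp only: term_ops, rule cl_eqI, rule law_eq.comp_id_left; assumption?)
lemma cmp_idm_right: "F : hm X Y ==> cmp F (idm X) = F"
 by (unfold hm_def idm_def mem_Collect_eq, elim exE conjE, simp only: term_ops, rule cl_eqI, rule law_eq.comp_id_right; assumption?)
lemma pls_assoc: "F : hm X Y ==> G : hm X Y ==> H : hm X Y ==> pls (pls F G) H = pls F (pls G H)"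
 by (unfold hm_def mem_Collect_eq, elim exE conjE, simp only: term_ops, rule cl_eqI, rule law_eq.plus_assoc; assumption?)
lemma pls_comm: "F : hm X Y ==> G : hm X Y ==> pls F G = pls G F"
 by (unfold hm_def mem_Collect_eq, elim exE conjE, simp only: term_ops, rule cl_eqI, rule law_eq.plus_comm; assumption?)
lemma pls_nul_left: "F : hm X Y ==> pls (nul X Y) F = F"
 by (unfold hm_def nul_def mem_Collect_eq, elim exE conjE, simp only: term_ops, rule cl_eqI, rule law_eq.plus_zero; assumption?)
lemma pls_nul_right: "F : hm X Y ==> pls F (nul X Y) = F"
 using pls_nul_left[of F X Y] pls_comm[of F X Y "nul X Y"] nul_hm hm_obs[of F X Y] by simp
lemma pls_scl_neg: "F : hm X Y ==> pls F (scl (-1) F) = nul X Y"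
 by (unfold hm_def nul_def mem_Collect_eq, elim exE conjE, simp only: term_ops, rule cl_eqI, rule law_eq.plus_minus; assumption?)
lemma scl_pls: "F : hm X Y ==> G : hm X Y ==> scl c (pls F G) = pls (scl c F) (scl c G)"
 by (unfold hm_def mem_Collect_eq, elim exE conjE, simp only: term_ops, rule cl_eqI, rule law_eq.scal_plus; assumption?)
lemma pls_scl: "F : hm X Y ==> scl (c + d) F = pls (scl c F) (scl d F)"
 by (unfold hm_def mem_Collect_eq, elim exE conjE, simp only: term_ops, rule cl_eqI, rule law_eq.plus_scal; assumption?)
lemma scl_scl: "F : hm X Y ==> scl c (scl d F) = scl (c * d) F"
 by (unfold hm_def mem_Collect_eq, elim exE conjE, simp only: term_ops, rule cl_eqI, rule law_eq.eq_sym, rule law_eq.scal_scal; assumption?)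
lemma scl_one: "F : hm X Y ==> scl 1 F = F"
 by (unfold hm_def mem_Collect_eq, elim exE conjE, simp only: term_ops, rule cl_eqI, rule law_eq.scal_one; assumption?)
text \<open>Obtained from \<open>0 = 1 + (-1)\<close>: the axioms provide additive inverses, from
  which the vanishing of the 0 multiple is derived.\<close>

lemma scl_zero: assumes "F : hm X Y" shows "scl 0 F = nul X Y"
proof -
 have "scl (1 + - 1) F = pls (scl 1 F) (scl (- 1) F)" by (rule pls_scl[OF assms])
 then show ?thesis using scl_one[OF assms] pls_scl_neg[OF assms] by simp
qed
lemma scl_nul: "X : OB ==> Y : OB ==> scl c (nul X Y) = nul X Y"
 using scl_scl[OF nul_hm, of X Y c 0] scl_zero[OF nul_hm, of X Y] by simp
lemma cmp_pls_left: "F : hm X Y ==> G : hm Y Z ==> H : hm Y Z ==> cmp (pls G H) F = pls (cmp G F) (cmp H F)"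
 by (unfold hm_def mem_Collect_eq, elim exE conjE, simp only: term_ops, rule cl_eqI, rule law_eq.comp_plus_left; assumption?)
lemma cmp_pls_right: "F : hm X Y ==> G : hm X Y ==> H : hm Y Z ==> cmp H (pls F G) = pls (cmp H F) (cmp H G)"
 by (unfold hm_def mem_Collect_eq, elim exE conjE, simp only: term_ops, rule cl_eqI, rule law_eq.comp_plus_right; assumption?)
lemma cmp_scl_left: "F : hm X Y ==> G : hm Y Z ==> cmp (scl c G) F = scl c (cmp G F)"
 by (unfold hm_def mem_Collect_eq, elim exE conjE, simp only: term_ops, rule cl_eqI, rule law_eq.comp_scal_left; assumption?)
lemma cmp_scl_right: "F : hm X Y ==> G : hm Y Z ==> cmp G (scl c F) = scl c (cmp G F)"
 by (unfold hm_def mem_Collect_eq, elim exE conjE, simp only: term_ops, rule cl_eqI, rule law_eq.comp_scal_right; assumption?)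
lemma cmp_nul_right: assumes "G : hm Y Z" "X : OB" shows "cmp G (nul X Y) = nul X Z"
proof -
 have n: "nul X Y : hm X Y" using assms hm_obs nul_hm by blast
 have "cmp G (nul X Y) = cmp G (scl 0 (nul X Y))" using scl_zero[OF n] by simp
 also have "... = scl 0 (cmp G (nul X Y))" by (rule cmp_scl_right[OF n assms(1)])
 also have "... = nul X Z" by (rule scl_zero[OF cmp_hm[OF n assms(1)]])
 finally show ?thesis .
qed
lemma cmp_nul_left: assumes "F : hm X Y" "Z : OB" shows "cmp (nul Y Z) F = nul X Z"
proof -
 have n: "nul Y Z : hm Y Z" using assms hm_obs nul_hm by blast
 have "cmp (nul Y Z) F = cmp (scl 0 (nul Y Z)) F" using scl_zero[OF n] by simp
 also have "... = scl 0 (cmp (nul Y Z) F)" by (rule cmp_scl_left[OF assms(1) n])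
 also have "... = nul X Z" by (rule scl_zero[OF cmp_hm[OF assms(1) n]])
 finally show ?thesis .
qed

lemma ten_pls_left: "F : hm X Y ==> G : hm X Y ==> H : hm X' Y' ==> ten (pls F G) H = pls (ten F H) (ten G H)"
 by (unfold hm_def mem_Collect_eq, elim exE conjE, simp only: term_ops, rule cl_eqI, rule law_eq.tens_plus_left; assumption?)
lemma ten_pls_right: "F : hm X Y ==> G : hm X Y ==> H : hm X' Y' ==> ten H (pls F G) = pls (ten H F) (ten H G)"
 by (unfold hm_def mem_Collect_eq, elim exE conjE, simp only: term_ops, rule cl_eqI, rule law_eq.tens_plus_right; assumption?)
lemma ten_scl_left: "F : hm X Y ==> H : hm X' Y' ==> ten (scl c F) H = scl c (ten F H)"
 by (unfold hm_def mem_Collect_eq, elim exE conjE, simp only: term_ops, rule cl_eqI, rule law_eq.tens_scal_left; assumption?)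
lemma ten_scl_right: "F : hm X Y ==> H : hm X' Y' ==> ten H (scl c F) = scl c (ten H F)"
 by (unfold hm_def mem_Collect_eq, elim exE conjE, simp only: term_ops, rule cl_eqI, rule law_eq.tens_scal_right; assumption?)
lemma ten_assoc: "F : hm X X' ==> G : hm Y Y' ==> H : hm Z Z' ==> ten (ten F G) H = ten F (ten G H)"
 by (unfold hm_def mem_Collect_eq, elim exE conjE, simp only: term_ops, rule cl_eqI, rule law_eq.tens_assoc; assumption?)
lemma ten_idm: "X : OB ==> Y : OB ==> ten (idm X) (idm Y) = idm (X @ Y)"
 by (unfold idm_def, simp only: term_ops, rule cl_eqI, rule law_eq.tens_id; assumption?)
lemma ten_nil_left: "F : hm X Y ==> ten (idm []) F = F"
 by (unfold hm_def idm_def mem_Collect_eq, elim exE conjE, simp only: term_ops, rule cl_eqI, rule law_eq.tens_unit_left; assumption?)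
lemma ten_nil_right: "F : hm X Y ==> ten F (idm []) = F"
 by (unfold hm_def idm_def mem_Collect_eq, elim exE conjE, simp only: term_ops, rule cl_eqI, rule law_eq.tens_unit_right; assumption?)

lemma ten_cmp:
 assumes "F : hmg X X' p" "F' : hm X' X''" "G' : hm Y Y'" "G : hmg Y' Y'' q"
 shows "cmp (ten F' G) (ten F G') = scl (ksgn p q) (ten (cmp F' F) (cmp G G'))"
proof -
 obtain f where f: "law_arr A f X X'" "law_homog A f p" "F = cl f" using assms(1) unfolding hmg_def by blast
 obtain f' where f': "law_arr A f' X' X''" "F' = cl f'" using assms(2) unfolding hm_def by blast
 obtain g' where g': "law_arr A g' Y Y'" "G' = cl g'" using assms(3) unfolding hm_def by blast
 obtain g where g: "law_arr A g Y' Y''" "law_homog A g q" "G = cl g" using assms(4) unfolding hmg_def by blast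
 show ?thesis unfolding f(3) f'(2) g'(2) g(3)
  unfolding cl_scl[symmetric] cl_cmp[symmetric] cl_ten[symmetric]
  by (rule cl_eqI[OF law_eq.interchange[OF f(1) f'(1) g'(1) g(1) f(2) g(2)]])
qed

lemma ten_cmp_even:
 assumes "F : hmg X X' p" "F' : hm X' X''" "G' : hm Y Y'" "G : hmg Y' Y'' q" "p = 0 | q = 0"
 shows "cmp (ten F' G) (ten F G') = ten (cmp F' F) (cmp G G')"
proof -
 have "ksgn p q = (1 :: 'k)" using assms(5) by auto
 moreover have "ten (cmp F' F) (cmp G G') : hm (X @ Y) (X'' @ Y'')"
  by (intro ten_hm cmp_hm[OF hmg_hm[OF assms(1)] assms(2)] cmp_hm[OF assms(3) hmg_hm[OF assms(4)]])
 ultimately show ?thesis using ten_cmp[OF assms(1-4)] scl_one by simp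
qed

lemma tok_hmg: "u : grade A p ==> cl (Tok u) : hmg [II] [II] p"
 unfolding hmg_def law_arr_iff mem_Collect_eq by (rule exI[of _ "Tok u"]) (auto intro: law_homog.intros(8))

text \<open>The interchange axiom speaks of homogeneous morphisms only. Every term is a sum of an
  even and an odd one: tokens split along \<open>A\<close>, and composites and tensor products are
  regrouped by total parity.\<close>

lemma hm_split: assumes "F : hm X Y" obtains F0 F1 where "F0 : hmg X Y 0" "F1 : hmg X Y 1" "F = pls F0 F1"
proof -
 have "\<exists>F0\<in>hmg (src f) (tgt f) 0. \<exists>F1\<in>hmg (src f) (tgt f) 1. cl f = pls F0 F1" if "wt f" for f
  using that
 proof (induction f)
  case (Ident X)
  then have "cl (Ident X) = pls (idm X) (nul X X)" using pls_nul_right[OF idm_hm] by (simp add: idm_def)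
  then show ?case using idm_hmg nul_hmg Ident by (metis src.simps(1) tgt.simps(1) wt.simps(1))
 next
  case (Comp g f)
  then obtain F0 F1 G0 G1 where F: "F0 : hmg (src f) (tgt f) 0" "F1 : hmg (src f) (tgt f) 1" "cl f = pls F0 F1"
   and G: "G0 : hmg (tgt f) (tgt g) 0" "G1 : hmg (tgt f) (tgt g) 1" "cl g = pls G0 G1" by auto
  note m = hmg_hm[OF F(1)] hmg_hm[OF F(2)] hmg_hm[OF G(1)] hmg_hm[OF G(2)]
  note c = cmp_hm[OF m(1) m(3)] cmp_hm[OF m(1) m(4)] cmp_hm[OF m(2) m(3)] cmp_hm[OF m(2) m(4)]
  have "cl (g \<odot> f) = pls (pls (cmp G0 F0) (cmp G1 F0)) (pls (cmp G0 F1) (cmp G1 F1))"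
   unfolding cl_cmp F(3) G(3) cmp_pls_right[OF m(1,2) pls_hm[OF m(3,4)]] cmp_pls_left[OF m(1,3,4)] cmp_pls_left[OF m(2,3,4)] ..
  also have "... = pls (pls (cmp G0 F0) (cmp G1 F1)) (pls (cmp G1 F0) (cmp G0 F1))"
   using pls_assoc pls_comm c pls_hm by (smt (verit, best))
  finally have "cl (g \<odot> f) = pls (pls (cmp G0 F0) (cmp G1 F1)) (pls (cmp G1 F0) (cmp G0 F1))" .
  moreover have "pls (cmp G0 F0) (cmp G1 F1) : hmg (src (g \<odot> f)) (tgt (g \<odot> f)) 0"
   "pls (cmp G1 F0) (cmp G0 F1) : hmg (src (g \<odot> f)) (tgt (g \<odot> f)) 1"
   using cmp_hmg[OF F(1) G(1)] cmp_hmg[OF F(2) G(2)] cmp_hmg[OF F(1) G(2)] cmp_hmg[OF F(2) G(1)] by (auto intro!: pls_hmg)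
  ultimately show ?case by blast
 next
  case (Tens f g)
  then obtain F0 F1 G0 G1 where F: "F0 : hmg (src f) (tgt f) 0" "F1 : hmg (src f) (tgt f) 1" "cl f = pls F0 F1"
   and G: "G0 : hmg (src g) (tgt g) 0" "G1 : hmg (src g) (tgt g) 1" "cl g = pls G0 G1" by auto
  note m = hmg_hm[OF F(1)] hmg_hm[OF F(2)] hmg_hm[OF G(1)] hmg_hm[OF G(2)]
  note c = ten_hm[OF m(1) m(3)] ten_hm[OF m(1) m(4)] ten_hm[OF m(2) m(3)] ten_hm[OF m(2) m(4)]
  have "cl (f \<boxtimes> g) = pls (pls (ten F0 G0) (ten F0 G1)) (pls (ten F1 G0) (ten F1 G1))"
   unfolding cl_ten F(3) G(3) ten_pls_left[OF m(1,2) pls_hm[OF m(3,4)]] ten_pls_right[OF m(3,4,1)] ten_pls_right[OF m(3,4,2)] ..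
  also have "... = pls (pls (ten F0 G0) (ten F1 G1)) (pls (ten F0 G1) (ten F1 G0))"
   using pls_assoc pls_comm c pls_hm by (smt (verit, best))
  finally have "cl (f \<boxtimes> g) = pls (pls (ten F0 G0) (ten F1 G1)) (pls (ten F0 G1) (ten F1 G0))" .
  moreover have "pls (ten F0 G0) (ten F1 G1) : hmg (src (f \<boxtimes> g)) (tgt (f \<boxtimes> g)) 0"
   "pls (ten F0 G1) (ten F1 G0) : hmg (src (f \<boxtimes> g)) (tgt (f \<boxtimes> g)) 1"
   using ten_hmg[OF F(1) G(1)] ten_hmg[OF F(2) G(2)] ten_hmg[OF F(1) G(2)] ten_hmg[OF F(2) G(1)] by (auto intro!: pls_hmg)
  ultimately show ?case by blast
 next
  case (Nul X Y)
  then have "cl (Nul X Y) = pls (nul X Y) (nul X Y)" using pls_nul_right[OF nul_hm] by (simp add: nul_def)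
  then show ?case using nul_hmg Nul by (metis src.simps(4) tgt.simps(4) wt.simps(4))
 next
  case (Plus f g)
  then obtain F0 F1 G0 G1 where F: "F0 : hmg (src f) (tgt f) 0" "F1 : hmg (src f) (tgt f) 1" "cl f = pls F0 F1"
   and G: "G0 : hmg (src f) (tgt f) 0" "G1 : hmg (src f) (tgt f) 1" "cl g = pls G0 G1" by auto
  note m = hmg_hm[OF F(1)] hmg_hm[OF F(2)] hmg_hm[OF G(1)] hmg_hm[OF G(2)]
  have "cl (Plus f g) = pls (pls F0 F1) (pls G0 G1)" by (simp add: cl_pls F G)
  also have "... = pls (pls F0 G0) (pls F1 G1)"
   using pls_assoc pls_comm m pls_hm by (smt (verit, best))
  finally have "cl (Plus f g) = pls (pls F0 G0) (pls F1 G1)" .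
  then show ?case using pls_hmg[OF F(1) G(1)] pls_hmg[OF F(2) G(2)] by auto
 next
  case (Scal c f)
  then obtain F0 F1 where F: "F0 : hmg (src f) (tgt f) 0" "F1 : hmg (src f) (tgt f) 1" "cl f = pls F0 F1" by auto
  then have "cl (Scal c f) = pls (scl c F0) (scl c F1)" using scl_pls[OF hmg_hm[OF F(1)] hmg_hm[OF F(2)]] by (simp add: cl_scl)
  then show ?case using scl_hmg[OF F(1), of c] scl_hmg[OF F(2), of c] by (metis src.simps(6) tgt.simps(6))
 next
  case (Tok a)
  obtain u w where uw: "u : grade A 0" "w : grade A 1" "a = u + w" by (rule grade_split)
  have e: "cl (Plus (Scal 1 (Tok u)) (Scal 1 (Tok w))) = cl (Tok (frobenius_data.scl A 1 u + frobenius_data.scl A 1 w))"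
   by (rule cl_eqI[OF law_eq.tok_linear])
  have "cl (Tok a) = pls (scl 1 (cl (Tok u))) (scl 1 (cl (Tok w)))"
   using e unfolding uw(3) cl_pls cl_scl scale_one by (rule sym)
  moreover have "scl 1 (cl (Tok u)) : hmg [II] [II] 0" "scl 1 (cl (Tok w)) : hmg [II] [II] 1"
   by (rule scl_hmg[OF tok_hmg], rule uw)+
  ultimately show ?case by auto
 next
  case Sig
  have "cl Sig : hmg [II, II] [II, II] 0" by (auto simp: hmg_def law_arr_iff intro!: exI[of _ Sig] law_homog.intros)
  moreover have "nul [II, II] [II, II] : hmg [II, II] [II, II] 1" by (rule nul_hmg) auto
  ultimately show ?case using pls_nul_right[OF hmg_hm] by fastforce
 next
  case Dot
  have d: "cl Dot : hmg [II] [II] (eps A)" by (auto simp: hmg_def law_arr_iff intro!: exI[of _ Dot] law_homog.intros)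
  have n: "nul [II] [II] : hmg [II] [II] p" for p by (rule nul_hmg) auto
  show ?case
  proof (cases "eps A = 0")
   case True
   then show ?thesis using d n pls_nul_right[OF hmg_hm[OF d]] by (metis src.simps(9) tgt.simps(9))
  next
   case False
   then have "eps A = 1" by simp
   then show ?thesis using d n pls_nul_left[OF hmg_hm[OF d]] by (metis src.simps(9) tgt.simps(9))
  qed
 next
  case (Rho Q)
  then have "cl (Rho Q) : hmg [QQ Q, II] [II, QQ Q] 0" by (auto simp: hmg_def law_arr_iff intro!: exI[of _ "Rho Q"] law_homog.intros)
  moreover have "nul [QQ Q, II] [II, QQ Q] : hmg [QQ Q, II] [II, QQ Q] 1" using Rho by (intro nul_hmg) auto
  ultimately show ?case using pls_nul_right[OF hmg_hm] by fastforce
 next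
  case (Lam Q)
  then have "cl (Lam Q) : hmg [II, QQ Q] [QQ Q, II] 0" by (auto simp: hmg_def law_arr_iff intro!: exI[of _ "Lam Q"] law_homog.intros)
  moreover have "nul [II, QQ Q] [QQ Q, II] : hmg [II, QQ Q] [QQ Q, II] 1" using Lam by (intro nul_hmg) auto
  ultimately show ?case using pls_nul_right[OF hmg_hm] by fastforce
 qed
 then show ?thesis using assms that unfolding hm_def law_arr_iff by blast
qed

text \<open>With \<open>F\<close> even the sign is 1 for either parity of \<open>G\<close>, so
  \<open>G\<close> may be inhomogeneous: treat its two components separately.\<close>

lemma ten_cmp_left_even:
 assumes "F : hmg X X' 0" "F' : hm X' X''" "G' : hm Y Y'" "G : hm Y' Y''"
 shows "cmp (ten F' G) (ten F G') = ten (cmp F' F) (cmp G G')"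
proof -
 obtain G0 G1 where G: "G0 : hmg Y' Y'' 0" "G1 : hmg Y' Y'' 1" "G = pls G0 G1" by (rule hm_split[OF assms(4)])
 note m = hmg_hm[OF G(1)] hmg_hm[OF G(2)] hmg_hm[OF assms(1)]
 show ?thesis
  unfolding G(3) ten_pls_right[OF m(1,2) assms(2)] cmp_pls_left[OF assms(3) m(1,2)]
   cmp_pls_left[OF ten_hm[OF m(3) assms(3)] ten_hm[OF assms(2) m(1)] ten_hm[OF assms(2) m(2)]]
   ten_cmp_even[OF assms(1-3) G(1) disjI1[OF refl]] ten_cmp_even[OF assms(1-3) G(2) disjI1[OF refl]]
   ten_pls_right[OF cmp_hm[OF assms(3) m(1)] cmp_hm[OF assms(3) m(2)] cmp_hm[OF m(3) assms(2)]] ..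
qed

lemma ten_cmp_right_even:
 assumes "F : hm X X'" "F' : hm X' X''" "G' : hm Y Y'" "G : hmg Y' Y'' 0"
 shows "cmp (ten F' G) (ten F G') = ten (cmp F' F) (cmp G G')"
proof -
 obtain F0 F1 where F: "F0 : hmg X X' 0" "F1 : hmg X X' 1" "F = pls F0 F1" by (rule hm_split[OF assms(1)])
 note m = hmg_hm[OF F(1)] hmg_hm[OF F(2)] hmg_hm[OF assms(4)]
 show ?thesis
  unfolding F(3) ten_pls_left[OF m(1,2) assms(3)] cmp_pls_right[OF m(1,2) assms(2)]
   cmp_pls_right[OF ten_hm[OF m(1) assms(3)] ten_hm[OF m(2) assms(3)] ten_hm[OF assms(2) m(3)]]
   ten_cmp_even[OF F(1) assms(2-4) disjI2[OF refl]] ten_cmp_even[OF F(2) assms(2-4) disjI2[OF refl]]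
   ten_pls_left[OF cmp_hm[OF m(1) assms(2)] cmp_hm[OF m(2) assms(2)] cmp_hm[OF assms(3) m(3)]] ..
qed

lemma wh_cmp:
 assumes "F : hm X Y" "G : hm Y Z" "W : OB" "W' : OB"
 shows "wh W (cmp G F) W' = cmp (wh W G W') (wh W F W')"
proof -
 note i = idm_hm[OF assms(4)] idm_hm[OF assms(3)]
 have 1: "cmp (ten G (idm W')) (ten F (idm W')) = ten (cmp G F) (idm W')"
  unfolding ten_cmp_right_even[OF assms(1,2) i(1) idm_hmg[OF assms(4)]] cmp_idm_left[OF i(1)] ..
 show ?thesis
  unfolding wh_def
   ten_cmp_left_even[OF idm_hmg[OF assms(3)] i(2) ten_hm[OF assms(1) i(1)] ten_hm[OF assms(2) i(1)]] 1 cmp_idm_left[OF i(2)] ..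
qed

lemma wh_wh:
 assumes "F : hm X Y" "W : OB" "W' : OB" "W1 : OB" "W1' : OB"
 shows "wh W (wh W1 F W1') W' = wh (W @ W1) F (W1' @ W')"
proof -
 note i = idm_hm[OF assms(2)] idm_hm[OF assms(3)] idm_hm[OF assms(4)] idm_hm[OF assms(5)]
 show ?thesis
  unfolding wh_def ten_idm[OF assms(2,4), symmetric] ten_idm[OF assms(5,3), symmetric]
   ten_assoc[OF i(1) i(3) ten_hm[OF assms(1) ten_hm[OF i(4) i(2)]]]
   ten_assoc[OF i(3) ten_hm[OF assms(1) i(4)] i(2)] ten_assoc[OF assms(1) i(4) i(2)] ..
qed

lemma wh_idm: "W : OB ==> X : OB ==> W' : OB ==> wh W (idm X) W' = idm (W @ X @ W')"
 by (simp add: wh_def ten_idm)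
lemma wh_nil: "F : hm X Y ==> wh [] F [] = F"
 unfolding wh_def by (simp add: ten_nil_left ten_nil_right)
lemma wh_pls: "F : hm X Y ==> G : hm X Y ==> W : OB ==> W' : OB ==> wh W (pls F G) W' = pls (wh W F W') (wh W G W')"
proof -
 assume a: "F : hm X Y" "G : hm X Y" "W : OB" "W' : OB"
 note i = idm_hm[OF a(3)] idm_hm[OF a(4)]
 show ?thesis unfolding wh_def ten_pls_left[OF a(1,2) i(2)] ten_pls_right[OF ten_hm[OF a(1) i(2)] ten_hm[OF a(2) i(2)] i(1)] ..
qed
lemma wh_scl: "F : hm X Y ==> W : OB ==> W' : OB ==> wh W (scl c F) W' = scl c (wh W F W')"
proof -
 assume a: "F : hm X Y" "W : OB" "W' : OB"
 note i = idm_hm[OF a(2)] idm_hm[OF a(3)]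
 show ?thesis unfolding wh_def ten_scl_left[OF a(1) i(2)] ten_scl_right[OF ten_hm[OF a(1) i(2)] i(1)] ..
qed
lemma wh_nul: assumes "X : OB" "Y : OB" "W : OB" "W' : OB"
 shows "wh W (nul X Y) W' = nul (W @ X @ W') (W @ Y @ W')"
 using wh_scl[OF nul_hm[OF assms(1,2)] assms(3,4), of 0] scl_zero[OF nul_hm[OF assms(1,2)]]
  scl_zero[OF wh_hm[OF nul_hm[OF assms(1,2)] assms(3,4) refl refl]] by simp
lemma ten_wh_left: "F : hm X Y ==> W : OB ==> ten F (idm W) = wh [] F W"
 unfolding wh_def using ten_nil_left[OF ten_hm[OF _ idm_hm]] by simp
lemma ten_wh_right: "F : hm X Y ==> ten (idm W) F = wh W F []"
 unfolding wh_def by (simp add: ten_nil_right)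

lemma ten_decomp: assumes "F : hm X X'" "G : hm Y Y'"
 shows "ten F G = cmp (wh [] F Y') (wh X G [])"
proof -
 have o: "X : OB" "X' : OB" "Y : OB" "Y' : OB" using assms hm_obs by auto
 have "cmp (ten F (idm Y')) (ten (idm X) G) = ten (cmp F (idm X)) (cmp (idm Y') G)"
  by (rule ten_cmp_left_even[OF idm_hmg[OF o(1)] assms(1,2) idm_hm[OF o(4)]])
 then show ?thesis
  unfolding cmp_idm_right[OF assms(1)] cmp_idm_left[OF assms(2)] ten_wh_left[OF assms(1) o(4)] ten_wh_right[OF assms(2)] ..
qed

text \<open>Absorb the gap \<open>Z\<close> and the right margin into \<open>G\<close>, apply the
  interchange law to the two resulting tensor factors, and whisker by \<open>W\<close> at the
  end.\<close>

lemma wh_interchange: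
 assumes "F : hmg X X' p" "G : hmg Y Y' q" "W : OB" "Z : OB" "W' : OB"
 shows "cmp (wh W F (Z @ Y' @ W')) (wh (W @ X @ Z) G W') = scl (ksgn p q) (cmp (wh (W @ X' @ Z) G W') (wh W F (Z @ Y @ W')))"
proof -
 note m = hmg_hm[OF assms(1)] hmg_hm[OF assms(2)]
 have o: "X : OB" "X' : OB" "Y : OB" "Y' : OB" using m hm_obs by auto
 define G2 where "G2 = wh Z G W'"
 have G2: "G2 : hmg (Z @ Y @ W') (Z @ Y' @ W') q" unfolding G2_def by (rule wh_hmg[OF assms(2)]) (use assms in auto)
 note m2 = hmg_hm[OF G2]
 have oY: "Z @ Y @ W' : OB" "Z @ Y' @ W' : OB" using o assms by auto
 have b: "cmp (ten (idm X') G2) (ten F (idm (Z @ Y @ W'))) = scl (ksgn p q) (ten F G2)"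
  using ten_cmp[OF assms(1) idm_hm[OF o(2)] idm_hm[OF oY(1)] G2]
  unfolding cmp_idm_left[OF m(1)] cmp_idm_right[OF m2] .
 have a: "cmp (ten F (idm (Z @ Y' @ W'))) (ten (idm X) G2) = ten F G2"
  using ten_decomp[OF m(1) m2] unfolding ten_wh_left[OF m(1) oY(2), symmetric] ten_wh_right[OF m2, symmetric] by simp
 have ab: "cmp (wh [] F (Z @ Y' @ W')) (wh X G2 []) = scl (ksgn p q) (cmp (wh X' G2 []) (wh [] F (Z @ Y @ W')))"
  using a b scl_scl[OF ten_hm[OF m(1) m2], of "ksgn p q" "ksgn p q"] scl_one[OF ten_hm[OF m(1) m2]]
  unfolding ten_wh_left[OF m(1) oY(2)] ten_wh_left[OF m(1) oY(1)] ten_wh_right[OF m2] by simp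
 have c: "wh W (cmp (wh [] F (Z @ Y' @ W')) (wh X G2 [])) [] = cmp (wh W F (Z @ Y' @ W')) (wh (W @ X @ Z) G W')"
 proof -
  have "wh W (cmp (wh [] F (Z @ Y' @ W')) (wh X G2 [])) [] = cmp (wh W (wh [] F (Z @ Y' @ W')) []) (wh W (wh X G2 []) [])"
   by (rule wh_cmp[where X = "X @ Z @ Y @ W'" and Y = "X @ Z @ Y' @ W'" and Z = "X' @ Z @ Y' @ W'"]; (rule wh_hm[OF m2] wh_hm[OF m(1)])?; use o assms in auto)
  then show ?thesis
   using wh_wh[OF m(1), of W "[]" "[]" "Z @ Y' @ W'"] wh_wh[OF m2, of W "[]" X "[]"] wh_wh[OF m(2), of "W @ X" "[]" Z W'] o assms
   by (simp add: G2_def)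
 qed
 have d: "wh W (cmp (wh X' G2 []) (wh [] F (Z @ Y @ W'))) [] = cmp (wh (W @ X' @ Z) G W') (wh W F (Z @ Y @ W'))"
 proof -
  have "wh W (cmp (wh X' G2 []) (wh [] F (Z @ Y @ W'))) [] = cmp (wh W (wh X' G2 []) []) (wh W (wh [] F (Z @ Y @ W')) [])"
   by (rule wh_cmp[where X = "X @ Z @ Y @ W'" and Y = "X' @ Z @ Y @ W'" and Z = "X' @ Z @ Y' @ W'"]; (rule wh_hm[OF m2] wh_hm[OF m(1)])?; use o assms in auto)
  then show ?thesis
   using wh_wh[OF m(1), of W "[]" "[]" "Z @ Y @ W'"] wh_wh[OF m2, of W "[]" X' "[]"] wh_wh[OF m(2), of "W @ X'" "[]" Z W'] o assms
   by (simp add: G2_def)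
 qed
 have e: "cmp (wh X' G2 []) (wh [] F (Z @ Y @ W')) : hm (X @ Z @ Y @ W') (X' @ Z @ Y' @ W')"
  by (rule cmp_hm[where Y = "X' @ Z @ Y @ W'"]; (rule wh_hm[OF m2] wh_hm[OF m(1)])?; use o assms in auto)
 show ?thesis
  using arg_cong[where f = "%F. wh W F []", OF ab] unfolding c wh_scl[OF e assms(3) obs_simps(1)] d .
qed

lemma wh_interchange_left_even:
 assumes "F : hmg X X' 0" "G : hm Y Y'" "W : OB" "Z : OB" "W' : OB"
 shows "cmp (wh W F (Z @ Y' @ W')) (wh (W @ X @ Z) G W') = cmp (wh (W @ X' @ Z) G W') (wh W F (Z @ Y @ W'))"
proof -
 obtain G0 G1 where G: "G0 : hmg Y Y' 0" "G1 : hmg Y Y' 1" "G = pls G0 G1" by (rule hm_split[OF assms(2)])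
 note m = hmg_hm[OF assms(1)] hmg_hm[OF G(1)] hmg_hm[OF G(2)]
 have o: "X : OB" "X' : OB" "Y : OB" "Y' : OB" using m(1) assms(2) hm_obs by auto
 have h: "wh W F (Z @ Y' @ W') : hm (W @ X @ Z @ Y' @ W') (W @ X' @ Z @ Y' @ W')"
  "wh W F (Z @ Y @ W') : hm (W @ X @ Z @ Y @ W') (W @ X' @ Z @ Y @ W')"
  by (rule wh_hm[OF m(1)]; use o assms in auto)+
 have g: "wh (W @ X @ Z) G0 W' : hm (W @ X @ Z @ Y @ W') (W @ X @ Z @ Y' @ W')" "wh (W @ X @ Z) G1 W' : hm (W @ X @ Z @ Y @ W') (W @ X @ Z @ Y' @ W')"
  "wh (W @ X' @ Z) G0 W' : hm (W @ X' @ Z @ Y @ W') (W @ X' @ Z @ Y' @ W')" "wh (W @ X' @ Z) G1 W' : hm (W @ X' @ Z @ Y @ W') (W @ X' @ Z @ Y' @ W')"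
  by (rule wh_hm[OF m(2)] wh_hm[OF m(3)]; use o assms in auto)+
 have e: "cmp (wh W F (Z @ Y' @ W')) (wh (W @ X @ Z) G0 W') = cmp (wh (W @ X' @ Z) G0 W') (wh W F (Z @ Y @ W'))"
  using wh_interchange[OF assms(1) G(1) assms(3-5)] scl_one[OF cmp_hm[OF h(2) g(3)]] by simp
 have e': "cmp (wh W F (Z @ Y' @ W')) (wh (W @ X @ Z) G1 W') = cmp (wh (W @ X' @ Z) G1 W') (wh W F (Z @ Y @ W'))"
  using wh_interchange[OF assms(1) G(2) assms(3-5)] scl_one[OF cmp_hm[OF h(2) g(4)]] by simp
 have o2: "W @ X @ Z : OB" "W @ X' @ Z : OB" using o assms by auto
 show ?thesis
  unfolding G(3) wh_pls[OF m(2,3) o2(1) assms(5)] wh_pls[OF m(2,3) o2(2) assms(5)]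
   cmp_pls_right[OF g(1,2) h(1)] cmp_pls_left[OF h(2) g(3,4)] e e' ..
qed

text \<open>Typing by functions: \<open>hm\<close> mentions both objects explicitly, whereas domain
  and codomain as functions let the simplifier compute them for composite expressions.\<close>

definition ar where "ar F \<longleftrightarrow> (\<exists>f. wt f & F = cl f)"
definition dm where "dm F = src (SOME f. f : F)"
definition cd where "cd F = tgt (SOME f. f : F)"

lemma ar_cl: "wt f ==> ar (cl f) & dm (cl f) = src f & cd (cl f) = tgt f"
proof -
 assume w: "wt f"
 have "(SOME g. g : cl f) : cl f" by (rule someI[of _ f]) (rule cl_mem[OF w])
 then show ?thesis using w cl_memD unfolding ar_def dm_def cd_def by metis
qed

lemma hm_iff: "F : hm X Y \<longleftrightarrow> ar F & dm F = X & cd F = Y"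
proof
 assume "F : hm X Y"
 then obtain f where "wt f" "src f = X" "tgt f = Y" "F = cl f" unfolding hm_def law_arr_iff by blast
 then show "ar F & dm F = X & cd F = Y" using ar_cl by simp
next
 assume a: "ar F & dm F = X & cd F = Y"
 then obtain f where "wt f" "F = cl f" unfolding ar_def by blast
 then have "law_arr A f X Y" using ar_cl[of f] a by (simp add: law_arr_iff)
 then show "F : hm X Y" using \<open>F = cl f\<close> unfolding hm_def by blast
qed

lemma ar_obs [simp]: "ar F ==> dm F : OB" "ar F ==> cd F : OB"
 using hm_obs[of F "dm F" "cd F"] by (auto simp: hm_iff)
lemma ar_cmp [simp]: assumes "ar F" "ar G" "cd F = dm G"
 shows "ar (cmp G F)" "dm (cmp G F) = dm F" "cd (cmp G F) = cd G"
 using cmp_hm[of F "dm F" "cd F" G "cd G"] assms by (auto simp: hm_iff)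
lemma ar_ten [simp]: assumes "ar F" "ar G"
 shows "ar (ten F G)" "dm (ten F G) = dm F @ dm G" "cd (ten F G) = cd F @ cd G"
 using ten_hm[of F "dm F" "cd F" G "dm G" "cd G"] assms by (auto simp: hm_iff)
lemma ar_pls [simp]: assumes "ar F" "ar G" "dm F = dm G" "cd F = cd G"
 shows "ar (pls F G)" "dm (pls F G) = dm G" "cd (pls F G) = cd G"
 using pls_hm[of F "dm F" "cd F" G] assms by (auto simp: hm_iff)
lemma ar_scl [simp]: assumes "ar F"
 shows "ar (scl c F)" "dm (scl c F) = dm F" "cd (scl c F) = cd F"
 using scl_hm[of F "dm F" "cd F" c] assms by (auto simp: hm_iff)
lemma ar_idm [simp]: assumes "X : OB"
 shows "ar (idm X)" "dm (idm X) = X" "cd (idm X) = X"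
 using idm_hm[of X] assms by (auto simp: hm_iff)
lemma ar_nul [simp]: assumes "X : OB" "Y : OB"
 shows "ar (nul X Y)" "dm (nul X Y) = X" "cd (nul X Y) = Y"
 using nul_hm[of X Y] assms by (auto simp: hm_iff)
lemma ar_wh [simp]: assumes "ar F" "W : OB" "W' : OB"
 shows "ar (wh W F W')" "dm (wh W F W') = W @ dm F @ W'" "cd (wh W F W') = W @ cd F @ W'"
 using assms by (auto simp: wh_def)

lemma idm_cmp [simp]: "ar F ==> cd F = X ==> cmp (idm X) F = F" using cmp_idm_left[of F "dm F" X] by (simp add: hm_iff)
lemma cmp_idm [simp]: "ar F ==> dm F = X ==> cmp F (idm X) = F" using cmp_idm_right[of F X "cd F"] by (simp add: hm_iff)
lemma nul_cmp [simp]: "ar F ==> cd F = Y ==> Z : OB ==> cmp (nul Y Z) F = nul (dm F) Z"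
 using cmp_nul_left[of F "dm F" Y Z] by (simp add: hm_iff)
lemma cmp_nul [simp]: "ar G ==> dm G = Y ==> X : OB ==> cmp G (nul X Y) = nul X (cd G)"
 using cmp_nul_right[of G Y "cd G" X] by (simp add: hm_iff)
lemma pls_cmp: "ar F ==> ar G ==> ar H ==> cd F = dm G ==> dm G = dm H ==> cd G = cd H ==> cmp (pls G H) F = pls (cmp G F) (cmp H F)"
 using cmp_pls_left[of F "dm F" "dm G" G "cd G" H] by (simp add: hm_iff)
lemma cmp_pls: "ar F ==> ar G ==> ar H ==> dm F = dm G ==> cd F = cd G ==> cd F = dm H ==> cmp H (pls F G) = pls (cmp H F) (cmp H G)"
 using cmp_pls_right[of F "dm F" "cd F" G H "cd H"] by (simp add: hm_iff)
lemma scl_cmp [simp]: "ar F ==> ar G ==> cd F = dm G ==> cmp (scl c G) F = scl c (cmp G F)"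
 using cmp_scl_left[of F "dm F" "dm G" G "cd G" c] by (simp add: hm_iff)
lemma cmp_scl [simp]: "ar F ==> ar G ==> cd F = dm G ==> cmp G (scl c F) = scl c (cmp G F)"
 using cmp_scl_right[of F "dm F" "dm G" G "cd G" c] by (simp add: hm_iff)
lemma nul_pls [simp]: "ar F ==> dm F = X ==> cd F = Y ==> pls (nul X Y) F = F" using pls_nul_left[of F X Y] by (simp add: hm_iff)
lemma pls_nul [simp]: "ar F ==> dm F = X ==> cd F = Y ==> pls F (nul X Y) = F" using pls_nul_right[of F X Y] by (simp add: hm_iff)
lemma scl_scl' [simp]: "ar F ==> scl c (scl d F) = scl (c * d) F" using scl_scl[of F "dm F" "cd F"] by (simp add: hm_iff)
lemma scl_1 [simp]: "ar F ==> scl 1 F = F" using scl_one[of F "dm F" "cd F"] by (simp add: hm_iff)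
lemma cmp_wh: "ar F ==> ar G ==> cd F = dm G ==> W : OB ==> W' : OB ==> wh W (cmp G F) W' = cmp (wh W G W') (wh W F W')"
 using wh_cmp[of F "dm F" "dm G" G "cd G" W W'] by (simp add: hm_iff)
lemma wh_wh' [simp]: "ar F ==> W : OB ==> W' : OB ==> W1 : OB ==> W1' : OB ==> wh W (wh W1 F W1') W' = wh (W @ W1) F (W1' @ W')"
 using wh_wh[of F "dm F" "cd F" W W' W1 W1'] by (simp add: hm_iff)
lemma wh_nil' [simp]: "ar F ==> wh [] F [] = F" using wh_nil[of F "dm F" "cd F"] by (simp add: hm_iff)
lemma pls_wh: "ar F ==> ar G ==> dm F = dm G ==> cd F = cd G ==> W : OB ==> W' : OB ==> wh W (pls F G) W' = pls (wh W F W') (wh W G W')"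
 using wh_pls[of F "dm F" "cd F" G W W'] by (simp add: hm_iff)
lemma scl_wh [simp]: "ar F ==> W : OB ==> W' : OB ==> wh W (scl c F) W' = scl c (wh W F W')"
 using wh_scl[of F "dm F" "cd F" W W'] by (simp add: hm_iff)

definition hg where "hg p F \<longleftrightarrow> F : hmg (dm F) (cd F) p"
lemma hg_ar: "hg p F ==> ar F" unfolding hg_def using hmg_hm by (auto simp: hm_iff)
lemma hmg_hg: "F : hmg X Y p ==> hg p F" unfolding hg_def using hmg_hm[of F X Y p] by (auto simp: hm_iff)
lemma hg_cl: "wt f ==> law_homog A f p ==> hg p (cl f)"
 using ar_cl[of f] unfolding hg_def hmg_def law_arr_iff by auto
lemma hg_cmp: "hg p F ==> hg q G ==> cd F = dm G ==> hg (q + p) (cmp G F)"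
 using cmp_hmg[of F "dm F" "cd F" p G "cd G" q] hmg_hg unfolding hg_def by simp
lemma hg_wh: "hg p F ==> W : OB ==> W' : OB ==> hg p (wh W F W')"
 unfolding hg_def by (rule wh_hmg) (auto dest: hg_ar[unfolded hg_def])
lemma hg_idm: "X : OB ==> hg 0 (idm X)" using idm_hmg hmg_hg by blast

text \<open>The margins appear as variables with equations, so that the rule unifies with any
  bracketing of the object words.\<close>

lemma wh_swap:
 assumes "hg p F" "hg q G" "W : OB" "Z : OB" "W' : OB"
  "P = W @ dm F @ Z" "S = Z @ cd G @ W'" "P' = W @ cd F @ Z" "S' = Z @ dm G @ W'"
 shows "cmp (wh W F S) (wh P G W') = scl (ksgn p q) (cmp (wh P' G W') (wh W F S'))"
 using wh_interchange[of F "dm F" "cd F" p G "dm G" "cd G" q W Z W'] assms unfolding hg_def by simp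

lemma wh_swap_even:
 assumes "hg 0 F" "ar G" "W : OB" "Z : OB" "W' : OB"
  "P = W @ dm F @ Z" "S = Z @ cd G @ W'" "P' = W @ cd F @ Z" "S' = Z @ dm G @ W'"
 shows "cmp (wh W F S) (wh P G W') = cmp (wh P' G W') (wh W F S')"
 using wh_interchange_left_even[of F "dm F" "cd F" G "dm G" "cd G" W Z W'] assms hm_iff[of G "dm G" "cd G"] unfolding hg_def by simp

end

section \<open>Spanning sets for morphism spaces\<close>

context frobenius_superalgebra begin

abbreviation "sg \<equiv> cl Sig"
abbreviation "tk a \<equiv> cl (Tok a)"
abbreviation "dt \<equiv> cl Dot"
abbreviation "rh Q \<equiv> cl (Rho Q)"
abbreviation "lm Q \<equiv> cl (Lam Q)"

lemma cl_simps [simp]: "wt f ==> ar (cl f)" "wt f ==> dm (cl f) = src f" "wt f ==> cd (cl f) = tgt f"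
 using ar_cl by auto
lemma cl_Ident [simp]: "cl (Ident X) = idm X" by (simp add: idm_def)
lemma cl_Nul [simp]: "cl (Nul X Y) = nul X Y" by (simp add: nul_def)

lemma ten_idm_right [simp]: "ar F ==> W : OB ==> ten F (idm W) = wh [] F W"
 using ten_wh_left[of F "dm F" "cd F"] by (simp add: hm_iff)
lemma ten_idm_left [simp]: "ar F ==> ten (idm W) F = wh W F []"
 using ten_wh_right[of F "dm F" "cd F"] by (simp add: hm_iff)
lemma wh_idm' [simp]: "W : OB ==> X : OB ==> W' : OB ==> wh W (idm X) W' = idm (W @ X @ W')"
 by (rule wh_idm)
lemma wh_nul' [simp]: "X : OB ==> Y : OB ==> W : OB ==> W' : OB ==> wh W (nul X Y) W' = nul (W @ X @ W') (W @ Y @ W')"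
 by (rule wh_nul)
text \<open>Turns an equation for a composite of two into a rewrite rule inside right-nested
  composites.\<close>

lemma cmp_rw: "cmp F G = H ==> cmp F (cmp G K) = cmp H K" by (metis cmp_assoc)

lemma hg_gens: "hg 0 sg" "a : grade A p ==> hg p (tk a)" "hg (eps A) dt"
 "Q : ECR (Pol A 1) ==> hg 0 (rh Q)" "Q : ECR (Pol A 1) ==> hg 0 (lm Q)"
 by (auto intro!: hg_cl intro: law_homog.intros(7-11))

lemma rel_sig_sig: "cmp sg sg = idm [II, II]"
 using cl_eqI[OF law_eq.sig_sig] by (simp add: cl_cmp)
lemma rel_sig_tok: "cmp sg (wh [] (tk a) [II]) = cmp (wh [II] (tk a) []) sg"
 using cl_eqI[OF law_eq.sig_tok] by (simp add: cl_cmp cl_ten)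
lemma rel_braid: "cmp (wh [] sg [II]) (cmp (wh [II] sg []) (wh [] sg [II])) = cmp (wh [II] sg []) (cmp (wh [] sg [II]) (wh [II] sg []))"
 using cl_eqI[OF law_eq.braid] by (simp add: cl_cmp cl_ten)
lemma rel_tok_mult: "cmp (tk a) (tk b) = tk (a * b)"
 using cl_eqI[OF law_eq.tok_mult] by (simp add: cl_cmp)
lemma rel_tok_one: "tk 1 = idm [II]"
 using cl_eqI[OF law_eq.tok_one] by simp
lemma rel_tok_linear: "tk (frobenius_data.scl A c a + frobenius_data.scl A d b) = pls (scl c (tk a)) (scl d (tk b))"
 using cl_eqI[OF law_eq.tok_linear, of c a d b] by (simp add: cl_pls cl_scl)
lemma rel_tok_add: "tk (a + b) = pls (tk a) (tk b)"
 using rel_tok_linear[of 1 a 1 b] by simp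
lemma rel_tok_dot: "a : grade A p ==> cmp (tk a) dt = scl (ksgn (eps A) p) (cmp dt (tk (nak A a)))"
 using cl_eqI[OF law_eq.tok_dot] by (simp add: cl_cmp cl_scl)
lemma rel_lam_tok: "Q : ECR (Pol A 1) ==> cmp (lm Q) (wh [] (tk a) [QQ Q]) = cmp (wh [QQ Q] (tk a) []) (lm Q)"
 using cl_eqI[OF law_eq.lam_tok] by (simp add: cl_cmp cl_ten)
lemma rel_lam_dot: "Q : ECR (Pol A 1) ==> cmp (lm Q) (wh [] dt [QQ Q]) = cmp (wh [QQ Q] dt []) (lm Q)"
 using cl_eqI[OF law_eq.lam_dot] by (simp add: cl_cmp cl_ten)
lemma rel_rho_tok: "Q : ECR (Pol A 1) ==> cmp (rh Q) (wh [QQ Q] (tk a) []) = cmp (wh [] (tk a) [QQ Q]) (rh Q)"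
 using cl_eqI[OF law_eq.rho_tok] by (simp add: cl_cmp cl_ten)
lemma rel_rho_dot: "Q : ECR (Pol A 1) ==> cmp (rh Q) (wh [QQ Q] dt []) = cmp (wh [] dt [QQ Q]) (rh Q)"
 using cl_eqI[OF law_eq.rho_dot] by (simp add: cl_cmp cl_ten)
lemma rel_rho_sig: "Q : ECR (Pol A 1) ==> cmp (wh [] sg [QQ Q]) (cmp (wh [II] (rh Q) []) (wh [] (rh Q) [II]))
  = cmp (wh [II] (rh Q) []) (cmp (wh [] (rh Q) [II]) (wh [QQ Q] sg []))"
 using cl_eqI[OF law_eq.rho_sig] by (simp add: cl_cmp cl_ten)
lemma rel_lam_sig: "Q : ECR (Pol A 1) ==> cmp (wh [] (lm Q) [II]) (cmp (wh [II] (lm Q) []) (wh [] sg [QQ Q]))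
  = cmp (wh [QQ Q] sg []) (cmp (wh [] (lm Q) [II]) (wh [II] (lm Q) []))"
 using cl_eqI[OF law_eq.lam_sig] by (simp add: cl_cmp cl_ten)

subsection \<open>Linear spans\<close>

text \<open>Morphism classes do not form a type with addition, so linear spans are closures under
  \<open>pls\<close> and \<open>scl\<close>, with the zero morphism of the given objects.\<close>

inductive_set lspan for X Y :: "('k, 'a) law_ob" and B where
 lnul: "nul X Y : lspan X Y B"
| lin: "b : B ==> b : lspan X Y B"
| lpls: "F : lspan X Y B ==> G : lspan X Y B ==> pls F G : lspan X Y B"
| lscl: "F : lspan X Y B ==> scl c F : lspan X Y B"

lemma lspan_hm: "B <= hm X Y ==> X : OB ==> Y : OB ==> F : lspan X Y B ==> F : hm X Y"
proof -
 assume a: "B <= hm X Y" "X : OB" "Y : OB" "F : lspan X Y B"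
 show ?thesis using a(4) by (induction) (use a in "auto intro: nul_hm pls_hm scl_hm")
qed

text \<open>Whiskering and composing on both sides is linear in the middle morphism, so a span
  condition need be checked on generators only.\<close>

lemma lspan_sandwich:
 assumes "F : lspan X Y B" "B <= hm X Y" "X : OB" "Y : OB" "P : OB" "S : OB"
  "ar K" "dm K = P @ Y @ S" "cd K = Y'" "ar M" "dm M = X'" "cd M = P @ X @ S"
  "\<And>b. b : B ==> cmp K (cmp (wh P b S) M) : lspan X' Y' B'"
 shows "cmp K (cmp (wh P F S) M) : lspan X' Y' B'"
 using assms(1)
proof induction
 case lnul
 have "X' : OB" using assms(10,11) ar_obs(1) by blast
 then have "cmp K (cmp (wh P (nul X Y) S) M) = nul X' Y'" using assms by simp
 then show ?case by (simp add: lspan.lnul)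
next
 case (lin b)
 then show ?case by (rule assms(13))
next
 case (lpls F G)
 have "F : hm X Y" "G : hm X Y" using lspan_hm[OF assms(2-4)] lpls by auto
 then have "cmp K (cmp (wh P (pls F G) S) M) = pls (cmp K (cmp (wh P F S) M)) (cmp K (cmp (wh P G S) M))"
  using assms by (simp add: hm_iff pls_wh pls_cmp cmp_pls)
 then show ?case using lpls by (simp add: lspan.lpls)
next
 case (lscl F c)
 have "F : hm X Y" using lspan_hm[OF assms(2-4)] lscl by auto
 then have "cmp K (cmp (wh P (scl c F) S) M) = scl c (cmp K (cmp (wh P F S) M))"
  using assms by (simp add: hm_iff)
 then show ?case using lscl by (simp add: lspan.lscl)
qed

lemma lspan_lspan:
 assumes "F : lspan X Y B" "\<And>b. b : B ==> b : lspan X Y B'" shows "F : lspan X Y B'"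
 using assms(1) by induction (auto intro: lspan.intros assms(2))

subsection \<open>Strands\<close>

text \<open>Every strand can be pulled to the left across the others; two strands labelled by central elements do not cross.\<close>

inductive_set Dec where
 dec_id: "idm [II] : Dec"
| dec_tok: "d : Dec ==> a : grade A p ==> cmp d (tk a) : Dec"
| dec_dot: "d : Dec ==> cmp d dt : Dec"

lemma Dec_props: "d : Dec ==> ar d & dm d = [II] & cd d = [II] & (\<exists>p. hg p d)"
proof (induction rule: Dec.induct)
 case dec_id
 then show ?case using hg_idm[of "[II]"] by auto
next
 case (dec_tok d a p)
 then obtain q where q: "hg q d" by auto
 have "hg (q + p) (cmp d (tk a))" by (rule hg_cmp[OF hg_gens(2) q]) (use dec_tok in auto)
 then show ?case using dec_tok by auto
next
 case (dec_dot d)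
 then obtain q where q: "hg q d" by auto
 have "hg (q + eps A) (cmp d dt)" by (rule hg_cmp[OF hg_gens(3) q]) (use dec_dot in auto)
 then show ?case using dec_dot by auto
qed

lemma Dec_cmp: "e : Dec ==> d : Dec ==> cmp d e : Dec"
proof (induction rule: Dec.induct)
 case dec_id
 then show ?case using Dec_props[of d] by simp
qed (auto simp: cmp_assoc[symmetric] intro: Dec.intros)

definition Decs where "Decs y = (if y = II then Dec else {idm [y]})"

text \<open>Crossing that takes \<open>y\<close> over \<open>u\<close> to the left. The last clause
  only makes the function total; \<open>okc\<close> excludes it.\<close>

fun xg where
 "xg II II = sg" | "xg (QQ Q) II = rh Q" | "xg II (QQ Q) = lm Q" | "xg (QQ Q) (QQ Q') = nul [QQ Q, QQ Q'] [QQ Q', QQ Q]"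

text \<open>The strand \<open>y\<close> starts at the right end of \<open>U\<close> and crosses its
  letters one by one, ending in front.\<close>

primrec Cr where
 "Cr y [] = idm [y]"
| "Cr y (u # U) = cmp (wh [] (xg u y) U) (wh [u] (Cr y U) [])"

definition okc where "okc y U \<longleftrightarrow> y = II | set U <= {II}"
lemma okc_simps [simp]: "okc II U" "okc y []" "okc y (U @ V) \<longleftrightarrow> okc y U & okc y V" "okc y (u # U) \<longleftrightarrow> (y = II | u = II) & okc y U"
 by (auto simp: okc_def)

lemma xg_props: "[u, y] : OB ==> ar (xg u y) & dm (xg u y) = [u, y] & cd (xg u y) = [y, u] & (y = II | u = II --> hg 0 (xg u y))"
 by (cases u; cases y) (auto simp: hg_gens)

lemma Cr_props: "[y] : OB ==> U : OB ==> ar (Cr y U) & dm (Cr y U) = U @ [y] & cd (Cr y U) = y # U & (okc y U --> hg 0 (Cr y U))"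
proof (induction U)
 case Nil
 then show ?case using hg_idm[of "[y]"] by auto
next
 case (Cons u U)
 then have x: "ar (xg u y) & dm (xg u y) = [u, y] & cd (xg u y) = [y, u] & (y = II | u = II --> hg 0 (xg u y))"
  by (intro xg_props) (auto split: lob.splits)
 have o: "[u] : OB" "U : OB" using Cons by auto
 have c: "ar (Cr y U) & dm (Cr y U) = U @ [y] & cd (Cr y U) = y # U & (okc y U --> hg 0 (Cr y U))" using Cons o by blast
 have "hg (0 + 0) (Cr y (u # U))" if "okc y (u # U)"
  unfolding Cr.simps by (rule hg_cmp[OF hg_wh hg_wh]) (use that c x o in auto)
 then show ?case using c x o by auto
qed

lemma Cr_simps [simp]: "[y] : OB ==> U : OB ==> ar (Cr y U)" "[y] : OB ==> U : OB ==> dm (Cr y U) = U @ [y]"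
 "[y] : OB ==> U : OB ==> cd (Cr y U) = y # U"
 using Cr_props by auto

lemma Cr_append: "[y] : OB ==> U : OB ==> V : OB ==> Cr y (U @ V) = cmp (wh [] (Cr y U) V) (wh U (Cr y V) [])"
proof (induction U)
 case Nil
 then show ?case using Cr_simps[of y V] by simp
next
 case (Cons u U)
 have o: "[u] : OB" "U : OB" "[u, y] : OB" using Cons by (auto split: lob.splits)
 note x = xg_props[OF o(3)]
 have IH: "Cr y (U @ V) = cmp (wh [] (Cr y U) V) (wh U (Cr y V) [])" using Cons o by blast
 have a: "wh [u] (Cr y (U @ V)) [] = cmp (wh [u] (Cr y U) V) (wh (u # U) (Cr y V) [])"
  unfolding IH using o Cons.prems by (subst cmp_wh) simp_all
 have b: "wh [] (Cr y (u # U)) V = cmp (wh [] (xg u y) (U @ V)) (wh [u] (Cr y U) V)"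
  unfolding Cr.simps using x o Cons.prems by (subst cmp_wh) simp_all
 show ?case unfolding b append_Cons Cr.simps(2)[of y u "U @ V"] a cmp_assoc ..
qed

lemma Decs_props: "[y] : OB ==> d : Decs y ==> ar d & dm d = [y] & cd d = [y] & (\<exists>p. hg p d)"
 using Dec_props[of d] hg_idm[of "[y]"] by (auto simp: Decs_def split: if_splits)
lemma Decs_id: "idm [y] : Decs y" by (auto simp: Decs_def dec_id)

text \<open>One strand ends at the front of the target: it starts at \<open>y\<close>, is decorated
  at its source by \<open>d\<close> and is pulled across \<open>U\<close>. The morphism
  \<open>H\<close> on the other strands is arbitrary; it is not expanded here, since faithfulness
  recurses on the target.\<close>

inductive_set Bs :: "(('k, 'a) law_ob \<times> ('k, 'a) law_ob \<times> ('k, 'a) law_term set) set" where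
 bs_nil: "([], [], idm []) : Bs"
| bs_Cons: "y # U @ V : OB ==> okc y U ==> d : Decs y ==> ar H ==> dm H = U @ V ==>
  (U @ y # V, y # cd H, cmp (wh [y] H []) (cmp (wh [] (Cr y U) V) (wh U d V))) : Bs"

definition SP where "SP X Y = lspan X Y {F. (X, Y, F) : Bs}"

lemma Bs_typed: "(X, Y, F) : Bs ==> F : hm X Y & X : OB & Y : OB"
proof (induction X Y F rule: Bs.induct)
 case bs_nil
 then show ?case by (simp add: hm_iff)
next
 case (bs_Cons y U V d H)
 then have o: "[y] : OB" "U : OB" "V : OB" by (auto split: lob.splits)
 then show ?case using bs_Cons Decs_props[OF o(1) \<open>d : Decs y\<close>] by (auto simp: hm_iff)
qed

lemma Bs_hm: "{F. (X, Y, F) : Bs} <= hm X Y" using Bs_typed by blast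

lemma SP_base: "(X, Y, F) : Bs ==> F : SP X Y" unfolding SP_def by (rule lspan.lin) simp
lemma SP_hm: "X : OB ==> Y : OB ==> F : SP X Y ==> F : hm X Y"
 unfolding SP_def using lspan_hm[OF Bs_hm] by blast
lemma SP_ops: "F : SP X Y ==> G : SP X Y ==> pls F G : SP X Y" "F : SP X Y ==> scl c F : SP X Y" "nul X Y : SP X Y"
 unfolding SP_def by (auto intro: lspan.intros)

lemma SP_strand:
 assumes "[y] : OB" "U : OB" "V : OB" "okc y U" "d : Decs y" "ar H" "dm H = U @ V"
  "X = U @ y # V" "Y = y # cd H" "F = cmp (wh [y] H []) (cmp (wh [] (Cr y U) V) (wh U d V))"
 shows "F : SP X Y"
proof -
 have "y # U @ V : OB" using assms(1-3) by simp
 from bs_Cons[OF this assms(4-7)] show ?thesis unfolding assms(8-10) by (rule SP_base)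
qed

lemma swap_rl:
 assumes "hg p F" "hg q G" "W : OB" "Z : OB" "W' : OB"
  "P = W @ dm F @ Z" "S = Z @ cd G @ W'" "P' = W @ cd F @ Z" "S' = Z @ dm G @ W'"
 shows "cmp (wh P' G W') (wh W F S') = scl (ksgn p q) (cmp (wh W F S) (wh P G W'))"
proof -
 have "ar F" "ar G" using assms(1,2) hg_ar by auto
 then have "ar (cmp (wh P' G W') (wh W F S'))" using assms(3-9) by (subst ar_cmp) simp_all
 then show ?thesis using wh_swap[OF assms] by simp
qed

text \<open>A strand pulled to the front of a window can be pulled on across the letters
  \<open>P\<close> before it: naturality moves the inner \<open>H0\<close> behind the new crossings,
  and the two pulls combine by \<open>Cr_append\<close>.\<close>

lemma SP_ext:
 assumes F: "F : SP W1 (y # W')" and o: "[y] : OB" "W1 : OB" "W' : OB" "P : OB" "S : OB"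
  and ok: "okc y P" and H: "ar H" "dm H = P @ W' @ S"
 shows "cmp (cmp (wh [y] H []) (wh [] (Cr y P) (W' @ S))) (cmp (wh P F S) (idm (P @ W1 @ S))) : SP (P @ W1 @ S) (y # cd H)"
proof -
 note yP = Cr_props[OF o(1) o(4)]
 show ?thesis unfolding SP_def
 proof (rule lspan_sandwich[OF F[unfolded SP_def] Bs_hm])
  fix b assume "b : {F. (W1, y # W', F) : Bs}"
  then have "(W1, y # W', b) : Bs" by simp
  then show "cmp (cmp (wh [y] H []) (wh [] (Cr y P) (W' @ S))) (cmp (wh P b S) (idm (P @ W1 @ S))) : lspan (P @ W1 @ S) (y # cd H) {F. (P @ W1 @ S, y # cd H, F) : Bs}"
  proof cases
   case (bs_Cons U V d H0)
   then have oo: "U : OB" "V : OB" by auto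
   note d = Decs_props[OF o(1) \<open>d : Decs y\<close>]
   note yU = Cr_props[OF o(1) oo(1)]
   have h0: "dm H0 = U @ V" "cd H0 = W'" "ar H0" using bs_Cons by auto
   have arb: "ar b" "dm b = W1" using Bs_typed[OF \<open>(W1, y # W', b) : Bs\<close>] by (auto simp: hm_iff)
   have e1: "cmp (wh P b S) (idm (P @ W1 @ S)) = wh P b S" using arb o by simp
   have beq: "b = cmp (wh [y] H0 []) (cmp (wh [] (Cr y U) V) (wh U d V))" using bs_Cons by simp
   have e2: "wh P b S = cmp (wh (P @ [y]) H0 S) (cmp (wh P (Cr y U) (V @ S)) (wh (P @ U) d (V @ S)))"
   unfolding beq using oo o h0 d yU by (simp add: cmp_wh)
   \<comment> \<open>The pull across \<open>P\<close> is even, so it commutes with the possibly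
     inhomogeneous \<open>H0\<close> without a sign.\<close>
   have e3: "cmp (wh [] (Cr y P) (W' @ S)) (wh (P @ [y]) H0 S) = cmp (wh (y # P) H0 S) (wh [] (Cr y P) (U @ V @ S))"
   by (rule wh_swap_even[where Z = "[]"]) (use yP ok o h0 in auto)
   have e4: "cmp (wh [y] H []) (wh (y # P) H0 S) = wh [y] (cmp H (wh P H0 S)) []"
   using o H h0 by (simp add: cmp_wh)
   have e5: "wh [] (Cr y (P @ U)) (V @ S) = cmp (wh [] (Cr y P) (U @ V @ S)) (wh P (Cr y U) (V @ S))"
   unfolding Cr_append[OF o(1) o(4) oo(1)] using yU yP o oo by (simp add: cmp_wh)
   have f: "cmp (cmp (wh [y] H []) (wh [] (Cr y P) (W' @ S))) (cmp (wh P b S) (idm (P @ W1 @ S)))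
   = cmp (wh [y] (cmp H (wh P H0 S)) []) (cmp (wh [] (Cr y (P @ U)) (V @ S)) (wh (P @ U) d (V @ S)))"
   unfolding e1 unfolding e2 e4[symmetric] e5 cmp_assoc cmp_rw[OF e3] ..
   have W1: "W1 = U @ y # V" using bs_Cons by simp
   have H': "ar (cmp H (wh P H0 S))" "dm (cmp H (wh P H0 S)) = (P @ U) @ V @ S" "cd (cmp H (wh P H0 S)) = cd H"
   using H h0 o by auto
   have okPU: "okc y (P @ U)" using ok \<open>okc y U\<close> by simp
   have oPU: "P @ U : OB" "V @ S : OB" using o oo by auto
   show ?thesis unfolding SP_def[symmetric]
   by (rule SP_strand[OF o(1) oPU okPU \<open>d : Decs y\<close> H'(1,2) _ _ f]) (simp_all only: W1 H'(3) append_assoc append_Cons)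
  qed
 qed (use o H yP in auto)
qed

text \<open>Shape of the correction terms when a generator is slid under a pulled strand: the
  leftmost source strand, decorated by \<open>e\<close>, goes straight to the front, and the strand
  that was being pulled is swallowed by \<open>h\<close>.\<close>

definition Low where "Low X Y = lspan (X @ [II]) (II # Y)
  {F. \<exists>W h e. X = II # W & ar h & dm h = W @ [II] & cd h = Y & e : Dec & F = cmp (wh [II] h []) (wh [] e (W @ [II]))}"

lemma Low_hm: "X : OB ==> {F. \<exists>W h e. X = II # W & ar h & dm h = W @ [II] & cd h = Y & e : Dec & F = cmp (wh [II] h []) (wh [] e (W @ [II]))} <= hm (X @ [II]) (II # Y)"
 by (auto simp: hm_iff dest!: Dec_props)

lemma strand_cases:
 assumes "U @ y # V = P @ W @ S"
 obtains (left) P2 where "P = U @ y # P2" "V = P2 @ W @ S"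
 | (right) S1 where "S = S1 @ y # V" "U = P @ W @ S1"
 | (inside) a b where "W = a @ y # b" "U = P @ a" "V = b @ S"
proof -
 from assms have "(\<exists>us. U = P @ us & us @ y # V = W @ S) | (\<exists>us. U @ us = P & y # V = us @ W @ S)"
  by (auto simp: append_eq_append_conv2)
 then show thesis
 proof (elim disjE exE conjE)
  fix us assume u: "U = P @ us" "us @ y # V = W @ S"
  then have "(\<exists>vs. us = W @ vs & vs @ y # V = S) | (\<exists>vs. us @ vs = W & y # V = vs @ S)"
   by (auto simp: append_eq_append_conv2)
  then show thesis
  proof (elim disjE exE conjE)
   fix vs assume "us = W @ vs" "vs @ y # V = S" then show thesis using right[of vs] u by simp
  next
   fix vs assume v: "us @ vs = W" "y # V = vs @ S"
   then show thesis
   proof (cases vs)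
   case Nil
   then show thesis using right[of "[]"] u v by simp
   next
   case (Cons z zs)
   then show thesis using inside[of us zs] u v by simp
   qed
  qed
 next
  fix us assume u: "U @ us = P" "y # V = us @ W @ S"
  then show thesis
  proof (cases us)
   case Nil
   show thesis
   proof (cases W)
   case Nil
   then show thesis using right[of "[]"] u \<open>us = []\<close> by simp
   next
   case (Cons z zs)
   then show thesis using inside[of "[]" zs] u \<open>us = []\<close> by simp
   qed
  next
   case (Cons z zs)
   then show thesis using left[of zs] u by simp
  qed
 qed
qed

text \<open>The generator \<open>g\<close> slides through a strand pulled across it, up to a
  correction \<open>L\<close>. Corrections occur only for \<open>y = II\<close>, from the relations
  of a crossing with a dot and from the mixed braid relation.\<close>

definition nat_ok where "nat_ok y g \<longleftrightarrow> (okc y (cd g) --> okc y (dm g) & (\<exists>L. cmp (Cr y (cd g)) (wh [] g [y]) = pls (cmp (wh [y] g []) (Cr y (dm g))) L \<and>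
  (L : Low (dm g) (cd g) & y = II | L = nul (dm g @ [y]) (y # cd g))))"
text \<open>The complementary case: the pulled strand starts at one of the letters of the target of
  \<open>g\<close>, so its decoration and pull sit directly on top of \<open>g\<close>.\<close>

definition loc_ok where "loc_ok y g \<longleftrightarrow> (\<forall>P R d. cd g = P @ y # R --> okc y P --> d : Decs y -->
  cmp (cmp (wh [] (Cr y P) R) (wh P d R)) g : SP (dm g) (y # P @ R))"

text \<open>A generator to the right of the chosen strand does not meet it; it passes the decoration
  with a sign and is absorbed into \<open>H\<close>.\<close>

lemma Bs_left:
 assumes g: "hg q g" and o: "[y] : OB" "U : OB" "P2 : OB" "S : OB"
  and ok: "okc y U" and d: "d : Decs y" and H: "ar H" "dm H = U @ P2 @ cd g @ S"
 shows "cmp (cmp (wh [y] H []) (cmp (wh [] (Cr y U) (P2 @ cd g @ S)) (wh U d (P2 @ cd g @ S)))) (wh (U @ y # P2) g S)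
   : SP (U @ y # P2 @ dm g @ S) (y # cd H)"
proof -
 note ag = hg_ar[OF g]
 obtain p where p: "hg p d" and dd: "ar d" "dm d = [y]" "cd d = [y]" using Decs_props[OF o(1) d] by auto
 note yU = Cr_props[OF o(1) o(2)]
 have e1: "cmp (wh U d (P2 @ cd g @ S)) (wh (U @ y # P2) g S) = scl (ksgn p q) (cmp (wh (U @ y # P2) g S) (wh U d (P2 @ dm g @ S)))"
  by (rule wh_swap[OF p g]) (use o dd in auto)
 have e2: "cmp (wh [] (Cr y U) (P2 @ cd g @ S)) (wh (U @ y # P2) g S) = cmp (wh (y # U @ P2) g S) (wh [] (Cr y U) (P2 @ dm g @ S))"
  by (rule wh_swap_even[where Z = P2]) (use o ok yU ag in auto)
 have e3: "cmp (wh [y] H []) (wh (y # U @ P2) g S) = wh [y] (cmp H (wh (U @ P2) g S)) []"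
  using o H ag by (simp add: cmp_wh)
 let ?B = "cmp (wh [y] (cmp H (wh (U @ P2) g S)) []) (cmp (wh [] (Cr y U) (P2 @ dm g @ S)) (wh U d (P2 @ dm g @ S)))"
 have arw: "ar (cmp (wh (U @ y # P2) g S) (wh U d (P2 @ dm g @ S)))" "dm (cmp (wh (U @ y # P2) g S) (wh U d (P2 @ dm g @ S))) = U @ y # P2 @ dm g @ S" "cd (cmp (wh (U @ y # P2) g S) (wh U d (P2 @ dm g @ S))) = U @ y # P2 @ cd g @ S"
  using o dd ag by auto
 have "cmp (cmp (wh [y] H []) (cmp (wh [] (Cr y U) (P2 @ cd g @ S)) (wh U d (P2 @ cd g @ S)))) (wh (U @ y # P2) g S)
   = cmp (cmp (wh [y] H []) (wh [] (Cr y U) (P2 @ cd g @ S))) (scl (ksgn p q) (cmp (wh (U @ y # P2) g S) (wh U d (P2 @ dm g @ S))))"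
  unfolding cmp_assoc e1 ..
 also have "... = scl (ksgn p q) (cmp (cmp (wh [y] H []) (wh [] (Cr y U) (P2 @ cd g @ S))) (cmp (wh (U @ y # P2) g S) (wh U d (P2 @ dm g @ S))))"
  by (rule cmp_scl) (use o dd ag H yU arw in auto)
 also have "... = scl (ksgn p q) ?B"
  unfolding cmp_assoc cmp_rw[OF e2] e3[symmetric] ..
 finally show ?thesis
  by (simp only:) (intro SP_ops(2) SP_strand[of y U "P2 @ dm g @ S" d "cmp H (wh (U @ P2) g S)"]; use o ok d H ag in simp)
qed

text \<open>A generator to the left is crossed by the pulled strand. After passing the decoration
  and the first crossings it meets the part \<open>Cr y (cd g)\<close>, where \<open>nat_ok\<close>
  applies.\<close>

lemma Bs_right:
 assumes g: "hg q g" and nat: "nat_ok y g" and o: "[y] : OB" "P : OB" "S1 : OB" "V : OB"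
  and ok: "okc y (P @ cd g @ S1)" and d: "d : Decs y" and H: "ar H" "dm H = P @ cd g @ S1 @ V"
 shows "cmp (cmp (wh [y] H []) (cmp (wh [] (Cr y (P @ cd g @ S1)) V) (wh (P @ cd g @ S1) d V))) (wh P g (S1 @ y # V))
   : SP (P @ dm g @ S1 @ y # V) (y # cd H)"
proof -
 note ag = hg_ar[OF g]
 obtain p where p: "hg p d" and dd: "ar d" "dm d = [y]" "cd d = [y]" using Decs_props[OF o(1) d] by auto
 have og: "dm g : OB" "cd g : OB" using ag by auto
 note yP = Cr_props[OF o(1) o(2)] and yS = Cr_props[OF o(1) o(3)] and yg = Cr_props[OF o(1) og(2)] and yd = Cr_props[OF o(1) og(1)]
 have okP: "okc y P" "okc y (cd g)" "okc y S1" using ok by auto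
 then obtain L where okd: "okc y (dm g)" and L: "cmp (Cr y (cd g)) (wh [] g [y]) = pls (cmp (wh [y] g []) (Cr y (dm g))) L"
  and LL: "L : Low (dm g) (cd g) & y = II | L = nul (dm g @ [y]) (y # cd g)" using nat unfolding nat_ok_def by blast
 have arL: "ar L" "dm L = dm g @ [y]" "cd L = y # cd g"
 proof -
  have "L : hm (dm g @ [y]) (y # cd g)" using LL
  proof (elim disjE conjE)
   assume "L : Low (dm g) (cd g)" "y = II"
   then show ?thesis unfolding Low_def using lspan_hm[OF Low_hm] og by simp
  qed (use og o in "auto intro!: nul_hm split: lob.splits")
  then show "ar L" "dm L = dm g @ [y]" "cd L = y # cd g" by (auto simp: hm_iff)
 qed
 define K where "K = cmp (wh [y] H []) (wh [] (Cr y P) (cd g @ S1 @ V))"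
 define M where "M = cmp (wh (P @ dm g) (Cr y S1) V) (wh (P @ dm g @ S1) d V)"
 have arK: "ar K" "dm K = P @ y # cd g @ S1 @ V" "cd K = y # cd H" unfolding K_def using o og H yP by auto
 have arM: "ar M" "dm M = P @ dm g @ S1 @ y # V" "cd M = P @ dm g @ y # S1 @ V" unfolding M_def using o og dd yS by auto
 have e0: "wh [] (Cr y (P @ cd g @ S1)) V = cmp (wh [] (Cr y P) (cd g @ S1 @ V)) (cmp (wh P (Cr y (cd g)) (S1 @ V)) (wh (P @ cd g) (Cr y S1) V))"
 proof -
  have "Cr y (P @ cd g @ S1) = cmp (wh [] (Cr y P) (cd g @ S1)) (wh P (Cr y (cd g @ S1)) [])"
   by (rule Cr_append) (use o og in auto)
  moreover have "Cr y (cd g @ S1) = cmp (wh [] (Cr y (cd g)) S1) (wh (cd g) (Cr y S1) [])"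
   by (rule Cr_append) (use o og in auto)
  ultimately show ?thesis using o og yP yS yg by (simp add: cmp_wh)
 qed
 have e1: "cmp (wh (P @ cd g @ S1) d V) (wh P g (S1 @ y # V)) = scl (ksgn q p) (cmp (wh P g (S1 @ y # V)) (wh (P @ dm g @ S1) d V))"
  by (rule swap_rl[OF g p]) (use o og dd in auto)
 have e2: "cmp (wh (P @ cd g) (Cr y S1) V) (wh P g (S1 @ y # V)) = cmp (wh P g (y # S1 @ V)) (wh (P @ dm g) (Cr y S1) V)"
 proof -
  have "cmp (wh (P @ cd g) (Cr y S1) V) (wh P g (S1 @ y # V)) = scl (ksgn q 0) (cmp (wh P g (y # S1 @ V)) (wh (P @ dm g) (Cr y S1) V))"
   by (rule swap_rl[OF g, where Z = "[]"]) (use o og okP yS in auto)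
  moreover have "ar (cmp (wh P g (y # S1 @ V)) (wh (P @ dm g) (Cr y S1) V))" using o og yS ag by auto
  ultimately show ?thesis by (simp add: ksgn_def)
 qed
 have e3: "cmp (wh P (Cr y (cd g)) (S1 @ V)) (wh P g (y # S1 @ V)) = wh P (pls (cmp (wh [y] g []) (Cr y (dm g))) L) (S1 @ V)"
  unfolding L[symmetric] using o og ag yg by (subst cmp_wh) simp_all
 let ?N = "pls (cmp (wh [y] g []) (Cr y (dm g))) L"
 have arN: "ar (cmp (wh [y] g []) (Cr y (dm g)))" "dm (cmp (wh [y] g []) (Cr y (dm g))) = dm g @ [y]" "cd (cmp (wh [y] g []) (Cr y (dm g))) = y # cd g"
  using o og ag yd by auto
 have arN': "ar ?N" "dm ?N = dm g @ [y]" "cd ?N = y # cd g" using arN arL by auto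
 have main: "cmp (cmp (wh [y] H []) (cmp (wh [] (Cr y (P @ cd g @ S1)) V) (wh (P @ cd g @ S1) d V))) (wh P g (S1 @ y # V))
   = scl (ksgn q p) (cmp K (cmp (wh P ?N (S1 @ V)) M))"
 proof -
  have "cmp (cmp (wh [y] H []) (cmp (wh [] (Cr y (P @ cd g @ S1)) V) (wh (P @ cd g @ S1) d V))) (wh P g (S1 @ y # V))
   = cmp (cmp (wh [y] H []) (wh [] (Cr y (P @ cd g @ S1)) V)) (scl (ksgn q p) (cmp (wh P g (S1 @ y # V)) (wh (P @ dm g @ S1) d V)))"
   unfolding cmp_assoc e1 ..
  also have "... = scl (ksgn q p) (cmp (cmp (wh [y] H []) (wh [] (Cr y (P @ cd g @ S1)) V)) (cmp (wh P g (S1 @ y # V)) (wh (P @ dm g @ S1) d V)))"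
   by (rule cmp_scl) (use o og dd ag H in auto)
  also have "... = scl (ksgn q p) (cmp K (cmp (wh P ?N (S1 @ V)) M))"
   unfolding e0 K_def M_def cmp_assoc cmp_rw[OF e2] cmp_rw[OF e3] ..
  finally show ?thesis .
 qed
 \<comment> \<open>The main term has \<open>g\<close> below the strand and is absorbed into
   \<open>H\<close>; the term with \<open>L\<close> needs a new choice of front strand.\<close>
 have split: "cmp K (cmp (wh P ?N (S1 @ V)) M) = pls (cmp K (cmp (wh P (cmp (wh [y] g []) (Cr y (dm g))) (S1 @ V)) M)) (cmp K (cmp (wh P L (S1 @ V)) M))"
  using o og arN arL arK arM by (simp add: pls_wh pls_cmp cmp_pls)
 have first: "cmp K (cmp (wh P (cmp (wh [y] g []) (Cr y (dm g))) (S1 @ V)) M) : SP (P @ dm g @ S1 @ y # V) (y # cd H)"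
 proof -
  have f1: "cmp (wh [] (Cr y P) (cd g @ S1 @ V)) (wh (P @ [y]) g (S1 @ V)) = cmp (wh (y # P) g (S1 @ V)) (wh [] (Cr y P) (dm g @ S1 @ V))"
   by (rule wh_swap_even[where Z = "[]"]) (use o og okP yP ag in auto)
  have f2: "cmp (wh [y] H []) (wh (y # P) g (S1 @ V)) = wh [y] (cmp H (wh P g (S1 @ V))) []"
   using o og H ag by (simp add: cmp_wh)
  have f3: "wh P (cmp (wh [y] g []) (Cr y (dm g))) (S1 @ V) = cmp (wh (P @ [y]) g (S1 @ V)) (wh P (Cr y (dm g)) (S1 @ V))"
   using o og ag yd by (simp add: cmp_wh)
  have f4: "wh [] (Cr y (P @ dm g @ S1)) V = cmp (wh [] (Cr y P) (dm g @ S1 @ V)) (cmp (wh P (Cr y (dm g)) (S1 @ V)) (wh (P @ dm g) (Cr y S1) V))"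
  proof -
   have "Cr y (P @ dm g @ S1) = cmp (wh [] (Cr y P) (dm g @ S1)) (wh P (Cr y (dm g @ S1)) [])"
   by (rule Cr_append) (use o og in auto)
   moreover have "Cr y (dm g @ S1) = cmp (wh [] (Cr y (dm g)) S1) (wh (dm g) (Cr y S1) [])"
   by (rule Cr_append) (use o og in auto)
   ultimately show ?thesis using o og yP yS yd by (simp add: cmp_wh)
  qed
  have f5: "cmp K (cmp (wh P (cmp (wh [y] g []) (Cr y (dm g))) (S1 @ V)) M)
   = cmp (wh [y] (cmp H (wh P g (S1 @ V))) []) (cmp (wh [] (Cr y (P @ dm g @ S1)) V) (wh (P @ dm g @ S1) d V))"
   unfolding f2[symmetric] f4 K_def M_def f3 cmp_assoc cmp_rw[OF f1] ..
  show ?thesis by (rule SP_strand[OF o(1) _ o(4) _ d _ _ _ _ f5]) (use o og okP okd H ag in auto)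
 qed
 have second: "cmp K (cmp (wh P L (S1 @ V)) M) : SP (P @ dm g @ S1 @ y # V) (y # cd H)"
  using LL
 proof (elim disjE conjE)
  assume L0: "L = nul (dm g @ [y]) (y # cd g)"
  have oy: "y # cd g : OB" using o og by (auto split: lob.splits)
  have ol: "P @ dm g @ S1 @ y # V : OB" using o og by (auto split: lob.splits)
  have w: "wh P L (S1 @ V) = nul (P @ dm g @ y # S1 @ V) (P @ y # cd g @ S1 @ V)" unfolding L0 using o og oy by simp
  have oy2: "P @ y # cd g @ S1 @ V : OB" using o og by (auto split: lob.splits)
  have "cmp K (cmp (wh P L (S1 @ V)) M) = nul (P @ dm g @ S1 @ y # V) (y # cd H)"
   unfolding w nul_cmp[OF arM(1,3) oy2] arM(2) cmp_nul[OF arK(1,2) ol] arK(3) ..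
  then show ?thesis using SP_ops(3) by simp
 next
  assume L1: "L : Low (dm g) (cd g)" and y: "y = II"
  show ?thesis unfolding SP_def
  proof (rule lspan_sandwich[OF L1[unfolded Low_def] Low_hm[OF og(1)]])
   fix b assume "b : {F. \<exists>W h e. dm g = II # W & ar h & dm h = W @ [II] & cd h = cd g & e : Dec & F = cmp (wh [II] h []) (wh [] e (W @ [II]))}"
   then obtain W h e where w: "dm g = II # W" "ar h" "dm h = W @ [II]" "cd h = cd g" "e : Dec" and b: "b = cmp (wh [II] h []) (wh [] e (W @ [II]))" by blast
   obtain r where e: "ar e" "dm e = [II]" "cd e = [II]" "hg r e" using Dec_props[OF w(5)] by auto
   have oW: "W : OB" using og w by simp
   \<comment> \<open>In the correction the old strand only travels across \<open>S1\<close>, and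
     with its decoration it becomes part of the rest.\<close>
   define R where "R = cmp (wh [] (Cr y S1) V) (wh S1 d V)"
   have R: "hg (0 + p) R" unfolding R_def by (rule hg_cmp[OF hg_wh[OF p] hg_wh]) (use yS okP o dd in auto)
   have arR: "ar R" "dm R = S1 @ y # V" "cd R = y # S1 @ V" unfolding R_def using yS o dd by auto
   have M: "M = wh (P @ dm g) R []" unfolding M_def R_def using yS o dd og by (simp add: cmp_wh)
   have wb: "wh P b (S1 @ V) = cmp (wh (P @ [II]) h (S1 @ V)) (wh P e (W @ [II] @ S1 @ V))"
   unfolding b using o e w oW by (simp add: cmp_wh)
   have s1: "cmp (wh P e (W @ [II] @ S1 @ V)) (wh (P @ dm g) R []) = scl (ksgn r (0 + p)) (cmp (wh (P @ [II] @ W) R []) (wh P e (W @ S1 @ y # V)))"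
   by (rule wh_swap[OF e(4) R, where Z = W]) (use o oW w e arR y in auto)
   have s2: "cmp (wh [] (Cr y P) (cd g @ S1 @ V)) (wh (P @ [II]) h (S1 @ V)) = cmp (wh (II # P) h (S1 @ V)) (wh [] (Cr y P) (W @ [II] @ S1 @ V))"
   by (rule wh_swap_even[where Z = "[]"]) (use o okP yP w y in auto)
   have s3: "cmp (wh [] (Cr y P) (W @ [II] @ S1 @ V)) (wh (P @ [II] @ W) R []) = cmp (wh (II # P @ W) R []) (wh [] (Cr y P) (W @ S1 @ y # V))"
   by (rule wh_swap_even[where Z = W]) (use o oW okP yP arR y in auto)
   \<comment> \<open>The new front strand is the one starting right after \<open>P\<close>,
     decorated by \<open>e\<close>; \<open>h\<close> and the remainder of the old strand are
     collected here.\<close>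
   define H' where "H' = cmp H (cmp (wh P h (S1 @ V)) (wh (P @ W) R []))"
   have H': "ar H'" "dm H' = P @ W @ S1 @ y # V" "cd H' = cd H" unfolding H'_def using H o oW w arR y by auto
   have s4: "wh [y] H' [] = cmp (wh [y] H []) (cmp (wh (II # P) h (S1 @ V)) (wh (II # P @ W) R []))"
   unfolding H'_def using H o oW w arR y by (simp add: cmp_wh)
   have ae: "ar (cmp (wh (P @ [II] @ W) R []) (wh P e (W @ S1 @ y # V)))" "cd (cmp (wh (P @ [II] @ W) R []) (wh P e (W @ S1 @ y # V))) = P @ II # W @ II # S1 @ V"
   using o oW e arR y by auto
   have "cmp K (cmp (wh P b (S1 @ V)) M) = cmp (cmp K (wh (P @ [II]) h (S1 @ V))) (scl (ksgn r (0 + p)) (cmp (wh (P @ [II] @ W) R []) (wh P e (W @ S1 @ y # V))))"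
   unfolding wb M cmp_assoc s1 ..
   also have "... = scl (ksgn r (0 + p)) (cmp (cmp K (wh (P @ [II]) h (S1 @ V))) (cmp (wh (P @ [II] @ W) R []) (wh P e (W @ S1 @ y # V))))"
   by (rule cmp_scl) (use o oW e w arR y arK ae in auto)
   also have "cmp (cmp K (wh (P @ [II]) h (S1 @ V))) (cmp (wh (P @ [II] @ W) R []) (wh P e (W @ S1 @ y # V)))
   = cmp (wh [y] H' []) (cmp (wh [] (Cr y P) (W @ S1 @ y # V)) (wh P e (W @ S1 @ y # V)))"
   unfolding s4 K_def cmp_assoc cmp_rw[OF s2] cmp_rw[OF s3] ..
   finally have eq: "cmp K (cmp (wh P b (S1 @ V)) M) = scl (ksgn r (0 + p)) (cmp (wh [y] H' []) (cmp (wh [] (Cr y P) (W @ S1 @ y # V)) (wh P e (W @ S1 @ y # V))))" .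
   show "cmp K (cmp (wh P b (S1 @ V)) M) : lspan (P @ dm g @ S1 @ y # V) (y # cd H) {F. (P @ dm g @ S1 @ y # V, y # cd H, F) : Bs}"
   unfolding eq SP_def[symmetric]
   by (rule SP_ops(2), rule SP_strand[of y P "W @ S1 @ y # V" e H'])
   (use o oW w H' y okP in "auto simp: Decs_def")
  qed (use o og arK arM y in auto)
 qed
 show ?thesis unfolding main split by (intro SP_ops(1,2) first second)
qed

text \<open>The chosen strand starts to the left of the target of \<open>g\<close>, to its right, or
  inside it. The empty basic morphism is excluded by \<open>cd g ~= []\<close>.\<close>

lemma Bs_pre:
 assumes b: "(X, Y, b) : Bs" and X: "X = P @ cd g @ S" and g: "hg q g" "cd g ~= []"
  and nat: "\<And>y. [y] : OB ==> nat_ok y g" and loc: "\<And>y. [y] : OB ==> loc_ok y g"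
 shows "cmp b (wh P g S) : SP (P @ dm g @ S) Y"
 using b
proof cases
 case bs_nil
 then show ?thesis using X g by simp
next
 case (bs_Cons y U V d H)
 note ag = hg_ar[OF g(1)]
 have og: "dm g : OB" "cd g : OB" using ag by auto
 have oy: "[y] : OB" "U : OB" "V : OB" using bs_Cons by (auto split: lob.splits)
 have "U @ y # V = P @ cd g @ S" using bs_Cons X by simp
 then show ?thesis
 proof (cases rule: strand_cases)
  case (left P2)
  then show ?thesis using Bs_left[OF g(1) oy(1,2), of P2 S d H] bs_Cons oy by simp
 next
  case (right S1)
  have o: "P : OB" "S1 : OB" using oy right by auto
  show ?thesis using Bs_right[OF g(1) nat[OF oy(1)] oy(1) o oy(3), of d H] bs_Cons right by simp
 next
  case (inside a c)
  have o: "P : OB" "a : OB" "c : OB" "S : OB" using oy inside by auto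
  have ok: "okc y P" "okc y a" using bs_Cons inside by auto
  note d = Decs_props[OF oy(1) \<open>d : Decs y\<close>]
  note ya = Cr_props[OF oy(1) o(2)] and yP = Cr_props[OF oy(1) o(1)]
  let ?F = "cmp (cmp (wh [] (Cr y a) c) (wh a d c)) g"
  have F: "?F : SP (dm g) (y # a @ c)" using loc[OF oy(1)] inside(1) ok(2) bs_Cons unfolding loc_ok_def by blast
  have H: "ar H" "dm H = P @ (a @ c) @ S" using bs_Cons inside by auto
  have "cmp (cmp (wh [y] H []) (wh [] (Cr y P) ((a @ c) @ S))) (cmp (wh P ?F S) (idm (P @ dm g @ S))) : SP (P @ dm g @ S) (y # cd H)"
   by (rule SP_ext[OF F oy(1) og(1) _ o(1,4) ok(1) H]) (use o in auto)
  moreover have "cmp (wh P ?F S) (idm (P @ dm g @ S)) = cmp (wh P (Cr y a) (c @ S)) (cmp (wh (P @ a) d (c @ S)) (wh P g S))"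
   using d o oy og ag ya inside by (simp add: cmp_wh cmp_assoc)
  moreover have "wh [] (Cr y (P @ a)) V = cmp (wh [] (Cr y P) (a @ c @ S)) (wh P (Cr y a) (c @ S))"
   unfolding Cr_append[OF oy(1) o(1,2)] inside using o oy ya yP by (simp add: cmp_wh)
  ultimately show ?thesis using bs_Cons inside by (simp add: cmp_assoc)
 qed
qed

text \<open>Stability of the spans under precomposition with \<open>g\<close> in every context.
  Unlike membership in a span, this passes to composites, sums and whiskerings, hence from
  generators to all morphisms.\<close>

definition preg where "preg g \<longleftrightarrow> (\<forall>P S Y F. P : OB --> S : OB --> Y : OB --> F : SP (P @ cd g @ S) Y --> cmp F (wh P g S) : SP (P @ dm g @ S) Y)"

lemma preg_gen:
 assumes g: "hg q g" "cd g ~= []" and nat: "\<And>y. [y] : OB ==> nat_ok y g" and loc: "\<And>y. [y] : OB ==> loc_ok y g"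
 shows "preg g"
 unfolding preg_def
proof (intro allI impI)
 fix P S Y F assume o: "P : OB" "S : OB" "Y : OB" and F: "F : SP (P @ cd g @ S) Y"
 note ag = hg_ar[OF g(1)]
 have oX: "P @ cd g @ S : OB" using o ag by simp
 have "F : hm (P @ cd g @ S) Y" by (rule SP_hm[OF oX o(3) F])
 then have f: "ar F" "dm F = P @ cd g @ S" "cd F = Y" by (auto simp: hm_iff)
 have "cmp (idm Y) (cmp (wh [] F []) (wh P g S)) : lspan (P @ dm g @ S) Y {F. (P @ dm g @ S, Y, F) : Bs}"
 proof (rule lspan_sandwich[OF F[unfolded SP_def] Bs_hm])
  fix b assume "b : {F. (P @ cd g @ S, Y, F) : Bs}"
  then have b: "(P @ cd g @ S, Y, b) : Bs" by simp
  have "ar b" "dm b = P @ cd g @ S" "cd b = Y" using Bs_typed[OF b] by (auto simp: hm_iff)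
  then show "cmp (idm Y) (cmp (wh [] b []) (wh P g S)) : lspan (P @ dm g @ S) Y {F. (P @ dm g @ S, Y, F) : Bs}"
   using Bs_pre[OF b refl g nat loc] o ag unfolding SP_def by simp
 qed (use o ag oX in auto)
 then show "cmp F (wh P g S) : SP (P @ dm g @ S) Y" unfolding SP_def using f o ag by simp
qed

lemma preg_pls: "preg g ==> preg h ==> ar g ==> ar h ==> dm g = dm h ==> cd g = cd h ==> preg (pls g h)"
 unfolding preg_def
proof (intro allI impI)
 fix P S Y F assume g: "\<forall>P S Y F. P : OB --> S : OB --> Y : OB --> F : SP (P @ cd g @ S) Y --> cmp F (wh P g S) : SP (P @ dm g @ S) Y"
  and h: "\<forall>P S Y F. P : OB --> S : OB --> Y : OB --> F : SP (P @ cd h @ S) Y --> cmp F (wh P h S) : SP (P @ dm h @ S) Y"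
  and t: "ar g" "ar h" "dm g = dm h" "cd g = cd h"
  and o: "P : OB" "S : OB" "Y : OB" and F: "F : SP (P @ cd (pls g h) @ S) Y"
 have "F : hm (P @ cd h @ S) Y" by (rule SP_hm) (use o t F in auto)
 then have f: "ar F" "dm F = P @ cd h @ S" "cd F = Y" by (auto simp: hm_iff)
 have "cmp F (wh P (pls g h) S) = pls (cmp F (wh P g S)) (cmp F (wh P h S))"
  using f o t by (simp add: pls_wh cmp_pls)
 then show "cmp F (wh P (pls g h) S) : SP (P @ dm (pls g h) @ S) Y" using g h o F t by (auto intro!: SP_ops(1))
qed

lemma preg_scl: "preg g ==> ar g ==> preg (scl c g)"
 unfolding preg_def
proof (intro allI impI)
 fix P S Y F assume g: "\<forall>P S Y F. P : OB --> S : OB --> Y : OB --> F : SP (P @ cd g @ S) Y --> cmp F (wh P g S) : SP (P @ dm g @ S) Y"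
  and t: "ar g"
  and o: "P : OB" "S : OB" "Y : OB" and F: "F : SP (P @ cd (scl c g) @ S) Y"
 have "F : hm (P @ cd g @ S) Y" by (rule SP_hm) (use o t F in auto)
 then have f: "ar F" "dm F = P @ cd g @ S" "cd F = Y" by (auto simp: hm_iff)
 have "cmp F (wh P (scl c g) S) = scl c (cmp F (wh P g S))" using f o t by simp
 then show "cmp F (wh P (scl c g) S) : SP (P @ dm (scl c g) @ S) Y" using g o F t by (auto intro!: SP_ops(2))
qed

lemma preg_nul: "X : OB ==> X' : OB ==> preg (nul X X')"
 unfolding preg_def
proof (intro allI impI)
 fix P S Y F assume t: "X : OB" "X' : OB"
  and o: "P : OB" "S : OB" "Y : OB" and F: "F : SP (P @ cd (nul X X') @ S) Y"
 have "F : hm (P @ X' @ S) Y" by (rule SP_hm) (use o t F in auto)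
 then have f: "ar F" "dm F = P @ X' @ S" "cd F = Y" by (auto simp: hm_iff)
 have "cmp F (wh P (nul X X') S) = nul (P @ X @ S) Y" using f o t by simp
 then show "cmp F (wh P (nul X X') S) : SP (P @ dm (nul X X') @ S) Y" using t by (simp add: SP_ops(3))
qed

lemma preg_cmp: "preg g ==> preg h ==> ar g ==> ar h ==> cd h = dm g ==> preg (cmp g h)"
 unfolding preg_def by (auto simp: cmp_wh cmp_assoc[symmetric])

lemma preg_wh: "preg g ==> ar g ==> W : OB ==> W' : OB ==> preg (wh W g W')"
 unfolding preg_def
proof (intro allI impI)
 fix P S Y F assume g: "\<forall>P S Y F. P : OB --> S : OB --> Y : OB --> F : SP (P @ cd g @ S) Y --> cmp F (wh P g S) : SP (P @ dm g @ S) Y"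
  and t: "ar g" "W : OB" "W' : OB"
  and o: "P : OB" "S : OB" "Y : OB" and F: "F : SP (P @ cd (wh W g W') @ S) Y"
 have "cmp F (wh (P @ W) g (W' @ S)) : SP ((P @ W) @ dm g @ (W' @ S)) Y"
  using g[rule_format, of "P @ W" "W' @ S" Y F] o t F by simp
 then show "cmp F (wh P (wh W g W') S) : SP (P @ dm (wh W g W') @ S) Y" using o t by simp
qed

lemma preg_apply: "preg g ==> ar g ==> F : SP (cd g) Y ==> Y : OB ==> cmp F g : SP (dm g) Y"
 unfolding preg_def using wh_nil'[of g] by (metis append.left_neutral append.right_neutral obs_simps(1))

end

section \<open>Generators and the spanning theorem\<close>

context frobenius_superalgebra begin

subsection \<open>Elements of the polynomial algebras in coordinates\<close>

lemma VV_expand: "v : VV n ==> finite I ==> kys v <= I ==> v = (\<Sum>l\<in>I. pscale (lkp v l) (sng l 1))"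
proof (rule poly_mapping_eqI)
 fix k assume I: "finite I" "kys v <= I"
 have "lkp (\<Sum>l\<in>I. pscale (lkp v l) (sng l 1)) k
   = (\<Sum>l\<in>I. if l = k then lkp v k else 0)"
  by (auto simp: lookup_sum lookup_single when_def intro!: sum.cong)
 also have "... = lkp v k" using I by (auto simp: in_keys_iff)
 finally show "lkp v k = lkp (\<Sum>l\<in>I. pscale (lkp v l) (sng l 1)) k" ..
qed

lemma VV_bound: "\<exists>N. \<forall>l\<in>kys v. \<forall>e\<in>set l. snd e < (N :: nat)" for v :: "('a \<times> nat) list \<Rightarrow>\<^sub>0 'k"
proof -
 have "finite (\<Union>l\<in>kys v. snd ` set l)" by auto
 then obtain N where "\<forall>r\<in>(\<Union>l\<in>kys v. snd ` set l). r < N" using finite_nat_set_iff_bounded by blast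
 then show ?thesis by blast
qed

text \<open>The coefficient of \<open>x^r\<close> is assembled from the coordinates of the
  one-letter words with exponent \<open>r\<close>; all exponents of a finite support lie below some
  \<open>N\<close>.\<close>

lemma Pol1_coords: assumes u: "u : carr (Pol A 1)" shows "\<exists>a N. u = pol1_of A a N"
proof -
 define v where "v = PH 1 u"
 have v: "v : VV 1" using PH_VV[OF u] by (simp add: v_def)
 obtain N where N: "\<forall>l\<in>kys v. \<forall>e\<in>set l. snd e < N" using VV_bound by blast
 define a where "a r = (\<Sum>b\<in>basis A. frobenius_data.scl A (lkp v [(b, r)]) b)" for r
 let ?f = "\<Sum>r<N. mon (GA 1 (a r) # replicate r (GX 1))"
 have f: "?f : falg_on 1" by (auto simp: falg_on_def dest!: subsetD[OF keys_sum] split: if_splits)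
 have w: "PHI 1 (mon (GA 1 (a r) # replicate r (GX 1))) = (\<Sum>c\<in>basis A. pscale (lkp v [(c, r)]) (sng [(c, r)] 1))" for r
 proof -
  have p: "wact (block 1 (c, r)) (vac 1) = sng [(c, r)] 1" if "c : basis A" for c
   using wact_pword[of "[(c, r)]" 1 1 0] that one_VV by (simp add: L_def One_nat_def)
  have 1: "(Lx ^^ r) (vac 1) = e1 1 r"
   by (induction r) (simp_all add: vac_simps Lx_e1_one)
  have "PHI 1 (mon (GA 1 (a r) # replicate r (GX 1))) = La (a r) (e1 1 r)"
   using gact_VV1[of "GA 1 (a r)" "e1 1 r"] e1_VV by (simp add: PHI_def wact_replicate_x1 vac_VV 1 del: gact.simps)
  also have "... = e1 (a r) r" by (simp add: La_e1)
  also have "... = (\<Sum>c\<in>basis A. pscale (cf c (a r)) (sng [(c, r)] 1))" by (simp add: e1_def)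
  finally show ?thesis by (simp add: a_def cf_sum_basis del: pscale_simps(5))
 qed
 let ?I = "(%(r, c). [(c, r)]) ` ({..<N} \<times> basis A)"
 have "kys v <= ?I"
 proof
  fix l assume l: "l : kys v"
  then have "l : L 1" using v by (auto simp: VV_def supp_def)
  then obtain c r where "l = [(c, r)]" "c : basis A" by (auto simp: L_def length_Suc_conv One_nat_def)
  then show "l : ?I" using N l by force
 qed
 then have "v = (\<Sum>l\<in>?I. pscale (lkp v l) (sng l 1))"
  by (intro VV_expand[OF v]) (auto simp: basis_finite)
 also have "... = (\<Sum>(r, c)\<in>{..<N} \<times> basis A. pscale (lkp v [(c, r)]) (sng [(c, r)] 1))"
  by (subst sum.reindex) (auto simp: inj_on_def intro!: sum.cong simp del: pscale_simps(5))
 also have "... = PHI 1 ?f" unfolding lin_sum[OF lin_PHI] w sum.cartesian_product ..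
 finally have "PH 1 u = PH 1 (pol_class A 1 ?f)" unfolding PH_class[OF f] v_def .
 then have "u = pol_class A 1 ?f" by (rule PH_inj[OF u, THEN iffD1, rotated]) (use f in "auto simp: Pol_carr")
 then show ?thesis unfolding pol1_of_def by blast
qed

lemma gact_GA2_GX1: assumes "c : grade A p" "v : VV 2"
 shows "gact (GA 2 c) (gact (GX 1) v) = pscale (ksgn (eps A) p) (gact (GX 1) (gact (GA 2 c) v))"
proof -
 have "mon [GA 2 c] * mon [GX 1] - pscale (ksgn (eps A) p) (mon [GX 1] * mon [GA 2 c]) : pol_ideal A 2"
  using pol_rel.x_nak[of 1 2 2 c A p] assms by (auto intro: pol_ideal.rel)
 from act_pol_ideal[OF this assms(2)] show ?thesis by (simp add: act_diff vm_mult del: gact.simps)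
qed

text \<open>The words of \<open>pol2_of\<close> put both algebra elements before both powers,
  whereas the model alternates them; the coordinates differ by the sign for moving
  \<open>c_2\<close> past \<open>x_1^r\<close>.\<close>

lemma Pol2_coords: assumes u: "u : carr (Pol A 2)" shows "\<exists>\<mu> N. u = pol2_of A \<mu> N"
proof -
 define v where "v = PH 2 u"
 have v: "v : VV 2" using PH_VV[OF u] by (simp add: v_def)
 obtain N where N: "\<forall>l\<in>kys v. \<forall>e\<in>set l. snd e < N" using VV_bound by blast
 \<comment> \<open>Sign of moving \<open>c_2\<close> past one \<open>x_1\<close>; its
   \<open>r\<close>-th power squares to 1, so it can be cancelled.\<close>
 define k :: "'a => 'k" where "k c = ksgn (eps A) (bpar A c)" for c
 have kk: "k c ^ r * k c ^ r = 1" for c r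
  by (simp add: k_def ksgn_def power_mult_distrib[symmetric])
 define \<mu> where "\<mu> b c r s = lkp v [(b, r), (c, s)] * k c ^ r" for b c r s
 let ?w = "%b c r s. [GA 1 b, GA 2 c] @ replicate r (GX 1) @ replicate s (GX 2)"
 let ?f = "\<Sum>b\<in>basis A. \<Sum>c\<in>basis A. \<Sum>r<N. \<Sum>s<N. pscale (\<mu> b c r s) (mon (?w b c r s))"
 have FW: "mon (?w b c r s) : falg_on 2" for b c r s by (auto simp: falg_on_def split: if_splits)
 have f: "?f : falg_on 2" by (intro falg_on_sum falg_on_closed(6) FW)
 have sl: "gact (GA 2 c) (wact (replicate r (GX 1)) z) = pscale (k c ^ r) (wact (replicate r (GX 1)) (gact (GA 2 c) z))"
  if "c : basis A" "z : VV 2" for c r z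
 proof (induction r)
  case (Suc r)
  have "wact (replicate r (GX 1)) z : VV 2" by (rule opr_VV[OF opr_wact that(2)]) (auto simp: FW_def)
  then show ?case using gact_GA2_GX1[OF basis_grade[OF that(1)]] Suc
   by (simp add: k_def lin_pscale mult.commute del: gact.simps)
 qed (simp del: gact.simps)
 have w: "PHI 2 (mon (?w b c r s)) = pscale (k c ^ r) (sng [(b, r), (c, s)] 1)"
  if bc: "b : basis A" "c : basis A" for b c r s
 proof -
  have p: "wact (block 1 (b, r) @ block 2 (c, s)) (vac 2) = sng [(b, r), (c, s)] 1"
   using wact_pword[of "[(b, r), (c, s)]" 2 1 0] bc one_VV by (simp add: L_def One_nat_def numeral_2_eq_2)
  have z: "wact (replicate s (GX 2)) (vac 2) : VV 2" by (rule opr_VV[OF opr_wact vac_VV]) (auto simp: FW_def)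
  have "PHI 2 (mon (?w b c r s)) = gact (GA 1 b) (gact (GA 2 c) (wact (replicate r (GX 1)) (wact (replicate s (GX 2)) (vac 2))))"
   by (simp add: PHI_def wact_append del: gact.simps)
  also have "... = pscale (k c ^ r) (wact (block 1 (b, r) @ block 2 (c, s)) (vac 2))"
   unfolding sl[OF bc(2) z] by (simp add: block_def wact_append lin_pscale del: gact.simps)
  finally show ?thesis unfolding p .
 qed
 let ?J = "basis A \<times> basis A \<times> {..<N} \<times> {..<N}"
 let ?I = "(%(b, c, r, s). [(b, r), (c, s)]) ` ?J"
 have "kys v <= ?I"
 proof
  fix l assume l: "l : kys v"
  then have "l : L 2" using v by (auto simp: VV_def supp_def)
  then obtain b r c s where "l = [(b, r), (c, s)]" "b : basis A" "c : basis A" by (auto simp: L_def length_Suc_conv numeral_2_eq_2)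
  then show "l : ?I" using N l by force
 qed
 then have "v = (\<Sum>l\<in>?I. pscale (lkp v l) (sng l 1))"
  by (intro VV_expand[OF v]) (auto simp: basis_finite)
 also have "... = (\<Sum>(b, c, r, s)\<in>?J. pscale (lkp v [(b, r), (c, s)]) (sng [(b, r), (c, s)] 1))"
  by (subst sum.reindex) (auto simp: inj_on_def intro!: sum.cong simp del: pscale_simps(5))
 also have "... = (\<Sum>(b, c, r, s)\<in>?J. PHI 2 (pscale (\<mu> b c r s) (mon (?w b c r s))))"
 proof (intro sum.cong refl, clarsimp simp del: pscale_simps(5))
  fix b c r s assume "b : basis A" "c : basis A"
  then show "pscale (lkp v [(b, r), (c, s)]) (sng [(b, r), (c, s)] 1) = PHI 2 (pscale (\<mu> b c r s) (mon (GA 1 b # GA 2 c # replicate r (GX 1) @ replicate s (GX 2))))"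
   using w[of b c r s] kk[of c r] by (simp add: lin_pscale[OF lin_PHI] \<mu>_def mult.assoc del: pscale_simps(5))
 qed
 also have "... = PHI 2 ?f" by (simp add: lin_sum[OF lin_PHI] sum.cartesian_product case_prod_unfold)
 finally have "PH 2 u = PH 2 (pol_class A 2 ?f)" unfolding PH_class[OF f] v_def .
 then have "u = pol_class A 2 ?f" by (rule PH_inj[OF u, THEN iffD1, rotated]) (use f in "auto simp: Pol_carr")
 then show ?thesis unfolding pol2_of_def by blast
qed

lemma ECR_carr: "Q : ECR (Pol A 1) ==> Q : carr (Pol A 1)"
 using ECR_rep[of Q] by (auto simp: Pol_carr)

lemma demazure_ECR_carr: "Q : ECR (Pol A 1) ==> demazure A 2 1 (pol_at A 2 1 Q) : carr (Pol A 2)"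
 using dem_falg_on[OF cq_falg(2)[of Q]] by (auto simp: pol_at_ECR Pol_carr)

subsection \<open>The relations involving expansions\<close>

lemma basis_list: obtains bs where "distinct bs" "set bs = basis A"
 using finite_distinct_list[OF basis_finite] by blast

lemma lsum_ar: "X : OB ==> Y : OB ==> \<forall>t\<in>set ts. wt t & src t = X & tgt t = Y ==>
  wt (lsum X Y ts) & src (lsum X Y ts) = X & tgt (lsum X Y ts) = Y"
 using lsum_wt src_lsum tgt_lsum by blast

lemma lspan_lsum: "\<forall>t\<in>set ts. cl t : lspan X Y B ==> cl (lsum X Y ts) : lspan X Y B"
 by (induction ts) (auto simp: lsum_def cl_pls intro: lspan.intros)

lemma preg_lsum: "X : OB ==> Y : OB ==> \<forall>t\<in>set ts. wt t & src t = X & tgt t = Y & preg (cl t) ==> preg (cl (lsum X Y ts))"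
proof (induction ts)
 case Nil
 then show ?case using preg_nul by (simp add: lsum_def)
next
 case (Cons t ts)
 have "preg (pls (cl t) (cl (lsum X Y ts)))"
  by (rule preg_pls) (use Cons lsum_ar[of X Y ts] in auto)
 then show ?case by (simp add: lsum_def cl_pls)
qed

lemma decomp: "ar F ==> ar G ==> ten F G = cmp (wh [] F (cd G)) (wh (dm F) G [])"
 using ten_decomp[of F "dm F" "cd F" G "dm G" "cd G"] by (simp add: hm_iff)

lemma decomp_hg: "hg p F ==> hg q G ==> ten F G = scl (ksgn p q) (cmp (wh (cd F) G []) (wh [] F (dm G)))"
proof -
 assume a: "hg p F" "hg q G"
 note b = hg_ar[OF a(1)] hg_ar[OF a(2)]
 have "cmp (wh [] F (cd G)) (wh (dm F) G []) = scl (ksgn p q) (cmp (wh (cd F) G []) (wh [] F (dm G)))"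
  by (rule wh_swap[OF a, where Z = "[]"]) auto
 then show ?thesis using decomp b by simp
qed

text \<open>Interchange separates \<open>d\<close> from \<open>h\<close> at the cost of a sign,
  after \<open>h\<close> has been split into homogeneous parts.\<close>

lemma Low_ten:
 assumes d: "d : Dec" and h: "ar h" "dm h = W @ [II]"
 shows "ten d h : Low (II # W) (cd h)"
proof -
 obtain p where p: "hg p d" and dd: "ar d" "dm d = [II]" "cd d = [II]" using Dec_props[OF d] by auto
 have hom: "ten d k : Low (II # W) (cd h)" if "hg q k" "dm k = W @ [II]" "cd k = cd h" for k q
 proof -
  have "cmp (wh [II] k []) (wh [] d (W @ [II])) : Low (II # W) (cd h)"
   unfolding Low_def by (rule lspan.lin) (use hg_ar[OF that(1)] that d in auto)
  then show ?thesis unfolding decomp_hg[OF p that(1)] Low_def dd that(2) by (rule lspan.lscl)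
 qed
 have "h : hm (W @ [II]) (cd h)" using h by (simp add: hm_iff)
 then obtain h0 h1 where k: "h0 : hmg (W @ [II]) (cd h) 0" "h1 : hmg (W @ [II]) (cd h) 1" "h = pls h0 h1"
  by (rule hm_split)
 have k': "ar h0" "dm h0 = W @ [II]" "cd h0 = cd h" "ar h1" "dm h1 = W @ [II]" "cd h1 = cd h"
  using hmg_hm[OF k(1)] hmg_hm[OF k(2)] by (auto simp: hm_iff)
 have "ten d h = pls (ten d h0) (ten d h1)"
  unfolding k(3) by (rule ten_pls_right[OF hmg_hm[OF k(1)] hmg_hm[OF k(2)], of d "[II]" "[II]"]) (use dd in "simp add: hm_iff")
 then show ?thesis using hom[OF hmg_hg[OF k(1)] k'(2,3)] hom[OF hmg_hg[OF k(2)] k'(5,6)] unfolding Low_def by (auto intro: lspan.lpls)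
qed

lemma Dec_tok: "a : grade A p ==> tk a : Dec"
 using dec_tok[OF dec_id, of a p] by simp
lemma Dec_dt: "dt : Dec" using dec_dot[OF dec_id] by simp
lemma Dec_dots: "cl (dots r) : Dec"
 by (induction r) (auto simp: dec_id cl_cmp intro: Dec_cmp Dec_dt)

text \<open>Brackets are sums of composites of tokens and dots; the empty power of the dot is the
  identity, which is the token of 1.\<close>

lemma preg_tok_dot_word: "preg dt ==> (\<And>a. preg (tk a)) ==> preg (cl (bracket1 a N))"
proof -
 assume a: "preg dt" "\<And>a. preg (tk a)"
 have d: "preg (cl (dots r))" for r
 proof (induction r)
  case 0
  have "tk 1 = idm [II]" by (rule rel_tok_one)
  then show ?case using a(2)[of 1] by simp
 qed (auto simp: cl_cmp intro!: preg_cmp a)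
 show ?thesis unfolding bracket1_def
  by (rule preg_lsum) (auto simp: cl_cmp intro!: preg_cmp a d)
qed

lemma rel_lam_rho: assumes "Q : ECR (Pol A 1)"
 obtains a N where "cmp (rh Q) (lm Q) = wh [] (cl (bracket1 a N)) [QQ Q]" "cmp (lm Q) (rh Q) = wh [QQ Q] (cl (bracket1 a N)) []"
proof -
 obtain a N where a: "Q = pol1_of A a N" using Pol1_coords[OF ECR_carr[OF assms]] by blast
 show thesis
  by (rule that[of a N]) (use cl_eqI[OF law_eq.rho_lam[OF assms a]] cl_eqI[OF law_eq.lam_rho[OF assms a]] assms in "simp_all add: cl_cmp cl_ten")
qed

lemma rel_tok_sig: "cmp (wh [] (tk a) [II]) sg = cmp sg (wh [II] (tk a) [])"
proof -
 have "cmp sg (wh [II] (tk a) []) = cmp sg (cmp (wh [II] (tk a) []) (cmp sg sg))" by (simp add: rel_sig_sig)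
 also have "... = cmp (cmp sg sg) (cmp (wh [] (tk a) [II]) sg)" unfolding cmp_assoc cmp_rw[OF rel_sig_tok[symmetric]] ..
 finally show ?thesis by (simp add: rel_sig_sig)
qed

lemma preg_lsum_conj: "\<forall>t\<in>set ts. wt t & src t = [II, II] & tgt t = [II, II] & preg (cmp sg (cmp (cl t) sg)) ==>
  preg (cmp sg (cmp (cl (lsum [II, II] [II, II] ts)) sg))"
proof (induction ts)
 case Nil
 then show ?case using preg_nul[of "[II, II]" "[II, II]"] by (simp add: lsum_def)
next
 case (Cons t ts)
 note l = lsum_ar[of "[II, II]" "[II, II]" ts]
 have "preg (pls (cmp sg (cmp (cl t) sg)) (cmp sg (cmp (cl (lsum [II, II] [II, II] ts)) sg)))"
  by (rule preg_pls) (use Cons l in auto)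
 moreover have "cmp sg (cmp (cl (lsum [II, II] [II, II] (t # ts))) sg) = pls (cmp sg (cmp (cl t) sg)) (cmp sg (cmp (cl (lsum [II, II] [II, II] ts)) sg))"
  using Cons.prems l by (simp add: lsum_def[of _ _ "t # ts"] lsum_def[of _ _ ts, symmetric] cl_pls pls_cmp cmp_pls)
 ultimately show ?case by simp
qed

text \<open>The correction \<open>T\<close> is a sum of pairs of tokens, one on each strand. It is
  therefore of the lower shape, and both \<open>T\<close> and its conjugate by the crossing inherit
  \<open>preg\<close> from tokens; this is an implication because tokens are treated only
  later.\<close>

lemma rel_sig_dot:
 obtains T where "cmp sg (wh [] dt [II]) = pls (cmp (wh [II] dt []) sg) (scl (- 1) T)"
  "ar T" "dm T = [II, II]" "cd T = [II, II]" "T : Low [II] [II]" "(\<forall>a. preg (tk a)) --> preg T & preg (cmp sg (cmp T sg))"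
proof -
 obtain bs where bs: "distinct bs" "set bs = basis A" by (rule basis_list)
 let ?ts = "[Scal (ksgn (eps A) (bpar A b)) (Tok b \<boxtimes> Tok (dual A b)). b \<leftarrow> bs]"
 let ?T = "cl (lsum [II, II] [II, II] ?ts)"
 have t: "\<forall>t\<in>set ?ts. wt t & src t = [II, II] & tgt t = [II, II]" by auto
 have T: "ar ?T" "dm ?T = [II, II]" "cd ?T = [II, II]" using lsum_ar[OF _ _ t] by auto
 have eq: "cmp sg (wh [] dt [II]) = pls (cmp (wh [II] dt []) sg) (scl (- 1) ?T)"
  using cl_eqI[OF law_eq.sig_dot[OF bs]] by (simp add: cl_cmp cl_ten cl_pls cl_scl)
 have low: "?T : Low [II] [II]" unfolding Low_def append.simps
 proof (rule lspan_lsum, clarsimp simp: cl_scl cl_ten)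
  fix b assume b: "b : set bs"
  have "ten (tk b) (tk (dual A b)) : Low [II] (cd (tk (dual A b)))"
   by (rule Low_ten[OF Dec_tok[OF basis_grade]]) (use b bs in auto)
  then show "scl (ksgn (eps A) (bpar A b)) (ten (tk b) (tk (dual A b))) : lspan [II, II] [II, II]
   {F. \<exists>h. ar h & dm h = [II] & cd h = [II] & (\<exists>e. e : Dec & F = cmp (wh [II] h []) (wh [] e [II]))}"
   unfolding Low_def by (auto intro!: lspan.lscl)
 qed
 have pr: "preg ?T" if p: "\<And>a. preg (tk a)"
 proof (rule preg_lsum)
  show "\<forall>t\<in>set ?ts. wt t & src t = [II, II] & tgt t = [II, II] & preg (cl t)"
   using p by (auto simp: cl_scl cl_ten decomp intro!: preg_scl preg_cmp preg_wh)
 qed auto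
 have pr2: "preg (cmp sg (cmp ?T sg))" if p: "\<And>a. preg (tk a)"
 proof (rule preg_lsum_conj)
  have "cmp sg (cmp (ten (tk b) (tk c)) sg) = cmp (wh [II] (tk b) []) (wh [] (tk c) [II])" for b c
  proof -
   have "cmp sg (cmp (ten (tk b) (tk c)) sg) = cmp (wh [II] (tk b) []) (cmp sg (cmp (wh [II] (tk c) []) sg))"
   by (simp add: decomp cmp_assoc cmp_rw[OF rel_sig_tok])
   also have "cmp sg (cmp (wh [II] (tk c) []) sg) = cmp (cmp sg sg) (wh [] (tk c) [II])"
   by (simp add: rel_sig_tok[symmetric] cmp_assoc)
   finally show ?thesis by (simp add: rel_sig_sig)
  qed
  then show "\<forall>t\<in>set ?ts. wt t & src t = [II, II] & tgt t = [II, II] & preg (cmp sg (cmp (cl t) sg))"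
   using p by (auto simp: cl_scl cl_ten intro!: preg_scl preg_cmp preg_wh)
 qed
 show thesis using that[OF eq T low] pr pr2 by blast
qed

text \<open>Each summand of the bracket is a decoration on the first strand beside a morphism on the
  others, so the correction in the mixed braid relation is again of the lower shape.\<close>

lemma rel_mixed: assumes Q: "Q : ECR (Pol A 1)"
 obtains T where "cmp (wh [] (rh Q) [II]) (cmp (wh [QQ Q] sg []) (wh [] (lm Q) [II])) =
   pls (cmp (wh [II] (lm Q) []) (cmp (wh [] sg [QQ Q]) (wh [II] (rh Q) []))) (scl (- 1) T)"
  "T : Low [II, QQ Q] [QQ Q, II]" "ar T" "dm T = [II, QQ Q, II]" "cd T = [II, QQ Q, II]"
proof -
 obtain bs where bs: "distinct bs" "set bs = basis A" by (rule basis_list)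
 obtain \<mu> N where m: "demazure A 2 1 (pol_at A 2 1 Q) = pol2_of A \<mu> N" using Pol2_coords[OF demazure_ECR_carr[OF Q]] by blast
 let ?T = "cl (bracket2 Q bs \<mu> N)"
 have eq: "cmp (wh [] (rh Q) [II]) (cmp (wh [QQ Q] sg []) (wh [] (lm Q) [II])) =
   pls (cmp (wh [II] (lm Q) []) (cmp (wh [] sg [QQ Q]) (wh [II] (rh Q) []))) (scl (- 1) ?T)"
  using cl_eqI[OF law_eq.mixed_braid[OF Q bs m]] Q by (simp add: cl_cmp cl_ten cl_pls cl_scl)
 have T: "ar ?T" "dm ?T = [II, QQ Q, II]" "cd ?T = [II, QQ Q, II]" using bracket2_wt[OF Q] by auto
 have el: "cl (Scal (\<mu> b c r s) ((Tok b \<boxtimes> Ident [QQ Q] \<boxtimes> Tok c) \<odot> (dots r \<boxtimes> Ident [QQ Q] \<boxtimes> dots s))) : Low [II, QQ Q] [QQ Q, II]"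
  if b: "b : basis A" "c : basis A" for b c r s
 proof -
  obtain p where p: "hg p (cl (dots r))" using Dec_props[OF Dec_dots] by blast
  have h: "hg (bpar A c) (wh [QQ Q] (tk c) [])" by (rule hg_wh[OF hg_gens(2)[OF basis_grade[OF b(2)]]]) (use Q in auto)
  have "cmp (ten (tk b) (wh [QQ Q] (tk c) [])) (ten (cl (dots r)) (wh [QQ Q] (cl (dots s)) []))
   = scl (ksgn p (bpar A c)) (ten (cmp (tk b) (cl (dots r))) (cmp (wh [QQ Q] (tk c) []) (wh [QQ Q] (cl (dots s)) [])))"
   using h p unfolding hg_def
   by (intro ten_cmp[of _ "[II]" "[II]" _ _ "[II]" _ "[QQ Q, II]" "[QQ Q, II]" _ "[QQ Q, II]"]) (use Q in "simp_all add: hm_iff")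
  moreover have "ten (cmp (tk b) (cl (dots r))) (cmp (wh [QQ Q] (tk c) []) (wh [QQ Q] (cl (dots s)) [])) : Low [II, QQ Q] [QQ Q, II]"
   using Low_ten[of "cmp (tk b) (cl (dots r))" "cmp (wh [QQ Q] (tk c) []) (wh [QQ Q] (cl (dots s)) [])" "[QQ Q]"] Q
   Dec_cmp[OF Dec_dots Dec_tok[OF basis_grade[OF b(1)]]] by simp
  ultimately show ?thesis using Q by (simp add: cl_scl cl_cmp cl_ten Low_def lspan.lscl)
 qed
 have low: "?T : Low [II, QQ Q] [QQ Q, II]"
  unfolding bracket2_def Low_def append.simps
  by (rule lspan_lsum) (use el bs in "auto simp only: Low_def append.simps set_concat set_map set_upt")
 show thesis by (rule that[OF eq low T])
qed

subsection \<open>Precomposition with the generators\<close>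

lemma nat_okI: "cmp (Cr y (cd g)) (wh [] g [y]) = cmp (wh [y] g []) (Cr y (dm g)) ==> okc y (dm g) ==> ar g ==> [y] : OB ==> nat_ok y g"
proof -
 assume a: "cmp (Cr y (cd g)) (wh [] g [y]) = cmp (wh [y] g []) (Cr y (dm g))" "okc y (dm g)" "ar g" "[y] : OB"
 have "dm g : OB" using a by auto
 then have "pls (cmp (wh [y] g []) (Cr y (dm g))) (nul (dm g @ [y]) (y # cd g)) = cmp (wh [y] g []) (Cr y (dm g))"
  by (intro pls_nul) (use a in auto)
 then show ?thesis using a unfolding nat_ok_def by metis
qed

lemma Cr_single [simp]: "[u, y] : OB ==> Cr y [u] = xg u y"
 using xg_props[of u y] by (cases u; cases y; simp)

lemma nat_tok: "[y] : OB ==> nat_ok y (tk a)"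
 by (rule nat_okI; cases y) (auto simp: rel_sig_tok rel_lam_tok)

lemma nat_dot: assumes "[y] : OB" shows "nat_ok y dt"
proof (cases y)
 case II
 obtain T where T: "cmp sg (wh [] dt [II]) = pls (cmp (wh [II] dt []) sg) (scl (- 1) T)" "T : Low [II] [II]"
  by (rule rel_sig_dot)
 have "scl (- 1) T : Low [II] [II]" using T(2) unfolding Low_def by (rule lspan.lscl)
 then show ?thesis using T(1) II unfolding nat_ok_def by auto
next
 case (QQ Q)
 show ?thesis by (rule nat_okI) (use QQ assms in "auto simp: rel_lam_dot")
qed

lemma nat_sig: "[y] : OB ==> nat_ok y sg"
 by (rule nat_okI; cases y) (auto simp: rel_braid rel_lam_sig cmp_assoc)

lemma nat_rho: assumes "[y] : OB" "Q : ECR (Pol A 1)" shows "nat_ok y (rh Q)"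
proof (cases y)
 case II
 show ?thesis by (rule nat_okI) (use II assms in "auto simp: rel_rho_sig cmp_assoc")
qed (use assms in "simp add: nat_ok_def")

lemma nat_lam: assumes "[y] : OB" "Q : ECR (Pol A 1)" shows "nat_ok y (lm Q)"
proof (cases y)
 case II
 obtain T where T: "cmp (wh [] (rh Q) [II]) (cmp (wh [QQ Q] sg []) (wh [] (lm Q) [II])) =
   pls (cmp (wh [II] (lm Q) []) (cmp (wh [] sg [QQ Q]) (wh [II] (rh Q) []))) (scl (- 1) T)"
  "T : Low [II, QQ Q] [QQ Q, II]" by (rule rel_mixed[OF assms(2)])
 have "scl (- 1) T : Low [II, QQ Q] [QQ Q, II]" using T(2) unfolding Low_def by (rule lspan.lscl)
 then show ?thesis using T(1) II assms unfolding nat_ok_def by (auto simp: cmp_assoc)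
qed (use assms in "simp add: nat_ok_def")

lemma split_single: "[x] = P @ y # R \<longleftrightarrow> P = [] & y = x & R = []"
 by (cases P) auto
lemma split_pair: "[x, x'] = P @ y # R \<longleftrightarrow> P = [] & y = x & R = [x'] | P = [x] & y = x' & R = []"
 by (cases P; cases "tl P") auto

lemma SP_dec: "d : Dec ==> d : SP [II] [II]"
 by (rule SP_strand[of II "[]" "[]" d "idm []"]) (use Dec_props[of d] in "auto simp: Decs_def")
lemma SP_dec_right: assumes "d : Dec" "W : OB" shows "wh [] d W : SP (II # W) (II # W)"
 by (rule SP_strand[of II "[]" W d "idm W"]) (use Dec_props[of d] assms in "auto simp: Decs_def")
lemma SP_idm: assumes "Y : OB" shows "idm Y : SP Y Y"
proof (cases Y)
 case Nil
 then show ?thesis using SP_base[OF bs_nil] by simp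
next
 case (Cons y V)
 then have "[y] : OB" "V : OB" using assms by (auto split: lob.splits)
 then show ?thesis unfolding Cons by (intro SP_strand[of y "[]" V "idm [y]" "idm V"]) (auto simp: Decs_id)
qed

lemma loc_tok: "a : grade A p ==> loc_ok y (tk a)"
 unfolding loc_ok_def using Dec_props dec_tok by (auto simp: split_single Decs_def intro!: SP_dec)
lemma loc_dot: "loc_ok y dt"
 unfolding loc_ok_def using Dec_props dec_dot by (auto simp: split_single Decs_def intro!: SP_dec)

lemma preg_tok: "preg (tk a)"
proof -
 obtain u w where uw: "u : grade A 0" "w : grade A 1" "a = u + w" by (rule grade_split)
 have "preg (tk u)" "preg (tk w)"
  by (rule preg_gen[OF hg_gens(2)[OF uw(1)] _ nat_tok loc_tok[OF uw(1)]], simp_all,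
   rule preg_gen[OF hg_gens(2)[OF uw(2)] _ nat_tok loc_tok[OF uw(2)]], simp_all)
 then show ?thesis unfolding uw(3) rel_tok_add by (intro preg_pls) auto
qed
lemma preg_dot: "preg dt"
 by (rule preg_gen[OF hg_gens(3) _ nat_dot loc_dot]) auto

lemma SP_tok: assumes "F : SP (P @ II # S) Y" "P : OB" "S : OB" "Y : OB"
 shows "cmp F (wh P (tk a) S) : SP (P @ II # S) Y" "cmp F (wh P dt S) : SP (P @ II # S) Y"
 using preg_tok[of a] preg_dot assms unfolding preg_def by auto

text \<open>The strand starts at either output of the crossing. Both claims are proved together by
  peeling the decoration nearest to the crossing and sliding it to the source, where
  \<open>SP_tok\<close> absorbs it; only dots leave a correction.\<close>

lemma loc_sig_left: "d : Dec ==> cmp (wh [] d [II]) sg : SP [II, II] [II, II] & cmp sg (cmp (wh [II] d []) sg) : SP [II, II] [II, II]"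
proof (induction rule: Dec.induct)
 case dec_id
 have "sg : SP [II, II] [II, II]"
  by (rule SP_strand[of II "[II]" "[]" "idm [II]" "idm [II]"]) (auto simp: Decs_id)
 then show ?case using SP_idm[of "[II, II]"] by (simp add: rel_sig_sig)
next
 case (dec_tok d a p)
 note d = Dec_props[OF dec_tok(1)]
 have "cmp (wh [] (cmp d (tk a)) [II]) sg = cmp (cmp (wh [] d [II]) sg) (wh [II] (tk a) [])"
  using d by (simp add: cmp_wh cmp_assoc rel_tok_sig)
 moreover have "cmp sg (cmp (wh [II] (cmp d (tk a)) []) sg) = cmp (cmp sg (cmp (wh [II] d []) sg)) (wh [] (tk a) [II])"
  using d by (simp add: cmp_wh cmp_assoc rel_sig_tok)
 ultimately show ?case
  using SP_tok(1)[of "cmp (wh [] d [II]) sg" "[II]" "[]" "[II, II]" a] SP_tok(1)[of "cmp sg (cmp (wh [II] d []) sg)" "[]" "[II]" "[II, II]" a] dec_tok.IH by simp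
next
 case (dec_dot d)
 note d = Dec_props[OF dec_dot(1)]
 obtain T where T: "cmp sg (wh [] dt [II]) = pls (cmp (wh [II] dt []) sg) (scl (- 1) T)"
  "ar T" "dm T = [II, II]" "cd T = [II, II]" "T : Low [II] [II]" "(\<forall>a. preg (tk a)) --> preg T & preg (cmp sg (cmp T sg))" by (rule rel_sig_dot)
 have pT: "cmp F T : SP [II, II] [II, II]" if "F : SP [II, II] [II, II]" for F
  using T(6) preg_tok preg_apply[OF _ T(2), of F "[II, II]"] that T by simp
 have b: "cmp sg (wh [II] d []) : SP [II, II] [II, II]"
  by (rule SP_strand[of II "[II]" "[]" d "idm [II]"]) (use d dec_dot in "auto simp: Decs_def")
 have neg: "pls F (scl (- 1) F) = nul (dm F) (cd F)" if "ar F" for F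
  using pls_scl_neg[of F "dm F" "cd F"] that by (simp add: hm_iff)
 \<comment> \<open>The dot relation solved for the side on which the dot has just passed the
   crossing.\<close>
 have e1: "cmp (wh [II] dt []) sg = pls (cmp sg (wh [] dt [II])) T"
  unfolding T(1) using T(2-4) pls_assoc[of "cmp (wh [II] dt []) sg" "[II, II]" "[II, II]" "scl (- 1) T" T]
   pls_comm[of "scl (- 1) T" "[II, II]" "[II, II]" T] by (simp add: hm_iff neg)
 \<comment> \<open>The same relation conjugated by the crossing, which is its own inverse.\<close>
 have e2: "cmp (wh [] dt [II]) sg = pls (cmp sg (wh [II] dt [])) (scl (- 1) (cmp sg (cmp T sg)))"
 proof -
  have "cmp (wh [] dt [II]) sg = cmp sg (cmp (cmp sg (wh [] dt [II])) sg)"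
   by (simp add: cmp_assoc[symmetric] rel_sig_sig)
  also have "... = pls (cmp sg (cmp (wh [II] dt []) (cmp sg sg))) (scl (- 1) (cmp sg (cmp T sg)))"
   unfolding T(1) using T(2-4) by (simp add: pls_cmp cmp_pls cmp_assoc)
  finally show ?thesis by (simp add: rel_sig_sig)
 qed
 have sTs: "cmp F (cmp sg (cmp T sg)) : SP [II, II] [II, II]" if F: "F : SP [II, II] [II, II]" for F
  using T(6) preg_tok preg_apply[of "cmp sg (cmp T sg)" F "[II, II]"] F T(2-4) by simp
 have f: "ar (cmp (wh [] d [II]) sg)" using d by simp
 have 1: "cmp (wh [] (cmp d dt) [II]) sg = pls (cmp (cmp (wh [] d [II]) sg) (wh [II] dt [])) (scl (- 1) (cmp (wh [] d [II]) (cmp sg (cmp T sg))))"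
  using d T(2-4) by (simp add: cmp_wh cmp_assoc e2 cmp_pls)
 have 2: "cmp sg (cmp (wh [II] (cmp d dt) []) sg) = pls (cmp (cmp sg (cmp (wh [II] d []) sg)) (wh [] dt [II])) (cmp (cmp sg (wh [II] d [])) T)"
  using d T(2-4) by (simp add: cmp_wh cmp_assoc e1 cmp_pls)
 show ?case unfolding 1 2
  using SP_tok(2)[of "cmp (wh [] d [II]) sg" "[II]" "[]" "[II, II]"] SP_tok(2)[of "cmp sg (cmp (wh [II] d []) sg)" "[]" "[II]" "[II, II]"] dec_dot.IH
   pT[OF b] sTs[OF SP_dec_right[OF dec_dot(1), of "[II]"]] by (auto intro!: SP_ops)
qed

lemma loc_sig: "loc_ok y sg"
 unfolding loc_ok_def using loc_sig_left Dec_props by (auto simp: split_pair Decs_def cmp_assoc)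

lemma preg_sig: "preg sg"
 by (rule preg_gen[OF hg_gens(1) _ nat_sig loc_sig]) auto

text \<open>The analogue for an \<open>II\<close> strand beside a \<open>Q\<close> strand:
  decorations slide through without correction, and at the end \<open>rh\<close> after
  \<open>lm\<close> is the bracket of \<open>Q\<close>, a sum of decorations.\<close>

lemma loc_rho_II: assumes Q: "Q : ECR (Pol A 1)" shows "d : Dec ==> cmp (wh [] d [QQ Q]) (rh Q) : SP [QQ Q, II] [II, QQ Q] & cmp (rh Q) (cmp (wh [QQ Q] d []) (lm Q)) : SP [II, QQ Q] [II, QQ Q]"
proof (induction rule: Dec.induct)
 case dec_id
 obtain a N where b: "cmp (rh Q) (lm Q) = wh [] (cl (bracket1 a N)) [QQ Q]" by (rule rel_lam_rho[OF Q])
 have "rh Q : SP [QQ Q, II] [II, QQ Q]"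
  by (rule SP_strand[of II "[QQ Q]" "[]" "idm [II]" "idm [QQ Q]"]) (use Q in "auto simp: Decs_id")
 moreover have "cmp (idm [II, QQ Q]) (wh [] (cl (bracket1 a N)) [QQ Q]) : SP [II, QQ Q] [II, QQ Q]"
  using preg_apply[OF preg_wh[OF preg_tok_dot_word[OF preg_dot preg_tok], of a N "[]" "[QQ Q]"], of "idm [II, QQ Q]" "[II, QQ Q]"] SP_idm[of "[II, QQ Q]"] Q by simp
 ultimately show ?case using b Q by simp
next
 case (dec_tok d a p)
 note d = Dec_props[OF dec_tok(1)]
 have "cmp (wh [] (cmp d (tk a)) [QQ Q]) (rh Q) = cmp (cmp (wh [] d [QQ Q]) (rh Q)) (wh [QQ Q] (tk a) [])"
  using d Q by (simp add: cmp_wh cmp_assoc rel_rho_tok)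
 moreover have "cmp (rh Q) (cmp (wh [QQ Q] (cmp d (tk a)) []) (lm Q)) = cmp (cmp (rh Q) (cmp (wh [QQ Q] d []) (lm Q))) (wh [] (tk a) [QQ Q])"
  using d Q by (simp add: cmp_wh cmp_assoc rel_lam_tok)
 ultimately show ?case
  using SP_tok(1)[of "cmp (wh [] d [QQ Q]) (rh Q)" "[QQ Q]" "[]" "[II, QQ Q]" a] SP_tok(1)[of "cmp (rh Q) (cmp (wh [QQ Q] d []) (lm Q))" "[]" "[QQ Q]" "[II, QQ Q]" a] dec_tok Q by simp
next
 case (dec_dot d)
 note d = Dec_props[OF dec_dot(1)]
 have "cmp (wh [] (cmp d dt) [QQ Q]) (rh Q) = cmp (cmp (wh [] d [QQ Q]) (rh Q)) (wh [QQ Q] dt [])"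
  using d Q by (simp add: cmp_wh cmp_assoc rel_rho_dot)
 moreover have "cmp (rh Q) (cmp (wh [QQ Q] (cmp d dt) []) (lm Q)) = cmp (cmp (rh Q) (cmp (wh [QQ Q] d []) (lm Q))) (wh [] dt [QQ Q])"
  using d Q by (simp add: cmp_wh cmp_assoc rel_lam_dot)
 ultimately show ?case
  using SP_tok(2)[of "cmp (wh [] d [QQ Q]) (rh Q)" "[QQ Q]" "[]" "[II, QQ Q]"] SP_tok(2)[of "cmp (rh Q) (cmp (wh [QQ Q] d []) (lm Q))" "[]" "[QQ Q]" "[II, QQ Q]"] dec_dot Q by simp
qed

text \<open>If the \<open>Q\<close> strand itself is pulled back to the front, \<open>lm\<close>
  meets \<open>rh\<close> and becomes the bracket of \<open>Q\<close> on the other strand, which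
  goes into \<open>H\<close>.\<close>

lemma preg_rho: assumes Q: "Q : ECR (Pol A 1)" shows "preg (rh Q)"
proof (rule preg_gen[OF hg_gens(4)[OF Q] _ nat_rho[OF _ Q]])
 fix y :: "('k, 'a) falg set lob"
 obtain a N where b: "cmp (lm Q) (rh Q) = wh [QQ Q] (cl (bracket1 a N)) []" by (rule rel_lam_rho[OF Q])
 have "wh [QQ Q] (cl (bracket1 a N)) [] : SP [QQ Q, II] [QQ Q, II]"
  by (rule SP_strand[of "QQ Q" "[]" "[II]" "idm [QQ Q]" "cl (bracket1 a N)"]) (use Q in "auto simp: Decs_id")
 then show "loc_ok y (rh Q)"
  unfolding loc_ok_def using loc_rho_II[OF Q] Dec_props Q b by (auto simp: split_pair Decs_def cmp_assoc)
qed (use Q in auto)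

lemma preg_lam: assumes Q: "Q : ECR (Pol A 1)" shows "preg (lm Q)"
proof (rule preg_gen[OF hg_gens(5)[OF Q] _ nat_lam[OF _ Q]])
 fix y :: "('k, 'a) falg set lob"
 have "lm Q : SP [II, QQ Q] [QQ Q, II]"
  by (rule SP_strand[of "QQ Q" "[II]" "[]" "idm [QQ Q]" "idm [II]"]) (use Q in "auto simp: Decs_id")
 then show "loc_ok y (lm Q)"
  unfolding loc_ok_def using loc_rho_II[OF Q] Dec_props Q by (auto simp: split_pair Decs_def cmp_assoc)
qed (use Q in auto)

lemma preg_idm: "X : OB ==> preg (idm X)"
 unfolding preg_def
proof (intro allI impI)
 fix P S Y F assume o: "X : OB" "P : OB" "S : OB" "Y : OB" and F: "F : SP (P @ cd (idm X) @ S) Y"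
 have "F : hm (P @ X @ S) Y" by (rule SP_hm) (use o F in auto)
 then show "cmp F (wh P (idm X) S) : SP (P @ dm (idm X) @ S) Y" using o F by (simp add: hm_iff)
qed

text \<open>Identities lie in their spans, all morphisms are \<open>preg\<close> by induction on
  terms, and \<open>F\<close> is an identity precomposed with \<open>F\<close>.\<close>

theorem spanning: assumes "ar F" shows "F : SP (dm F) (cd F)"
proof -
 have "preg (cl f)" if "wt f" for f
  using that
 proof (induction f)
  case (Ident X)
  then show ?case by (simp add: preg_idm)
 next
  case (Tens f g)
  then show ?case using wt_obs[of f] wt_obs[of g] by (auto simp: cl_ten decomp intro!: preg_cmp preg_wh)
 qed (auto simp: cl_cmp cl_pls cl_scl intro!: preg_cmp preg_nul preg_pls preg_scl preg_sig preg_tok preg_dot preg_rho preg_lam)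
 moreover obtain f where "wt f" "F = cl f" using assms by (auto simp: ar_def)
 ultimately have "preg F" by simp
 then show ?thesis using preg_apply[of F "idm (cd F)" "cd F"] SP_idm[of "cd F"] assms by simp
qed

end

section \<open>Faithfulness\<close>

context frobenius_superalgebra begin

subsection \<open>Evaluation on classes\<close>

text \<open>Evaluation of a class through a chosen term; by soundness the value on vectors of the
  source space does not depend on the choice.\<close>

definition evc where "evc F = ev (SOME f. f : F)"

lemma evc_rep: assumes "ar F" obtains f where "wt f" "F = cl f" "evc F = ev f" "src f = dm F" "tgt f = cd F"
proof -
 obtain g where g: "wt g" "F = cl g" using assms by (auto simp: ar_def)
 have m: "(SOME f. f : F) : F" unfolding g(2) by (rule someI[of _ g]) (rule cl_mem[OF g(1)])
 have "wt (SOME f. f : F)" "cl (SOME f. f : F) = F" using cl_memD[of "SOME f. f : F" g] cl_of_mem[of "SOME f. f : F" g] m unfolding g(2) by auto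
 then show thesis using that[of "SOME f. f : F"] by (metis cl_simps(2,3) evc_def)
qed

lemma opr_evc: "ar F ==> opr (nI (dm F)) (nI (cd F)) (evc F)"
 by (erule evc_rep) (metis ev_opr)
lemma lin_evc: "ar F ==> lin (evc F)" using opr_evc opr_lin by blast
lemma evc_VV: "ar F ==> v : VV (nI (dm F)) ==> evc F v : VV (nI (cd F))" using opr_evc opr_VV by blast

lemma evc_cl: assumes "wt f" "v : VV (nI (src f))" shows "evc (cl f) v = ev f v"
proof -
 have "ar (cl f)" using assms by simp
 then obtain g where g: "wt g" "cl f = cl g" "evc (cl f) = ev g" "src g = dm (cl f)" by (rule evc_rep)
 then have "law_eq A (src f) (tgt f) f g" using cl_eq_iff[OF assms(1)] by blast
 then show ?thesis using soundness assms(2) g(3) by metis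
qed

lemma evc_cmp: assumes "ar F" "ar G" "cd F = dm G" "v : VV (nI (dm F))" shows "evc (cmp G F) v = evc G (evc F v)"
proof -
 obtain f where f: "wt f" "F = cl f" "evc F = ev f" "src f = dm F" "tgt f = cd F" by (rule evc_rep[OF assms(1)])
 obtain g where g: "wt g" "G = cl g" "evc G = ev g" "src g = dm G" "tgt g = cd G" by (rule evc_rep[OF assms(2)])
 have "evc (cmp G F) v = ev (g \<odot> f) v"
  unfolding f(2) g(2) cl_cmp[symmetric] by (rule evc_cl) (use f(1,4,5) g(1,4,5) assms(3,4) in simp_all)
 then show ?thesis by (simp add: f(3) g(3))
qed

lemma evc_pls: assumes "ar F" "ar G" "dm F = dm G" "cd F = cd G" "v : VV (nI (dm F))" shows "evc (pls F G) v = evc F v + evc G v"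
proof -
 obtain f where f: "wt f" "F = cl f" "evc F = ev f" "src f = dm F" "tgt f = cd F" by (rule evc_rep[OF assms(1)])
 obtain g where g: "wt g" "G = cl g" "evc G = ev g" "src g = dm G" "tgt g = cd G" by (rule evc_rep[OF assms(2)])
 have "evc (pls F G) v = ev (Plus f g) v"
  unfolding f(2) g(2) cl_pls[symmetric] by (rule evc_cl) (use f(1,4,5) g(1,4,5) assms(3-5) in simp_all)
 then show ?thesis by (simp add: f(3) g(3))
qed

lemma evc_scl: assumes "ar F" "v : VV (nI (dm F))" shows "evc (scl c F) v = pscale c (evc F v)"
proof -
 obtain f where f: "wt f" "F = cl f" "evc F = ev f" "src f = dm F" "tgt f = cd F" by (rule evc_rep[OF assms(1)])
 have "evc (scl c F) v = ev (Scal c f) v"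
  unfolding f(2) cl_scl[symmetric] by (rule evc_cl) (use f(1,4,5) assms(2) in simp_all)
 then show ?thesis by (simp add: f(3))
qed

lemma evc_nul: "X : OB ==> Y : OB ==> v : VV (nI X) ==> evc (nul X Y) v = 0"
 using evc_cl[of "Nul X Y" v] by simp
lemma evc_idm: "X : OB ==> v : VV (nI X) ==> evc (idm X) v = v"
 using evc_cl[of "Ident X" v] by simp

lemma evc_wh: assumes "ar F" "W : OB" "W' : OB" "v : VV (nI W + (nI (dm F) + nI W'))"
 shows "evc (wh W F W') v = tens (nI W) idv (tens (nI (dm F)) (evc F) idv) v"
proof -
 obtain f where f: "wt f" "F = cl f" "evc F = ev f" "src f = dm F" "tgt f = cd F" by (rule evc_rep[OF assms(1)])
 have "evc (wh W F W') v = ev (Ident W \<boxtimes> f \<boxtimes> Ident W') v"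
  unfolding f(2) cl_wh[symmetric] by (rule evc_cl) (use f(1,4,5) assms(2-4) in simp_all)
 then show ?thesis by (simp add: f(3,4))
qed
lemma evc_wh_left: assumes "ar F" "W' : OB" "v : VV (nI (dm F) + nI W')"
 shows "evc (wh [] F W') v = tens (nI (dm F)) (evc F) idv v"
 using evc_wh[OF assms(1) _ assms(2), of "[]" v] assms by (simp add: tens0 lin_evc)
lemma evc_wh_right: assumes "ar F" "W : OB" "v : VV (nI W + nI (dm F))"
 shows "evc (wh W F []) v = tens (nI W) idv (evc F) v"
 using evc_wh[OF assms(1,2), of "[]" v] assms
  tens_right_cong[OF assms(3), of "tens (nI (dm F)) (evc F) idv" "evc F" "%v. v"] by (simp add: tens_unit_right lin_evc)

subsection \<open>Coefficients of the first and the remaining letters\<close>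

text \<open>Coefficient of the first letter \<open>e\<close>, a vector in the remaining letters;
  \<open>rc l\<close> fixes the remaining letters and keeps the first.\<close>

definition fc :: "'a \<times> nat => ((('a \<times> nat) list) \<Rightarrow>\<^sub>0 'k) => (('a \<times> nat) list \<Rightarrow>\<^sub>0 'k)" where
 "fc e = plinear (%l. if l ~= [] & hd l = e then sng (tl l) 1 else 0)"
definition rc :: "('a \<times> nat) list => ((('a \<times> nat) list) \<Rightarrow>\<^sub>0 'k) => (('a \<times> nat) list \<Rightarrow>\<^sub>0 'k)" where
 "rc l' = plinear (%l. if l ~= [] & tl l = l' then sng [hd l] 1 else 0)"
lemma lin_fc [simp]: "lin (fc e)" and lin_rc [simp]: "lin (rc l)" by (simp_all add: fc_def rc_def)
lemma fc_single [simp]: "fc e (sng (e' # l) 1) = (if e' = e then sng l 1 else 0)"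
 by (simp add: fc_def)
lemma rc_single [simp]: "rc l (sng (e # l') 1) = (if l' = l then sng [e] 1 else 0)"
 by (simp add: rc_def)
lemma fc_mult: "fc e (sng [e'] 1 * w) = (if e' = e then w else 0)"
proof (rule supp_mult_single_induct[where I = UNIV and F = "%w. fc e (sng [e'] 1 * w)"])
 show "lin (%w. if e' = e then w else (0 :: ('a \<times> nat) list \<Rightarrow>\<^sub>0 'k))" by (auto simp: lin_def)
qed (auto simp: vm_mult supp_def intro: lin_comp[OF lin_mult_left lin_fc] lin_comp[OF lin_mult_right lin_fc])
lemma lin_if: "lin (%w. if P then w else (0 :: ('a \<times> nat) list \<Rightarrow>\<^sub>0 'k))" by (auto simp: lin_def)
lemma rc_mult: assumes "u : VV 1" shows "rc l (u * sng l' 1) = (if l' = l then u else 0)"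
proof -
 have 1: "lin (%u. rc l (u * sng l' 1))"
  by (auto intro: lin_comp[OF lin_mult_left lin_rc] lin_comp[OF lin_mult_right lin_rc])
 show ?thesis by (rule VV_eqI[OF 1 lin_if[of "l' = l"] assms]) (auto simp: vm_mult L_1)
qed

lemma lookup_fc: "lkp (fc e v) l = lkp v (e # l)"
proof -
 have "lkp (fc e v) l = (\<Sum>k\<in>kys v. if k = e # l then lkp v (e # l) else 0)"
  unfolding fc_def plinear_def lookup_sum
  by (rule sum.cong) (auto simp: lookup_single when_def neq_Nil_conv)
 also have "... = lkp v (e # l)" by (simp add: in_keys_iff)
 finally show ?thesis .
qed
lemma lookup_rc: "lkp (rc l v) [e] = lkp v (e # l)"
proof -
 have "lkp (rc l v) [e] = (\<Sum>k\<in>kys v. if k = e # l then lkp v (e # l) else 0)"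
  unfolding rc_def plinear_def lookup_sum
  by (rule sum.cong) (auto simp: lookup_single when_def neq_Nil_conv)
 also have "... = lkp v (e # l)" by (simp add: in_keys_iff)
 finally show ?thesis .
qed

lemma VV_Suc_zeroI: assumes "v : VV (Suc n)" "\<And>e l. lkp v (e # l) = 0" shows "v = 0"
proof (rule poly_mapping_eqI)
 fix l
 show "lkp v l = lkp 0 l"
 proof (cases l)
  case Nil
  then have "l \<notin> kys v" using assms(1) by (auto simp: VV_def supp_def L_def)
  then show ?thesis by (simp add: in_keys_iff)
 qed (simp add: assms(2))
qed

lemma fc_VV: "v : VV (Suc n) ==> fc e v : VV n" unfolding VV_def
 by (erule lin_supp[OF lin_fc]) (auto simp: L_Suc supp_def split: if_splits)
lemma rc_VV: "v : VV (Suc n) ==> rc l v : VV 1" unfolding VV_def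
 by (erule lin_supp[OF lin_rc]) (auto simp: L_Suc L_1 supp_def split: if_splits)

text \<open>An operator on the remaining letters can be read off coefficientwise, up to the twist by
  the parity of \<open>e\<close>.\<close>

lemma fc_tens: assumes "lin G" "v : VV (Suc n)" shows "fc e (tens 1 idv G v) = twist (epar e) G (fc e v)"
proof (rule VV_eqI[OF _ _ assms(2)])
 show "lin (%v. fc e (tens 1 idv G v))" "lin (%v. twist (epar e) G (fc e v))"
  by (rule lin_comp[OF lin_tens lin_fc], rule lin_comp[OF lin_fc lin_twist[OF assms(1)]])
 fix l assume "l : L (Suc n)"
 then obtain e' l' where "l = e' # l'" by (auto simp: L_Suc)
 then show "fc e (tens 1 idv G (sng l 1)) = twist (epar e) G (fc e (sng l 1))"
  using lin_0[OF lin_twist[OF assms(1)]] by (simp add: tens_single fc_mult One_nat_def)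
qed

lemma rc_tens: assumes "opr 1 1 F" "v : VV (Suc n)" shows "rc l (tens 1 F idv v) = F (rc l v)"
proof (rule VV_eqI[OF _ _ assms(2)])
 note F = opr_lin[OF assms(1)]
 show "lin (%v. rc l (tens 1 F idv v))" "lin (%v. F (rc l v))"
  by (rule lin_comp[OF lin_tens lin_rc], rule lin_comp[OF lin_rc F])
 fix k assume "k : L (Suc n)"
 then obtain e' l' where k: "k = e' # l'" "fst e' : basis A" by (auto simp: L_Suc)
 then have "F (sng [e'] 1) : VV 1" by (intro opr_VV[OF assms(1)] VV_single) (simp add: L_def One_nat_def)
 then show "rc l (tens 1 F idv (sng k 1)) = F (rc l (sng k 1))"
  using lin_0[OF F] k by (simp add: tens_single rc_mult One_nat_def)
qed

text \<open>Reading coefficients of the first letter gives a twisted \<open>G\<close> applied to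
  each of them; the twist is undone by the sign operator, which is its own inverse.\<close>

lemma tens_id_inj: assumes "lin G" "\<And>w. w : VV n ==> G w = 0 ==> w = 0" "v : VV (Suc n)" "tens 1 idv G v = 0" shows "v = 0"
proof (rule VV_Suc_zeroI[OF assms(3)])
 fix e l
 have "twist (epar e) G (fc e v) = 0" using fc_tens[OF assms(1,3)] assms(4) by (simp add: lin_0)
 then have "Pw (epar e) (twist (epar e) G (fc e v)) = 0" by (simp add: lin_0)
 then have "G (Pw (epar e) (fc e v)) = 0" by (simp add: twist_def)
 then have "Pw (epar e) (fc e v) = 0" using assms(2) Pw_in_VV fc_VV[OF assms(3)] by blast
 then have "Pw (epar e) (Pw (epar e) (fc e v)) = 0" by (simp add: lin_0)
 then show "lkp v (e # l) = 0" using lookup_fc[of e v l] by simp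
qed

lemma tens_left_inj: assumes "opr 1 1 F" "\<And>w. w : VV 1 ==> F w = 0 ==> w = 0" "v : VV (Suc n)" "tens 1 F idv v = 0" shows "v = 0"
proof (rule VV_Suc_zeroI[OF assms(3)])
 fix e l
 have "F (rc l v) = 0" using rc_tens[OF assms(1,3)] assms(4) by (simp add: lin_0)
 then have "rc l v = 0" using assms(2) rc_VV[OF assms(3)] by blast
 then show "lkp v (e # l) = 0" using lookup_rc[of l v e] by simp
qed

subsection \<open>Multiplication by a central element on every strand\<close>

text \<open>The product \<open>Q_1 ... Q_n\<close> acting on all strands at once.\<close>

primrec Zq where "Zq Q 0 = idv" | "Zq Q (Suc n) = tens 1 (act (qrep Q)) (Zq Q n)"

context
 fixes Q assumes Q: "Q : ECR (Pol A 1)"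
begin

lemma q_opr: "opr 1 1 (act (qrep Q))" by (rule opr_act[OF ECR_rep(1)[OF Q]])

lemma Zq_opr: "opr n n (Zq Q n) & opar n 0 (Zq Q n)"
proof (induction n)
 case (Suc n)
 then show ?case using opr_tens[OF q_opr, of n n "Zq Q n"] opar_tens[OF ECR_act_even[OF Q], of n 0 "Zq Q n"] opr_lin[of n n "Zq Q n"] by (simp add: plus_1_eq_Suc)
qed simp
lemma lin_Zq: "lin (Zq Q n)" using Zq_opr opr_lin by blast

lemma Zq_add: "Zq Q (m + n) v = tens m (Zq Q m) (Zq Q n) v"
proof (induction m arbitrary: v)
 case 0
 then show ?case by (simp add: tens0 lin_Zq)
next
 case (Suc m)
 have "Zq Q (m + n) = tens m (Zq Q m) (Zq Q n)" using Suc by blast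
 then show ?case using tens_assoc[OF lin_Zq lin_Zq, of 1 m "act (qrep Q)" m n v] by (simp add: plus_1_eq_Suc)
qed

lemma Zq_inj: "v : VV n ==> Zq Q n v = 0 ==> v = 0"
proof (induction n arbitrary: v)
 case (Suc n)
 have v: "v : VV (1 + n)" using Suc by (simp add: plus_1_eq_Suc)
 have w: "tens 1 idv (Zq Q n) v : VV (Suc n)" using opr_VV[OF opr_tens[of 1 1 "%v. v" n n "Zq Q n"] v] Zq_opr by (simp add: plus_1_eq_Suc)
 have "tens 1 (act (qrep Q)) idv (tens 1 idv (Zq Q n) v) = 0"
  using Suc.prems tens_factor[OF opr_lin[OF q_opr] lin_Zq v] by simp
 then have "tens 1 idv (Zq Q n) v = 0"
  using tens_left_inj[OF q_opr ECR_act_inj[OF Q] w] by blast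
 then show ?case using tens_id_inj[OF lin_Zq Suc.IH Suc.prems(1)] by blast
qed simp

lemma Zq_1: "v : VV 1 ==> Zq Q 1 v = act (qrep Q) v"
 by (simp add: One_nat_def tens_unit_right opr_lin[OF q_opr])

text \<open>On one strand this is centrality of \<open>Q\<close>, on a crossing it is
  \<open>tau_cq_cq2\<close>, and evenness carries it through tensor products.\<close>

lemma Zq_commute: "wt f ==> v : VV (nI (src f)) ==> ev f (Zq Q (nI (src f)) v) = Zq Q (nI (tgt f)) (ev f v)"
proof (induction f arbitrary: v)
 case (Comp g f)
 then show ?case using ev_VV[of f v] by simp
next
 case (Tens f g)
 have z: "opr n n (Zq Q n)" "opar n 0 (Zq Q n)" for n using Zq_opr by auto
 have f: "opr (nI (src f)) (nI (tgt f)) (ev f)" "opr (nI (src g)) (nI (tgt g)) (ev g)" using Tens.prems ev_opr by auto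
 have v: "v : VV (nI (src f) + nI (src g))" using Tens.prems by simp
 have "ev (f \<boxtimes> g) (Zq Q (nI (src (f \<boxtimes> g))) v) = tens (nI (src f)) (ev f) (ev g) (tens (nI (src f)) (Zq Q (nI (src f))) (Zq Q (nI (src g))) v)"
  by (simp add: Zq_add)
 also have "... = tens (nI (src f)) (%v. ev f (Zq Q (nI (src f)) v)) (%v. ev g (Zq Q (nI (src g)) v)) v"
  by (rule tens_comp_left_even[OF z(1) z(2) lin_Zq opr_lin[OF f(1)] opr_lin[OF f(2)] v])
 also have "... = tens (nI (src f)) (%v. Zq Q (nI (tgt f)) (ev f v)) (%v. Zq Q (nI (tgt g)) (ev g v)) v"
  by (rule op_tens_cong[OF v]) (use Tens in auto)
 also have "... = tens (nI (tgt f)) (Zq Q (nI (tgt f))) (Zq Q (nI (tgt g))) (tens (nI (src f)) (ev f) (ev g) v)"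
  by (rule tens_comp_right_even[OF f lin_Zq lin_Zq z(2) v, symmetric])
 finally show ?case by (simp add: Zq_add)
next
 case (Plus f g)
 then show ?case using lin_add[OF lin_Zq] by simp
next
 case (Scal c f)
 then show ?case using lin_pscale[OF lin_Zq] by simp
next
 case Sig
 have v: "v : VV 2" "v : VV (1 + 1)" using Sig by (simp_all add: numeral_2_eq_2 One_nat_def)
 have Z2: "Zq Q 2 u = act (cq Q) (act (cq2 Q) u)" if u: "u : VV 2" for u
 proof -
  have u': "u : VV (1 + 1)" using u by (simp add: numeral_2_eq_2 One_nat_def)
  have "Zq Q (1 + 1) u = tens 1 (Zq Q 1) (Zq Q 1) u" by (rule Zq_add)
  also have "... = tens 1 (act (qrep Q)) (act (qrep Q)) u" by (rule op_tens_cong[OF u']) (simp_all add: Zq_1)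
  also have "... = tens 1 (act (qrep Q)) idv (tens 1 idv (act (qrep Q)) u)"
   by (rule tens_factor[OF opr_lin[OF q_opr] opr_lin[OF q_opr] u'])
  also have "... = act (cq Q) (act (cq2 Q) u)"
   using cq_tens(2)[OF Q u] cq_tens(1)[OF Q opr_VV[OF cq_opr(4)[OF Q] u]] by (simp add: cq_def[OF Q])
  finally show ?thesis by simp
 qed
 show ?case using tau_cq_cq2[OF Q v(1)] Z2 v tau_VV[OF v(1)] by (simp add: numeral_2_eq_2[symmetric])
next
 case (Tok a)
 then have v: "v : VV 1" by simp
 have g: "act (mon [GA 1 a]) u = La a u" if "u : VV 1" for u using gact_VV1[of "GA 1 a" u] that by (simp del: gact.simps)
 show ?case using ECR_act_commute[OF Q, of "mon [GA 1 a]" v] v g opr_VV[OF q_opr v] opr_VV[OF opr_La v, of a]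
  by (simp add: Zq_1 falg_on_single FW_Cons del: act_single)
next
 case Dot
 then have v: "v : VV 1" by simp
 have g: "act (mon [GX 1]) u = Lx u" if "u : VV 1" for u using gact_VV1[of "GX 1" u] that by (simp del: gact.simps)
 show ?case using ECR_act_commute[OF Q, of "mon [GX 1]" v] v g opr_VV[OF q_opr v] opr_VV[OF opr_Lx v]
  by (simp add: Zq_1 falg_on_single FW_Cons del: act_single)
next
 case (Lam P)
 then have P: "P : ECR (Pol A 1)" and v: "v : VV 1" by auto
 show ?case using ECR_act_commute[OF Q ECR_rep(1)[OF P] v] v opr_VV[OF opr_act[OF ECR_rep(1)[OF P]] v] by (simp add: Zq_1)
qed (simp_all add: lin_0[OF lin_Zq])

text \<open>The condition \<open>okc\<close> leaves only \<open>II\<close> letters to cross, and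
  each crossing is a \<open>Lam Q\<close>, hence multiplication by \<open>Q\<close> on that
  strand.\<close>

lemma evc_Cr_Q: "okc (QQ Q) U ==> U : OB ==> v : VV (nI U) ==> evc (Cr (QQ Q) U) v = Zq Q (nI U) v"
proof (induction U arbitrary: v)
 case Nil
 then show ?case using Q by (simp add: evc_idm)
next
 case (Cons u U)
 then have u: "u = II" "okc (QQ Q) U" "U : OB" by auto
 have oQ: "[QQ Q] : OB" using Q by simp
 have v: "v : VV (1 + nI U)" using Cons.prems u by (simp add: add.commute)
 have w: "tens 1 idv (Zq Q (nI U)) v : VV (1 + nI U)" using opr_VV[OF opr_tens[of 1 1 "%v. v" _ _ "Zq Q (nI U)"] v] Zq_opr by simp
 have "evc (wh [II] (Cr (QQ Q) U) []) v = tens 1 idv (evc (Cr (QQ Q) U)) v"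
  using evc_wh_right[of "Cr (QQ Q) U" "[II]" v] u Q v oQ by simp
 also have "... = tens 1 idv (Zq Q (nI U)) v"
  by (rule tens_right_cong[OF v]) (use Cons.IH u in auto)
 finally have 1: "evc (wh [II] (Cr (QQ Q) U) []) v = tens 1 idv (Zq Q (nI U)) v" .
 have 2: "evc (wh [] (lm Q) U) w = tens 1 (act (qrep Q)) idv w" if w: "w : VV (1 + nI U)" for w
 proof -
  have "evc (wh [] (lm Q) U) w = tens 1 (evc (lm Q)) idv w"
   using evc_wh_left[of "lm Q" U w] u Q w by simp
  also have "... = tens 1 (act (qrep Q)) idv w"
   by (rule tens_left_cong[OF w]) (use evc_cl[of "Lam Q"] Q in auto)
  finally show ?thesis .
 qed
 show ?case unfolding Cr.simps u xg.simps
  using evc_cmp[of "wh [II] (Cr (QQ Q) U) []" "wh [] (lm Q) U" v] u Q oQ v 1 2[OF w]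
   tens_factor[OF opr_lin[OF q_opr] lin_Zq v] by (simp add: add.commute[of _ 1] plus_1_eq_Suc)
qed

end

end

context frobenius_superalgebra begin

subsection \<open>The degree filtration\<close>

definition dg :: "('a \<times> nat) list => nat" where "dg l = sum_list (map snd l)"
lemma dg_simps [simp]: "dg [] = 0" "dg (e # l) = snd e + dg l" "dg (l @ l') = dg l + dg l'" by (simp_all add: dg_def)

text \<open>The inequality is strict, so that terms below a leading word of degree \<open>n\<close>
  lie in \<open>Dl n\<close>, and total degree at most \<open>n\<close> reads
  \<open>Dl (Suc n)\<close>.\<close>

definition Dl :: "nat => (('a \<times> nat) list \<Rightarrow>\<^sub>0 'k) set" where "Dl n = supp {l. dg l < n}"

lemma Dl_add: "u : Dl n ==> v : Dl n ==> u + v : Dl n" unfolding Dl_def by (rule supp_add)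
lemma Dl_diff: "u : Dl n ==> v : Dl n ==> u - v : Dl n" unfolding Dl_def by (rule supp_diff)
lemma Dl_pscale: "u : Dl n ==> pscale c u : Dl n" unfolding Dl_def by (rule supp_pscale)
lemma Dl_0: "0 : Dl n" by (simp add: Dl_def supp_def)
lemma Dl_mono: "m <= n ==> u : Dl m ==> u : Dl n" by (auto simp: Dl_def supp_def)
lemma Dl_sum: "(\<And>i. i : I ==> f i : Dl n) ==> sum f I : Dl n" unfolding Dl_def by (rule supp_sum)
lemma Dl_single: "dg l < n ==> sng l c : Dl n" unfolding Dl_def by (rule supp_single) simp
lemmas Dl_closed = Dl_add Dl_diff Dl_pscale Dl_0 Dl_mono Dl_sum Dl_single

lemma Dl_mult: "u : Dl (Suc a) ==> w : Dl b ==> u * w : Dl (a + b)" "u : Dl a ==> w : Dl (Suc b) ==> u * w : Dl (a + b)"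
 unfolding Dl_def by (erule supp_mult, assumption, simp add: plus_list_def)+

lemma Dl_Pw: "v : Dl n ==> Pw p v : Dl n"
 unfolding Dl_def by (erule lin_supp[OF lin_Pw]) (simp add: supp_single)

lemma Dl_VV: "v : VV m ==> v : Dl n ==> v : supp {l : L m. dg l < n}"
 by (auto simp: VV_def Dl_def supp_def)

text \<open>\<open>F\<close> raises the total degree in the \<open>x\<close> by at most
  \<open>q\<close>.\<close>

definition dgr where "dgr m q F \<longleftrightarrow> (\<forall>l\<in>L m. F (sng l 1) : Dl (Suc (dg l + q)))"

lemma dgr_apply: "lin F ==> dgr m q F ==> v : VV m ==> v : Dl n ==> F v : Dl (n + q)"
proof -
 assume a: "lin F" "dgr m q F" "v : VV m" "v : Dl n"
 show ?thesis unfolding Dl_def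
 proof (rule lin_supp[OF a(1) Dl_VV[OF a(3,4)]])
  fix l assume l: "l : {l : L m. dg l < n}"
  then have "F (sng l 1) : Dl (Suc (dg l + q))" using a(2) by (simp add: dgr_def)
  then show "F (sng l 1) : supp {l. dg l < n + q}" using Dl_closed(5)[of "Suc (dg l + q)" "n + q"] l by (simp add: Dl_def)
 qed
qed

lemma dgr_id: "dgr m 0 idv" by (simp add: dgr_def Dl_closed(7))

lemma dgr_tens: assumes "dgr m q F" "dgr n q' G" "lin G" shows "dgr (m + n) (q + q') (tens m F G)"
 unfolding dgr_def
proof
 fix l assume "l : L (m + n)"
 then obtain l1 l2 where l: "l1 : L m" "l2 : L n" "l = l1 @ l2" by (rule L_split)
 have "Pw p (G (Pw p (sng l2 1))) : Dl (Suc (dg l2 + q'))" for p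
 proof -
  have "G (Pw p (sng l2 1)) = pscale (ksgn p (lpar l2)) (G (sng l2 1))"
   using lin_single[OF assms(3), of l2 "ksgn p (lpar l2)"] by simp
  then show ?thesis using assms(2) l by (auto simp: dgr_def intro!: Dl_Pw Dl_closed(3))
 qed
 moreover have "F (sng l1 1) : Dl (Suc (dg l1 + q))" using assms(1) l by (simp add: dgr_def)
 ultimately show "tens m F G (sng l 1) : Dl (Suc (dg l + (q + q')))"
  using Dl_mult(1)[of "F (sng l1 1)" "dg l1 + q" _ "Suc (dg l2 + q')"] l
  by (simp add: tens_append L_length twist_def ac_simps)
qed

lemma e1_Dl: "e1 a r : Dl (Suc r)"
 unfolding e1_def by (intro Dl_closed(6) Dl_closed(3) Dl_closed(7)) simp
lemma dgr_La: "dgr 1 0 (La a)"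
 unfolding dgr_def
proof
 fix l assume "l : L 1"
 then obtain b r where l: "l = [(b, r)]" "b : basis A" unfolding L_1 by blast
 have "La a (sng l 1) = e1 (a * b) r" unfolding l(1) e1_basis[OF l(2), symmetric] by (rule La_e1)
 then show "La a (sng l 1) : Dl (Suc (dg l + 0))" using e1_Dl[of "a * b" r] l by simp
qed
lemma dgr_Lx: "dgr 1 1 Lx"
 unfolding dgr_def
proof
 fix l assume "l : L 1"
 then obtain b r where l: "l = [(b, r)]" "b : basis A" unfolding L_1 by blast
 have "Lx (sng l 1) = pscale (ksgn (eps A) (bpar A b)) (e1 (nki b) (Suc r))"
  unfolding l(1) e1_basis[OF l(2), symmetric] by (rule Lx_e1[OF basis_grade[OF l(2)]])
 moreover have "Suc (dg l + 1) = Suc (Suc r)" using l by simp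
 ultimately show "Lx (sng l 1) : Dl (Suc (dg l + 1))" by (simp only: Dl_pscale e1_Dl)
qed

lemma gact_Dl: assumes "i : {1..2}" "v : VV 2" "v : Dl n"
 shows "gact (GA i a) v : Dl n" "gact (GX i) v : Dl (Suc n)"
proof -
 have 2: "dgr 2 q (ins (i - 1) F)" if "dgr 1 q F" "lin F" for F q
 proof -
  have "i = 1 | i = 2" using assms(1) by auto
  then show ?thesis
   using dgr_tens[OF dgr_id[of 0] dgr_tens[OF that(1) dgr_id[of 1]]] dgr_tens[OF dgr_id[of 1] dgr_tens[OF that(1) dgr_id[of 0]]]
   by (auto simp: ins_def numeral_2_eq_2 plus_1_eq_Suc One_nat_def)
 qed
 show "gact (GA i a) v : Dl n" "gact (GX i) v : Dl (Suc n)"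
  using dgr_apply[OF lin_ins 2[OF dgr_La] assms(2,3)] dgr_apply[OF lin_ins 2[OF dgr_Lx] assms(2,3)]
  by (simp_all add: opr_lin[OF opr_La] opr_lin[OF opr_Lx] add.commute[of _ 1] plus_1_eq_Suc)
qed

lemma tele_Dl: "i : {1..2} ==> j : {1..2} ==> v : VV 2 ==> v : Dl n ==> tele i j v : Dl n"
 unfolding tele_def by (intro Dl_closed(6) Dl_closed(3) gact_Dl gact_VV) auto

primrec nx where "nx [] = (0 :: nat)" | "nx (g # w) = (case g of GA i a => nx w | GX i => Suc (nx w))"

text \<open>Induction along a word of generators: passing a token gives no correction, and passing
  an \<open>x\<close> gives a teleporter applied to the shorter vector, whose degree is one
  less.\<close>

lemma tau_lead_word: "w : FW 2 ==> wact w (vac 2) : VV 2 & wact w (vac 2) : Dl (Suc (nx w)) \<and>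
  tau (wact w (vac 2)) - Sw (wact w (vac 2)) : Dl (nx w)"
proof (induction w)
 case Nil
 have "e1 1 0 * e1 1 0 : Dl (0 + Suc 0)" by (rule Dl_mult(1)) (use e1_Dl[of 1 0] in auto)
 then have "vac 2 : Dl (Suc 0)" by (simp add: vac_simps numeral_2_eq_2)
 then show ?case using vac_VV[of 2] by (simp add: tau_vac Sw_vac Dl_closed(4))
next
 case (Cons g w)
 define v where "v = wact w (vac 2)"
 have g: "pgen_index g : {1..2}" and w: "w : FW 2" using Cons.prems by (auto simp: FW_Cons)
 have v: "v : VV 2" "v : Dl (Suc (nx w))" "tau v - Sw v : Dl (nx w)" using Cons.IH[OF w] by (auto simp: v_def)
 have d: "tau v - Sw v : VV 2" using v tau_VV Sw_VV by simp
 show ?case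
 proof (cases g)
  case (GA i a)
  have i: "i : {1..2}" "tr12 i : {1..2}" using g GA tr12_mem by auto
  have "tau (gact g v) - Sw (gact g v) = gact (GA (tr12 i) a) (tau v - Sw v)"
   using tau_GA[OF i(1) v(1), of a] Sw_gact[OF g v(1)] GA by (simp add: lin_diff[OF lin_gact] del: gact.simps)
  then have "tau (gact g v) - Sw (gact g v) : Dl (nx w)" using gact_Dl(1)[OF i(2) d v(3)] by metis
  moreover have "gact g v : Dl (Suc (nx w))" unfolding GA by (rule gact_Dl(1)[OF i(1) v(1,2)])
  moreover have "wact (g # w) (vac 2) = gact g v" "nx (g # w) = nx w" by (simp_all add: v_def GA del: gact.simps)
  ultimately show ?thesis using gact_VV[OF g v(1)] by (simp only:)
 next
  case (GX i)
  have i2: "i : {1..2}" using g GX by simp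
  have i: "i = 1 | i = 2" "i : {1..2}" "tr12 i : {1..2}" using i2 tr12_mem[OF i2] by fastforce+
  have "\<exists>t\<in>Dl (Suc (nx w)). tau (gact g v) - Sw (gact g v) = gact (GX (tr12 i)) (tau v - Sw v) + t"
   using i(1)
  proof
   assume i1: "i = 1"
   have "tau (gact g v) - Sw (gact g v) = gact (GX (tr12 i)) (tau v - Sw v) + (0 - tele 1 2 v)"
   using tau_X1[OF v(1)] Sw_gact[OF g v(1)] unfolding GX i1 lin_diff[OF lin_gact] tr12_simps pgen_relabel.simps by simp
   moreover have "0 - tele 1 2 v : Dl (Suc (nx w))" by (rule Dl_diff[OF Dl_0 tele_Dl[OF _ _ v(1,2)]]) auto
   ultimately show ?thesis by blast
  next
   assume i2: "i = 2"
   have "tau (gact g v) - Sw (gact g v) = gact (GX (tr12 i)) (tau v - Sw v) + tele 2 1 v"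
   using tau_X2[OF v(1)] Sw_gact[OF g v(1)] unfolding GX i2 lin_diff[OF lin_gact] tr12_simps pgen_relabel.simps by simp
   moreover have "tele 2 1 v : Dl (Suc (nx w))" by (rule tele_Dl[OF _ _ v(1,2)]) auto
   ultimately show ?thesis by blast
  qed
  then obtain t where t: "t : Dl (Suc (nx w))" "tau (gact g v) - Sw (gact g v) = gact (GX (tr12 i)) (tau v - Sw v) + t" by blast
  have "tau (gact g v) - Sw (gact g v) : Dl (Suc (nx w))"
   unfolding t(2) by (rule Dl_add[OF gact_Dl(2)[OF i(3) d v(3)] t(1)])
  moreover have "gact g v : Dl (Suc (Suc (nx w)))" unfolding GX by (rule gact_Dl(2)[OF i(2) v(1,2)])
  moreover have "wact (g # w) (vac 2) = gact g v" "nx (g # w) = Suc (nx w)" by (simp_all add: v_def GX del: gact.simps)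
  ultimately show ?thesis using gact_VV[OF g v(1)] by (simp only:)
 qed
qed

lemma tau_lead: assumes "[e, e'] : L 2"
 shows "tau (sng [e, e'] 1) - pscale (ksgn (epar e) (epar e')) (sng [e', e] 1) : Dl (snd e + snd e')"
proof -
 have w: "wact (pword 1 [e, e']) (vac 2) = sng [e, e'] 1"
  using wact_pword[OF assms, of 1 0] one_VV by (simp add: One_nat_def)
 have r: "nx (replicate n (GX i) @ w) = n + nx w" for n i w by (induction n) auto
 have "nx (pword 1 [e, e']) = snd e + snd e'" using r[of _ _ "[]"] by (simp add: block_def r)
 moreover have "pword 1 [e, e'] : FW 2" by (auto simp: block_def FW_def)
 ultimately show ?thesis using tau_lead_word[of "pword 1 [e, e']"] w by (simp add: Sw_single)
qed

lemma dgr_tau: "dgr 2 0 tau"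
 unfolding dgr_def
proof
 fix l assume l: "l : L 2"
 then obtain e e' where e: "l = [e, e']" by (auto simp: L_def length_Suc_conv numeral_2_eq_2)
 let ?s = "pscale (ksgn (epar e) (epar e')) (sng [e', e] 1)"
 have "(tau (sng l 1) - ?s) + ?s : Dl (Suc (dg l))"
  by (intro Dl_closed(1) Dl_closed(3) Dl_closed(7) Dl_closed(5)[OF _ tau_lead[of e e', folded e]]) (use l e in auto)
 then show "tau (sng l 1) : Dl (Suc (dg l + 0))" by simp
qed

text \<open>Operator of pulling an \<open>II\<close> strand across \<open>U\<close>: one crossing
  per \<open>II\<close>, while passing a \<open>Q\<close> strand uses \<open>Rho\<close>, which acts
  as the identity.\<close>

primrec CO where
 "CO [] = idv"
| "CO (u # U) = (case u of II => (%v. tens 2 tau idv (tens 1 idv (CO U) v)) | QQ Q => CO U)"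

lemma CO_props: "opr (nI U + 1) (nI U + 1) (CO U) & opar (nI U + 1) 0 (CO U) & dgr (nI U + 1) 0 (CO U)"
proof (induction U)
 case Nil
 then show ?case by (simp add: dgr_id)
next
 case (Cons u U)
 show ?case
 proof (cases u)
  case II
  let ?n = "nI U + 1"
  have t: "opr (1 + ?n) (1 + ?n) (tens 1 idv (CO U))" "opar (1 + ?n) (0 + 0) (tens 1 idv (CO U))" "dgr (1 + ?n) (0 + 0) (tens 1 idv (CO U))"
   using Cons opr_lin[OF conjunct1[OF Cons]] by (intro opr_tens opar_tens dgr_tens dgr_id opr_id opar_id; simp)+
  have s: "opr (2 + nI U) (2 + nI U) (tens 2 tau idv)" "opar (2 + nI U) (0 + 0) (tens 2 tau idv)" "dgr (2 + nI U) (0 + 0) (tens 2 tau idv)"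
   by (intro opr_tens opar_tens dgr_tens dgr_id opr_id opar_id opr_tau opar_tau dgr_tau; simp)+
  have e: "2 + nI U = 1 + ?n" "nI (II # U) + 1 = 1 + ?n" by auto
  have "opr (1 + ?n) (1 + ?n) (CO (II # U))" "opar (1 + ?n) 0 (CO (II # U))"
   using opr_comp[OF t(1) s(1)[unfolded e]] opar_comp[OF t(2,1) s(2)[unfolded e]] lin_tens by auto
  moreover have "dgr (1 + ?n) 0 (CO (II # U))" unfolding dgr_def
  proof
   fix l assume l: "l : L (1 + ?n)"
   have "tens 1 idv (CO U) (sng l 1) : Dl (Suc (dg l))" using t(3) l by (simp add: dgr_def)
   moreover have "tens 1 idv (CO U) (sng l 1) : VV (1 + ?n)" by (rule opr_VV[OF t(1) VV_single[OF l]])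
   ultimately show "CO (II # U) (sng l 1) : Dl (Suc (dg l + 0))"
   using dgr_apply[OF lin_tens s(3)[unfolded e]] by simp
  qed
  ultimately show ?thesis using II by (simp add: ac_simps)
 next
  case (QQ Q)
  then show ?thesis using Cons by simp
 qed
qed

text \<open>Modulo lower degree each crossing is a signed swap, so the last letter moves to the
  front. Recording \<open>s * s = 1\<close> makes the leading coefficient invertible over any
  ring.\<close>

lemma CO_lead: "l : L (nI U) ==> fst e : basis A ==>
 \<exists>s. s * s = 1 & CO U (sng (l @ [e]) 1) - pscale s (sng (e # l) 1) : Dl (dg l + snd e)"
proof (induction U arbitrary: l)
 case Nil
 then show ?case by (auto simp: L_0 Dl_closed(4) intro!: exI[of _ 1])
next
 case (Cons u U)
 show ?case
 proof (cases u)
  case (QQ Q)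
  then show ?thesis using Cons by simp
 next
  case II
  then obtain e' l' where l: "l = e' # l'" "fst e' : basis A" "l' : L (nI U)" using Cons.prems by (auto simp: L_Suc simp flip: Suc_eq_plus1)
  obtain s where s: "s * s = 1" "CO U (sng (l' @ [e]) 1) - pscale s (sng (e # l') 1) : Dl (dg l' + snd e)"
   using Cons.IH[OF l(3) Cons.prems(2)] by blast
  \<comment> \<open>The remainder of the inner pull; the outer crossing does not raise degrees, so
    it stays a remainder.\<close>
  define low where "low = CO U (sng (l' @ [e]) 1) - pscale s (sng (e # l') 1)"
  have C: "CO U (sng (l' @ [e]) 1) = pscale s (sng (e # l') 1) + low" by (simp add: low_def)
  have m: "l' @ [e] : L (nI U + 1)" "e # l' : L (nI U + 1)" using l Cons.prems(2) by (auto simp: L_def One_nat_def)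
  have lowV: "low : VV (nI U + 1)" unfolding low_def using opr_VV[OF _ VV_single[OF m(1)], of "nI U + 1" "CO U"] CO_props[of U] VV_single[OF m(2)] by (simp del: pscale_simps(5))
  have V1: "sng [e'] 1 : VV 1" using l by (intro VV_single) (simp add: L_def One_nat_def)
  have "tens 1 idv (CO U) (sng [e'] 1 * sng (l' @ [e]) 1) = sng [e'] 1 * CO U (sng (l' @ [e]) 1)"
   using CO_props[of U] by (intro tens_mult_even[OF _ _ V1 _ VV_single[OF m(1)]]) (auto intro: opr_lin)
  then have a: "tens 1 idv (CO U) (sng (l @ [e]) 1) = pscale s (sng (e' # e # l') 1) + sng [e'] 1 * low"
   unfolding C by (simp add: vm_mult l distrib_left)
  let ?k = "ksgn (epar e') (epar e)"
  define t where "t = tau (sng [e', e] 1) - pscale ?k (sng [e, e'] 1)"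
  have t: "t : Dl (snd e' + snd e)" unfolding t_def by (rule tau_lead) (use l Cons.prems in "simp add: L_def numeral_2_eq_2")
  have b: "tens 2 tau idv (sng ([e', e] @ l') 1) = pscale ?k (sng (e # e' # l') 1) + t * sng l' 1"
   by (subst tens_append) (simp_all add: t_def vm_mult left_diff_distrib)
  have eq: "CO (u # U) (sng (l @ [e]) 1) - pscale (s * ?k) (sng (e # l) 1)
   = pscale s (t * sng l' 1) + tens 2 tau idv (sng [e'] 1 * low)"
  proof -
   have "CO (u # U) (sng (l @ [e]) 1) = pscale s (tens 2 tau idv (sng ([e', e] @ l') 1)) + tens 2 tau idv (sng [e'] 1 * low)"
   using II a by (simp add: lin_add[OF lin_tens] lin_pscale[OF lin_tens] del: pscale_simps(5))
   then show ?thesis unfolding b l(1) by (simp add: pscale_add)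
  qed
  have 1: "t * sng l' 1 : Dl (dg l + snd e)"
   using Dl_mult(2)[OF t Dl_closed(7), of l' "dg l'" 1] l by (simp add: ac_simps)
  have 2: "sng [e'] 1 * low : Dl (dg l + snd e)"
   using Dl_mult(1)[OF Dl_closed(7), of "[e']" "snd e'" low "dg l' + snd e" 1] s(2) l by (simp add: low_def ac_simps)
  have V2: "sng [e'] 1 * low : VV (2 + nI U)"
   using VV_mult[OF V1 lowV] by (simp add: numeral_2_eq_2 One_nat_def)
  have 3: "tens 2 tau idv (sng [e'] 1 * low) : Dl (dg l + snd e)"
   using dgr_apply[OF lin_tens dgr_tens[OF dgr_tau dgr_id] V2 2] by simp
  have "(s * ?k) * (s * ?k) = 1" using s(1) by (simp add: ac_simps)
  then show ?thesis unfolding eq[symmetric] using 1 3 eq by (metis Dl_closed(1) Dl_closed(3))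
 qed
qed

lemma evc_Cr_II: "U : OB ==> v : VV (nI U + 1) ==> evc (Cr II U) v = CO U v"
proof (induction U arbitrary: v)
 case Nil
 then show ?case by (simp add: evc_idm)
next
 case (Cons u U)
 then have o: "[u] : OB" "U : OB" by (auto split: lob.splits)
 show ?case
 proof (cases u)
  case II
  have v: "v : VV (1 + (nI U + 1))" using Cons.prems II by (simp add: ac_simps)
  have w: "tens 1 idv (CO U) v : VV (1 + (nI U + 1))" by (rule opr_VV[OF opr_tens[OF opr_id(1) conjunct1[OF CO_props]] v])
  have "evc (wh [II] (Cr II U) []) v = tens 1 idv (evc (Cr II U)) v"
   using evc_wh_right[of "Cr II U" "[II]" v] o v by simp
  also have "... = tens 1 idv (CO U) v" by (rule tens_right_cong[OF v]) (use Cons.IH o in auto)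
  finally have 1: "evc (wh [II] (Cr II U) []) v = tens 1 idv (CO U) v" .
  have 2: "evc (wh [] sg U) z = tens 2 tau idv z" if z: "z : VV (2 + nI U)" for z
  proof -
   have "evc (wh [] sg U) z = tens 2 (evc sg) idv z" using evc_wh_left[of sg U z] o z by (simp add: numeral_2_eq_2 One_nat_def)
   also have "... = tens 2 tau idv z" by (rule tens_left_cong[OF z]) (use evc_cl[of Sig] in "simp add: numeral_2_eq_2 One_nat_def")
   finally show ?thesis .
  qed
  have w2: "tens 1 idv (CO U) v : VV (2 + nI U)" using w by (simp add: numeral_2_eq_2 One_nat_def)
  show ?thesis unfolding Cr.simps II xg.simps
   using evc_cmp[of "wh [II] (Cr II U) []" "wh [] sg U" v] o v 1 2[OF w2] by (simp add: ac_simps)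
 next
  case (QQ Q)
  have v: "v : VV (0 + (nI U + 1))" using Cons.prems QQ by simp
  have Q: "Q : ECR (Pol A 1)" using o QQ by simp
  have 1: "evc (wh [QQ Q] (Cr II U) []) v = CO U v"
   using evc_wh_right[of "Cr II U" "[QQ Q]" v] o v QQ Cons.IH by (simp add: tens0 lin_evc)
  have 2: "evc (wh [] (rh Q) U) z = z" if z: "z : VV (1 + nI U)" for z
  proof -
   have "evc (wh [] (rh Q) U) z = tens 1 (evc (rh Q)) idv z" using evc_wh_left[of "rh Q" U z] o Q z by simp
   also have "... = tens 1 idv idv z" by (rule tens_left_cong[OF z]) (use evc_cl[of "Rho Q"] Q in simp)
   finally show ?thesis by simp
  qed
  have w2: "CO U v : VV (1 + nI U)" using opr_VV[of "nI U + 1" "nI U + 1" "CO U" v] CO_props[of U] v by (simp add: ac_simps)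
  show ?thesis unfolding Cr.simps QQ xg.simps
   using evc_cmp[of "wh [QQ Q] (Cr II U) []" "wh [] (rh Q) U" v] o Q QQ v 1 2[OF w2] by (simp add: ac_simps)
 qed
qed

end

context frobenius_superalgebra begin

subsection \<open>Normal forms of decorations\<close>

definition DS where "DS = {cmp (tk b) (cl (dots r)) | b r. b : basis A}"
lemma DS_hm: "DS <= hm [II] [II]" by (auto simp: DS_def hm_iff)

lemma rel_tok_scale: "tk (frobenius_data.scl A c a) = scl c (tk a)"
proof -
 have "scl 0 (tk 0) = nul [II] [II]" by (rule scl_zero) (simp add: hm_iff)
 then show ?thesis using rel_tok_linear[of c a 0 0] by simp
qed

lemma tok_dots_span: "cmp (tk a) (cl (dots r)) : lspan [II] [II] DS"
proof -
 have "subspace {a. cmp (tk a) (cl (dots r)) : lspan [II] [II] DS}"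
  unfolding subspace_def
 proof (intro conjI allI ballI)
  have "tk 0 = scl 0 (tk 0)" using rel_tok_scale[of 0 0] by simp
  also have "... = nul [II] [II]" by (rule scl_zero) (simp add: hm_iff)
  finally show "0 : {a. cmp (tk a) (cl (dots r)) : lspan [II] [II] DS}" by (simp add: lspan.lnul)
 qed (auto simp: rel_tok_add rel_tok_scale pls_cmp intro: lspan.intros)
 moreover have "basis A <= {a. cmp (tk a) (cl (dots r)) : lspan [II] [II] DS}"
  by (auto simp: DS_def intro!: lspan.lin)
 ultimately have "span (basis A) <= {a. cmp (tk a) (cl (dots r)) : lspan [II] [II] DS}" by (intro span_minimal)
 then show ?thesis using basis_span by auto
qed

lemma dots_dt: "cmp (cl (dots r)) dt = cl (dots (Suc r))"
 by (induction r) (simp_all add: cl_cmp cmp_assoc)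

text \<open>Tokens move to the target side of the dots by \<open>x b = +- nki b x\<close>;
  \<open>nki\<close> preserves parity, so the induction can continue.\<close>

lemma dots_tok: "a : grade A p ==> \<exists>s. \<exists>c\<in>grade A p. cmp (cl (dots r)) (tk a) = scl s (cmp (tk c) (cl (dots r)))"
proof (induction r)
 case 0
 then show ?case by (intro exI[of _ 1] bexI[of _ a]) simp_all
next
 case (Suc r)
 then obtain s c where c: "c : grade A p" "cmp (cl (dots r)) (tk a) = scl s (cmp (tk c) (cl (dots r)))" by blast
 have n: "nki c : grade A p" by (rule nki_grade[OF c(1)])
 have "cmp (tk (nki c)) dt = scl (ksgn (eps A) p) (cmp dt (tk c))" using rel_tok_dot[OF n] by simp
 then have d: "cmp dt (tk c) = scl (ksgn (eps A) p) (cmp (tk (nki c)) dt)" by simp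
 have "cmp (cl (dots (Suc r))) (tk a) = scl s (cmp (cmp dt (tk c)) (cl (dots r)))"
  using c(2) by (simp add: cl_cmp cmp_assoc)
 also have "... = scl (s * ksgn (eps A) p) (cmp (tk (nki c)) (cl (dots (Suc r))))"
  unfolding d by (simp add: cl_cmp cmp_assoc)
 finally show ?case using n by blast
qed

text \<open>Decorations reduce to the normal forms \<open>b x^r\<close> with \<open>b\<close> in the
  basis, as in the polynomial algebra.\<close>

lemma Dec_span: "d : Dec ==> d : lspan [II] [II] DS"
proof (induction rule: Dec.induct)
 case dec_id
 show ?case using tok_dots_span[of 1 0] by (simp add: rel_tok_one)
next
 case (dec_tok d a p)
 have "cmp (idm [II]) (cmp (wh [] d []) (tk a)) : lspan [II] [II] DS"
 proof (rule lspan_sandwich[OF dec_tok.IH DS_hm])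
  fix b assume "b : DS"
  then obtain x r where x: "b = cmp (tk x) (cl (dots r))" by (auto simp: DS_def)
  obtain s c where c: "cmp (cl (dots r)) (tk a) = scl s (cmp (tk c) (cl (dots r)))" using dots_tok[OF dec_tok.hyps(2)] by blast
  have "cmp (idm [II]) (cmp (wh [] b []) (tk a)) = scl s (cmp (tk (x * c)) (cl (dots r)))"
   unfolding x by (simp add: cmp_assoc c rel_tok_mult[symmetric])
  then show "cmp (idm [II]) (cmp (wh [] b []) (tk a)) : lspan [II] [II] DS" using lspan.lscl[OF tok_dots_span] by simp
 qed auto
 then show ?case using Dec_props[OF dec_tok.hyps(1)] by simp
next
 case (dec_dot d)
 have "cmp (idm [II]) (cmp (wh [] d []) dt) : lspan [II] [II] DS"
 proof (rule lspan_sandwich[OF dec_dot.IH DS_hm])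
  fix b assume "b : DS"
  then obtain x r where x: "b = cmp (tk x) (cl (dots r))" by (auto simp: DS_def)
  have "cmp (idm [II]) (cmp (wh [] b []) dt) = cmp (tk x) (cl (dots (Suc r)))"
   unfolding x by (simp add: cmp_assoc dots_dt del: dots.simps)
  then show "cmp (idm [II]) (cmp (wh [] b []) dt) : lspan [II] [II] DS" using tok_dots_span[of x "Suc r"] by simp
 qed auto
 then show ?case using Dec_props[OF dec_dot.hyps(1)] by simp
qed

subsection \<open>Finite sums of strands\<close>

text \<open>The basic morphism whose front strand starts at place \<open>p\<close> of
  \<open>X\<close>, counted from 0, with decoration \<open>b x^r\<close>.\<close>

definition BI where "BI X i H = (case i of (p, b, r) =>
  cmp (wh [II] H []) (cmp (wh [] (Cr II (take p X)) (drop (Suc p) X)) (wh (take p X) (cmp (tk b) (cl (dots r))) (drop (Suc p) X))))"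
definition del where "del p X = take p X @ drop (Suc p) X"

lemma obs_take_drop: "X : OB ==> take p X : OB & drop p X : OB"
 by (auto simp: law_obs_def dest: in_set_takeD in_set_dropD)

lemma BI_hm: assumes "X : OB" "p < length X" "X ! p = II" "H : hm (del p X) Y"
 shows "BI X (p, b, r) H : hm X (II # Y)"
proof -
 have "X = take p X @ II # drop (Suc p) X" using id_take_nth_drop[OF assms(2)] assms(3) by simp
 then show ?thesis using assms(4) obs_take_drop[OF assms(1)] by (auto simp: BI_def hm_iff del_def)
qed

lemma BI_lin: assumes "X : OB" "p < length X" "X ! p = II" "H : hm (del p X) Y"
 shows "G : hm (del p X) Y ==> BI X (p, b, r) (pls G H) = pls (BI X (p, b, r) G) (BI X (p, b, r) H)"
  "BI X (p, b, r) (scl c H) = scl c (BI X (p, b, r) H)" "Y : OB ==> BI X (p, b, r) (nul (del p X) Y) = nul X (II # Y)"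
proof -
 have X: "X = take p X @ II # drop (Suc p) X" using id_take_nth_drop[OF assms(2)] assms(3) by simp
 note o = obs_take_drop[OF assms(1)]
 show "G : hm (del p X) Y ==> BI X (p, b, r) (pls G H) = pls (BI X (p, b, r) G) (BI X (p, b, r) H)"
  using assms(4) o by (simp add: BI_def hm_iff del_def pls_wh pls_cmp)
 show "BI X (p, b, r) (scl c H) = scl c (BI X (p, b, r) H)"
  using assms(4) o by (simp add: BI_def hm_iff del_def)
 have "wh [II] (nul (del p X) Y) [] = nul (II # del p X) (II # Y)" if "Y : OB" using o that by (simp add: del_def)
 then show "Y : OB ==> BI X (p, b, r) (nul (del p X) Y) = nul X (II # Y)"
  using o X[symmetric] by (simp add: BI_def del_def)
qed

text \<open>Sums run over lists, because addition of classes obeys its laws only inside a fixed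
  morphism space.\<close>

definition psum where "psum X Y l f = foldr (%i. pls (f i)) l (nul X Y)"
lemma psum_simps: "psum X Y [] f = nul X Y" "psum X Y (i # l) f = pls (f i) (psum X Y l f)" by (simp_all add: psum_def)

context
 fixes X Y assumes oXY: "X : OB" "Y : OB"
begin

lemma psum_hm: "\<forall>i\<in>set l. f i : hm X Y ==> psum X Y l f : hm X Y"
 by (induction l) (auto simp: psum_simps intro: nul_hm oXY pls_hm)

lemma psum_cong: "\<forall>i\<in>set l. f i = g i ==> psum X Y l f = psum X Y l g"
 by (induction l) (auto simp: psum_simps)

lemma psum_nul: "psum X Y l (%i. nul X Y) = nul X Y"
 by (induction l) (simp_all add: psum_simps oXY)

lemma pls_4: assumes "a : hm X Y" "b : hm X Y" "c : hm X Y" "d : hm X Y"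
 shows "pls (pls a b) (pls c d) = pls (pls a c) (pls b d)"
proof -
 have "pls (pls a b) (pls c d) = pls a (pls (pls b c) d)" using assms by (simp add: pls_assoc pls_hm)
 also have "pls b c = pls c b" by (rule pls_comm[OF assms(2,3)])
 also have "pls a (pls (pls c b) d) = pls (pls a c) (pls b d)" using assms by (simp add: pls_assoc pls_hm)
 finally show ?thesis .
qed

lemma psum_pls: "\<forall>i\<in>set l. f i : hm X Y & g i : hm X Y ==> psum X Y l (%i. pls (f i) (g i)) = pls (psum X Y l f) (psum X Y l g)"
proof (induction l)
 case (Cons i l)
 then show ?case using pls_4[of "f i" "g i" "psum X Y l f" "psum X Y l g"] psum_hm[of l f] psum_hm[of l g] by (simp add: psum_simps)
qed (simp add: psum_simps oXY)

lemma psum_scl: "\<forall>i\<in>set l. f i : hm X Y ==> psum X Y l (%i. scl c (f i)) = scl c (psum X Y l f)"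
proof (induction l)
 case (Cons i l)
 then show ?case using scl_pls[of "f i" X Y "psum X Y l f" c] psum_hm[of l f] by (simp add: psum_simps)
qed (simp add: psum_simps scl_nul oXY)

lemma psum_single: "distinct l ==> j : set l ==> G : hm X Y ==> psum X Y l (%i. if i = j then G else nul X Y) = G"
proof (induction l)
 case (Cons i l)
 show ?case
 proof (cases "i = j")
  case True
  then have "psum X Y l (%i. if i = j then G else nul X Y) = psum X Y l (%i. nul X Y)"
   using Cons.prems by (intro psum_cong) auto
  then show ?thesis using True Cons.prems by (simp add: psum_simps psum_nul hm_iff)
 next
  case False
  then show ?thesis using Cons by (simp add: psum_simps hm_iff)
 qed
qed simp

lemma evc_psum: "\<forall>i\<in>set l. f i : hm X Y ==> v : VV (nI X) ==> evc (psum X Y l f) v = (\<Sum>i\<leftarrow>l. evc (f i) v)"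
proof (induction l)
 case (Cons i l)
 then show ?case using psum_hm[of l f] evc_pls[of "f i" "psum X Y l f" v] by (simp add: psum_simps hm_iff)
qed (simp add: psum_simps evc_nul oXY)

end

definition ps where "ps X = filter (%p. X ! p = II) [0..<length X]"
definition idx where "idx X bs R = List.product (ps X) (List.product bs [0..<R])"
lemma set_idx: "(p, b, r) : set (idx X bs R) \<longleftrightarrow> p < length X & X ! p = II & b : set bs & r < R"
 by (auto simp: idx_def ps_def)
lemma distinct_idx: "distinct bs ==> distinct (idx X bs R)"
 by (auto simp: idx_def ps_def intro!: distinct_product)

lemma SP_II_span:
 assumes "F : SP X (II # Y)" "X : OB" "Y : OB"
 shows "F : lspan X (II # Y) {BI X (p, b, r) H | p b r H. p < length X & X ! p = II & b : basis A & H : hm (del p X) Y}" (is "_ : lspan _ _ ?B")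
 using assms(1) unfolding SP_def
proof (rule lspan_lspan)
 fix g assume "g : {F. (X, II # Y, F) : Bs}"
 then have "(X, II # Y, g) : Bs" by simp
 then show "g : lspan X (II # Y) ?B"
 proof cases
  case (bs_Cons U V d H)
  have o: "U : OB" "V : OB" using bs_Cons by auto
  have X: "X = U @ II # V" and g: "g = cmp (cmp (wh [II] H []) (wh [] (Cr II U) V)) (cmp (wh U d V) (idm X))"
  proof -
   have d: "ar d" "dm d = [II]" "cd d = [II]" using Dec_props[of d] bs_Cons by (auto simp: Decs_def)
   show X: "X = U @ II # V" using bs_Cons by simp
   show "g = cmp (cmp (wh [II] H []) (wh [] (Cr II U) V)) (cmp (wh U d V) (idm X))"
   using bs_Cons d o X by (simp add: cmp_assoc)
  qed
  have H: "ar H" "dm H = U @ V" "cd H = Y" using bs_Cons by auto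
  have d: "d : lspan [II] [II] DS" using bs_Cons by (intro Dec_span) (simp add: Decs_def)
  show ?thesis unfolding g
  proof (rule lspan_sandwich[OF d DS_hm])
   fix k assume "k : DS"
   then obtain b r where k: "k = cmp (tk b) (cl (dots r))" "b : basis A" by (auto simp: DS_def)
   have "cmp (cmp (wh [II] H []) (wh [] (Cr II U) V)) (cmp (wh U k V) (idm X)) = BI X (length U, b, r) H"
   unfolding BI_def k X using o H by (simp add: cmp_assoc)
   then show "cmp (cmp (wh [II] H []) (wh [] (Cr II U) V)) (cmp (wh U k V) (idm X)) : lspan X (II # Y) ?B"
   using k H X by (intro lspan.lin CollectI exI conjI) (auto simp: hm_iff del_def)
  qed (use o H assms X in auto)
 qed
qed

text \<open>A span element becomes one sum with exactly one morphism \<open>H\<close> per index, so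
  that the coefficients \<open>H\<close> can be identified one at a time.\<close>

lemma SP_II_psum:
 assumes "F : SP X (II # Y)" and o: "X : OB" "Y : OB" and bs: "distinct bs" "set bs = basis A"
 shows "\<exists>R H. (\<forall>p b r. (p, b, r) : set (idx X bs R) --> H (p, b, r) : hm (del p X) Y) & F = psum X (II # Y) (idx X bs R) (%i. BI X i (H i))"
proof -
 let ?P = "%R F. \<exists>H. (\<forall>p b r. (p, b, r) : set (idx X bs R) --> H (p, b, r) : hm (del p X) Y) & F = psum X (II # Y) (idx X bs R) (%i. BI X i (H i))"
 have oY: "II # Y : OB" using o by simp
 have od: "del p X : OB" for p using obs_take_drop[OF o(1)] by (simp add: del_def)
 \<comment> \<open>Claiming the form for all sufficiently large \<open>R\<close> lets two summands
   be written over a common index set; missing entries are zero morphisms.\<close>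
 have "\<exists>R0. \<forall>R\<ge>R0. ?P R F"
  using SP_II_span[OF assms(1) o]
 proof induction
  case lnul
  have "psum X (II # Y) (idx X bs R) (%i. BI X i (nul (del (fst i) X) Y)) = nul X (II # Y)" for R
  proof -
   have "psum X (II # Y) (idx X bs R) (%i. BI X i (nul (del (fst i) X) Y)) = psum X (II # Y) (idx X bs R) (%i. nul X (II # Y))"
   by (rule psum_cong[OF o(1) oY]) (use BI_lin(3)[OF o(1) _ _ nul_hm[OF od o(2)] o(2)] in "auto simp: set_idx")
   then show ?thesis by (simp add: psum_nul[OF o(1) oY])
  qed
  then show ?case using nul_hm[OF od o(2)] by (intro exI[of _ 0] allI impI exI[of _ "%i. nul (del (fst i) X) Y"]) simp
 next
  case (lin g)
  then obtain p b r H where g: "g = BI X (p, b, r) H" "p < length X" "X ! p = II" "b : basis A" "H : hm (del p X) Y" by blast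
  show ?case
  proof (intro exI[of _ "Suc r"] allI impI)
   fix R assume R: "Suc r <= R"
   let ?H = "%i. if i = (p, b, r) then H else nul (del (fst i) X) Y"
   have "psum X (II # Y) (idx X bs R) (%i. BI X i (?H i)) = psum X (II # Y) (idx X bs R) (%i. if i = (p, b, r) then g else nul X (II # Y))"
   by (rule psum_cong[OF o(1) oY]) (use g BI_lin(3)[OF o(1) _ _ nul_hm[OF od o(2)] o(2)] in "auto simp: set_idx")
   also have "... = g"
   by (rule psum_single[OF o(1) oY distinct_idx[OF bs(1)]]) (use g R bs BI_hm[OF o(1)] in "auto simp: set_idx")
   finally show "?P R g" using g nul_hm[OF od o(2)] by (intro exI[of _ ?H]) auto
  qed
 next
  case (lpls F G)
  then obtain R1 R2 where R: "\<And>R. R \<ge> R1 ==> ?P R F" "\<And>R. R \<ge> R2 ==> ?P R G" by blast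
  show ?case
  proof (intro exI[of _ "max R1 R2"] allI impI)
   fix R assume "max R1 R2 <= R"
   then obtain H1 H2 where 1: "\<And>p b r. (p, b, r) : set (idx X bs R) ==> H1 (p, b, r) : hm (del p X) Y" "F = psum X (II # Y) (idx X bs R) (%i. BI X i (H1 i))"
   and 2: "\<And>p b r. (p, b, r) : set (idx X bs R) ==> H2 (p, b, r) : hm (del p X) Y" "G = psum X (II # Y) (idx X bs R) (%i. BI X i (H2 i))"
   using R(1)[of R] R(2)[of R] by auto
   have "psum X (II # Y) (idx X bs R) (%i. BI X i (pls (H1 i) (H2 i))) = psum X (II # Y) (idx X bs R) (%i. pls (BI X i (H1 i)) (BI X i (H2 i)))"
   by (rule psum_cong[OF o(1) oY], unfold Ball_def split_paired_All set_idx, intro allI impI BI_lin(1)[OF o(1)])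
   (use 1(1) 2(1) in "auto simp: set_idx")
   also have "... = pls F G" unfolding 1(2) 2(2)
   by (rule psum_pls[OF o(1) oY]) (use 1(1) 2(1) BI_hm[OF o(1)] in "auto simp: set_idx")
   finally show "?P R (pls F G)" using 1(1) 2(1) by (intro exI[of _ "%i. pls (H1 i) (H2 i)"]) (auto intro: pls_hm)
  qed
 next
  case (lscl F c)
  then obtain R1 where R: "\<And>R. R \<ge> R1 ==> ?P R F" by blast
  show ?case
  proof (intro exI[of _ R1] allI impI)
   fix R assume "R1 <= R"
   then obtain H where 1: "\<And>p b r. (p, b, r) : set (idx X bs R) ==> H (p, b, r) : hm (del p X) Y" "F = psum X (II # Y) (idx X bs R) (%i. BI X i (H i))"
   using R[of R] by auto
   have "psum X (II # Y) (idx X bs R) (%i. BI X i (scl c (H i))) = psum X (II # Y) (idx X bs R) (%i. scl c (BI X i (H i)))"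
   by (rule psum_cong[OF o(1) oY], unfold Ball_def split_paired_All set_idx, intro allI impI BI_lin(2)[OF o(1)])
   (use 1(1) in "auto simp: set_idx")
   also have "... = scl c F" unfolding 1(2)
   by (rule psum_scl[OF o(1) oY]) (use 1(1) BI_hm[OF o(1)] in "auto simp: set_idx")
   finally show "?P R (scl c F)" using 1(1) by (intro exI[of _ "%i. scl c (H i)"]) (auto intro: scl_hm)
  qed
 qed
 then show ?thesis by blast
qed

end

context frobenius_superalgebra begin

subsection \<open>Strands evaluated on words with one large exponent\<close>

definition Op where "Op b r v = La b ((Lx ^^ r) v)"
lemma Op_opr: "opr 1 1 (Op b r)"
 unfolding Op_def[abs_def] by (rule opr_comp[OF opr_funpow_Lx opr_La])

lemma dgr_funpow: "v : VV 1 ==> v : Dl n ==> (Lx ^^ r) v : Dl (n + r)"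
proof (induction r)
 case (Suc r)
 have "Lx ((Lx ^^ r) v) : Dl (n + r + 1)"
  by (rule dgr_apply[OF opr_lin[OF opr_Lx] dgr_Lx Lx_funpow_VV[OF Suc.prems(1)] Suc.IH[OF Suc.prems]])
 then show ?case by (simp add: One_nat_def)
qed simp

lemma Op_Dl: "v : VV 1 ==> v : Dl n ==> Op b r v : Dl (n + r)"
 unfolding Op_def using dgr_apply[OF opr_lin[OF opr_La] dgr_La Lx_funpow_VV dgr_funpow] by simp

lemma Op_e1: "b : basis A ==> Op b r (e1 1 N) = sng [(b, r + N)] 1"
proof -
 assume b: "b : basis A"
 have "(Lx ^^ r) (e1 1 N) = e1 1 (r + N)" by (induction r) (simp_all add: Lx_e1_one)
 then show ?thesis using b by (simp add: Op_def La_e1 e1_basis)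
qed

lemma evc_dec: assumes "v : VV 1" shows "evc (cmp (tk b) (cl (dots r))) v = Op b r v"
 using evc_cl[of "Tok b \<odot> dots r" v] assms by (simp add: cl_cmp ev_dots Op_def)

text \<open>The part of \<open>BI X (p, b, r) H\<close> that acts before \<open>H\<close>:
  decoration at place \<open>p\<close>, then the pull to the front.\<close>

definition TT where "TT X p b r v = tens (nI (take p X) + 1) (CO (take p X)) idv (tens (nI (take p X)) idv (tens 1 (Op b r) idv) v)"

lemma nI_split: assumes "p < length X" "X ! p = II" shows "nI X = nI (take p X) + (1 + nI (drop (Suc p) X))"
proof -
 have "nI X = nI (take p X @ II # drop (Suc p) X)" using id_take_nth_drop[OF assms(1)] assms(2) by simp
 then show ?thesis by simp
qed

lemma TT_opr: assumes "p < length X" "X ! p = II"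
 shows "opr (nI X) (Suc (nI (del p X))) (TT X p b r)"
proof -
 let ?k = "nI (take p X)" and ?n = "nI (drop (Suc p) X)"
 have "opr (?k + (1 + ?n)) (?k + (1 + ?n)) (tens ?k idv (tens 1 (Op b r) idv))"
  by (intro opr_tens opr_id Op_opr)
 moreover have "opr (?k + 1 + ?n) (?k + 1 + ?n) (tens (?k + 1) (CO (take p X)) idv)"
  by (intro opr_tens opr_id conjunct1[OF CO_props])
 ultimately have "opr (?k + (1 + ?n)) (?k + (1 + ?n)) (TT X p b r)"
  unfolding TT_def[abs_def] using opr_comp by (simp add: add.assoc)
 then show ?thesis using nI_split[OF assms] by (simp add: del_def plus_1_eq_Suc)
qed

lemma evc_BI: assumes "X : OB" "p < length X" "X ! p = II" "H : hm (del p X) Y" "v : VV (nI X)"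
 shows "evc (BI X (p, b, r) H) v = tens 1 idv (evc H) (TT X p b r v)"
proof -
 define U V where "U = take p X" and "V = drop (Suc p) X"
 have o: "U : OB" "V : OB" using obs_take_drop[OF assms(1)] by (auto simp: U_def V_def)
 have H: "ar H" "dm H = U @ V" using assms(4) by (auto simp: hm_iff del_def U_def V_def)
 have v: "v : VV (nI U + (1 + nI V))" using assms(5) nI_split[OF assms(2,3)] by (simp add: U_def V_def)
 let ?d = "cmp (tk b) (cl (dots r))"
 define w where "w = tens (nI U) idv (tens 1 (Op b r) idv) v"
 have w: "w : VV (nI U + (1 + nI V))" unfolding w_def by (rule opr_VV[OF _ v]) (intro opr_tens opr_id Op_opr)
 have 1: "evc (wh U ?d V) v = w"
 proof -
  have "evc (wh U ?d V) v = tens (nI U) idv (tens 1 (evc ?d) idv) v"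
   using evc_wh[of ?d U V v] o v by simp
  also have "... = w" unfolding w_def
   by (rule tens_right_cong[OF v], rule tens_left_cong) (auto simp: evc_dec)
  finally show ?thesis .
 qed
 have w': "w : VV ((nI U + 1) + nI V)" using w by (simp add: add.assoc)
 have 2: "evc (wh [] (Cr II U) V) w = TT X p b r v"
 proof -
  have "evc (wh [] (Cr II U) V) w = tens (nI U + 1) (evc (Cr II U)) idv w"
   using evc_wh_left[of "Cr II U" V w] o w' by simp
  also have "... = tens (nI U + 1) (CO U) idv w"
   by (rule tens_left_cong[OF w']) (use evc_Cr_II o in auto)
  finally show ?thesis by (simp add: TT_def w_def U_def)
 qed
 have t: "TT X p b r v : VV (1 + nI (U @ V))" using opr_VV[OF TT_opr[OF assms(2,3)] assms(5), of b r] by (simp add: del_def U_def V_def plus_1_eq_Suc)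
 have 3: "evc (wh [II] H []) (TT X p b r v) = tens 1 idv (evc H) (TT X p b r v)"
  using evc_wh_right[of H "[II]" "TT X p b r v"] H t by simp
 have a: "evc (cmp (wh [] (Cr II U) V) (wh U ?d V)) v = TT X p b r v"
  using evc_cmp[of "wh U ?d V" "wh [] (Cr II U) V" v] o v 1 2 by (simp add: ac_simps)
 have "evc (BI X (p, b, r) H) v = evc (cmp (wh [II] H []) (cmp (wh [] (Cr II U) V) (wh U ?d V))) v"
  by (simp add: BI_def U_def V_def)
 also have "... = evc (wh [II] H []) (evc (cmp (wh [] (Cr II U) V) (wh U ?d V)) v)"
  by (rule evc_cmp) (use o H v in "auto simp: ac_simps")
 finally show ?thesis unfolding a 3 .
qed

text \<open>The test vector: the word \<open>l\<close> with the letter \<open>x^N\<close> inserted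
  at place \<open>k\<close>.\<close>

definition vN where "vN k l N = sng (take k l) 1 * (e1 1 N * sng (drop k l) 1)"

lemma vN_VV: assumes "l : L (k + n)" shows "vN k l N : VV (k + (1 + n))"
 unfolding vN_def using VV_mult[OF VV_single[OF L_take[OF assms]] VV_mult[OF e1_VV VV_single[OF L_drop[OF assms]]]] .

text \<open>The strand starting at the marked place carries \<open>x^N\<close> to the front and
  picks up \<open>b x^r\<close>; all else has lower total degree.\<close>

lemma TT_own:
 assumes X: "p < length X" "X ! p = II" and l: "l : L (nI (del p X))" and b: "b : basis A" and k: "k = nI (take p X)"
 shows "\<exists>s. s * s = 1 & TT X p b r (vN k l N) - pscale s (sng ((b, r + N) # l) 1) : Dl (dg l + r + N)"
proof -
 define n where "n = nI (drop (Suc p) X)"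
 have l': "l : L (k + n)" using l by (simp add: del_def k n_def)
 define l1 l2 where "l1 = take k l" and "l2 = drop k l"
 have L12: "l1 : L k" "l2 : L n" "l = l1 @ l2" using L_take[OF l'] L_drop[OF l'] by (auto simp: l1_def l2_def)
 let ?S = "%l. sng l (1 :: 'k)"
 have V: "?S l1 : VV k" "?S l2 : VV n" using L12 by (auto intro: VV_single)
 let ?w = "e1 1 N * ?S l2"
 have hw: "?w : HV (0 + rpar N + lpar l2)" by (rule HV_mult[OF e1_HV[OF grade_one] HV_single])
 have G: "tens 1 (Op b r) idv ?w = ?S ((b, r + N) # l2)"
  using tens_mult_even[OF opr_lin[OF Op_opr] lin_id(1) e1_VV opar_id(1) V(2), of b r 1 N] b by (simp add: Op_e1 vm_mult)
 \<comment> \<open>Signs for passing the decoration over the left block: one from the twist before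
   it acts, one after.\<close>
 define s0 :: 'k where "s0 = ksgn (lpar l1) (lpar ((b, r + N) # l2)) * ksgn (lpar l1) (0 + rpar N + lpar l2)"
 have s0: "s0 * s0 = 1" "twist (lpar l1) (tens 1 (Op b r) idv) ?w = pscale s0 (?S ((b, r + N) # l2))"
 proof -
  have "s0 * s0 = (ksgn (lpar l1) (lpar ((b, r + N) # l2)) * ksgn (lpar l1) (lpar ((b, r + N) # l2))) *
   (ksgn (lpar l1) (0 + rpar N + lpar l2) * ksgn (lpar l1) (0 + rpar N + lpar l2))"
   unfolding s0_def by (simp only: mult.assoc mult.left_commute)
  then show "s0 * s0 = 1" by (simp only: ksgn_self mult_1_right)
  show "twist (lpar l1) (tens 1 (Op b r) idv) ?w = pscale s0 (?S ((b, r + N) # l2))"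
   unfolding twist_def Pw_HV[OF hw] lin_pscale[OF lin_tens] G lin_pscale[OF lin_Pw] Pw_single s0_def by (simp add: mult.commute)
 qed
 have T0: "tens k idv (tens 1 (Op b r) idv) (vN k l N) = pscale s0 (?S ((l1 @ [(b, r + N)]) @ l2))"
  unfolding vN_def l1_def[symmetric] l2_def[symmetric]
  by (subst tens_mult[OF lin_id(1) lin_tens V(1) HV_single]) (simp add: s0(2) vm_mult)
 obtain s where s: "s * s = 1" "CO (take p X) (?S (l1 @ [(b, r + N)])) - pscale s (?S ((b, r + N) # l1)) : Dl (dg l1 + (r + N))"
  using CO_lead[of l1 "take p X" "(b, r + N)"] L12 b k by auto
 define low where "low = CO (take p X) (?S (l1 @ [(b, r + N)])) - pscale s (?S ((b, r + N) # l1))"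
 have "TT X p b r (vN k l N) = pscale s0 (CO (take p X) (?S (l1 @ [(b, r + N)])) * ?S l2)"
  unfolding TT_def k[symmetric] T0 lin_pscale[OF lin_tens] by (subst tens_append) (use L12 L_length in auto)
 also have "CO (take p X) (?S (l1 @ [(b, r + N)])) = pscale s (?S ((b, r + N) # l1)) + low" by (simp add: low_def)
 finally have "TT X p b r (vN k l N) = pscale s0 ((pscale s (?S ((b, r + N) # l1)) + low) * ?S l2)" .
 then have "TT X p b r (vN k l N) - pscale (s0 * s) (?S ((b, r + N) # l)) = pscale s0 (low * ?S l2)"
  by (simp add: L12(3) distrib_right pscale_add vm_mult)
 moreover have "low * ?S l2 : Dl (dg l1 + (r + N) + dg l2)"
  by (rule Dl_mult(2)) (use s(2) in "auto simp: low_def intro: Dl_single")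
 then have "pscale s0 (low * ?S l2) : Dl (dg l + r + N)" using L12(3) by (intro Dl_pscale) (simp add: ac_simps)
 moreover have "(s0 * s) * (s0 * s) = (s0 * s0) * (s * s)" by (simp only: mult.assoc mult.left_commute)
 then have "(s0 * s) * (s0 * s) = 1" unfolding s0(1) s(1) by simp
 ultimately show ?thesis by metis
qed

lemma fc_out: assumes "x : supp {l. l ~= [] & snd (hd l) < j}" "j <= snd e" shows "fc e x = 0"
proof (rule poly_mapping_eqI)
 fix l
 have "e # l \<notin> kys x" using assms by (auto simp: supp_def)
 then show "lkp (fc e x) l = lkp 0 l" by (simp add: lookup_fc in_keys_iff)
qed

lemma nI_take_less: assumes "p' < p" "p <= length X" "X ! p' = II" shows "nI (take p' X) < nI (take p X)"
proof -
 have "take p X = take p' X @ II # drop (Suc p') (take p X)"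
  using id_take_nth_drop[of p' "take p X"] assms by (simp add: min_def)
 then have "nI (take p X) = nI (take p' X @ II # drop (Suc p') (take p X))" by simp
 then show ?thesis by simp
qed

text \<open>A strand starting further left is decorated and pulled without touching
  \<open>x^N\<close>, so its front letter has exponent at most \<open>dg l + r\<close>, too small
  for the coefficient at \<open>e\<close>.\<close>

lemma TT_left:
 assumes X: "p < length X" "X ! p = II" "p' < p" "X ! p' = II" and l: "l : L (nI (del p X))" and k: "k = nI (take p X)" and e: "dg l + r < snd e"
 shows "fc e (TT X p' b r (vN k l N)) = 0"
proof -
 define n where "n = nI (drop (Suc p) X)"
 define k' where "k' = nI (take p' X)"
 have kk: "k' < k" using nI_take_less[of p' p X] X by (simp add: k k'_def)
 have l': "l : L (k + n)" using l by (simp add: del_def k n_def)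
 define l1 l2 where "l1 = take k l" and "l2 = drop k l"
 have L12: "l1 : L k" "l2 : L n" "l = l1 @ l2" using L_take[OF l'] L_drop[OF l'] by (auto simp: l1_def l2_def)
 have len: "k' < length l1" using kk L_length[OF L12(1)] by simp
 define la f lb where "la = take k' l1" and "f = l1 ! k'" and "lb = drop (Suc k') l1"
 have l1: "l1 = la @ f # lb" unfolding la_def f_def lb_def by (rule id_take_nth_drop[OF len])
 have lens: "length la = k'" "length lb = k - k' - 1" using len L_length[OF L12(1)] by (simp_all add: la_def lb_def)
 have "fst ` set (la @ f # lb) <= basis A" using L12(1) unfolding l1[symmetric] by (simp add: L_def)
 then have bas: "fst ` set la <= basis A" "fst f : basis A" "fst ` set lb <= basis A" by (simp_all only: set_append list.set image_Un image_insert insert_subset Un_subset_iff)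
 have La: "la : L k'" "[f] : L 1" "lb : L (k - k' - 1)" using lens bas by (simp_all add: L_def One_nat_def)
 let ?S = "%l. sng l (1 :: 'k)"
 define w where "w = ?S lb * (e1 1 N * ?S l2)"
 have w: "w : VV (k - k' - 1 + (1 + n))" unfolding w_def by (intro VV_mult VV_single e1_VV La L12)
 have v: "vN k l N = ?S la * (?S [f] * w)"
 proof -
  have "?S l1 = ?S la * (?S [f] * ?S lb)" unfolding l1 vm_mult by simp
  then show ?thesis unfolding vN_def l1_def[symmetric] l2_def[symmetric] w_def by (simp only: mult.assoc)
 qed
 have V: "?S la : VV k'" "?S [f] : VV 1" using La by (auto intro: VV_single)
 let ?q = "lpar la"
 let ?u = "?S la * Pw ?q (Op b r (?S [f]))"
 have opf: "Op b r (?S [f]) : VV 1" by (rule opr_VV[OF Op_opr V(2)])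
 have opd: "Op b r (?S [f]) : Dl (Suc (snd f) + r)" by (rule Op_Dl[OF V(2) Dl_single]) simp
 have u: "?u : VV (k' + 1)" by (intro VV_mult V Pw_in_VV opf)
 have ud: "?u : Dl (dg la + (Suc (snd f) + r))" by (rule Dl_mult(1)[OF Dl_single Dl_Pw[OF opd]]) simp
 have tw: "twist ?q (tens 1 (Op b r) idv) (?S [f] * w) = pscale (ksgn ?q (lpar [f])) (Pw ?q (Op b r (?S [f])) * w)"
 proof -
  have "Pw ?q (?S [f] * w) = pscale (ksgn ?q (lpar [f])) (?S [f] * Pw ?q w)"
   unfolding Pw_mult by (subst Pw_HV[OF HV_single]) (simp only: pscale_mult_left)
  then have "tens 1 (Op b r) idv (Pw ?q (?S [f] * w)) = pscale (ksgn ?q (lpar [f])) (Op b r (?S [f]) * Pw ?q w)"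
   using tens_mult_even[OF opr_lin[OF Op_opr] lin_id(1) V(2) opar_id(1) Pw_in_VV[OF w], of b r ?q] by (simp add: lin_pscale[OF lin_tens] del: pscale_simps(5))
  then show ?thesis by (simp add: twist_def lin_pscale[OF lin_Pw] Pw_mult del: pscale_simps(5))
 qed
 have T0: "tens k' idv (tens 1 (Op b r) idv) (vN k l N) = pscale (ksgn ?q (lpar [f])) (?u * w)"
  unfolding v by (subst tens_mult[OF lin_id(1) lin_tens V(1) HV_single]) (simp add: tw mult.assoc)
 \<comment> \<open>The vector factors as \<open>u * w\<close> with \<open>x^N\<close> inside
   \<open>w\<close>, and the pull acts on \<open>u\<close> only.\<close>
 have T: "TT X p' b r (vN k l N) = pscale (ksgn ?q (lpar [f])) (CO (take p' X) ?u * w)"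
  unfolding TT_def k'_def[symmetric] T0 lin_pscale[OF lin_tens]
  using tens_mult_even[OF opr_lin[OF conjunct1[OF CO_props]] lin_id(1) u opar_id(1) w, of "take p' X"] by simp
 have c: "CO (take p' X) ?u : VV (k' + 1)" "CO (take p' X) ?u : Dl (dg la + (Suc (snd f) + r))"
 proof -
  note P = CO_props[of "take p' X", folded k'_def]
  show "CO (take p' X) ?u : VV (k' + 1)" by (rule opr_VV[OF conjunct1[OF P] u])
  show "CO (take p' X) ?u : Dl (dg la + (Suc (snd f) + r))"
   using dgr_apply[OF opr_lin[OF conjunct1[OF P]] conjunct2[OF conjunct2[OF P]] u ud] by simp
 qed
 have "CO (take p' X) ?u * w : supp {l. l ~= [] & snd (hd l) < Suc (dg l1 + r)}"
 proof (rule supp_mult[OF Dl_VV[OF c]])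
  show "w : supp UNIV" by (simp add: supp_def)
  fix i j assume "i : {l : L (k' + 1). dg l < dg la + (Suc (snd f) + r)}"
  then obtain g i' where "i = g # i'" "dg i < dg la + (Suc (snd f) + r)" by (cases i) (auto simp: L_def)
  then show "i + j : {l. l ~= [] & snd (hd l) < Suc (dg l1 + r)}" by (simp add: plus_list_def l1)
 qed
 then have "fc e (CO (take p' X) ?u * w) = 0" by (rule fc_out) (use e L12(3) in simp)
 then show ?thesis unfolding T by (simp add: lin_pscale[OF lin_fc] del: pscale_simps(5))
qed

end

context frobenius_superalgebra begin

subsection \<open>Injectivity on morphism spaces\<close>

text \<open>Trivial kernel for all morphisms with target \<open>Y\<close>, with arbitrary source.
  The source must vary, since removing a strand changes it.\<close>

definition faithful_at where "faithful_at Y \<longleftrightarrow> (\<forall>H. ar H --> cd H = Y --> (\<forall>v\<in>VV (nI (dm H)). evc H v = 0) --> H = nul (dm H) Y)"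

text \<open>By the spanning theorem morphisms to the unit object are zero or scalars, and a scalar
  is seen on the vacuum.\<close>

lemma faithful_nil: "faithful_at []"
 unfolding faithful_at_def
proof (intro allI impI)
 fix F assume F: "ar F" "cd F = []" "\<forall>v\<in>VV (nI (dm F)). evc F v = 0"
 define X where "X = dm F"
 have oX: "X : OB" using F(1) by (simp add: X_def)
 have "F : SP X []" unfolding X_def using spanning[OF F(1)] F(2) by simp
 then have "F = nul (X) [] | X = [] & (\<exists>c. F = scl c (idm []))"
  unfolding SP_def
 proof induction
  case (lin b)
  then have "(X, [], b) : Bs" by simp
  then show ?case
  proof cases
   case bs_nil
   have "idm [] = scl 1 (idm [])" by simp
   then show ?thesis using bs_nil by (intro disjI2 conjI exI[of _ 1]) simp_all
  qed
 next
  case (lpls G H)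
  have z: "nul [] [] = scl 0 (idm [])" using scl_zero[OF idm_hm[of "[]"]] by simp
  show ?case
  proof (cases "X = []")
   case True
   have ex: "\<exists>c. K = scl c (idm [])" if "K = nul X [] | X = [] & (\<exists>c. K = scl c (idm []))" for K
   using that
   proof
   assume "K = nul X []"
   then show ?thesis unfolding True z by blast
   qed blast
   obtain c d where "G = scl c (idm [])" "H = scl d (idm [])" using ex[OF lpls.IH(1)] ex[OF lpls.IH(2)] by blast
   then have "pls G H = scl (c + d) (idm [])" using pls_scl[OF idm_hm[of "[]"], of c d] by simp
   then show ?thesis using True by blast
  next
   case False
   then have "G = nul (X) []" "H = nul (X) []" using lpls.IH by auto
   then show ?thesis using oX by simp
  qed
 next
  case (lscl G c)
  show ?case using lscl.IH
  proof (elim disjE conjE exE)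
   fix d assume "X = []" "G = scl d (idm [])"
   then have "scl c G = scl (c * d) (idm [])" using scl_scl[OF idm_hm[of "[]"], of c d] by simp
   then show ?thesis using \<open>X = []\<close> by blast
  qed (use scl_nul[of "X" "[]" c] oX in simp)
 qed simp
 then have "F = nul X []"
 proof (elim disjE conjE exE)
  fix c assume c: "X = []" "F = scl c (idm [])"
  \<comment> \<open>Evaluate at the unit vector, the basis of the model of the unit object.\<close>
  have "pscale c 1 = (0 :: ('a \<times> nat) list \<Rightarrow>\<^sub>0 'k)"
   using F(3)[folded X_def] c(1) evc_scl[of "idm []" 1 c] evc_idm[of "[]" 1] one_VV unfolding c(2) by simp
  then have "lkp (pscale c (1 :: ('a \<times> nat) list \<Rightarrow>\<^sub>0 'k)) [] = 0" by simp
  then have "c = 0" by (simp add: one_single_Nil)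
  then show ?thesis using c scl_zero[OF idm_hm[of "[]"]] by simp
 qed
 then show "F = nul (dm F) []" by (simp add: X_def)
qed

definition BQ where "BQ Q U V H = cmp (wh [QQ Q] H []) (cmp (wh [] (Cr (QQ Q) U) V) (wh U (idm [QQ Q]) V))"

text \<open>A \<open>Q\<close> strand cannot cross another one, so only the first letter other than
  \<open>II\<close> can be the start of the front strand.\<close>

lemma okc_split_unique: "U @ QQ Q # V = U' @ QQ Q # V' ==> okc (QQ Q) U ==> okc (QQ Q) U' ==> U = U' & V = V'"
proof (induction U arbitrary: U')
 case Nil
 then show ?case by (cases U') auto
next
 case (Cons u U)
 then show ?case by (cases U') auto
qed

text \<open>The starting place is unique and a \<open>Q\<close> strand has no decorations, so sums
  of basic morphisms combine into one.\<close>

lemma SP_Q: assumes "F : SP X (QQ Q # Y)" "X : OB" "QQ Q # Y : OB"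
 shows "F = nul X (QQ Q # Y) | (\<exists>U V H. X = U @ QQ Q # V & okc (QQ Q) U & H : hm (U @ V) Y & F = BQ Q U V H)"
 using assms(1) unfolding SP_def
proof induction
 case (lin b)
 then have "(X, QQ Q # Y, b) : Bs" by simp
 then show ?case
 proof cases
  case (bs_Cons U V d H)
  then have "X = U @ QQ Q # V & okc (QQ Q) U & H : hm (U @ V) Y & b = BQ Q U V H"
   by (simp add: hm_iff BQ_def Decs_def)
  then show ?thesis by blast
 qed
next
 case (lpls F G)
 have hm: "F : hm X (QQ Q # Y)" "G : hm X (QQ Q # Y)" using SP_hm[OF assms(2,3)] lpls.hyps by (auto simp: SP_def)
 show ?case
 proof (cases "F = nul X (QQ Q # Y) | G = nul X (QQ Q # Y)")
  case True
  then show ?thesis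
  proof
   assume "F = nul X (QQ Q # Y)"
   then have e: "pls F G = G" using pls_nul_left[OF hm(2)] by simp
   show ?thesis unfolding e by (rule lpls.IH(2))
  next
   assume "G = nul X (QQ Q # Y)"
   then have e: "pls F G = F" using pls_nul_right[OF hm(1)] by simp
   show ?thesis unfolding e by (rule lpls.IH(1))
  qed
 next
  case False
  then obtain U V H U' V' H' where 1: "X = U @ QQ Q # V" "okc (QQ Q) U" "H : hm (U @ V) Y" "F = BQ Q U V H"
   and 2: "X = U' @ QQ Q # V'" "okc (QQ Q) U'" "H' : hm (U' @ V') Y" "G = BQ Q U' V' H'" using lpls.IH by blast
  have e: "U' = U" "V' = V" using okc_split_unique[of U Q V U' V'] 1 2 by auto
  have o: "[QQ Q] : OB" "U : OB" "V : OB" using assms(2,3) 1 by auto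
  have "pls F G = BQ Q U V (pls H H')" unfolding 1(4) 2(4) e BQ_def
   using 1(3) 2(3) o unfolding e by (simp add: hm_iff pls_wh pls_cmp)
  then show ?thesis using 1 2 e pls_hm by blast
 qed
next
 case (lscl F c)
 show ?case
 proof (cases "F = nul X (QQ Q # Y)")
  case True
  then show ?thesis using scl_nul assms(2,3) by simp
 next
  case False
  then obtain U V H where 1: "X = U @ QQ Q # V" "okc (QQ Q) U" "H : hm (U @ V) Y" "F = BQ Q U V H" using lscl.IH by blast
  have o: "[QQ Q] : OB" "U : OB" "V : OB" using assms(2,3) 1 by auto
  have "scl c F = BQ Q U V (scl c H)" unfolding 1(4) BQ_def using 1(3) o by (simp add: hm_iff)
  then show ?thesis using 1 scl_hm by blast
 qed
qed simp

text \<open>The morphism acts as \<open>H\<close> after \<open>Q\<close> on the strands of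
  \<open>U\<close>. Supplying \<open>Q\<close> on the strands of \<open>V\<close> as well turns this
  into \<open>H\<close> after \<open>Zq\<close>; \<open>Zq\<close> moves past \<open>H\<close> and
  is injective, so \<open>H\<close> acts as 0.\<close>

lemma faithful_Q: assumes "faithful_at Y" shows "faithful_at (QQ Q # Y)"
 unfolding faithful_at_def
proof (intro allI impI)
 fix F assume F: "ar F" "cd F = QQ Q # Y" "\<forall>v\<in>VV (nI (dm F)). evc F v = 0"
 have o: "dm F : OB" "QQ Q # Y : OB" using ar_obs[OF F(1)] F(2) by simp_all
 then have Q: "Q : ECR (Pol A 1)" and oY: "Y : OB" and oQ: "[QQ Q] : OB" by auto
 have "F : SP (dm F) (QQ Q # Y)" using spanning[OF F(1)] F(2) by simp
 from SP_Q[OF this o] show "F = nul (dm F) (QQ Q # Y)"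
 proof (elim disjE exE conjE)
  fix U V H assume X: "dm F = U @ QQ Q # V" and ok: "okc (QQ Q) U" and Hm: "H : hm (U @ V) Y" and FB: "F = BQ Q U V H"
  have oU: "U : OB" "V : OB" using o X by auto
  have H: "ar H" "dm H = U @ V" "cd H = Y" using Hm by (auto simp: hm_iff)
  let ?k = "nI U" and ?n = "nI V"
  note z = Zq_opr[OF Q] lin_Zq[OF Q]
  have ev0: "evc F v = evc H (tens ?k (Zq Q ?k) idv v)" if v: "v : VV (?k + ?n)" for v
  proof -
   have w: "tens ?k (Zq Q ?k) idv v : VV (?k + ?n)" by (rule opr_VV[OF opr_tens[OF conjunct1[OF z(1)] opr_id(1)] v])
   have 1: "evc (wh U (idm [QQ Q]) V) v = v" using evc_idm[of "U @ [QQ Q] @ V" v] oU oQ v by simp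
   have "evc (wh [] (Cr (QQ Q) U) V) v = tens ?k (evc (Cr (QQ Q) U)) idv v"
   using evc_wh_left[of "Cr (QQ Q) U" V v] oU oQ v by simp
   also have "... = tens ?k (Zq Q ?k) idv v"
   by (rule tens_left_cong[OF v]) (use evc_Cr_Q[OF Q ok oU(1)] in auto)
   finally have 2: "evc (wh [] (Cr (QQ Q) U) V) v = tens ?k (Zq Q ?k) idv v" .
   have 3: "evc (wh [QQ Q] H []) u = evc H u" if "u : VV (?k + ?n)" for u
   using evc_wh_right[of H "[QQ Q]" u] H oQ that by (simp add: tens0 lin_evc)
   have "evc (cmp (wh [] (Cr (QQ Q) U) V) (wh U (idm [QQ Q]) V)) v = evc (wh [] (Cr (QQ Q) U) V) (evc (wh U (idm [QQ Q]) V) v)"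
   by (rule evc_cmp) (use oU oQ v in auto)
   moreover have "evc F v = evc (wh [QQ Q] H []) (evc (cmp (wh [] (Cr (QQ Q) U) V) (wh U (idm [QQ Q]) V)) v)"
   unfolding FB BQ_def by (rule evc_cmp) (use oU oQ H v in auto)
   ultimately show ?thesis using 1 2 3[OF w] by simp
  qed
  have "evc H w = 0" if w: "w : VV (nI (dm H))" for w
  proof -
   have w': "w : VV (?k + ?n)" using w H by simp
   \<comment> \<open>The input that supplies the missing factors \<open>Q\<close> on the strands of
     \<open>V\<close>.\<close>
   have t: "tens ?k idv (Zq Q ?n) w : VV (?k + ?n)" by (rule opr_VV[OF opr_tens[OF opr_id(1) conjunct1[OF z(1)]] w'])
   have "Zq Q (?k + ?n) w = tens ?k (Zq Q ?k) idv (tens ?k idv (Zq Q ?n) w)"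
   unfolding Zq_add[OF Q] by (rule tens_factor[OF z(2) z(2) w'])
   then have "evc H (Zq Q (?k + ?n) w) = evc F (tens ?k idv (Zq Q ?n) w)" using ev0[OF t] by simp
   also have "... = 0" using F(3) t X by simp
   finally have 0: "evc H (Zq Q (nI (dm H)) w) = 0" using H by simp
   obtain h where h: "wt h" "H = cl h" "evc H = ev h" "src h = dm H" "tgt h = cd H" by (rule evc_rep[OF H(1)])
   have "Zq Q (nI (cd H)) (evc H w) = 0" using Zq_commute[OF Q h(1), of w] 0 w unfolding h(3,4,5) by simp
   then show ?thesis using Zq_inj[OF Q evc_VV[OF H(1) w]] by blast
  qed
  then have "H = nul (U @ V) Y" using assms H unfolding faithful_at_def by metis
  then show ?thesis unfolding FB X[symmetric] using X oU oQ oY FB by (simp add: BQ_def)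
 qed
qed

lemma twist_zero:
 assumes "lin G" "x : supp I" "\<And>l. l : I ==> G (sng l 1) = 0" shows "twist p G x = 0"
proof (rule supp_mult_single_induct[OF lin_twist[OF assms(1)] _ assms(2), where G = "%v. 0"])
 fix l assume "l : I"
 then show "twist p G (sng l 1) = 0"
  using assms(3) lin_single[OF assms(1), of l "ksgn p (lpar l)"] by (simp add: twist_def lin_0)
qed (simp add: lin_def)

text \<open>Write \<open>F\<close> as the sum of the \<open>BI\<close> terms and show that each
  \<open>H (p, b, r)\<close> acts as 0, taking \<open>p\<close> from right to left. At a given
  \<open>p\<close>, test vectors with \<open>x^N\<close> at that place show it word by word.\<close>

lemma faithful_II: assumes IH: "faithful_at Y" shows "faithful_at (II # Y)"
 unfolding faithful_at_def
proof (intro allI impI)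
 fix F assume F: "ar F" "cd F = II # Y" "\<forall>v\<in>VV (nI (dm F)). evc F v = 0"
 define X where "X = dm F"
 have o: "X : OB" "II # Y : OB" "Y : OB" using ar_obs[OF F(1)] F(2) by (simp_all add: X_def)
 obtain bs where bs: "distinct bs" "set bs = basis A" by (rule basis_list)
 have "F : SP X (II # Y)" using spanning[OF F(1)] F(2) by (simp add: X_def)
 from SP_II_psum[OF this o(1,3) bs] obtain R H where Hm: "\<And>p b r. (p, b, r) : set (idx X bs R) ==> H (p, b, r) : hm (del p X) Y"
  and Fsum: "F = psum X (II # Y) (idx X bs R) (%i. BI X i (H i))" by blast
 let ?I = "set (idx X bs R)"
 have BI: "\<forall>i\<in>?I. BI X i (H i) : hm X (II # Y)"
  unfolding Ball_def split_paired_All using Hm BI_hm[OF o(1)] by (auto simp: set_idx)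
 \<comment> \<open>The coefficient at a first letter \<open>e\<close> of the vanishing vector
   \<open>evc F v\<close>, expanded over all strands.\<close>
 have sum0: "(\<Sum>(p, b, r)\<in>?I. twist (epar e) (evc (H (p, b, r))) (fc e (TT X p b r v))) = 0" if v: "v : VV (nI X)" for v e
 proof -
  have "(\<Sum>i\<in>?I. evc (BI X i (H i)) v) = evc F v"
   unfolding Fsum evc_psum[OF o(1,2) BI v] by (simp add: sum_list_distinct_conv_sum_set distinct_idx bs)
  also have "... = 0" using F(3) v by (simp add: X_def)
  finally have "fc e (\<Sum>i\<in>?I. evc (BI X i (H i)) v) = 0" by (simp add: lin_0)
  then have "(\<Sum>i\<in>?I. fc e (evc (BI X i (H i)) v)) = 0" by (simp add: lin_sum)
  moreover have "fc e (evc (BI X i (H i)) v) = (case i of (p, b, r) => twist (epar e) (evc (H (p, b, r))) (fc e (TT X p b r v)))" if i: "i : ?I" for i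
  proof -
   obtain p b r where pbr: "i = (p, b, r)" by (cases i)
   have p: "p < length X" "X ! p = II" using i pbr by (auto simp: set_idx)
   have h: "H (p, b, r) : hm (del p X) Y" using Hm i pbr by simp
   then have a: "ar (H (p, b, r))" by (simp add: hm_iff)
   show ?thesis unfolding pbr prod.case evc_BI[OF o(1) p h v]
   by (rule fc_tens[OF lin_evc[OF a] opr_VV[OF TT_opr[OF p] v]])
  qed
  ultimately show ?thesis by simp
 qed
 \<comment> \<open>Strands further right may be assumed zero; those further left are invisible by
   \<open>TT_left\<close>.\<close>
 have van: "H (p, b, r) = nul (del p X) Y" if i: "(p, b, r) : ?I" for p b r
  using i
 proof (induction "length X - p" arbitrary: p b r rule: less_induct)
  case less
  have p: "p < length X" "X ! p = II" using less.prems by (auto simp: set_idx)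
  have later: "evc (H (p', b', r')) v = 0" if "(p', b', r') : ?I" "p < p'" "v : VV (nI (del p' X))" for p' b' r' v
  proof -
   have "H (p', b', r') = nul (del p' X) Y" using less.hyps[of p' b' r'] that p by (auto simp: set_idx)
   then show ?thesis using evc_nul[of "del p' X" Y v] that o(3) obs_take_drop[OF o(1)] by (simp add: del_def)
  qed
  let ?m = "nI (del p X)"
  \<comment> \<open>Terms with the same \<open>p\<close> interfere only through lower words
    \<open>l'\<close> with \<open>dg l' + r < dg l + r'\<close>; the measure
    \<open>dg l + (R - r)\<close> decreases along these.\<close>
  have wz: "evc (H (p, b, r)) (sng l 1) = 0" if "(p, b, r) : ?I" "l : L ?m" for b r l
   using that
  proof (induction "dg l + (R - r)" arbitrary: l b r rule: less_induct)
   case less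
   note lwh = less.hyps
   have b: "b : basis A" "r < R" using less.prems bs by (auto simp: set_idx)
   define k where "k = nI (take p X)"
   \<comment> \<open>Large enough that \<open>dg l + r' < r + N\<close> for every
     \<open>r' < R\<close>, as \<open>TT_left\<close> demands.\<close>
   define N where "N = dg l + R + 1"
   define e where "e = (b, r + N)"
   have l': "l : L (k + nI (drop (Suc p) X))" using less.prems by (simp add: k_def del_def)
   have v: "vN k l N : VV (nI X)" unfolding nI_split[OF p] k_def[symmetric] by (rule vN_VV[OF l'])
   let ?g = "%(p, b, r). twist (epar e) (evc (H (p, b, r))) (fc e (TT X p b r (vN k l N)))"
   have linH: "lin (evc (H i))" if "i : ?I" for i using Hm[of "fst i" "fst (snd i)" "snd (snd i)"] that lin_evc by (simp add: hm_iff)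
   have TV: "TT X p' b' r' (vN k l N) : VV (Suc (nI (del p' X)))" if "(p', b', r') : ?I" for p' b' r'
   by (rule opr_VV[OF TT_opr v]) (use that in "auto simp: set_idx")
   \<comment> \<open>The lower-order part of a term at the same place contributes nothing: its
     coefficient at \<open>e\<close> involves only words that the inner induction has
     settled.\<close>
   have low: "twist (epar e) (evc (H (p, b', r'))) (fc e w) = 0"
   if i: "(p, b', r') : ?I" and w: "w : Dl (dg l + r' + N)" "w : VV (Suc ?m)" for b' r' w
   proof (rule twist_zero[OF linH[OF i]])
   show "fc e w : supp {l' : L ?m. dg l' + r < dg l + r'}"
   proof -
   have "fc e w : VV ?m" by (rule fc_VV[OF w(2)])
   moreover have "dg l' + r < dg l + r'" if "l' : kys (fc e w)" for l'
   proof -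
   have "e # l' : kys w" using that by (simp add: in_keys_iff lookup_fc)
   then have "dg (e # l') < dg l + r' + N" using w(1) by (auto simp: Dl_def supp_def)
   then show ?thesis by (simp add: e_def)
   qed
   ultimately show ?thesis by (auto simp: supp_def VV_def)
   qed
   fix l' assume l': "l' : {l' : L ?m. dg l' + r < dg l + r'}"
   have "r' < R" using i by (simp add: set_idx)
   then have "dg l' + (R - r') < dg l + (R - r)" using l' b by auto
   then show "evc (H (p, b', r')) (sng l' 1) = 0" by (rule lwh[OF _ i]) (use l' in simp)
   qed
   obtain s where s: "s * s = 1" "TT X p b r (vN k l N) - pscale s (sng (e # l) 1) : Dl (dg l + r + N)"
   using TT_own[OF p less.prems(2) b(1) k_def, of r N] unfolding e_def by blast
   have el: "e # l : L (Suc ?m)" using less.prems b by (simp add: e_def L_Cons)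
   have others: "?g i = 0" if i: "i : ?I - {(p, b, r)}" for i
   proof -
   obtain p' b' r' where pbr: "i = (p', b', r')" by (cases i)
   have i': "(p', b', r') : ?I" "(p', b', r') ~= (p, b, r)" using i pbr by auto
   have p': "p' < length X" "X ! p' = II" "b' : basis A" "r' < R" using i' bs by (auto simp: set_idx)
   consider "p' < p" | "p' = p" | "p < p'" by linarith
   then show ?thesis
   proof cases
   case 1
   have "fc e (TT X p' b' r' (vN k l N)) = 0"
   by (rule TT_left[OF p 1 p'(2) less.prems(2) k_def]) (use p'(4) in "simp add: e_def N_def")
   then show ?thesis unfolding pbr prod.case by (simp add: lin_0[OF lin_twist[OF linH[OF i'(1)]]])
   next
   case 2
   obtain s' where s': "TT X p b' r' (vN k l N) - pscale s' (sng ((b', r' + N) # l) 1) : Dl (dg l + r' + N)"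
   using TT_own[OF p less.prems(2) p'(3) k_def, of r' N] by blast
   define w where "w = TT X p b' r' (vN k l N) - pscale s' (sng ((b', r' + N) # l) 1)"
   have el': "(b', r' + N) # l : L (Suc ?m)" using less.prems p' by (simp add: L_Cons)
   have wV: "w : VV (Suc ?m)" unfolding w_def using TV[of p b' r'] i' 2 VV_single[OF el'] by (intro VV_closed(3,4)) auto
   have "(b', r' + N) ~= e" using i' 2 by (auto simp: e_def)
   then have "fc e (TT X p b' r' (vN k l N)) = fc e w"
   unfolding w_def lin_diff[OF lin_fc] lin_pscale[OF lin_fc] by simp
   then show ?thesis unfolding pbr 2 prod.case using low[of b' r' w] i' 2 s' wV by (simp add: w_def)
   next
   case 3
   have "twist (epar e) (evc (H (p', b', r'))) (fc e (TT X p' b' r' (vN k l N))) = 0"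
   using later[OF i'(1) 3] fc_VV[OF TV[OF i'(1)], of e] Pw_in_VV[of _ "nI (del p' X)" "epar e"] by (simp add: twist_def lin_0)
   then show ?thesis by (simp add: pbr)
   qed
   qed
   define w where "w = TT X p b r (vN k l N) - pscale s (sng (e # l) 1)"
   have wV: "w : VV (Suc ?m)" unfolding w_def using TV[OF less.prems(1)] VV_single[OF el] by (intro VV_closed(3,4)) auto
   have "sum ?g ?I = ?g (p, b, r)"
   using others less.prems(1) by (simp add: sum.remove[of ?I "(p, b, r)"])
   then have "?g (p, b, r) = 0" using sum0[OF v, of e] by simp
   moreover have "fc e (TT X p b r (vN k l N)) = pscale s (sng l 1) + fc e w"
   unfolding w_def lin_diff[OF lin_fc] lin_pscale[OF lin_fc] by simp
   ultimately have "twist (epar e) (evc (H (p, b, r))) (pscale s (sng l 1)) = 0"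
   using low[OF less.prems(1) s(2)[folded w_def] wV] lin_add[OF lin_twist[OF linH[OF less.prems(1)]]] by simp
   \<comment> \<open>Multiplying by \<open>s\<close> once more removes it, since
     \<open>s * s = 1\<close>; no division is involved.\<close>
   then have "pscale s (twist (epar e) (evc (H (p, b, r))) (pscale s (sng l 1))) = 0" by simp
   then have "twist (epar e) (evc (H (p, b, r))) (sng l 1) = 0"
   unfolding lin_pscale[OF lin_twist[OF linH[OF less.prems(1)]]] using s(1) by simp
   then have "twist (epar e) (twist (epar e) (evc (H (p, b, r)))) (sng l 1) = 0"
   using lin_single[OF lin_twist[OF linH[OF less.prems(1)]], of "epar e" l "ksgn (epar e) (lpar l)"] by (simp add: twist_def[of "epar e" "twist _ _"] lin_0 del: twist_twist)
   then show ?case unfolding twist_twist bit_add_self by (simp add: twist_def)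
  qed
  have h: "H (p, b, r) : hm (del p X) Y" by (rule Hm[OF less.prems])
  then have h': "ar (H (p, b, r))" "dm (H (p, b, r)) = del p X" "cd (H (p, b, r)) = Y" by (auto simp: hm_iff)
  have lz: "lin (%v :: ('a \<times> nat) list \<Rightarrow>\<^sub>0 'k. 0 :: ('a \<times> nat) list \<Rightarrow>\<^sub>0 'k)" by (simp add: lin_def)
  have "evc (H (p, b, r)) v = 0" if "v : VV (nI (dm (H (p, b, r))))" for v
   by (rule VV_eqI[OF lin_evc[OF h'(1)] lz that[unfolded h'(2)]]) (rule wz[OF less.prems])
  then show ?case using IH h' unfolding faithful_at_def by metis
 qed
 have "F = psum X (II # Y) (idx X bs R) (%i. nul X (II # Y))"
  unfolding Fsum
 proof (rule psum_cong[OF o(1,2)], unfold Ball_def split_paired_All, intro allI impI)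
  fix p b r assume i: "(p, b, r) : ?I"
  then have p: "p < length X" "X ! p = II" by (auto simp: set_idx)
  show "BI X (p, b, r) (H (p, b, r)) = nul X (II # Y)"
   unfolding van[OF i] by (rule BI_lin(3)[OF o(1) p Hm[OF i] o(3)])
 qed
 also have "... = nul X (II # Y)" by (rule psum_nul[OF o(1,2)])
 finally show "F = nul (dm F) (II # Y)" unfolding X_def .
qed

lemma faithful_all: "faithful_at Y"
proof (induction Y)
 case (Cons y Y)
 then show ?case by (cases y) (auto intro: faithful_II faithful_Q)
qed (rule faithful_nil)

text \<open>Passing to the difference of the two morphisms reduces injectivity to the trivial kernel
  of \<open>faithful_all\<close>.\<close>

lemma ev_inj: assumes f: "law_arr A f X Y" "law_arr A g X Y" and e: "\<And>v. v : VV (nI X) ==> ev f v = ev g v" shows "cl f = cl g"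
proof -
 have t: "wt f" "wt g" "src f = X" "src g = X" "tgt f = Y" "tgt g = Y" using f by (auto simp: law_arr_iff)
 define D where "D = cl (Plus f (Scal (- 1) g))"
 have D: "ar D" "dm D = X" "cd D = Y" using t by (auto simp: D_def)
 have "evc D v = 0" if "v : VV (nI (dm D))" for v
  unfolding D_def using evc_cl[of "Plus f (Scal (- 1) g)" v] that t e D by (simp add: pscale_uminus)
 then have "D = nul X Y" using faithful_all[of Y] D unfolding faithful_at_def by metis
 then have n: "pls (cl f) (scl (- 1) (cl g)) = nul X Y" by (simp add: D_def cl_pls cl_scl)
 have h: "cl f : hm X Y" "cl g : hm X Y" using t by (auto simp: hm_iff)
 have m: "scl (- 1) (cl g) : hm X Y" by (rule scl_hm[OF h(2)])
 have "cl f = pls (cl f) (pls (scl (- 1) (cl g)) (cl g))"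
  using pls_scl_neg[OF h(2)] pls_comm[OF m h(2)] pls_nul_right[OF h(1)] by simp
 also have "... = pls (nul X Y) (cl g)" using pls_assoc[OF h(1) m h(2)] n by simp
 also have "... = cl g" by (rule pls_nul_left[OF h(2)])
 finally show ?thesis .
qed

lemma Pfun_faithful: "faithful_functor (LAW A) Pfun"
 unfolding faithful_functor_def LAW_simps Pfun_simps truncate_simps
proof (intro ballI impI)
 fix X Y F G assume FG: "F : carr (Hom (LAW A) X Y)" "G : carr (Hom (LAW A) X Y)"
  and e: "\<forall>u\<in>carr (Pol A (nI X)). on_morf F u = on_morf G u"
 obtain f where f: "law_arr A f X Y" "F = cl f" using FG(1) unfolding LAW_simps by blast
 obtain g where g: "law_arr A g X Y" "G = cl g" using FG(2) unfolding LAW_simps by blast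
 have "ev f v = ev g v" if v: "v : VV (nI X)" for v
 proof -
  have u: "PS (nI X) v : carr (Pol A (nI X))" by (rule PS_carr[OF v])
  then show ?thesis using PH_on_morf[OF f(1) u] PH_on_morf[OF g(1) u] e v f g by simp
 qed
 then show "F = G" using ev_inj[OF f(1) g(1)] f g by simp
qed

end

theorem corollary5p23:
  fixes A :: "('k::comm_ring_1, 'a::{ring, monoid_mult}) frobenius_data"
  assumes "frobenius_superalgebra A"
  shows "\<exists>P :: ('k, ('k, 'a) law_ob, ('k, 'a) law_term set, ('k, 'a) falg set) smod_functor.
    monoidal_functor (LAW A) P \<and>
    (\<forall>X\<in>law_obs A. on_ob P X = smodule.truncate (Pol A (count_list X II))) \<and>
    (\<forall>X\<in>law_obs A. \<forall>Y\<in>law_obs A. \<forall>f\<in>carr (on_ob P X). \<forall>g\<in>carr (on_ob P Y).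
       fmu P X Y (pure_tensor (on_ob P X) (on_ob P Y) f g)
         = pol_juxt A (count_list X II) (count_list Y II) f g) \<and>
    (\<forall>c. feta P c = smul (Pol A 0) c (unt (Pol A 0))) \<and>
    (\<forall>a. \<forall>f\<in>carr (Pol A 1).
       on_mor P (law_class A [II] [II] (Tok a)) f
         = mul (Pol A 1) (pol_class A 1 (mon [GA 1 a])) f) \<and>
    (\<forall>f\<in>carr (Pol A 1).
       on_mor P (law_class A [II] [II] Dot) f
         = mul (Pol A 1) (pol_class A 1 (mon [GX 1])) f) \<and>
    (\<forall>f\<in>carr (Pol A 2).
       on_mor P (law_class A [II, II] [II, II] Sig) f
         = add (Pol A 2) (pol_swap A 2 1 f) (smul (Pol A 2) (- 1) (demazure A 2 1 f))) \<and>
    (\<forall>Q\<in>ECR (Pol A 1). \<forall>f\<in>carr (Pol A 1).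
       on_mor P (law_class A [QQ Q, II] [II, QQ Q] (Rho Q)) f = f \<and>
       on_mor P (law_class A [II, QQ Q] [QQ Q, II] (Lam Q)) f = mul (Pol A 1) Q f) \<and>
    faithful_functor (LAW A) P"
proof -
  interpret frobenius_superalgebra A by (rule assms)
  have eta: "PS 0 (pscale c 1) = smul (Pol A 0) c (unt (Pol A 0))" for c
    using PH_smul[OF PH_unit(2), of c] PH_unit(1) PS_scalar_1(1)[of c] by (intro Pol_eqI[of _ 0] PS_carr) auto
  have juxt: "fm (nI X) (nI Y) (pure_tensor (smodule.truncate (Pol A (nI X))) (smodule.truncate (Pol A (nI Y))) f g) = pol_juxt A (nI X) (nI Y) f g"
    if "f \<in> carr (Pol A (nI X))" "g \<in> carr (Pol A (nI Y))" for X Y :: "('k, 'a) law_ob" and f g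
    using that fm_pure pol_juxt_PS by simp
  show ?thesis
    by (rule exI[of _ Pfun]) (simp add: Pfun_monoidal Pfun_faithful on_morf_values eta juxt del: One_nat_def)
qed

end
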